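(* For every positive integer $d$, $$\mathrm{Ext}^{2}_{\mathcal{F}(\mathsf{gr};\mathbb{Z})}(\mathfrak{a}, S^{d}\circ\mathfrak{a}) \cong \bigoplus_{p\in J_d}\mathbb{Z}/p,$$ where $J_d$ is the set of prime numbers $p$ such that there exist an integer $n\geq 0$ and an integer $m\geq 1$ with $d=p^n(p^m+1)$.
   Context: $\mathsf{gr}$ is the category of finitely generated free groups and group homomorphisms, and $\mathcal{F}(\mathsf{gr};\mathbb{Z})$ is the abelian category of functors from $\mathsf{gr}$ to the category $\mathsf{Ab}$ of abelian groups; Ext-groups are taken in this category. $\mathfrak{a}\in\mathcal{F}(\mathsf{gr};\mathbb{Z})$ is the abelianization functor $G\mapsto G/[G,G]$. $S^d$ is the $d$-th symmetric power functor on finitely generated free abelian groups, $S^d(A)=(A^{\otimes d})_{\mathfrak{S}_d}$ (coinvariants under the symmetric group $\mathfrak{S}_d$), and $S^d\circ\mathfrak{a}$ is its composite with abelianization. *)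

theory Defs
  imports
    "HOL-Algebra.Algebra"
    "HOL-Combinatorics.Combinatorics"
    "HOL-Library.Infinite_Typeclass"
begin

text \<open>
  Groups are carrier-based, so morphisms are homomorphisms that are undefined outside
  the carrier of their source; this makes equality of morphisms equality of functions.
\<close>

definition mor :: "'a monoid \<Rightarrow> 'b monoid \<Rightarrow> ('a \<Rightarrow> 'b) set" where
  "mor G H = hom G H \<inter> extensional (carrier G)"

text \<open>The letter \<open>(b, x)\<close> stands for \<open>x\<close> if \<open>b\<close> holds and for the inverse of \<open>x\<close> otherwise.\<close>

definition word_val :: "'g monoid \<Rightarrow> (bool \<times> 'g) list \<Rightarrow> 'g" where
  "word_val G w = foldr (\<lambda>(b, x) y. (if b then x else inv\<^bsub>G\<^esub> x) \<otimes>\<^bsub>G\<^esub> y) w \<one>\<^bsub>G\<^esub>"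

definition reduced_word :: "(bool \<times> 'g) list \<Rightarrow> bool" where
  "reduced_word w \<longleftrightarrow> successively (\<lambda>(b, x) (c, y). \<not> (x = y \<and> b \<noteq> c)) w"

definition free_basis :: "'g monoid \<Rightarrow> 'g set \<Rightarrow> bool" where
  "free_basis G S \<longleftrightarrow>
     S \<subseteq> carrier G \<and>
     bij_betw (word_val G) {w. reduced_word w \<and> snd ` set w \<subseteq> S} (carrier G)"

text \<open>
  The objects of the category \<open>gr\<close>, with underlying sets in the type \<open>'g\<close>. As soon as \<open>'g\<close> is
  infinite, it contains free groups of every finite rank, and the category does not depend on
  \<open>'g\<close> up to equivalence.
\<close>

definition gr :: "'g monoid set" where
  "gr = {G. group G \<and> (\<exists>S. finite S \<and> free_basis G S)}"

text \<open>\<open>arr F G H f\<close> is the value of \<open>F\<close> on the morphism \<open>f\<close> from \<open>G\<close> to \<open>H\<close>.\<close>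

record ('g, 'u) gr_functor =
  obj :: "'g monoid \<Rightarrow> 'u monoid"
  arr :: "'g monoid \<Rightarrow> 'g monoid \<Rightarrow> ('g \<Rightarrow> 'g) \<Rightarrow> 'u \<Rightarrow> 'u"

definition is_functor :: "('g, 'u) gr_functor \<Rightarrow> bool" where
  "is_functor F \<longleftrightarrow>
     (\<forall>G\<in>gr. comm_group (obj F G)) \<and>
     (\<forall>G\<in>gr. \<forall>H\<in>gr. \<forall>f\<in>mor G H. arr F G H f \<in> mor (obj F G) (obj F H)) \<and>
     (\<forall>G\<in>gr. arr F G G (\<lambda>x\<in>carrier G. x) = (\<lambda>x\<in>carrier (obj F G). x)) \<and>
     (\<forall>G\<in>gr. \<forall>H\<in>gr. \<forall>K\<in>gr. \<forall>f\<in>mor G H. \<forall>g\<in>mor H K.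
        arr F G K (compose (carrier G) g f) =
          compose (carrier (obj F G)) (arr F H K g) (arr F G H f))"

definition nat_trans ::
    "('g, 'u) gr_functor \<Rightarrow> ('g, 'v) gr_functor \<Rightarrow> ('g monoid \<Rightarrow> 'u \<Rightarrow> 'v) set" where
  "nat_trans F F' =
     {\<eta> \<in> (\<Pi>\<^sub>E G\<in>gr. mor (obj F G) (obj F' G)).
        \<forall>G\<in>gr. \<forall>H\<in>gr. \<forall>f\<in>mor G H.
          compose (carrier (obj F G)) (arr F' G H f) (\<eta> G) =
          compose (carrier (obj F G)) (\<eta> H) (arr F G H f)}"

definition nt_comp :: "('g, 'u) gr_functor \<Rightarrow> ('g monoid \<Rightarrow> 'v \<Rightarrow> 'w) \<Rightarrow>
    ('g monoid \<Rightarrow> 'u \<Rightarrow> 'v) \<Rightarrow> 'g monoid \<Rightarrow> 'u \<Rightarrow> 'w" where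
  "nt_comp F \<theta> \<eta> = (\<lambda>G\<in>gr. compose (carrier (obj F G)) (\<theta> G) (\<eta> G))"

definition hom_group ::
    "('g, 'u) gr_functor \<Rightarrow> ('g, 'v) gr_functor \<Rightarrow> ('g monoid \<Rightarrow> 'u \<Rightarrow> 'v) monoid" where
  "hom_group F F' =
     \<lparr>carrier = nat_trans F F',
      monoid.mult = (\<lambda>\<eta> \<theta>. \<lambda>G\<in>gr. \<lambda>x\<in>carrier (obj F G). \<eta> G x \<otimes>\<^bsub>obj F' G\<^esub> \<theta> G x),
      one = (\<lambda>G\<in>gr. \<lambda>x\<in>carrier (obj F G). \<one>\<^bsub>obj F' G\<^esub>)\<rparr>"

text \<open>Kernels, images and hence epimorphisms and exactness in the functor category are
  objectwise.\<close>

definition is_epi ::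
    "('g, 'u) gr_functor \<Rightarrow> ('g, 'v) gr_functor \<Rightarrow> ('g monoid \<Rightarrow> 'u \<Rightarrow> 'v) \<Rightarrow> bool" where
  "is_epi F F' \<eta> \<longleftrightarrow>
     \<eta> \<in> nat_trans F F' \<and> (\<forall>G\<in>gr. \<eta> G ` carrier (obj F G) = carrier (obj F' G))"

definition exact_at :: "('g, 'u) gr_functor \<Rightarrow> ('g, 'v) gr_functor \<Rightarrow> ('g, 'w) gr_functor \<Rightarrow>
    ('g monoid \<Rightarrow> 'u \<Rightarrow> 'v) \<Rightarrow> ('g monoid \<Rightarrow> 'v \<Rightarrow> 'w) \<Rightarrow> bool" where
  "exact_at F F' F'' \<eta> \<theta> \<longleftrightarrow>
     \<eta> \<in> nat_trans F F' \<and> \<theta> \<in> nat_trans F' F'' \<and>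
     (\<forall>G\<in>gr. \<eta> G ` carrier (obj F G) = kernel (obj F' G) (obj F'' G) (\<theta> G))"

text \<open>
  Projectivity is tested against functors whose values have underlying sets in the type \<open>'u\<close>.
  If \<open>'u\<close> is infinite, it accommodates the free abelian groups on the countable sets
  \<open>mor F G\<close> with \<open>F\<close> and \<open>G\<close> in \<open>gr\<close>, so these functors form an abelian category with enough
  projectives, and being projective does not depend on restricting to it.
\<close>

definition projective :: "('g, 'u) gr_functor \<Rightarrow> bool" where
  "projective P \<longleftrightarrow>
     is_functor P \<and>
     (\<forall>(E :: ('g, 'u) gr_functor) (Q :: ('g, 'u) gr_functor) e f.
        is_functor E \<and> is_functor Q \<and> is_epi E Q e \<and> f \<in> nat_trans P Q \<longrightarrow>
        (\<exists>g\<in>nat_trans P E. nt_comp P e g = f))"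

text \<open>The augmented complex \<open>\<dots> \<rightarrow> P 2 \<rightarrow> P 1 \<rightarrow> P 0 \<rightarrow> A \<rightarrow> 0\<close> with
  \<open>\<delta> n\<close> going from \<open>P (Suc n)\<close> to \<open>P n\<close>.\<close>

definition projective_resolution :: "('g, 'a) gr_functor \<Rightarrow> (nat \<Rightarrow> ('g, 'u) gr_functor) \<Rightarrow>
    (nat \<Rightarrow> 'g monoid \<Rightarrow> 'u \<Rightarrow> 'u) \<Rightarrow> ('g monoid \<Rightarrow> 'u \<Rightarrow> 'a) \<Rightarrow> bool" where
  "projective_resolution A P \<delta> \<epsilon> \<longleftrightarrow>
     (\<forall>n. projective (P n)) \<and>
     is_epi (P 0) A \<epsilon> \<and>
     exact_at (P 1) (P 0) A (\<delta> 0) \<epsilon> \<and>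
     (\<forall>n. exact_at (P (Suc (Suc n))) (P (Suc n)) (P n) (\<delta> (Suc n)) (\<delta> n))"

text \<open>The cohomology groups of the cochain complex \<open>Hom(P n, B)\<close>.\<close>

definition coboundary_map :: "(nat \<Rightarrow> ('g, 'u) gr_functor) \<Rightarrow> (nat \<Rightarrow> 'g monoid \<Rightarrow> 'u \<Rightarrow> 'u) \<Rightarrow>
    nat \<Rightarrow> ('g monoid \<Rightarrow> 'u \<Rightarrow> 'v) \<Rightarrow> 'g monoid \<Rightarrow> 'u \<Rightarrow> 'v" where
  "coboundary_map P \<delta> n \<phi> = nt_comp (P (Suc n)) \<phi> (\<delta> n)"

definition cocycles :: "(nat \<Rightarrow> ('g, 'u) gr_functor) \<Rightarrow> (nat \<Rightarrow> 'g monoid \<Rightarrow> 'u \<Rightarrow> 'u) \<Rightarrow>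
    ('g, 'v) gr_functor \<Rightarrow> nat \<Rightarrow> ('g monoid \<Rightarrow> 'u \<Rightarrow> 'v) set" where
  "cocycles P \<delta> B n =
     kernel (hom_group (P n) B) (hom_group (P (Suc n)) B) (coboundary_map P \<delta> n)"

definition coboundaries :: "(nat \<Rightarrow> ('g, 'u) gr_functor) \<Rightarrow> (nat \<Rightarrow> 'g monoid \<Rightarrow> 'u \<Rightarrow> 'u) \<Rightarrow>
    ('g, 'v) gr_functor \<Rightarrow> nat \<Rightarrow> ('g monoid \<Rightarrow> 'u \<Rightarrow> 'v) set" where
  "coboundaries P \<delta> B n =
     (case n of 0 \<Rightarrow> {\<one>\<^bsub>hom_group (P 0) B\<^esub>}
      | Suc m \<Rightarrow> coboundary_map P \<delta> m ` carrier (hom_group (P m) B))"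

definition cohomology :: "(nat \<Rightarrow> ('g, 'u) gr_functor) \<Rightarrow> (nat \<Rightarrow> 'g monoid \<Rightarrow> 'u \<Rightarrow> 'u) \<Rightarrow>
    ('g, 'v) gr_functor \<Rightarrow> nat \<Rightarrow> ('g monoid \<Rightarrow> 'u \<Rightarrow> 'v) set monoid" where
  "cohomology P \<delta> B n =
     (hom_group (P n) B)\<lparr>carrier := cocycles P \<delta> B n\<rparr> Mod coboundaries P \<delta> B n"

text \<open>
  The Ext groups, computed from a chosen projective resolution whose values have underlying sets
  in the type \<open>'u\<close>; by the comparison theorem the isomorphism class does not depend on the choice.
\<close>

definition Ext :: "'u itself \<Rightarrow> nat \<Rightarrow> ('g, 'a) gr_functor \<Rightarrow> ('g, 'v) gr_functor \<Rightarrow>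
    ('g monoid \<Rightarrow> 'u \<Rightarrow> 'v) set monoid" where
  "Ext U n A B =
     (let (P, \<delta>) = (SOME (P, \<delta>). \<exists>\<epsilon>. projective_resolution A P \<delta> \<epsilon>) in cohomology P \<delta> B n)"

text \<open>The map \<open>G Mod M \<rightarrow> H Mod N\<close> induced by a homomorphism \<open>h\<close> from \<open>G\<close> to \<open>H\<close> sending \<open>M\<close>
  into \<open>N\<close>: the coset of \<open>x\<close> goes to the coset of \<open>h x\<close>.\<close>

definition quot_map ::
    "'a monoid \<Rightarrow> 'a set \<Rightarrow> 'b monoid \<Rightarrow> 'b set \<Rightarrow> ('a \<Rightarrow> 'b) \<Rightarrow> 'a set \<Rightarrow> 'b set" where
  "quot_map G M H N h = (\<lambda>C\<in>carrier (G Mod M). N <#>\<^bsub>H\<^esub> (h ` C))"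

definition abelianization :: "('g, 'g set) gr_functor" where
  "abelianization =
     \<lparr>obj = (\<lambda>G. G Mod derived G (carrier G)),
      arr = (\<lambda>G H. quot_map G (derived G (carrier G)) H (derived H (carrier H)))\<rparr>"

text \<open>The \<open>d\<close>-fold tensor power of an abelian group \<open>A\<close>: the free abelian group on the lists of
  \<open>d\<close> elements of \<open>A\<close> (pure tensors) modulo additivity in each entry.\<close>

definition pure_tensors :: "nat \<Rightarrow> 'a monoid \<Rightarrow> 'a list set" where
  "pure_tensors d A = {xs. length xs = d \<and> set xs \<subseteq> carrier A}"

definition tensor_rels :: "nat \<Rightarrow> 'a monoid \<Rightarrow> ('a list \<Rightarrow>\<^sub>0 int) set" where
  "tensor_rels d A = generate (free_Abelian_group (pure_tensors d A))
     {frag_of (xs[i := x \<otimes>\<^bsub>A\<^esub> y]) - frag_of (xs[i := x]) - frag_of (xs[i := y]) | xs i x y.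
        xs \<in> pure_tensors d A \<and> i < d \<and> x \<in> carrier A \<and> y \<in> carrier A}"

definition tensor_power :: "nat \<Rightarrow> 'a monoid \<Rightarrow> ('a list \<Rightarrow>\<^sub>0 int) set monoid" where
  "tensor_power d A = free_Abelian_group (pure_tensors d A) Mod tensor_rels d A"

definition tensor_power_map ::
    "nat \<Rightarrow> 'a monoid \<Rightarrow> 'b monoid \<Rightarrow> ('a \<Rightarrow> 'b) \<Rightarrow> ('a list \<Rightarrow>\<^sub>0 int) set \<Rightarrow> ('b list \<Rightarrow>\<^sub>0 int) set" where
  "tensor_power_map d A B f =
     quot_map (free_Abelian_group (pure_tensors d A)) (tensor_rels d A)
              (free_Abelian_group (pure_tensors d B)) (tensor_rels d B)
              (frag_extend (\<lambda>xs. frag_of (map f xs)))"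

definition tensor_permute ::
    "nat \<Rightarrow> 'a monoid \<Rightarrow> (nat \<Rightarrow> nat) \<Rightarrow> ('a list \<Rightarrow>\<^sub>0 int) set \<Rightarrow> ('a list \<Rightarrow>\<^sub>0 int) set" where
  "tensor_permute d A \<sigma> =
     quot_map (free_Abelian_group (pure_tensors d A)) (tensor_rels d A)
              (free_Abelian_group (pure_tensors d A)) (tensor_rels d A)
              (frag_extend (\<lambda>xs. frag_of (permute_list \<sigma> xs)))"

text \<open>The symmetric power is the group of coinvariants of the tensor power under the
  permutations of \<open>{..<d}\<close>.\<close>

definition sym_rels :: "nat \<Rightarrow> 'a monoid \<Rightarrow> ('a list \<Rightarrow>\<^sub>0 int) set set" where
  "sym_rels d A = generate (tensor_power d A)
     {tensor_permute d A \<sigma> t \<otimes>\<^bsub>tensor_power d A\<^esub> inv\<^bsub>tensor_power d A\<^esub> t | \<sigma> t.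
        \<sigma> permutes {..<d} \<and> t \<in> carrier (tensor_power d A)}"

definition sym_power :: "nat \<Rightarrow> 'a monoid \<Rightarrow> ('a list \<Rightarrow>\<^sub>0 int) set set monoid" where
  "sym_power d A = tensor_power d A Mod sym_rels d A"

definition sym_power_map :: "nat \<Rightarrow> 'a monoid \<Rightarrow> 'b monoid \<Rightarrow> ('a \<Rightarrow> 'b) \<Rightarrow>
    ('a list \<Rightarrow>\<^sub>0 int) set set \<Rightarrow> ('b list \<Rightarrow>\<^sub>0 int) set set" where
  "sym_power_map d A B f =
     quot_map (tensor_power d A) (sym_rels d A) (tensor_power d B) (sym_rels d B)
              (tensor_power_map d A B f)"

definition sym_power_after ::
    "nat \<Rightarrow> ('g, 'a) gr_functor \<Rightarrow> ('g, ('a list \<Rightarrow>\<^sub>0 int) set set) gr_functor" where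
  "sym_power_after d F =
     \<lparr>obj = (\<lambda>G. sym_power d (obj F G)),
      arr = (\<lambda>G H f. sym_power_map d (obj F G) (obj F H) (arr F G H f))\<rparr>"

definition J :: "nat \<Rightarrow> nat set" where
  "J d = {p. Factorial_Ring.prime p \<and> (\<exists>n m. m \<ge> 1 \<and> d = p ^ n * (p ^ m + 1))}"

end

theory Submission
  imports Defs "HOL-Computational_Algebra.Polynomial"
begin

text \<open>
  The proof computes Ext from the bar complex. For a free group \<open>G\<close> the bar complex with trivial
  coefficients has homology \<open>G / [G, G]\<close> in degree one and zero in higher degrees. Its terms are the
  functors \<open>G \<mapsto> \<int>[G\<^sup>n]\<close>, which are linearizations of representable functors and hence
  projective, so in positive degrees and shifted by one it is a projective resolution of
  abelianization (\<open>bar_resolution\<close>). The group Ext is defined from an unspecified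
  resolution; by the comparison theorem a complete invariant of cocycles modulo coboundaries on the
  bar resolution suffices (\<open>Ext_iso\<close>).

  By the Yoneda lemma, the transformations from \<open>\<int>[G\<^sup>n]\<close> to the \<open>d\<close>-th symmetric power of
  abelianization are the elements of the symmetric power of \<open>\<int>\<^sup>n\<close>, that is, the integral forms of
  degree \<open>d\<close> in \<open>n\<close> variables. Such a form is determined by its values at integers, and these are read
  off at tuples of powers of the generator of an infinite cyclic group (\<open>pol_nat\<close>). The differential
  becomes the coboundary of polynomial cochains of the additive group (\<open>pol_cobd\<close>), so that the second Ext
  group is the degree \<open>d\<close> part of the third cohomology of the additive group with polynomial
  cochains over the integers.

  It remains to determine this group by congruences between binomial coefficients. After
  normalisation every cocycle is annihilated by \<open>d!\<close> up to coboundaries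
  (\<open>normalised_cocycle_torsion\<close>), so one may work at one prime \<open>p\<close> at a time. If \<open>p * f\<close> is the
  coboundary of \<open>g\<close>, then \<open>g\<close> is a two-cocycle modulo \<open>p\<close>, and \<open>f\<close> is a coboundary if and only if \<open>g\<close> is congruent
  modulo \<open>p\<close> to an integral cocycle. Normalised two-cocycles modulo \<open>p\<close> of degree \<open>d\<close> are
  multiples of the binomial one \<open>(x + y)\<^sup>d - x\<^sup>d - y\<^sup>d\<close>, divided by \<open>p\<close> if \<open>d\<close> is a power of \<open>p\<close>, and these lift;
  only for \<open>d = p ^ n * (p ^ m + 1)\<close> with \<open>m \<ge> 1\<close> is there another one, the product
  of \<open>x\<close> to the power \<open>p ^ n\<close> and \<open>y\<close> to the power \<open>p ^ (n + m)\<close> (\<open>cocyc2_zero\<close>). Its image under the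
  Bockstein homomorphism generates the summand \<open>\<int>/p\<close>. The number \<open>local_inv\<close>, a
  combination of three coefficients of \<open>f\<close>, detects this summand, and the vanishing of all these
  numbers modulo the respective primes is equivalent to being a coboundary
  (\<open>local_inv_cob2_dvd\<close>, \<open>cocycle_is_coboundary\<close>). As the primes are distinct, the invariants are
  independent (\<open>cocycle_with_invariants\<close>).
\<close>

section \<open>Binomial coefficients modulo a prime\<close>

lemma choose_prime_mult_dvd:
  fixes p n k :: nat
  assumes "Factorial_Ring.prime p" "p dvd n" "\<not> p dvd k"
  shows "p dvd (n choose k)"
proof (cases "k = 0 \<or> n = 0")
  case True
  then show ?thesis using assms by (cases "k = 0") (auto simp: binomial_eq_0)
next
  case False
  then obtain n' k' where nk: "n = Suc n'" "k = Suc k'" by (meson not0_implies_Suc)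
  have "k * (n choose k) = n * (n' choose k')"
    unfolding nk by (metis Suc_times_binomial_eq mult.commute)
  then show ?thesis using assms by (metis dvd_mult2 prime_dvd_mult_iff)
qed

text \<open>Induction on \<open>n\<close>: in Vandermonde's identity for \<open>p + p * n\<close> the terms with \<open>0 < j < p\<close>
  are divisible by \<open>p\<close>, and the two others give Pascal's rule for \<open>n\<close>.\<close>

lemma choose_prime_mult_cong:
  fixes p n k :: nat
  assumes p: "Factorial_Ring.prime p"
  shows "int p dvd int (p * n choose (p * k)) - int (n choose k)"
proof (induction n arbitrary: k)
  case 0
  then show ?case using prime_gt_0_nat[OF p] by (cases k) (auto simp: binomial_eq_0)
next
  case (Suc n)
  have p0: "p > 0" using p by (simp add: prime_gt_0_nat)
  show ?case
  proof (cases k)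
    case 0
    then show ?thesis by simp
  next
    case (Suc k')
    have "int (p * Suc n choose (p * k)) = (\<Sum>j\<le>p * k. int (p choose j) * int (p * n choose (p * k - j)))"
      using vandermonde[of p "p * n" "p * k"] by (simp add: algebra_simps flip: of_nat_mult of_nat_sum)
    also have "\<dots> = (\<Sum>j\<in>{0,p}. int (p choose j) * int (p * n choose (p * k - j)))
        + (\<Sum>j\<in>{..p * k} - {0,p}. int (p choose j) * int (p * n choose (p * k - j)))"
      using Suc p0 by (subst sum.subset_diff[of "{0,p}"]) auto
    also have "(\<Sum>j\<in>{0,p}. int (p choose j) * int (p * n choose (p * k - j)))
        = int (p * n choose (p * k)) + int (p * n choose (p * k'))"
      using p0 Suc by simp
    finally have e: "int (p * Suc n choose (p * k)) = int (p * n choose (p * k)) + int (p * n choose (p * k'))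
       + (\<Sum>j\<in>{..p * k} - {0,p}. int (p choose j) * int (p * n choose (p * k - j)))" .
    have "int p dvd (\<Sum>j\<in>{..p * k} - {0,p}. int (p choose j) * int (p * n choose (p * k - j)))"
    proof (rule dvd_sum)
      fix j assume "j \<in> {..p * k} - {0,p}"
      then have "p dvd (p choose j)"
        by (cases "j < p") (auto simp: binomial_eq_0 nat_dvd_not_less intro!: choose_prime_mult_dvd[OF p])
      then show "int p dvd int (p choose j) * int (p * n choose (p * k - j))" by simp
    qed
    moreover have "int p dvd int (p * n choose (p * k)) - int (n choose k)" by (rule Suc.IH)
    moreover have "int p dvd int (p * n choose (p * k')) - int (n choose k')" by (rule Suc.IH)
    moreover have "int (Suc n choose k) = int (n choose k) + int (n choose k')"
      using Suc by simp
    ultimately show ?thesis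
      unfolding e
      by (smt (verit) dvd_add)
  qed
qed

text \<open>Iterating the previous congruence removes the common factor \<open>p ^ e\<close>.\<close>

lemma choose_prime_power_cong:
  fixes p r :: nat
  assumes p: "Factorial_Ring.prime p"
  shows "int p dvd int (p ^ e * r choose p ^ e) - int r"
proof (induction e)
  case 0
  then show ?case by simp
next
  case (Suc e)
  have "int p dvd int (p * (p ^ e * r) choose (p * p ^ e)) - int (p ^ e * r choose p ^ e)"
    by (rule choose_prime_mult_cong[OF p])
  then have "int p dvd (int (p * (p ^ e * r) choose (p * p ^ e)) - int (p ^ e * r choose p ^ e))
     + (int (p ^ e * r choose p ^ e) - int r)"
    using Suc.IH by (rule dvd_add)
  then show ?case by (simp add: mult.assoc)
qed

lemma choose_prime_power_unit:
  fixes p r :: nat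
  assumes p: "Factorial_Ring.prime p" and "\<not> p dvd r"
  shows "\<not> int p dvd int (p ^ e * r choose p ^ e)"
  using choose_prime_power_cong[OF p, of e r] assms(2) dvd_diff[of "int p" "int (p ^ e * r choose p ^ e)" "int (p ^ e * r choose p ^ e) - int r"]
  by auto

lemma prime_power_decomp:
  fixes p n :: nat
  assumes "Factorial_Ring.prime p" "n > 0"
  obtains e r where "n = p ^ e * r" "\<not> p dvd r"
proof -
  obtain r where "n = p ^ multiplicity p n * r" "\<not> p dvd r"
    using assms prime_gt_1_nat[OF assms(1)]
    by (elim multiplicity_decompose'[of n p, rotated 2]) auto
  then show ?thesis using that by blast
qed

lemma prime_power_decomp_unique:
  fixes p r s :: nat
  assumes p: "Factorial_Ring.prime p" and "p ^ e * r = p ^ f * s" "\<not> p dvd r" "\<not> p dvd s"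
  shows "e = f \<and> r = s"
proof -
  have le: "e' \<le> f'" if "p ^ e' * r' = p ^ f' * s'" "\<not> p dvd s'" for e' f' r' s'
  proof (rule ccontr)
    assume "\<not> e' \<le> f'"
    then obtain k where k: "e' = f' + Suc k" by (metis less_imp_Suc_add not_le add_Suc_right)
    have "p ^ f' * (p ^ Suc k * r') = p ^ f' * s'" using that(1) unfolding k by (simp add: power_add mult.assoc mult.left_commute)
    then have "p ^ Suc k * r' = s'" using prime_gt_0_nat[OF p] by simp
    then show False using that(2) by auto
  qed
  have "e = f" using le[OF assms(2) assms(4)] le[OF assms(2)[symmetric] assms(3)] by simp
  then show ?thesis using assms(2) prime_gt_0_nat[OF p] by simp
qed

text \<open>If \<open>n = p ^ e * r\<close> with \<open>r > 1\<close> prime to \<open>p\<close>, then \<open>n choose p ^ e\<close> is congruent to \<open>r\<close>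
  modulo \<open>p\<close>, hence not divisible by it.\<close>

lemma power_of_prime_if_dvd_choose:
  fixes p n :: nat
  assumes p: "Factorial_Ring.prime p" and n: "n > 0"
    and dv: "\<And>a. 0 < a \<Longrightarrow> a < n \<Longrightarrow> p dvd (n choose a)"
  shows "\<exists>m. n = p ^ m"
proof -
  obtain e r where er: "n = p ^ e * r" "\<not> p dvd r" using prime_power_decomp[OF p n] .
  have "r = 1"
  proof (rule ccontr)
    assume "r \<noteq> 1"
    moreover have "r \<noteq> 0" using er n by auto
    ultimately have "p ^ e < n" using er prime_gt_0_nat[OF p] by simp
    then have "p dvd (n choose p ^ e)" using prime_gt_0_nat[OF p] by (intro dv) auto
    then show False using choose_prime_power_unit[OF p er(2), of e] er(1) by simp
  qed
  then show ?thesis using er by auto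
qed

lemma dvd_choose_prime_power:
  fixes p k u :: nat
  assumes p: "Factorial_Ring.prime p" and u: "0 < u" "u < p ^ k"
  shows "p dvd (p ^ k choose u)"
  using u
proof (induction k arbitrary: u)
  case 0
  then show ?case by simp
next
  case (Suc k)
  show ?case
  proof (cases "p dvd u")
    case True
    then obtain v where v: "u = p * v" by auto
    have "p dvd (p ^ k choose v)" using Suc.prems prime_gt_0_nat[OF p] v by (intro Suc.IH) auto
    moreover have "int p dvd int (p * p ^ k choose (p * v)) - int (p ^ k choose v)"
      by (rule choose_prime_mult_cong[OF p])
    ultimately have "int p dvd int (p * p ^ k choose (p * v))"
      by (metis zdvd_zdiffD int_dvd_int_iff)
    then show ?thesis using v by simp
  next
    case False
    then show ?thesis using choose_prime_mult_dvd[OF p, of "p ^ Suc k" u] by simp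
  qed
qed

text \<open>By Pascal's rule the entries of the row before one whose inner entries vanish modulo \<open>p\<close>
  alternate in sign, so none of them vanishes.\<close>

lemma not_dvd_choose_pred:
  fixes p n i :: nat
  assumes p: "Factorial_Ring.prime p" and i: "i < n"
    and dv: "\<And>j. 0 < j \<Longrightarrow> j \<le> i \<Longrightarrow> p dvd (n choose j)"
  shows "\<not> p dvd (n - 1 choose i)"
  using i dv
proof (induction i)
  case 0
  then show ?case using prime_gt_1_nat[OF p] by simp
next
  case (Suc i)
  obtain n' where n': "n = Suc n'" using Suc.prems by (cases n) auto
  have "p dvd (n' choose i) + (n' choose Suc i)" using Suc.prems(2)[of "Suc i"] n' by simp
  moreover have "\<not> p dvd (n - 1 choose i)" using Suc by simp
  ultimately show ?case using n' by (metis dvd_add_right_iff dvd_add_left_iff add.commute diff_Suc_1)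
qed

text \<open>The quotient by \<open>p\<close> is the binomial coefficient \<open>p ^ Suc k - 1 choose p ^ k - 1\<close> of the row
  before, which is a unit modulo \<open>p\<close>.\<close>

lemma choose_prime_power_div:
  fixes p k :: nat
  assumes p: "Factorial_Ring.prime p"
  obtains c where "p ^ Suc k choose p ^ k = p * c" "\<not> p dvd c"
proof
  have p1: "p > 1" using p by (rule prime_gt_1_nat)
  have "p ^ k * (p ^ Suc k choose p ^ k) = p ^ Suc k * (p ^ Suc k - 1 choose (p ^ k - 1))"
    using times_binomial_minus1_eq[of "p ^ k" "p ^ Suc k"] p1 by simp
  then show "p ^ Suc k choose p ^ k = p * (p ^ Suc k - 1 choose (p ^ k - 1))"
    using p1 by (simp add: mult.assoc)
  have lt: "p ^ k < p ^ Suc k" using p1 by (intro power_strict_increasing) auto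
  show "\<not> p dvd (p ^ Suc k - 1 choose (p ^ k - 1))"
  proof (rule not_dvd_choose_pred[OF p])
    show "p ^ k - 1 < p ^ Suc k" using lt by linarith
    show "p dvd (p ^ Suc k choose j)" if "0 < j" "j \<le> p ^ k - 1" for j
    proof (rule dvd_choose_prime_power[OF p that(1)])
      show "j < p ^ Suc k" using that lt by linarith
    qed
  qed
qed

lemma choose_pred_prime_unit:
  fixes p d :: nat
  assumes p: "Factorial_Ring.prime p" and "p dvd d" "d > 0"
  shows "\<not> p dvd (d - 1 choose (p - 1))"
proof (rule not_dvd_choose_pred[OF p])
  show "p - 1 < d" using assms prime_gt_0_nat[OF p] dvd_imp_le[of p d] by linarith
  fix j assume "0 < j" "j \<le> p - 1"
  then have "\<not> p dvd j" using dvd_imp_le[of p j] prime_gt_0_nat[OF p] by linarith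
  then show "p dvd (d choose j)" using choose_prime_mult_dvd[OF p assms(2)] by simp
qed

section \<open>Two-cocycles of the additive group modulo a prime\<close>

text \<open>With \<open>g u\<close> the coefficient of \<open>x ^ u * y ^ (d - u)\<close>, this is the cocycle condition modulo \<open>p\<close>
  for a form of degree \<open>d\<close> in two variables without pure powers, read off at the monomials that
  contain all three variables.\<close>

definition cocyc2 :: "nat \<Rightarrow> nat \<Rightarrow> (nat \<Rightarrow> int) \<Rightarrow> bool" where
  "cocyc2 p d g \<longleftrightarrow> (\<forall>a b c. 0 < a \<longrightarrow> 0 < b \<longrightarrow> 0 < c \<longrightarrow> a + b + c = d \<longrightarrow>
     int p dvd int (a + b choose a) * g (a + b) - int (b + c choose b) * g a)"

lemma cocyc2D:
  assumes "cocyc2 p d g" "0 < a" "0 < b" "0 < c" "a + b + c = d"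
  shows "int p dvd int (a + b choose a) * g (a + b) - int (b + c choose b) * g a"
  using assms unfolding cocyc2_def by blast

text \<open>The cocycles of degree \<open>d\<close> modulo \<open>p\<close> are spanned by one class that is visible at
  \<open>u = p ^ e\<close>, where \<open>p ^ e\<close> is the power of \<open>p\<close> in \<open>d\<close> (or the next lower power, if \<open>d\<close>
  is itself a power of \<open>p\<close>), and, for \<open>d = p ^ e * (p ^ m + 1)\<close>, by the monomials pairing
  \<open>p ^ e\<close> with \<open>p ^ (e + m)\<close>. So a cocycle that vanishes at these exponents vanishes.
  The proof is by induction on \<open>d\<close>. If \<open>p\<close> divides \<open>d\<close>, then \<open>g 1\<close> vanishes, hence so do the
  \<open>g u\<close> with \<open>u\<close> prime to \<open>p\<close>, and \<open>v \<mapsto> g (p * v)\<close> is a cocycle of degree \<open>d / p\<close>. If \<open>p\<close>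
  does not divide \<open>d\<close>, a cocycle with \<open>g 1 = 0\<close> and \<open>g (d - 1) \<noteq> 0\<close> would make all inner
  \<open>d - 1 choose a\<close> divisible by \<open>p\<close>, so that \<open>d - 1\<close> would be a power of \<open>p\<close>,
  which is the case \<open>d = p ^ m + 1\<close> covered by the third condition on \<open>g\<close>.\<close>

lemma cocyc2_zero:
  fixes p d :: nat and g :: "nat \<Rightarrow> int"
  assumes p: "Factorial_Ring.prime p" and "d \<ge> 2" "cocyc2 p d g"
    and "\<And>e. d = p ^ Suc e \<Longrightarrow> int p dvd g (p ^ e)"
    and "\<And>e r. d = p ^ e * r \<Longrightarrow> \<not> p dvd r \<Longrightarrow> r > 1 \<Longrightarrow> int p dvd g (p ^ e)"
    and "\<And>e m. d = p ^ e * (p ^ m + 1) \<Longrightarrow> m \<ge> 1 \<Longrightarrow> int p dvd g (p ^ (e + m))"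
    and "0 < u" "u < d"
  shows "int p dvd g u"
  using assms(2-)
proof (induction d arbitrary: g u rule: less_induct)
  case (less d)
  note coc = less.prems(2) and A1 = less.prems(3) and A2 = less.prems(4) and A3 = less.prems(5)
  have pi: "Factorial_Ring.prime (int p)" using p by simp
  \<comment> \<open>The cocycle condition where the third, the first, or the second of the exponents is \<open>1\<close>.\<close>
  have r1: "int p dvd int (d - 1 choose u) * g (d - 1) - int (d - u) * g u" if "0 < u" "u + 2 \<le> d" for u
  proof -
    have e: "u + (d - 1 - u) = d - 1" "(d - 1 - u) + 1 = d - u" "d - u = Suc (d - 1 - u)" using that by auto
    have "(d - u) choose (d - 1 - u) = d - u" unfolding e(3) by (simp only: binomial_Suc_n)
    then show ?thesis
      using cocyc2D[OF coc, of u "d - 1 - u" 1] that unfolding e by simp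
  qed
  have r2: "int p dvd int u * g u - int (d - 1 choose (u - 1)) * g 1" if "2 \<le> u" "u < d" for u
  proof -
    have e: "1 + (u - 1) = u" "(u - 1) + (d - u) = d - 1" using that by auto
    show ?thesis using cocyc2D[OF coc, of 1 "u - 1" "d - u"] that unfolding e by simp
  qed
  have r3: "int p dvd int (a + 1) * g (a + 1) - int (d - a) * g a" if "0 < a" "a + 2 \<le> d" for a
  proof -
    have e: "1 + (d - 1 - a) = d - a" using that by auto
    have "a + 1 choose a = a + 1" by simp
    then show ?thesis using cocyc2D[OF coc, of a 1 "d - 1 - a"] that unfolding e by simp
  qed
  have gone: "int p dvd g u" if "int p dvd g 1" "2 \<le> u" "u < d" "\<not> p dvd u" for u
  proof -
    have "int p dvd int u * g u" using zdvd_zdiffD[OF r2[OF that(2,3)]] that(1) by (simp add: dvd_mult)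
    then show ?thesis using that(4) pi by (simp add: prime_dvd_mult_iff)
  qed
  show ?case
  proof (cases "p dvd d")
    case False
    have g1: "int p dvd g 1" using A2[of 0 d] False less.prems(1) by simp
    have gd: "int p dvd g (d - 1)"
    proof (rule ccontr)
      assume ng: "\<not> int p dvd g (d - 1)"
      \<comment> \<open>Eliminating \<open>g a\<close> and \<open>g (a + 1)\<close> from the three relations leaves
        \<open>(d - 1 choose a) * (g (d - 1) - g 1)\<close>.\<close>
      have "p dvd (d - 1 choose a)" if a: "0 < a" "a < d - 1" for a
      proof -
        have "int p dvd (int (d - 1 choose a) * g (d - 1) - int (d - a) * g a)"
          using r1[of a] a by simp
        moreover have "int p dvd int (a + 1) * g (a + 1) - int (d - 1 choose a) * g 1"
          using r2[of "a + 1"] a by simp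
        moreover have "int p dvd int (a + 1) * g (a + 1) - int (d - a) * g a" using r3[of a] a by simp
        ultimately have "int p dvd int (d - 1 choose a) * g (d - 1) - int (d - 1 choose a) * g 1"
          by (smt (verit) dvd_add dvd_diff)
        then have "int p dvd int (d - 1 choose a) * g (d - 1)" using g1 by (meson zdvd_zdiffD dvd_mult)
        then show ?thesis using ng pi by (simp add: prime_dvd_mult_iff)
      qed
      then obtain m where m: "d - 1 = p ^ m"
        using power_of_prime_if_dvd_choose[OF p, of "d - 1"] less.prems(1) by auto
      have "m \<noteq> 0" using m ng g1 by (cases m) auto
      moreover have "d = p ^ 0 * (p ^ m + 1)" using m less.prems(1) by simp
      ultimately have "int p dvd g (p ^ (0 + m))" by (intro A3) auto
      then show False using m ng by simp
    qed
    show ?thesis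
    proof (cases "u = 1 \<or> u = d - 1")
      case True
      then show ?thesis using g1 gd by auto
    next
      case u: False
      have u2: "u + 2 \<le> d" "2 \<le> u" using u less.prems by auto
      have "int p dvd int (d - u) * g u"
        using dvd_diff[OF dvd_mult[OF gd, of "int (d - 1 choose u)"] r1[OF less.prems(6) u2(1)]] by simp
      moreover have "int p dvd int u * g u"
        using zdvd_zdiffD[OF r2[OF u2(2) less.prems(7)] dvd_mult[OF g1]] .
      ultimately have "int p dvd int (d - u) * g u + int u * g u" by (rule dvd_add)
      then have "int p dvd int d * g u" using less.prems by (simp add: of_nat_diff algebra_simps)
      then show ?thesis using False pi by (simp add: prime_dvd_mult_iff)
    qed
  next
    case pd: True
    \<comment> \<open>For \<open>d = p\<close> no \<open>u\<close> is divisible by \<open>p\<close>, and \<open>g 1\<close> vanishes by assumption.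
      Otherwise \<open>g 1\<close> vanishes by the cocycle relation at \<open>u = p\<close>.\<close>
    show ?thesis
    proof (cases "d = p")
      case True
      have g1: "int p dvd g 1" using A1[of 0] True by simp
      have "\<not> p dvd u" using less.prems True by (auto dest: dvd_imp_le)
      then show ?thesis using gone[OF g1, of u] g1 less.prems by (cases "u = 1") auto
    next
      case False
      have p2: "p \<ge> 2" using p by (rule prime_ge_2_nat)
      have pltd: "p < d" using pd False less.prems(1) by (metis dvd_imp_le le_neq_implies_less not_numeral_le_zero gr0I)
      have nd: "\<not> p dvd (d - 1 choose (p - 1))" using choose_pred_prime_unit[OF p pd] pltd by simp
      have g1: "int p dvd g 1"
      proof -
        have "int p dvd int p * g p - int (d - 1 choose (p - 1)) * g 1" using r2[of p] p2 pltd by simp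
        from dvd_diff[OF dvd_triv_left[of "int p" "g p"] this]
        have "int p dvd int (d - 1 choose (p - 1)) * g 1" by simp
        then show ?thesis using nd pi by (simp add: prime_dvd_mult_iff)
      qed
      show ?thesis
      proof (cases "p dvd u")
        case False
        then show ?thesis using gone[OF g1, of u] g1 less.prems by (cases "u = 1") auto
      next
        case True
        then obtain v where v: "u = p * v" by auto
        obtain d' where d': "d = p * d'" using pd by auto
        have d'2: "d' \<ge> 2" using d' pltd p2 by (cases d'; cases "d' - 1") auto
        have "int p dvd (\<lambda>v. g (p * v)) v"
        proof (rule less.IH[of d' "\<lambda>v. g (p * v)" v])
          show "d' < d" using d' d'2 p2 by simp
          show "2 \<le> d'" by fact
          show "0 < v" "v < d'" using v d' less.prems by auto
          show "cocyc2 p d' (\<lambda>v. g (p * v))"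
            unfolding cocyc2_def
          proof (intro allI impI)
            fix a b c assume abc: "0 < a" "0 < b" "0 < c" "a + b + c = d'"
            have "int p dvd int (p * a + p * b choose (p * a)) * g (p * a + p * b) - int (p * b + p * c choose (p * b)) * g (p * a)"
              using abc p2 d' by (intro cocyc2D[OF coc]) (auto simp flip: distrib_left)
            moreover have "int p dvd (int (p * (a + b) choose (p * a)) - int (a + b choose a)) * g (p * (a + b))"
              using choose_prime_mult_cong[OF p, of "a + b" a] by simp
            moreover have "int p dvd (int (p * (b + c) choose (p * b)) - int (b + c choose b)) * g (p * a)"
              using choose_prime_mult_cong[OF p, of "b + c" b] by simp
            ultimately show "int p dvd int (a + b choose a) * g (p * (a + b)) - int (b + c choose b) * g (p * a)"
              unfolding distrib_left[symmetric] left_diff_distrib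
              by (smt (verit) dvd_add dvd_diff)
          qed
          show "int p dvd g (p * p ^ e)" if "d' = p ^ Suc e" for e
            using A1[of "Suc e"] that d' by simp
          show "int p dvd g (p * p ^ e)" if "d' = p ^ e * r" "\<not> p dvd r" "r > 1" for e r
            using A2[of "Suc e" r] that d' by (simp add: mult.assoc)
          show "int p dvd g (p * p ^ (e + m))" if "d' = p ^ e * (p ^ m + 1)" "m \<ge> 1" for e m
            using A3[of "Suc e" m] that d' by (simp add: mult.assoc distrib_left)
        qed
        then show ?thesis using v by simp
      qed
    qed
  qed
qed

section \<open>Three-cocycles of the additive group with integral coefficients\<close>

text \<open>The arrays \<open>g\<close> and \<open>f\<close> are the coefficients of forms in two and in three variables, and
  \<open>cob2\<close> and \<open>cob3\<close> are the effect on coefficients of the inhomogeneous coboundary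
  \<open>g(y, z) - g(x + y, z) + g(x, y + z) - g(x, y)\<close> of the additive group and of its analogue in
  the next degree. A form that omits the first or the last variable only has monomials in which the
  exponent of this variable is \<open>0\<close>.\<close>

definition cob2 :: "(nat \<Rightarrow> nat \<Rightarrow> int) \<Rightarrow> nat \<Rightarrow> nat \<Rightarrow> nat \<Rightarrow> int" where
  "cob2 g a b c = (if a = 0 then g b c else 0) - int (a + b choose a) * g (a + b) c
     + int (b + c choose b) * g a (b + c) - (if c = 0 then g a b else 0)"

definition cob3 :: "(nat \<Rightarrow> nat \<Rightarrow> nat \<Rightarrow> int) \<Rightarrow> nat \<Rightarrow> nat \<Rightarrow> nat \<Rightarrow> nat \<Rightarrow> int" where
  "cob3 f a b c e = (if a = 0 then f b c e else 0) - int (a + b choose a) * f (a + b) c e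
     + int (b + c choose b) * f a (b + c) e - int (c + e choose c) * f a b (c + e)
     + (if e = 0 then f a b c else 0)"

definition wt2 :: "nat \<Rightarrow> (nat \<Rightarrow> nat \<Rightarrow> int) \<Rightarrow> bool" where
  "wt2 d g \<longleftrightarrow> (\<forall>a b. a + b \<noteq> d \<longrightarrow> g a b = 0)"

definition wt3 :: "nat \<Rightarrow> (nat \<Rightarrow> nat \<Rightarrow> nat \<Rightarrow> int) \<Rightarrow> bool" where
  "wt3 d f \<longleftrightarrow> (\<forall>a b c. a + b + c \<noteq> d \<longrightarrow> f a b c = 0)"

definition normal2 :: "(nat \<Rightarrow> nat \<Rightarrow> int) \<Rightarrow> bool" where
  "normal2 g \<longleftrightarrow> (\<forall>a b. a = 0 \<or> b = 0 \<longrightarrow> g a b = 0)"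

text \<open>The invariant of a cocycle of degree \<open>d = p ^ n * (p ^ m + 1)\<close> that detects its class at \<open>p\<close>:
  the three monomials distribute the parts \<open>q\<close> and \<open>(p - 1) * q\<close> of \<open>p ^ (n + m)\<close> and the part
  \<open>p ^ n\<close> over the variables in such a way that coboundaries only contribute multiples of \<open>p\<close>.\<close>

definition local_inv :: "nat \<Rightarrow> nat \<Rightarrow> nat \<Rightarrow> (nat \<Rightarrow> nat \<Rightarrow> nat \<Rightarrow> int) \<Rightarrow> int" where
  "local_inv p n m f = (let i = p ^ n; q = p ^ (n + m - 1) in
     f i q ((p - 1) * q) - f q i ((p - 1) * q) + f q ((p - 1) * q) i)"

lemma choose_assoc:
  "int (a + b choose a) * int (a + b + c choose (a + b)) = int (b + c choose b) * int (a + b + c choose a)"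
proof -
  have "(a + b + c choose (a + b)) * (a + b choose a) = (a + b + c choose a) * (b + c choose b)"
    using choose_mult[of a "a + b" "a + b + c"] by (simp add: add.assoc)
  then show ?thesis by (metis mult.commute of_nat_mult)
qed

lemma cob3_cob2_aux:
  fixes A B C D E F G x y :: int
  assumes "A * B = C * D" "C * E = F * G"
  shows "A * (x * B) + C * (y * E) = C * (x * D) + F * (y * G)"
proof -
  have "A * (x * B) + C * (y * E) = x * (A * B) + y * (C * E)" by (simp add: ac_simps)
  also have "\<dots> = C * (x * D) + F * (y * G)" unfolding assms by (simp add: ac_simps)
  finally show ?thesis .
qed

lemma cob3_cob2: "cob3 (cob2 g) a b c e = 0"
proof -
  define A B C D where "A = int (a + b choose a)" and "B = int (a + b + c choose (a + b))"
    and "C = int (b + c choose b)" and "D = int (a + b + c choose a)"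
  define E F G where "E = int (b + c + e choose (b + c))" and "F = int (c + e choose c)"
    and "G = int (b + c + e choose b)"
  note df = A_def B_def C_def D_def E_def F_def G_def
  have 1: "A * B = C * D" unfolding df by (rule choose_assoc)
  have 2: "C * E = F * G" unfolding df by (rule choose_assoc)
  have z: "a = 0 \<Longrightarrow> A = 1 \<and> B = C \<and> D = 1" "b = 0 \<Longrightarrow> A = 1 \<and> C = 1 \<and> G = 1 \<and> D = B \<and> E = F"
    "c = 0 \<Longrightarrow> B = 1 \<and> C = 1 \<and> F = 1 \<and> D = A \<and> E = G" "e = 0 \<Longrightarrow> E = 1 \<and> F = 1 \<and> G = C"
    unfolding df by auto
  have "cob3 (cob2 g) a b c e = C * (y * E) + A * (x * B) - (C * (x * D) + F * (y * G))"
    if "x = g (a + b + c) e" "y = g a (b + c + e)" for x y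
    unfolding cob3_def cob2_def that
    unfolding add.assoc[symmetric] A_def[symmetric] B_def[symmetric] C_def[symmetric] D_def[symmetric]
      E_def[symmetric] F_def[symmetric] G_def[symmetric]
    using z by (cases "a = 0"; cases "b = 0"; cases "c = 0"; cases "e = 0") (simp_all add: algebra_simps)
  from this[OF refl refl] show ?thesis
    using cob3_cob2_aux[OF 1 2, of "g (a + b + c) e" "g a (b + c + e)"] by linarith
qed

lemma cob2_add: "cob2 (\<lambda>a b. g a b + h a b) a b c = cob2 g a b c + cob2 h a b c"
  by (simp add: cob2_def algebra_simps)

lemma cob2_diff: "cob2 (\<lambda>a b. g a b - h a b) a b c = cob2 g a b c - cob2 h a b c"
  by (simp add: cob2_def algebra_simps)

lemma cob2_mult: "cob2 (\<lambda>a b. k * g a b) a b c = k * cob2 g a b c"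
  by (simp add: cob2_def algebra_simps)

lemma cob3_diff: "cob3 (\<lambda>a b c. f a b c - h a b c) a b c e = cob3 f a b c e - cob3 h a b c e"
  by (simp add: cob3_def algebra_simps)

lemma cob3_mult: "cob3 (\<lambda>a b c. k * f a b c) a b c e = k * cob3 f a b c e"
  by (simp add: cob3_def algebra_simps)

lemma cob2_nrm: "normal2 g \<Longrightarrow> a = 0 \<or> b = 0 \<or> c = 0 \<Longrightarrow> cob2 g a b c = 0"
  by (auto simp: cob2_def normal2_def)

lemma cob2_wt: "wt2 d g \<Longrightarrow> a + b + c \<noteq> d \<Longrightarrow> cob2 g a b c = 0"
  by (auto simp: cob2_def wt2_def)

lemma cob2_pos:
  "0 < a \<Longrightarrow> 0 < c \<Longrightarrow> cob2 g a b c = int (b + c choose b) * g a (b + c) - int (a + b choose a) * g (a + b) c"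
  by (auto simp: cob2_def)

lemma local_inv_diff: "local_inv p n m (\<lambda>a b c. f a b c - h a b c) = local_inv p n m f - local_inv p n m h"
  by (simp add: local_inv_def Let_def)

lemma local_inv_mult: "local_inv p n m (\<lambda>a b c. k * f a b c) = k * local_inv p n m f"
  by (simp add: local_inv_def Let_def algebra_simps)

text \<open>Put \<open>i = p ^ n\<close> and \<open>q = p ^ (n + m - 1)\<close>, so that \<open>p * q = p ^ (n + m)\<close>. On \<open>cob2 g\<close> the
  alternating sum over the three positions of \<open>i\<close> makes the values of \<open>g\<close> at
  \<open>(i + q, (p - 1) * q)\<close> and \<open>(q, i + (p - 1) * q)\<close> cancel, and what remains is the
  antisymmetrization of \<open>g\<close> at \<open>(i, p * q)\<close>, times one binomial coefficient.\<close>

lemma local_inv_cob2: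
  assumes p: "Factorial_Ring.prime p" and m: "m \<ge> 1"
  shows "local_inv p n m (cob2 g)
    = int (p ^ (n + m) choose p ^ (n + m - 1)) * (g (p ^ n) (p ^ (n + m)) - g (p ^ (n + m)) (p ^ n))"
proof -
  define q where "q = p ^ (n + m - 1)"
  define i where "i = p ^ n"
  obtain s where s: "p = Suc s" "s > 0" using prime_gt_1_nat[OF p] by (cases p) auto
  have q: "p ^ (n + m) = q + s * q" "q > 0"
    using m s by (cases "n + m"; simp add: q_def)+
  have i: "i > 0" using s by (simp add: i_def)
  have ps: "p - 1 = s" using s by simp
  have sq: "s * q > 0" using s q by simp
  have e1: "int (q + i choose q) = int (i + q choose i)"
    using binomial_symmetric[of q "q + i"] by (simp add: add.commute)
  have e2: "int (s * q + i choose s * q) = int (i + s * q choose i)"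
    using binomial_symmetric[of i "i + s * q"] by (simp add: add.commute)
  show ?thesis
    unfolding local_inv_def Let_def q_def[symmetric] i_def[symmetric] q(1) ps
    using cob2_pos[of i "s * q" g q] cob2_pos[of q "s * q" g i] cob2_pos[of q i g "s * q"] i q(2) sq e1 e2
    by (simp add: algebra_simps)
qed

lemma choose_prime_power_div_int:
  fixes p :: nat
  assumes p: "Factorial_Ring.prime p" and m: "m \<ge> (1::nat)"
  obtains c where "int (p ^ (n + m) choose p ^ (n + m - 1)) = int p * int c" "\<not> p dvd c"
proof -
  obtain k where k: "n + m = Suc k" using m by (cases "n + m") auto
  obtain c where "p ^ Suc k choose p ^ k = p * c" "\<not> p dvd c" using choose_prime_power_div[OF p] .
  then show ?thesis using that[of c] k by (metis diff_Suc_1 of_nat_mult)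
qed

text \<open>The remaining binomial coefficient \<open>p ^ (n + m) choose p ^ (n + m - 1)\<close> is divisible by \<open>p\<close>. It is
  not divisible by the square of \<open>p\<close>, which is why the invariant loses no information.\<close>

lemma local_inv_cob2_dvd:
  assumes "Factorial_Ring.prime p" "m \<ge> 1"
  shows "int p dvd local_inv p n m (cob2 g)"
  using choose_prime_power_div_int[OF assms, of n] unfolding local_inv_cob2[OF assms]
  by (metis dvd_mult2 dvd_triv_left)

subsection \<open>Normalisation\<close>

text \<open>Subtracting the coboundary of a form in pure powers kills the coefficients of \<open>z ^ d\<close> and
  \<open>x ^ d\<close>; the cocycle identity at degenerate arguments then kills every other monomial that
  omits a variable.\<close>

lemma normalise_cocycle:
  assumes d: "d > 0" and w: "wt3 d f" and coc: "\<And>a b c e. cob3 f a b c e = 0"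
  obtains g where "wt2 d g"
    "\<And>a b c. a = 0 \<or> b = 0 \<or> c = 0 \<Longrightarrow> f a b c = cob2 g a b c"
proof -
  define g where "g a b = (if a + b \<noteq> d then 0 else if a = 0 then f 0 0 d else if b = 0 then - f d 0 0 else 0)" for a b
  define h where "h a b c = f a b c - cob2 g a b c" for a b c
  have wg: "wt2 d g" by (auto simp: wt2_def g_def)
  have wh: "h a b c = 0" if "a + b + c \<noteq> d" for a b c
    using w wg that by (simp add: h_def wt3_def cob2_wt)
  have hc: "cob3 h a b c e = 0" for a b c e
    unfolding h_def by (subst cob3_diff) (simp add: coc cob3_cob2)
  have h0: "h 0 b c = 0" for b c
  proof -
    have "h 0 0 d = 0" using d by (simp add: h_def cob2_def g_def)
    then have "h 0 0 n = 0" for n using wh[of 0 0 n] by (cases "n = d") auto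
    then show ?thesis using hc[of 0 0 b c] by (auto simp: cob3_def split: if_splits)
  qed
  have h1: "h a b 0 = 0" for a b
  proof -
    have "h d 0 0 = 0" using d by (simp add: h_def cob2_def g_def)
    then have "h n 0 0 = 0" for n using wh[of n 0 0] by (cases "n = d") auto
    then show ?thesis using hc[of a b 0 0] h0 by (auto simp: cob3_def split: if_splits)
  qed
  have h2: "h a 0 c = 0" for a c
    using hc[of a 0 0 c] h0 h1 by (cases "a = 0"; cases "c = 0") (auto simp: cob3_def)
  show ?thesis
  proof (rule that[OF wg])
    fix a b c :: nat assume "a = 0 \<or> b = 0 \<or> c = 0"
    then have "h a b c = 0" using h0 h1 h2 by auto
    then show "f a b c = cob2 g a b c" by (simp add: h_def)
  qed
qed

subsection \<open>Normalised cocycles are torsion\<close>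

text \<open>Comparing coefficients linear in the first variable gives a rational primitive: the cocycle
  identity at exponents \<open>(1, a - 1, b, c)\<close> expresses \<open>a\<close> times the coefficient at \<open>(a, b, c)\<close>
  through coefficients at which the first variable is linear. Dividing by \<open>a\<close> integrates this, and
  \<open>d!\<close> clears the denominators, since all exponents are at most \<open>d\<close>.\<close>

lemma normalised_cocycle_torsion:
  assumes w: "wt3 d f" and coc: "\<And>a b c e. cob3 f a b c e = 0"
    and nrm: "\<And>a b c. a = 0 \<or> b = 0 \<or> c = 0 \<Longrightarrow> f a b c = 0"
  obtains g where "wt2 d g" "normal2 g" "\<And>a b c. fact d * f a b c = cob2 g a b c"
proof -
  \<comment> \<open>\<open>d!\<close> divided by \<open>u\<close>, the integral form of the factor \<open>1 / u\<close>.\<close>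
  define L where "L = (\<lambda>u. int (fact d div u))"
  have L: "int u * L u = fact d" if "0 < u" "u \<le> d" for u
  proof -
    have "u dvd fact d" using that by (simp add: dvd_fact)
    then have "u * (fact d div u) = fact d" by simp
    then show ?thesis unfolding L_def by (metis of_nat_mult of_nat_fact)
  qed
  define g where "g u v = (if u = 0 then 0 else - (L u) * f 1 (u - 1) v)" for u v
  have g1: "g 1 v = 0" for v using nrm by (simp add: g_def)
  have normal2: "normal2 g" by (auto simp: normal2_def g_def nrm)
  have "wt2 d g"
    unfolding wt2_def g_def
  proof (intro allI impI)
    fix a b assume "a + b \<noteq> d"
    then have "a \<noteq> 0 \<Longrightarrow> f 1 (a - 1) b = 0" using w unfolding wt3_def by simp
    then show "(if a = 0 then 0 else - L a * f 1 (a - 1) b) = 0" by simp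
  qed
  moreover have "fact d * f a b c = cob2 g a b c" for a b c
  proof (cases "a = 0 \<or> b = 0 \<or> c = 0 \<or> a + b + c \<noteq> d")
    case True
    then show ?thesis using nrm normal2 cob2_nrm[of g a b c] cob2_wt[OF \<open>wt2 d g\<close>, of a b c] w
      by (auto simp: wt3_def)
  next
    case False
    then obtain a' where a': "a = Suc a'" and abc: "b > 0" "c > 0" "a + b + c = d" by (cases a) auto
    have *: "int a * f a b c = int (a' + b choose a') * f 1 (a' + b) c - int (b + c choose b) * f 1 a' (b + c)"
      using coc[of 1 a' b c] abc(2) a' by (auto simp: cob3_def)
    have ab: "int (a + b) * (int a * int (a + b choose a)) = int (a + b) * (int (a + b) * int (a' + b choose a'))"
    proof -
      have "Suc a' * (Suc (a' + b) choose Suc a') = Suc (a' + b) * (a' + b choose a')"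
        by (rule Suc_times_binomial)
      then show ?thesis using a' by (metis add_Suc of_nat_mult)
    qed
    have "int a * cob2 g a b c = int (a + b choose a) * int a * L (a + b) * f 1 (a' + b) c
         - int (b + c choose b) * (int a * L a) * f 1 a' (b + c)"
      using False a' by (simp add: cob2_pos g_def algebra_simps)
    also have "int (a + b choose a) * int a * L (a + b) = int (a' + b choose a') * (int (a + b) * L (a + b))"
      using ab a' by (simp add: mult.assoc mult.left_commute mult.commute)
    also have "int (a + b) * L (a + b) = fact d" using L[of "a + b"] a' abc by simp
    also have "int a * L a = fact d" using L[of a] a' abc by simp
    finally have "int a * cob2 g a b c = fact d * (int a * f a b c)"
      unfolding * by (simp add: algebra_simps)
    then show ?thesis using a' by simp
  qed
  ultimately show ?thesis using that normal2 by blast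
qed

subsection \<open>The local invariants are complete\<close>

lemma cocyc2_of_divisible:
  assumes "\<And>a b c. int p * f a b c = cob2 g a b c"
  shows "cocyc2 p d (\<lambda>u. g u (d - u))"
  unfolding cocyc2_def
proof (intro allI impI)
  fix a b c assume a: "0 < a" "0 < b" "0 < c" "a + b + c = d"
  then have e: "d - (a + b) = c" "d - a = b + c" by auto
  show "int p dvd int (a + b choose a) * g (a + b) (d - (a + b)) - int (b + c choose b) * g a (d - a)"
    unfolding e
  proof (rule dvdI)
    show "int (a + b choose a) * g (a + b) c - int (b + c choose b) * g a (b + c) = int p * (- f a b c)"
      using assms[of a b c] cob2_pos[of a c g b] a by simp
  qed
qed

lemma cocyc2_diff: "cocyc2 p d g \<Longrightarrow> cocyc2 p d h \<Longrightarrow> cocyc2 p d (\<lambda>u. g u - h u)"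
  unfolding cocyc2_def
proof (intro allI impI)
  assume a: "\<forall>a b c. 0 < a \<longrightarrow> 0 < b \<longrightarrow> 0 < c \<longrightarrow> a + b + c = d \<longrightarrow>
     int p dvd int (a + b choose a) * g (a + b) - int (b + c choose b) * g a"
    "\<forall>a b c. 0 < a \<longrightarrow> 0 < b \<longrightarrow> 0 < c \<longrightarrow> a + b + c = d \<longrightarrow>
     int p dvd int (a + b choose a) * h (a + b) - int (b + c choose b) * h a"
  fix a b c assume "0 < a" "0 < b" "0 < c" "a + b + c = d"
  then have "int p dvd (int (a + b choose a) * g (a + b) - int (b + c choose b) * g a)
     - (int (a + b choose a) * h (a + b) - int (b + c choose b) * h a)" using a by - (rule dvd_diff; blast)
  then show "int p dvd int (a + b choose a) * (g (a + b) - h (a + b)) - int (b + c choose b) * (g a - h a)"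
    by (simp add: algebra_simps)
qed

text \<open>The form \<open>(x + y) ^ d - x ^ d - y ^ d\<close> is a cocycle, and so is every rational multiple of it.\<close>

lemma cob2_scaled_binomial:
  assumes k: "\<And>u. 0 < u \<Longrightarrow> u < d \<Longrightarrow> s * k u = h * int (d choose u)" and s: "s \<noteq> 0"
  shows "cob2 (\<lambda>a b. if a + b = d \<and> 0 < a \<and> 0 < b then k a else 0) a b c = 0"
proof (cases "a = 0 \<or> b = 0 \<or> c = 0 \<or> a + b + c \<noteq> d")
  case True
  have wn: "wt2 d (\<lambda>a b. if a + b = d \<and> 0 < a \<and> 0 < b then k a else 0)"
    "normal2 (\<lambda>a b. if a + b = d \<and> 0 < a \<and> 0 < b then k a else 0)"
    by (auto simp: wt2_def normal2_def)
  show ?thesis using cob2_nrm[OF wn(2)] cob2_wt[OF wn(1)] True by blast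
next
  case False
  then have d: "d = a + b + c" by simp
  have "s * (int (b + c choose b) * k a) = int (b + c choose b) * (s * k a)" by simp
  also have "\<dots> = h * (int (b + c choose b) * int (a + b + c choose a))"
    using k[of a] False d by simp
  also have "\<dots> = h * (int (a + b choose a) * int (a + b + c choose (a + b)))"
    by (simp only: choose_assoc)
  also have "\<dots> = int (a + b choose a) * (s * k (a + b))"
    using k[of "a + b"] False d by simp
  also have "\<dots> = s * (int (a + b choose a) * k (a + b))" by simp
  finally have "s * (int (b + c choose b) * k a) = s * (int (a + b choose a) * k (a + b))" .
  then have "int (b + c choose b) * k a = int (a + b choose a) * k (a + b)" using s by simp
  then show ?thesis using False d by (auto simp: cob2_pos add.assoc)
qed

lemma cong_multiple:
  fixes P c x :: int
  assumes "Factorial_Ring.prime P" "\<not> P dvd c"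
  obtains h where "P dvd x - h * c"
proof -
  have "coprime P c" using assms by (rule prime_imp_coprime)
  then obtain u v where "u * P + v * c = 1" by (metis bezout_int coprime_iff_gcd_eq_1)
  then have "x - (x * v) * c = x * (u * P + v * c) - (x * v) * c" by simp
  also have "\<dots> = P * (x * u)" by (simp add: algebra_simps)
  finally have "x - (x * v) * c = P * (x * u)" .
  then show ?thesis using that[of "x * v"] by simp
qed

lemma not_dvd_prime_power_plus_1:
  fixes p k :: nat
  assumes p: "Factorial_Ring.prime p" and "k \<ge> 1"
  shows "\<not> p dvd p ^ k + 1"
proof
  assume "p dvd p ^ k + 1"
  moreover have "p dvd p ^ k" using assms by (simp add: dvd_power)
  ultimately have "p dvd 1" by (metis dvd_add_right_iff)
  then show False using prime_gt_1_nat[OF p] by simp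
qed

text \<open>The factor \<open>p ^ m + 1\<close> is prime to \<open>p\<close>, so a prime in \<open>J d\<close> comes with well-defined
  exponents and contributes a single invariant.\<close>

lemma J_exponents_unique:
  fixes p :: nat
  assumes p: "Factorial_Ring.prime p" and "p ^ n * (p ^ m + 1) = p ^ n' * (p ^ m' + 1)" "m \<ge> 1" "m' \<ge> 1"
  shows "n = n' \<and> m = m'"
proof -
  have "n = n' \<and> p ^ m + 1 = p ^ m' + 1"
    using not_dvd_prime_power_plus_1[OF p] assms(3,4) by (intro prime_power_decomp_unique[OF p assms(2)]) auto
  then show ?thesis using prime_gt_1_nat[OF p] by simp
qed

text \<open>Let \<open>p * f\<close> be the coboundary of \<open>g\<close>. Then \<open>g\<close> is a cocycle modulo \<open>p\<close>, and \<open>f\<close> is a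
  coboundary as soon as \<open>g\<close> is congruent modulo \<open>p\<close> to an integral cocycle \<open>k\<close>, because then
  \<open>f\<close> is the coboundary of \<open>(g - k) / p\<close>. Such a \<open>k\<close> is sought among the multiples of
  \<open>(x + y) ^ d - x ^ d - y ^ d\<close>, divided by \<open>p\<close> if \<open>d\<close> is a power of \<open>p\<close>: a multiple is chosen
  that agrees with \<open>g\<close> at one exponent, and \<open>cocyc2_zero\<close> compares the two. The only other class of
  cocycles modulo \<open>p\<close> occurs for \<open>d = p ^ n * (p ^ m + 1)\<close>; there the invariant of \<open>f\<close> is, up
  to a unit, the difference of the values of \<open>g\<close> at the two exponents \<open>p ^ n\<close> and
  \<open>p ^ (n + m)\<close>, which for the symmetric \<open>k\<close> are equal.\<close>

lemma divide_coboundary: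
  assumes p: "Factorial_Ring.prime p" and d: "d > 0"
    and g: "wt2 d g" "normal2 g" and f: "\<And>a b c. int p * f a b c = cob2 g a b c"
    and iv: "\<And>n m. d = p ^ n * (p ^ m + 1) \<Longrightarrow> m \<ge> 1 \<Longrightarrow> int p dvd local_inv p n m f"
  shows "\<exists>g'. wt2 d g' \<and> normal2 g' \<and> (\<forall>a b c. f a b c = cob2 g' a b c)"
proof -
  have p0: "p > 0" "p > 1" using prime_gt_0_nat[OF p] prime_gt_1_nat[OF p] by auto
  have pi: "Factorial_Ring.prime (int p)" using p by simp
  define G where "G u = g u (d - u)" for u
  have G: "cocyc2 p d G" unfolding G_def by (rule cocyc2_of_divisible[OF f])
  obtain e r where er: "d = p ^ e * r" "\<not> p dvd r" using prime_power_decomp[OF p d] .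
  have r0: "r > 0" using er d by (cases r) auto
  have ex: "\<exists>s h k. s \<noteq> 0 \<and> (\<forall>u. 0 < u \<longrightarrow> u < d \<longrightarrow> s * k u = h * int (d choose u)) \<and> (\<forall>u. 0 < u \<longrightarrow> u < d \<longrightarrow> int p dvd G u - k u)" if d2: "d \<ge> 2"
  proof -
    have main: "int p dvd G u - k u" if k: "s \<noteq> 0" "\<And>u. 0 < u \<Longrightarrow> u < d \<Longrightarrow> s * k u = h * int (d choose u)" and u: "0 < u" "u < d"
        and c1: "\<And>e. d = p ^ Suc e \<Longrightarrow> int p dvd G (p ^ e) - k (p ^ e)"
        and c2: "r > 1 \<Longrightarrow> int p dvd G (p ^ e) - k (p ^ e)" for s h k u
    proof (rule cocyc2_zero[where g = "\<lambda>u. G u - k u", OF p d2 _ c1 _ _ u])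
      show "cocyc2 p d (\<lambda>u. G u - k u)"
      proof (rule cocyc2_diff[OF G])
        show "cocyc2 p d k"
          unfolding cocyc2_def
        proof (intro allI impI)
          fix a b c assume a: "0 < a" "0 < b" "0 < c" "a + b + c = d"
          show "int p dvd int (a + b choose a) * k (a + b) - int (b + c choose b) * k a"
            using cob2_scaled_binomial[where s = s and k = k and h = h, OF k(2,1), of a b c] a
              by (simp add: cob2_pos add.assoc)
        qed
      qed
      show "int p dvd G (p ^ e') - k (p ^ e')" if "d = p ^ e' * r'" "\<not> p dvd r'" "1 < r'" for e' r'
        using prime_power_decomp_unique[OF p _ that(2) er(2), of e' e] that er(1) c2 by simp
      show "int p dvd G (p ^ (n + m)) - k (p ^ (n + m))" if dd: "d = p ^ n * (p ^ m + 1)" and m: "m \<ge> 1" for n m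
      proof -
        have nd: "\<not> p dvd p ^ m + 1" by (rule not_dvd_prime_power_plus_1[OF p m])
        have "n = e \<and> p ^ m + 1 = r" using prime_power_decomp_unique[OF p _ nd er(2), of n e] dd er(1) by simp
        then have ne: "n = e" "r > 1" using p0 by auto
        have ds: "d - p ^ n = p ^ (n + m)" "d - p ^ (n + m) = p ^ n" using dd by (simp_all add: power_add distrib_left)
        obtain c where c: "int (p ^ (n + m) choose p ^ (n + m - 1)) = int p * int c" "\<not> p dvd c"
          using choose_prime_power_div_int[OF p m] .
        have "int p * local_inv p n m f = local_inv p n m (\<lambda>a b c. int p * f a b c)" by (rule local_inv_mult[symmetric])
        also have "\<dots> = local_inv p n m (cob2 g)" unfolding f ..
        also have "\<dots> = int p * (int c * (G (p ^ n) - G (p ^ (n + m))))"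
          unfolding local_inv_cob2[OF p m] c(1) G_def ds by simp
        finally have "local_inv p n m f = int c * (G (p ^ n) - G (p ^ (n + m)))" using p0 by simp
        then have 1: "int p dvd G (p ^ n) - G (p ^ (n + m))"
          using iv[OF dd m] c(2) pi by (simp add: prime_dvd_mult_iff)
        have lt: "0 < p ^ n" "p ^ n < d" "0 < p ^ (n + m)" "p ^ (n + m) < d"
          using ds p0 dd by (auto simp: power_add)
        have "s * k (p ^ (n + m)) = s * k (p ^ n)"
          using binomial_symmetric[of "p ^ n" d] ds(1) k(2)[OF lt(1,2)] k(2)[OF lt(3,4)] lt(2) by simp
        then have 2: "k (p ^ (n + m)) = k (p ^ n)" using k(1) by simp
        have "int p dvd G (p ^ n) - k (p ^ n)" using c2 ne by simp
        from dvd_diff[OF this 1] show ?thesis using 2 by simp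
      qed
    qed
    show ?thesis
    proof (cases "r = 1")
      case True
      obtain e' where e': "e = Suc e'" using True er d2 by (cases e) auto
      have de: "d = p ^ Suc e'" using True er e' by simp
      define k0 where "k0 u = (if 0 < u \<and> u < d then int (d choose u) div int p else 0)" for u
      have k0: "int p * k0 u = int (d choose u)" if "0 < u" "u < d" for u
        using dvd_choose_prime_power[OF p, of u "Suc e'"] that de by (auto simp: k0_def)
      obtain c where c: "p ^ Suc e' choose p ^ e' = p * c" "\<not> p dvd c" using choose_prime_power_div[OF p] .
      obtain h where h: "int p dvd G (p ^ e') - h * int c" using cong_multiple[OF pi, of "int c" "G (p ^ e')"] c(2) by auto
      define k where "k u = h * k0 u" for u
      \<comment> \<open>Here \<open>d\<close> is a power of \<open>p\<close>, so the binomial cocycle is divisible by \<open>p\<close>.\<close>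
      have k: "int p * k u = h * int (d choose u)" if "0 < u" "u < d" for u
        using k0[OF that] by (simp add: k_def)
      have "int p dvd G u - k u" if "0 < u" "u < d" for u
      proof (rule main[where s = "int p" and h = h and k = k, OF _ k that])
        show "int p dvd G (p ^ e'') - k (p ^ e'')" if "d = p ^ Suc e''" for e''
        proof -
          have "e'' = e'" using that de p0 by simp
          moreover have "k0 (p ^ e') = int c" using k0[of "p ^ e'"] p0 c(1) unfolding de by simp
          ultimately show ?thesis using h by (simp add: k_def)
        qed
      qed (use True p0 in auto)
      then show ?thesis using k p0 by (intro exI[of _ "int p"] exI[of _ h] exI[of _ k]) auto
    next
      case False
      then have r1: "r > 1" using r0 by simp
      have "\<not> int p dvd int (d choose p ^ e)" using choose_prime_power_unit[OF p er(2), of e] er(1) by simp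
      then obtain h where h: "int p dvd G (p ^ e) - h * int (d choose p ^ e)"
        using cong_multiple[OF pi] by blast
      have "int p dvd G u - h * int (d choose u)" if "0 < u" "u < d" for u
      proof (rule main[where s = 1 and h = h and k = "\<lambda>u. h * int (d choose u)", OF _ _ that])
        show "int p dvd G (p ^ e') - h * int (d choose p ^ e')" if "d = p ^ Suc e'" for e'
          using prime_power_decomp_unique[OF p, of "Suc e'" 1 e r] that er r1 p0 by simp
      qed (use h in auto)
      then show ?thesis by (intro exI[of _ "1::int"] exI[of _ h] exI[of _ "\<lambda>u. h * int (d choose u)"]) auto
    qed
  qed
  show ?thesis
  proof (cases "d \<ge> 2")
    case False
    then have d1: "d = 1" using d by simp
    have g0: "g a b = 0" for a b using g d1 by (cases "a = 0"; cases "b = 0") (auto simp: wt2_def normal2_def)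
    have "cob2 g a b c = 0" for a b c by (simp add: cob2_def g0)
    then have "f a b c = cob2 g a b c" for a b c using f[of a b c] p0 by simp
    then show ?thesis using g by blast
  next
    case True
    obtain s h k where s: "s \<noteq> (0::int)" and k: "\<And>u. 0 < u \<Longrightarrow> u < d \<Longrightarrow> s * k u = h * int (d choose u)"
      and pk: "\<And>u. 0 < u \<Longrightarrow> u < d \<Longrightarrow> int p dvd G u - k u" using ex[OF True] by blast
    define g' where "g' a b = (if a + b = d \<and> 0 < a \<and> 0 < b then (G a - k a) div int p else 0)" for a b
    have pg': "int p * g' a b = g a b - (if a + b = d \<and> 0 < a \<and> 0 < b then k a else 0)" for a b
    proof (cases "a + b = d \<and> 0 < a \<and> 0 < b")
      case True
      then have "d - a = b" "a < d" by auto
      then show ?thesis using True pk[of a] by (simp add: g'_def G_def)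
    next
      case False
      then have "g a b = 0" using g by (auto simp: wt2_def normal2_def)
      then show ?thesis using False by (auto simp: g'_def)
    qed
    have "f a b c = cob2 g' a b c" for a b c
    proof -
      have "int p * cob2 g' a b c = cob2 (\<lambda>a b. int p * g' a b) a b c" by (rule cob2_mult[symmetric])
      also have "\<dots> = cob2 g a b c - cob2 (\<lambda>a b. if a + b = d \<and> 0 < a \<and> 0 < b then k a else 0) a b c"
        unfolding pg' by (rule cob2_diff)
      also have "cob2 (\<lambda>a b. if a + b = d \<and> 0 < a \<and> 0 < b then k a else 0) a b c = 0"
        by (rule cob2_scaled_binomial[where s = s and h = h, OF k s])
      also have "cob2 g a b c - 0 = cob2 g a b c" by simp
      also have "\<dots> = int p * f a b c" by (rule f[symmetric])
      finally show ?thesis using p0 by simp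
    qed
    moreover have "wt2 d g'" "normal2 g'" by (auto simp: wt2_def normal2_def g'_def)
    ultimately show ?thesis by blast
  qed
qed

text \<open>Some positive multiple of a normalised cocycle is a coboundary. If the least such multiple were not
  \<open>1\<close>, it could be divided by one of its prime factors.\<close>

theorem cocycle_is_coboundary:
  assumes d: "d > 0" and w: "wt3 d f" and coc: "\<And>a b c e. cob3 f a b c e = 0"
    and iv: "\<And>p n m. Factorial_Ring.prime p \<Longrightarrow> d = p ^ n * (p ^ m + 1) \<Longrightarrow> m \<ge> 1 \<Longrightarrow> int p dvd local_inv p n m f"
  obtains g where "wt2 d g" "\<And>a b c. f a b c = cob2 g a b c"
proof -
  obtain g0 where g0: "wt2 d g0" "\<And>a b c. a = 0 \<or> b = 0 \<or> c = 0 \<Longrightarrow> f a b c = cob2 g0 a b c"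
    using normalise_cocycle[OF d w coc] by blast
  define h where "h a b c = f a b c - cob2 g0 a b c" for a b c
  have wh: "wt3 d h" using w g0(1) by (simp add: h_def wt3_def cob2_wt)
  have hc: "cob3 h a b c e = 0" for a b c e
    unfolding h_def by (subst cob3_diff) (simp add: coc cob3_cob2)
  have h0: "h a b c = 0" if "a = 0 \<or> b = 0 \<or> c = 0" for a b c
    using g0(2)[OF that] by (simp add: h_def)
  have hi: "int p dvd local_inv p n m h" if "Factorial_Ring.prime p" "d = p ^ n * (p ^ m + 1)" "m \<ge> 1" for p n m
    unfolding h_def local_inv_diff using iv[OF that] local_inv_cob2_dvd[OF that(1,3)] by (rule dvd_diff)
  define Q where "Q N \<longleftrightarrow> N > 0 \<and> (\<exists>g. wt2 d g \<and> normal2 g \<and> (\<forall>a b c. int N * h a b c = cob2 g a b c))" for N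
  obtain g1 where g1: "wt2 d g1" "normal2 g1" "\<And>a b c. fact d * h a b c = cob2 g1 a b c"
    using normalised_cocycle_torsion[OF wh hc h0] by blast
  have "Q (fact d)" unfolding Q_def
  proof (intro conjI exI[of _ g1] allI)
    show "int (fact d) * h a b c = cob2 g1 a b c" for a b c using g1(3) by simp
  qed (use g1 in auto)
  then have QL: "Q (LEAST N. Q N)" by (rule LeastI)
  define N where "N = (LEAST N. Q N)"
  have QN: "Q N" unfolding N_def by (rule QL)
  have "N = 1"
  proof (rule ccontr)
    assume "N \<noteq> 1"
    then obtain p where p: "Factorial_Ring.prime p" "p dvd N" using prime_factor_nat by blast
    then obtain M where M: "N = p * M" by auto
    obtain g where g: "wt2 d g" "normal2 g" "\<And>a b c. int N * h a b c = cob2 g a b c"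
      using QN unfolding Q_def by (elim conjE exE) simp
    have "\<exists>g'. wt2 d g' \<and> normal2 g' \<and> (\<forall>a b c. int M * h a b c = cob2 g' a b c)"
    proof (rule divide_coboundary[OF p(1) d g(1,2)])
      show "int p * (int M * h a b c) = cob2 g a b c" for a b c using g(3)[of a b c] M by simp
      show "int p dvd local_inv p n m (\<lambda>a b c. int M * h a b c)" if "d = p ^ n * (p ^ m + 1)" "m \<ge> 1" for n m
        unfolding local_inv_mult using hi[OF p(1) that] by simp
    qed
    moreover have "M > 0" using QN M unfolding Q_def by (cases M) auto
    ultimately have "Q M" unfolding Q_def by (intro conjI)
    then have "N \<le> M" unfolding N_def by (rule Least_le)
    then show False using M \<open>M > 0\<close> prime_gt_1_nat[OF p(1)] by simp
  qed
  then obtain g where g: "wt2 d g" "\<And>a b c. h a b c = cob2 g a b c"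
    using QN unfolding Q_def by (elim conjE exE) simp
  show ?thesis
  proof (rule that)
    show "wt2 d (\<lambda>a b. g0 a b + g a b)" using g g0 by (simp add: wt2_def)
    show "f a b c = cob2 (\<lambda>a b. g0 a b + g a b) a b c" for a b c
      unfolding cob2_add g(2)[symmetric] by (simp add: h_def)
  qed
qed

subsection \<open>The local invariants are independent\<close>

text \<open>Both exponents of \<open>x ^ (p ^ n) * y ^ (p ^ (n + m))\<close> are powers of \<open>p\<close>, so its coboundary is
  divisible by \<open>p\<close>. The quotient is a cocycle, and its invariant is the quotient by \<open>p\<close> of
  \<open>p ^ (n + m) choose p ^ (n + m - 1)\<close>, a unit.\<close>

lemma local_cocycle:
  assumes p: "Factorial_Ring.prime p" and d: "d = p ^ n * (p ^ m + 1)" and m: "m \<ge> 1"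
  shows "\<exists>f g. wt3 d f \<and> (\<forall>a b c e. cob3 f a b c e = 0) \<and> (\<forall>a b c. int p * f a b c = cob2 g a b c)
    \<and> \<not> int p dvd local_inv p n m f"
proof -
  have p0: "p > 0" "p > 1" using prime_gt_0_nat[OF p] prime_gt_1_nat[OF p] by auto
  define g where "g a b = (if a = p ^ n \<and> b = p ^ (n + m) then 1::int else 0)" for a b
  define f where "f a b c = cob2 g a b c div int p" for a b c
  have nm: "p ^ n > 0" "p ^ (n + m) > 0" "p ^ n < p ^ (n + m)" using p0 m by auto
  have nrm: "normal2 g" using nm by (auto simp: normal2_def g_def)
  have wg: "wt2 d g" using d by (auto simp: wt2_def g_def power_add distrib_left)
  have dv: "int p dvd cob2 g a b c" for a b c
  proof (cases "a = 0 \<or> b = 0 \<or> c = 0")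
    case True
    then show ?thesis using cob2_nrm[OF nrm] by simp
  next
    case False
    have "int p dvd int (b + c choose b) * g a (b + c)"
      using dvd_choose_prime_power[OF p, of b "n + m"] False by (auto simp: g_def)
    moreover have "int p dvd int (a + b choose a) * g (a + b) c"
      using dvd_choose_prime_power[OF p, of a n] False by (auto simp: g_def)
    ultimately show ?thesis using False by (simp add: cob2_pos)
  qed
  then have pf: "int p * f a b c = cob2 g a b c" for a b c by (simp add: f_def)
  obtain c where c: "int (p ^ (n + m) choose p ^ (n + m - 1)) = int p * int c" "\<not> p dvd c"
    using choose_prime_power_div_int[OF p m] .
  have "int p * local_inv p n m f = local_inv p n m (\<lambda>a b c. int p * f a b c)" by (rule local_inv_mult[symmetric])
  also have "\<dots> = local_inv p n m (cob2 g)" unfolding pf ..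
  also have "\<dots> = int p * int c" unfolding local_inv_cob2[OF p m] c(1) using nm by (simp add: g_def)
  finally have "local_inv p n m f = int c" using p0 by simp
  moreover have "cob3 f a b c e = 0" for a b c e
  proof -
    have "int p * cob3 f a b c e = cob3 (cob2 g) a b c e" unfolding cob3_mult[symmetric] pf ..
    then show ?thesis using p0 by (simp add: cob3_cob2)
  qed
  moreover have "wt3 d f" using cob2_wt[OF wg] by (simp add: wt3_def f_def)
  ultimately show ?thesis using pf c(2) by (intro exI[of _ f] exI[of _ g]) simp
qed

lemma finite_J: "d > 0 \<Longrightarrow> finite (J d)"
proof (rule finite_subset)
  assume "d > 0"
  show "J d \<subseteq> {..d}"
  proof
    fix p assume "p \<in> J d"
    then obtain n m where p: "Factorial_Ring.prime p" "m \<ge> 1" "d = p ^ n * (p ^ m + 1)" unfolding J_def by blast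
    have "p \<le> p ^ m" using p prime_gt_1_nat[OF p(1)] by (intro self_le_power) auto
    also have "\<dots> \<le> p ^ m + 1" by simp
    also have "\<dots> \<le> d" using p(3) mult_le_mono1[of 1 "p ^ n" "p ^ m + 1"] prime_gt_0_nat[OF p(1)] by simp
    finally show "p \<in> {..d}" by simp
  qed
qed simp

text \<open>The local cocycle at \<open>p\<close> is annihilated by \<open>p\<close> up to a coboundary, so its invariants at all
  other primes vanish, and the invariants can be adjusted one prime after the other.\<close>

theorem cocycle_with_invariants:
  fixes nn mm :: "nat \<Rightarrow> nat" and r :: "nat \<Rightarrow> int"
  assumes d: "d > 0" and e: "\<And>p. p \<in> J d \<Longrightarrow> d = p ^ nn p * (p ^ mm p + 1) \<and> mm p \<ge> 1"
  shows "\<exists>f. wt3 d f \<and> (\<forall>a b c e. cob3 f a b c e = 0)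
     \<and> (\<forall>p\<in>J d. int p dvd local_inv p (nn p) (mm p) f - r p)"
proof -
  have "\<exists>f. wt3 d f \<and> (\<forall>a b c e. cob3 f a b c e = 0)
     \<and> (\<forall>p\<in>S. int p dvd local_inv p (nn p) (mm p) f - r p)" if "finite S" "S \<subseteq> J d" for S
    using that
  proof (induction S rule: finite_induct)
    case empty
    then show ?case by (intro exI[of _ "\<lambda>a b c. 0"]) (auto simp: wt3_def cob3_def)
  next
    case (insert p S)
    then obtain f where f: "wt3 d f" "\<And>a b c e. cob3 f a b c e = 0"
      "\<And>p. p \<in> S \<Longrightarrow> int p dvd local_inv p (nn p) (mm p) f - r p" by auto
    have p: "Factorial_Ring.prime p" "p \<in> J d" using insert.prems by (auto simp: J_def)
    obtain f' g where f': "wt3 d f'" "\<And>a b c e. cob3 f' a b c e = 0" "\<And>a b c. int p * f' a b c = cob2 g a b c"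
      "\<not> int p dvd local_inv p (nn p) (mm p) f'"
      using local_cocycle[OF p(1) conjunct1[OF e[OF p(2)]] conjunct2[OF e[OF p(2)]]] by blast
    have "Factorial_Ring.prime (int p)" using p by simp
    from cong_multiple[OF this f'(4), of "local_inv p (nn p) (mm p) f - r p"]
    obtain k where k: "int p dvd local_inv p (nn p) (mm p) f - r p - k * local_inv p (nn p) (mm p) f'" .
    show ?case
    proof (intro exI[of _ "\<lambda>a b c. f a b c - k * f' a b c"] conjI allI ballI)
      show "wt3 d (\<lambda>a b c. f a b c - k * f' a b c)" using f f' by (simp add: wt3_def)
      show "cob3 (\<lambda>a b c. f a b c - k * f' a b c) a b c e = 0" for a b c e
        using f(2) f'(2) by (simp add: cob3_diff cob3_mult)
      fix q assume q: "q \<in> insert p S"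
      show "int q dvd local_inv q (nn q) (mm q) (\<lambda>a b c. f a b c - k * f' a b c) - r q"
      proof (cases "q = p")
        case True
        then show ?thesis using k by (simp add: local_inv_diff local_inv_mult algebra_simps)
      next
        case False
        then have qS: "q \<in> S" "Factorial_Ring.prime q" "q \<in> J d" using q insert.prems by (auto simp: J_def)
        have "int q dvd local_inv q (nn q) (mm q) (cob2 g)" using local_inv_cob2_dvd qS e by blast
        also have "local_inv q (nn q) (mm q) (cob2 g) = local_inv q (nn q) (mm q) (\<lambda>a b c. int p * f' a b c)"
          unfolding f'(3) ..
        also have "\<dots> = int p * local_inv q (nn q) (mm q) f'" by (rule local_inv_mult)
        finally have "int q dvd int p * local_inv q (nn q) (mm q) f'" .
        moreover have "\<not> q dvd p" using primes_dvd_imp_eq[OF qS(2) p(1)] False by blast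
        moreover have "Factorial_Ring.prime (int q)" using qS(2) by simp
        ultimately have "int q dvd local_inv q (nn q) (mm q) f'" by (simp add: prime_dvd_mult_iff)
        then have "int q dvd (local_inv q (nn q) (mm q) f - r q) - k * local_inv q (nn q) (mm q) f'"
          using f(3)[OF qS(1)] by - (rule dvd_diff, assumption, rule dvd_mult)
        then show ?thesis by (simp add: local_inv_diff local_inv_mult algebra_simps)
      qed
    qed
  qed
  then show ?thesis using finite_J[OF d] by blast
qed

section \<open>Homomorphisms and quotients\<close>

lemma morI: "f \<in> hom G H \<Longrightarrow> f \<in> extensional (carrier G) \<Longrightarrow> f \<in> mor G H"
  by (simp add: mor_def)

lemma mor_hom: "f \<in> mor G H \<Longrightarrow> f \<in> hom G H"
  by (simp add: mor_def)

lemma mor_ext: "f \<in> mor G H \<Longrightarrow> f \<in> extensional (carrier G)"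
  by (simp add: mor_def)

lemma mor_closed: "f \<in> mor G H \<Longrightarrow> x \<in> carrier G \<Longrightarrow> f x \<in> carrier H"
  by (auto simp: mor_def hom_def)

lemma mor_mult: "f \<in> mor G H \<Longrightarrow> x \<in> carrier G \<Longrightarrow> y \<in> carrier G \<Longrightarrow> f (x \<otimes>\<^bsub>G\<^esub> y) = f x \<otimes>\<^bsub>H\<^esub> f y"
  by (auto simp: mor_def hom_def)

lemma mor_one: "group G \<Longrightarrow> group H \<Longrightarrow> f \<in> mor G H \<Longrightarrow> f \<one>\<^bsub>G\<^esub> = \<one>\<^bsub>H\<^esub>"
  using hom_one[of f G H] by (auto simp: mor_def)

lemma mor_inv: "group G \<Longrightarrow> group H \<Longrightarrow> f \<in> mor G H \<Longrightarrow> x \<in> carrier G \<Longrightarrow> f (inv\<^bsub>G\<^esub> x) = inv\<^bsub>H\<^esub> f x"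
  by (metis group_hom.hom_inv group_hom.intro group_hom_axioms.intro mor_hom)

lemma mor_eqI: "f \<in> mor G H \<Longrightarrow> g \<in> mor G H \<Longrightarrow> (\<And>x. x \<in> carrier G \<Longrightarrow> f x = g x) \<Longrightarrow> f = g"
  by (meson extensionalityI mor_ext)

lemma restrict_mor: "monoid G \<Longrightarrow> f \<in> hom G H \<Longrightarrow> (\<lambda>x\<in>carrier G. f x) \<in> mor G H"
  by (auto simp: mor_def hom_def Pi_iff monoid.m_closed)

lemma mor_id: "monoid G \<Longrightarrow> (\<lambda>x\<in>carrier G. x) \<in> mor G G"
  by (auto simp: mor_def hom_def monoid.m_closed)

lemma mor_compose: "monoid G \<Longrightarrow> f \<in> mor G H \<Longrightarrow> g \<in> mor H K \<Longrightarrow> compose (carrier G) g f \<in> mor G K"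
  by (auto simp: mor_def hom_def compose_def Pi_iff monoid.m_closed)

lemma comm_group_group: "comm_group G \<Longrightarrow> group G"
  by (simp add: comm_group_def)

lemma comm_normal: "comm_group G \<Longrightarrow> subgroup N G \<Longrightarrow> N \<lhd> G"
  by (simp add: comm_group.normal_iff_subgroup)

lemma carrier_Mod: "carrier (G Mod N) = (\<lambda>x. N #>\<^bsub>G\<^esub> x) ` carrier G"
  by (auto simp: FactGroup_def RCOSETS_def)

lemma mult_Mod: "N \<lhd> G \<Longrightarrow> x \<in> carrier G \<Longrightarrow> y \<in> carrier G \<Longrightarrow>
   (N #>\<^bsub>G\<^esub> x) \<otimes>\<^bsub>G Mod N\<^esub> (N #>\<^bsub>G\<^esub> y) = N #>\<^bsub>G\<^esub> (x \<otimes>\<^bsub>G\<^esub> y)"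
  by (simp add: FactGroup_def normal.rcos_sum)

lemma coset_hom: "N \<lhd> G \<Longrightarrow> (\<lambda>x. N #>\<^bsub>G\<^esub> x) \<in> hom G (G Mod N)"
  by (rule homI) (auto simp: carrier_Mod normal.rcos_sum)

lemma coset_eq_one:
  assumes "N \<lhd> G" "x \<in> carrier G"
  shows "N #>\<^bsub>G\<^esub> x = \<one>\<^bsub>G Mod N\<^esub> \<longleftrightarrow> x \<in> N"
proof -
  interpret normal N G by fact
  show ?thesis using coset_join1[OF _ assms(2)] coset_join2[OF assms(2)] is_subgroup by auto
qed

lemma coset_eqI:
  assumes "N \<lhd> G" "x \<in> carrier G" "y \<in> carrier G" "x \<otimes>\<^bsub>G\<^esub> inv\<^bsub>G\<^esub> y \<in> N"
  shows "N #>\<^bsub>G\<^esub> x = N #>\<^bsub>G\<^esub> y"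
proof -
  interpret normal N G by fact
  have "x = (x \<otimes>\<^bsub>G\<^esub> inv\<^bsub>G\<^esub> y) \<otimes>\<^bsub>G\<^esub> y" using assms by (simp add: m_assoc)
  then have "x \<in> N #>\<^bsub>G\<^esub> y" using assms(4) by (auto simp: r_coset_def)
  then show ?thesis by (metis repr_independence assms(3) is_subgroup)
qed

lemma quot_map_coset:
  assumes "group G" "group H" "M \<lhd> G" "N \<lhd> H" "h \<in> hom G H" "h ` M \<subseteq> N" "x \<in> carrier G"
  shows "quot_map G M H N h (M #>\<^bsub>G\<^esub> x) = N #>\<^bsub>H\<^esub> h x"
proof -
  interpret M: normal M G by fact
  interpret N: normal N H by fact
  interpret h: group_hom G H h using assms by (simp add: group_hom_def group_hom_axioms_def)
  have Mc: "m \<in> carrier G" if "m \<in> M" for m using that M.subset by blast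
  have Nc: "m \<in> carrier H" if "m \<in> N" for m using that N.subset by blast
  have "N <#>\<^bsub>H\<^esub> (h ` (M #>\<^bsub>G\<^esub> x)) = N #>\<^bsub>H\<^esub> h x"
  proof (intro subset_antisym subsetI)
    fix y assume "y \<in> N <#>\<^bsub>H\<^esub> (h ` (M #>\<^bsub>G\<^esub> x))"
    then obtain n m where nm: "n \<in> N" "m \<in> M" "y = n \<otimes>\<^bsub>H\<^esub> h (m \<otimes>\<^bsub>G\<^esub> x)"
      by (auto simp: set_mult_def r_coset_def)
    then have "y = (n \<otimes>\<^bsub>H\<^esub> h m) \<otimes>\<^bsub>H\<^esub> h x" using Mc Nc assms(7) by (simp add: N.m_assoc)
    moreover have "n \<otimes>\<^bsub>H\<^esub> h m \<in> N" using nm assms(6) by blast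
    ultimately show "y \<in> N #>\<^bsub>H\<^esub> h x" by (auto simp: r_coset_def)
  next
    fix y assume "y \<in> N #>\<^bsub>H\<^esub> h x"
    then obtain n where n: "n \<in> N" "y = n \<otimes>\<^bsub>H\<^esub> h x" by (auto simp: r_coset_def)
    have "x \<in> M #>\<^bsub>G\<^esub> x" using assms(7) M.rcos_self M.is_subgroup by blast
    then show "y \<in> N <#>\<^bsub>H\<^esub> (h ` (M #>\<^bsub>G\<^esub> x))" using n by (auto simp: set_mult_def)
  qed
  then show ?thesis using assms(7) by (simp add: quot_map_def carrier_Mod)
qed

lemma quot_map_mor:
  assumes "group G" "group H" "M \<lhd> G" "N \<lhd> H" "h \<in> hom G H" "h ` M \<subseteq> N"
  shows "quot_map G M H N h \<in> mor (G Mod M) (H Mod N)"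
proof (rule morI)
  note q = quot_map_coset[OF assms]
  have hc: "h x \<in> carrier H" if "x \<in> carrier G" for x using assms(5) that by (auto simp: hom_def)
  show "quot_map G M H N h \<in> hom (G Mod M) (H Mod N)"
  proof (rule homI)
    fix x assume "x \<in> carrier (G Mod M)"
    then show "quot_map G M H N h x \<in> carrier (H Mod N)" using q hc by (auto simp: carrier_Mod)
  next
    fix x y assume "x \<in> carrier (G Mod M)" "y \<in> carrier (G Mod M)"
    then obtain a b where ab: "a \<in> carrier G" "b \<in> carrier G" "x = M #>\<^bsub>G\<^esub> a" "y = M #>\<^bsub>G\<^esub> b" by (auto simp: carrier_Mod)
    have "a \<otimes>\<^bsub>G\<^esub> b \<in> carrier G" using ab assms(1) by (simp add: group.is_monoid monoid.m_closed)
    then show "quot_map G M H N h (x \<otimes>\<^bsub>G Mod M\<^esub> y) = quot_map G M H N h x \<otimes>\<^bsub>H Mod N\<^esub> quot_map G M H N h y"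
      using ab assms(5) by (simp add: q mult_Mod[OF assms(3)] mult_Mod[OF assms(4)] hc hom_mult del: mult_FactGroup)
  qed
  show "quot_map G M H N h \<in> extensional (carrier (G Mod M))" by (simp add: quot_map_def)
qed

lemma hom_generate_subset:
  assumes "group G" "group H" "h \<in> hom G H" "K \<subseteq> carrier G" "subgroup N H" "\<And>x. x \<in> K \<Longrightarrow> h x \<in> N"
  shows "h ` generate G K \<subseteq> N"
proof -
  interpret group_hom G H h using assms by (simp add: group_hom_def group_hom_axioms_def)
  show ?thesis using generate_img[OF assms(4)] H.generate_subgroup_incl[of "h ` K", OF _ assms(5)] assms(6) by auto
qed

lemma hom_free_eqI:
  assumes "group K" "h \<in> hom (free_Abelian_group S) K" "k \<in> hom (free_Abelian_group S) K"
    and "\<And>x. x \<in> S \<Longrightarrow> h (frag_of x) = k (frag_of x)" and w: "w \<in> carrier (free_Abelian_group S)"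
  shows "h w = k w"
proof -
  interpret h: group_hom "free_Abelian_group S" K h using assms by (simp add: group_hom_def group_hom_axioms_def)
  interpret k: group_hom "free_Abelian_group S" K k using assms by (simp add: group_hom_def group_hom_axioms_def)
  have "Poly_Mapping.keys w \<subseteq> S" using w by simp
  then show ?thesis
  proof (induction w rule: free_Abelian_group_induct[consumes 1, case_names zero diff one])
    case zero
    then show ?case using h.hom_one k.hom_one by simp
  next
    case (diff x y)
    have "h (x - y) = h x \<otimes>\<^bsub>K\<^esub> inv\<^bsub>K\<^esub> h y" using h.hom_mult[of x "- y"] h.hom_inv[of y] diff by simp
    moreover have "k (x - y) = k x \<otimes>\<^bsub>K\<^esub> inv\<^bsub>K\<^esub> k y" using k.hom_mult[of x "- y"] k.hom_inv[of y] diff by simp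
    ultimately show ?case using diff by simp
  next
    case (one a)
    then show ?case using assms by simp
  qed
qed

lemma keys_diff_subset:
  fixes a b :: "'a \<Rightarrow>\<^sub>0 int"
  shows "Poly_Mapping.keys a \<subseteq> S \<Longrightarrow> Poly_Mapping.keys b \<subseteq> S \<Longrightarrow> Poly_Mapping.keys (a - b) \<subseteq> S"
  using keys_diff[of a b] by blast

lemma keys_add_subset:
  fixes a b :: "'a \<Rightarrow>\<^sub>0 int"
  shows "Poly_Mapping.keys a \<subseteq> S \<Longrightarrow> Poly_Mapping.keys b \<subseteq> S \<Longrightarrow> Poly_Mapping.keys (a + b) \<subseteq> S"
  using Poly_Mapping.keys_add[of a b] by blast

lemma frag_extend_closed:
  assumes "\<And>x. x \<in> S \<Longrightarrow> Poly_Mapping.keys (g x) \<subseteq> T" "Poly_Mapping.keys w \<subseteq> S"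
  shows "Poly_Mapping.keys (frag_extend g w) \<subseteq> T"
  using keys_frag_extend[of g w] assms by blast

lemma frag_extend_hom:
  assumes "\<And>x. x \<in> S \<Longrightarrow> Poly_Mapping.keys (g x) \<subseteq> T"
  shows "frag_extend g \<in> hom (free_Abelian_group S) (free_Abelian_group T)"
  using frag_extend_closed[of S g T, OF assms] by (intro homI) (auto simp: frag_extend_add)

lemma frag_extend_id:
  assumes "\<And>x. x \<in> S \<Longrightarrow> g x = frag_of x" "Poly_Mapping.keys w \<subseteq> S"
  shows "frag_extend g w = w"
proof -
  have "frag_extend g w = frag_extend frag_of w" using assms by (intro frag_extend_eq) blast
  then show ?thesis using frag_expansion[of w] by simp
qed

lemma frag_extend_frag_extend:
  "frag_extend f (frag_extend g w) = frag_extend (\<lambda>x. frag_extend f (g x)) w"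
proof -
  have "Poly_Mapping.keys w \<subseteq> UNIV" by simp
  then show ?thesis by (induction w rule: frag_induction) (auto simp: frag_extend_diff)
qed

section \<open>Symmetric powers\<close>

abbreviation tfree :: "nat \<Rightarrow> 'a monoid \<Rightarrow> ('a list \<Rightarrow>\<^sub>0 int) monoid" where
  "tfree d A \<equiv> free_Abelian_group (pure_tensors d A)"

text \<open>The class of a combination of pure tensors in the tensor power, and below its class in the symmetric
  power. All computations are done with representatives.\<close>

definition tcl :: "nat \<Rightarrow> 'a monoid \<Rightarrow> ('a list \<Rightarrow>\<^sub>0 int) \<Rightarrow> ('a list \<Rightarrow>\<^sub>0 int) set" where
  "tcl d A w = tensor_rels d A #>\<^bsub>tfree d A\<^esub> w"

definition scl :: "nat \<Rightarrow> 'a monoid \<Rightarrow> ('a list \<Rightarrow>\<^sub>0 int) \<Rightarrow> ('a list \<Rightarrow>\<^sub>0 int) set set" where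
  "scl d A w = sym_rels d A #>\<^bsub>tensor_power d A\<^esub> tcl d A w"

abbreviation lmap :: "('a list \<Rightarrow> 'b list) \<Rightarrow> ('a list \<Rightarrow>\<^sub>0 int) \<Rightarrow> ('b list \<Rightarrow>\<^sub>0 int)" where
  "lmap f \<equiv> frag_extend (\<lambda>xs. frag_of (f xs))"

lemma pure_tensors_update:
  "xs \<in> pure_tensors d A \<Longrightarrow> x \<in> carrier A \<Longrightarrow> xs[i := x] \<in> pure_tensors d A"
  using set_update_subset_insert[of xs i x] by (auto simp: pure_tensors_def)

lemma permute_pure_tensors:
  assumes "\<sigma> permutes {..<d}" "xs \<in> pure_tensors d A"
  shows "permute_list \<sigma> xs \<in> pure_tensors d A"
  using assms set_permute_list[of \<sigma> xs] by (auto simp: pure_tensors_def)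

lemma map_pure_tensors:
  "f \<in> mor A B \<Longrightarrow> xs \<in> pure_tensors d A \<Longrightarrow> map f xs \<in> pure_tensors d B"
  using mor_closed[of f A B] by (auto simp: pure_tensors_def)

lemma permute_list_update:
  assumes s: "\<sigma> permutes {..<length xs}" and i: "i < length xs"
  shows "permute_list \<sigma> (xs[i := x]) = (permute_list \<sigma> xs)[inv_into UNIV \<sigma> i := x]"
proof (rule nth_equalityI)
  show "length (permute_list \<sigma> (xs[i := x])) = length ((permute_list \<sigma> xs)[inv_into UNIV \<sigma> i := x])" by simp
  fix j assume j: "j < length (permute_list \<sigma> (xs[i := x]))"
  have "\<sigma> j < length xs" using permutes_in_image[OF s, of j] j by simp
  moreover have "inv_into UNIV \<sigma> i < length xs" using permutes_in_image[OF permutes_inv[OF s], of i] i by simp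
  moreover have "\<sigma> j = i \<longleftrightarrow> j = inv_into UNIV \<sigma> i" using permutes_inverses[OF s] by metis
  ultimately show "permute_list \<sigma> (xs[i := x]) ! j = (permute_list \<sigma> xs)[inv_into UNIV \<sigma> i := x] ! j"
    using j s i by (auto simp: permute_list_nth nth_list_update)
qed

definition trel_gens :: "nat \<Rightarrow> 'a monoid \<Rightarrow> ('a list \<Rightarrow>\<^sub>0 int) set" where
  "trel_gens d A = {frag_of (xs[i := x \<otimes>\<^bsub>A\<^esub> y]) - frag_of (xs[i := x]) - frag_of (xs[i := y]) | xs i x y.
        xs \<in> pure_tensors d A \<and> i < d \<and> x \<in> carrier A \<and> y \<in> carrier A}"

lemma trel_gensI:
  "xs \<in> pure_tensors d A \<Longrightarrow> i < d \<Longrightarrow> x \<in> carrier A \<Longrightarrow> y \<in> carrier A \<Longrightarrow>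
    frag_of (xs[i := x \<otimes>\<^bsub>A\<^esub> y]) - frag_of (xs[i := x]) - frag_of (xs[i := y]) \<in> trel_gens d A"
  unfolding trel_gens_def by blast

lemma tensor_rels_eq: "tensor_rels d A = generate (tfree d A) (trel_gens d A)"
  by (simp add: tensor_rels_def trel_gens_def)

locale sym_pow =
  fixes d :: nat and A :: "'a monoid"
  assumes A: "comm_group A"
begin

sublocale A: comm_group A by (rule A)

lemma trel_gens_carrier: "trel_gens d A \<subseteq> carrier (tfree d A)"
proof
  fix w assume "w \<in> trel_gens d A"
  then obtain xs i x y where w: "w = frag_of (xs[i := x \<otimes>\<^bsub>A\<^esub> y]) - frag_of (xs[i := x]) - frag_of (xs[i := y])"
    and *: "xs \<in> pure_tensors d A" "x \<in> carrier A" "y \<in> carrier A" unfolding trel_gens_def by blast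
  have "xs[i := x \<otimes>\<^bsub>A\<^esub> y] \<in> pure_tensors d A" "xs[i := x] \<in> pure_tensors d A" "xs[i := y] \<in> pure_tensors d A"
    using * by (auto intro: pure_tensors_update)
  then show "w \<in> carrier (tfree d A)" unfolding w
    by (simp add: keys_diff_subset keys_frag_of)
qed

lemma tensor_rels_subgroup: "subgroup (tensor_rels d A) (tfree d A)"
  unfolding tensor_rels_eq by (intro group.generate_is_subgroup trel_gens_carrier) simp

lemma tensor_rels_normal: "tensor_rels d A \<lhd> tfree d A"
  by (intro comm_normal abelian_free_Abelian_group tensor_rels_subgroup)

lemma tensor_power_comm: "comm_group (tensor_power d A)"
  unfolding tensor_power_def
  by (intro comm_group.abelian_FactGroup abelian_free_Abelian_group tensor_rels_subgroup)

lemma tcl_hom: "tcl d A \<in> hom (tfree d A) (tensor_power d A)"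
  using coset_hom[OF tensor_rels_normal] by (simp add: tcl_def[abs_def] tensor_power_def)

lemma carrier_tensor_power: "carrier (tensor_power d A) = tcl d A ` carrier (tfree d A)"
  by (simp add: tensor_power_def carrier_Mod tcl_def)

lemma lmap_permute_hom: "\<sigma> permutes {..<d} \<Longrightarrow> lmap (permute_list \<sigma>) \<in> hom (tfree d A) (tfree d A)"
  by (intro frag_extend_hom) (simp add: permute_pure_tensors keys_frag_of)

lemma lmap_permute_rels:
  assumes s: "\<sigma> permutes {..<d}"
  shows "lmap (permute_list \<sigma>) ` tensor_rels d A \<subseteq> tensor_rels d A"
proof (subst (1) tensor_rels_eq, rule hom_generate_subset[OF _ _ lmap_permute_hom[OF s] trel_gens_carrier tensor_rels_subgroup])
  fix w assume "w \<in> trel_gens d A"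
  then obtain xs i x y where w: "w = frag_of (xs[i := x \<otimes>\<^bsub>A\<^esub> y]) - frag_of (xs[i := x]) - frag_of (xs[i := y])"
    and *: "xs \<in> pure_tensors d A" "i < d" "x \<in> carrier A" "y \<in> carrier A" unfolding trel_gens_def by blast
  have len: "length xs = d" using * by (simp add: pure_tensors_def)
  have "inv_into UNIV \<sigma> i < d" using permutes_in_image[OF permutes_inv[OF s], of i] * by simp
  from trel_gensI[OF permute_pure_tensors[OF s *(1)] this *(3,4)]
  have "lmap (permute_list \<sigma>) w \<in> trel_gens d A"
    using *(2) len s unfolding w by (simp add: frag_extend_diff permute_list_update)
  then show "lmap (permute_list \<sigma>) w \<in> tensor_rels d A" unfolding tensor_rels_eq by (rule generate.incl)
qed simp_all

lemma tensor_permute_tcl: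
  assumes "\<sigma> permutes {..<d}" "w \<in> carrier (tfree d A)"
  shows "tensor_permute d A \<sigma> (tcl d A w) = tcl d A (lmap (permute_list \<sigma>) w)"
  unfolding tensor_permute_def tcl_def
  by (rule quot_map_coset[OF _ _ tensor_rels_normal tensor_rels_normal lmap_permute_hom lmap_permute_rels])
    (use assms in auto)

definition srel_gens :: "('a list \<Rightarrow>\<^sub>0 int) set set" where
  "srel_gens = {tcl d A (lmap (permute_list \<sigma>) w) \<otimes>\<^bsub>tensor_power d A\<^esub> inv\<^bsub>tensor_power d A\<^esub> tcl d A w | \<sigma> w.
        \<sigma> permutes {..<d} \<and> w \<in> carrier (tfree d A)}"

lemma sym_rels_eq: "sym_rels d A = generate (tensor_power d A) srel_gens"
proof -
  have "{tensor_permute d A \<sigma> t \<otimes>\<^bsub>tensor_power d A\<^esub> inv\<^bsub>tensor_power d A\<^esub> t | \<sigma> t.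
        \<sigma> permutes {..<d} \<and> t \<in> carrier (tensor_power d A)} = srel_gens" (is "?L = _")
  proof (intro subset_antisym subsetI)
    fix x assume "x \<in> ?L"
    then obtain \<sigma> w where *: "\<sigma> permutes {..<d}" "w \<in> carrier (tfree d A)"
      "x = tensor_permute d A \<sigma> (tcl d A w) \<otimes>\<^bsub>tensor_power d A\<^esub> inv\<^bsub>tensor_power d A\<^esub> tcl d A w"
      unfolding carrier_tensor_power by blast
    show "x \<in> srel_gens" unfolding srel_gens_def *(3) tensor_permute_tcl[OF *(1,2)]
      by (rule CollectI, rule exI, rule exI, rule conjI[OF refl conjI[OF *(1,2)]])
  next
    fix x assume "x \<in> srel_gens"
    then obtain \<sigma> w where *: "\<sigma> permutes {..<d}" "w \<in> carrier (tfree d A)"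
      "x = tcl d A (lmap (permute_list \<sigma>) w) \<otimes>\<^bsub>tensor_power d A\<^esub> inv\<^bsub>tensor_power d A\<^esub> tcl d A w"
      unfolding srel_gens_def by blast
    have "tcl d A w \<in> carrier (tensor_power d A)" using *(2) unfolding carrier_tensor_power by (rule imageI)
    then show "x \<in> ?L" using * tensor_permute_tcl[OF *(1,2)] by (intro CollectI exI[of _ \<sigma>] exI[of _ "tcl d A w"]) simp
  qed
  then show ?thesis by (simp add: sym_rels_def)
qed

lemma tcl_closed: "w \<in> carrier (tfree d A) \<Longrightarrow> tcl d A w \<in> carrier (tensor_power d A)"
  by (simp add: carrier_tensor_power)

lemma lmap_permute_closed: "\<sigma> permutes {..<d} \<Longrightarrow> w \<in> carrier (tfree d A) \<Longrightarrow> lmap (permute_list \<sigma>) w \<in> carrier (tfree d A)"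
  using lmap_permute_hom hom_in_carrier by fast

lemma srel_gens_carrier: "srel_gens \<subseteq> carrier (tensor_power d A)"
proof -
  interpret T: comm_group "tensor_power d A" by (rule tensor_power_comm)
  show ?thesis unfolding srel_gens_def
    using tcl_closed lmap_permute_closed by auto
qed

lemma sym_rels_subgroup: "subgroup (sym_rels d A) (tensor_power d A)"
  unfolding sym_rels_eq
  using comm_group_group[OF tensor_power_comm] srel_gens_carrier by (rule group.generate_is_subgroup)

lemma sym_rels_normal: "sym_rels d A \<lhd> tensor_power d A"
  by (intro comm_normal tensor_power_comm sym_rels_subgroup)

lemma sym_power_comm: "comm_group (sym_power d A)"
  unfolding sym_power_def
  by (intro comm_group.abelian_FactGroup tensor_power_comm sym_rels_subgroup)

lemma scl_hom: "scl d A \<in> hom (tfree d A) (sym_power d A)"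
proof -
  have "(\<lambda>t. sym_rels d A #>\<^bsub>tensor_power d A\<^esub> t) \<in> hom (tensor_power d A) (sym_power d A)"
    unfolding sym_power_def by (rule coset_hom[OF sym_rels_normal])
  from Group.hom_compose[OF tcl_hom this] show ?thesis by (simp add: comp_def scl_def[abs_def])
qed

lemma carrier_sym_power: "carrier (sym_power d A) = scl d A ` carrier (tfree d A)"
  by (auto simp: sym_power_def carrier_Mod carrier_tensor_power scl_def)

lemma scl_permute:
  assumes "\<sigma> permutes {..<d}" "w \<in> carrier (tfree d A)"
  shows "scl d A (lmap (permute_list \<sigma>) w) = scl d A w"
  unfolding scl_def
proof (rule coset_eqI[OF sym_rels_normal])
  show "tcl d A (lmap (permute_list \<sigma>) w) \<otimes>\<^bsub>tensor_power d A\<^esub> inv\<^bsub>tensor_power d A\<^esub> tcl d A w \<in> sym_rels d A"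
    unfolding sym_rels_eq
  proof (rule generate.incl)
    show "tcl d A (lmap (permute_list \<sigma>) w) \<otimes>\<^bsub>tensor_power d A\<^esub> inv\<^bsub>tensor_power d A\<^esub> tcl d A w \<in> srel_gens"
      unfolding srel_gens_def by (rule CollectI, rule exI, rule exI, rule conjI[OF refl conjI[OF assms]])
  qed
qed (use assms tcl_closed lmap_permute_closed in auto)

lemma scl_rels:
  assumes "w \<in> trel_gens d A"
  shows "scl d A w = \<one>\<^bsub>sym_power d A\<^esub>"
proof -
  have "w \<in> tensor_rels d A" unfolding tensor_rels_eq using assms by (rule generate.incl)
  moreover have "w \<in> carrier (tfree d A)" using trel_gens_carrier assms by (rule subsetD)
  ultimately have "tcl d A w = \<one>\<^bsub>tensor_power d A\<^esub>"
    unfolding tcl_def tensor_power_def using coset_eq_one[OF tensor_rels_normal] by blast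
  then show ?thesis
    using coset_eq_one[OF sym_rels_normal, of "\<one>\<^bsub>tensor_power d A\<^esub>"] subgroup.one_closed[OF sym_rels_subgroup]
      comm_group_group[OF tensor_power_comm] group.is_monoid monoid.one_closed
    by (metis scl_def sym_power_def)
qed

text \<open>Additivity in each entry kills the relations of the tensor power, and symmetry those that identify a
  tensor with its permutations.\<close>

lemma sym_power_universal:
  assumes K: "comm_group K" and h: "h \<in> hom (tfree d A) K"
    and rel: "\<And>w. w \<in> trel_gens d A \<Longrightarrow> h w = \<one>\<^bsub>K\<^esub>"
    and perm: "\<And>\<sigma> xs. \<sigma> permutes {..<d} \<Longrightarrow> xs \<in> pure_tensors d A \<Longrightarrow> h (frag_of (permute_list \<sigma> xs)) = h (frag_of xs)"
  obtains k where "k \<in> hom (sym_power d A) K" "\<And>w. w \<in> carrier (tfree d A) \<Longrightarrow> k (scl d A w) = h w"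
proof -
  have gK: "group K" using K by (rule comm_group_group)
  have triv: "subgroup {\<one>\<^bsub>K\<^esub>} K" using gK by (simp add: group.triv_subgroup)
  interpret h: group_hom "tfree d A" K h using h gK by (simp add: group_hom_def group_hom_axioms_def)
  have "h ` tensor_rels d A \<subseteq> {\<one>\<^bsub>K\<^esub>}"
    unfolding tensor_rels_eq using rel by (intro hom_generate_subset[OF _ gK h trel_gens_carrier triv]) auto
  then have "tensor_rels d A \<subseteq> kernel (tfree d A) K h"
    using subgroup.subset[OF tensor_rels_subgroup] by (auto simp: kernel_def simp del: carrier_free_Abelian_group_iff)
  from h.FactGroup_universal_kernel[OF tensor_rels_normal this]
  obtain g where g: "g \<in> hom (tensor_power d A) K" "\<And>w. w \<in> carrier (tfree d A) \<Longrightarrow> g (tcl d A w) = h w"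
    unfolding tensor_power_def tcl_def by blast
  have hp: "h (lmap (permute_list \<sigma>) w) = h w" if s: "\<sigma> permutes {..<d}" and w: "w \<in> carrier (tfree d A)" for \<sigma> w
  proof -
    have "(h \<circ> lmap (permute_list \<sigma>)) w = h w"
    proof (rule hom_free_eqI[OF gK _ h _ w])
      show "h \<circ> lmap (permute_list \<sigma>) \<in> hom (tfree d A) K"
        using lmap_permute_hom[OF s] h by (rule Group.hom_compose)
      show "(h \<circ> lmap (permute_list \<sigma>)) (frag_of xs) = h (frag_of xs)" if "xs \<in> pure_tensors d A" for xs
        using perm[OF s that] by simp
    qed
    then show ?thesis by simp
  qed
  interpret g: group_hom "tensor_power d A" K g
    using g(1) gK comm_group_group[OF tensor_power_comm] by (simp add: group_hom_def group_hom_axioms_def)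
  have "g ` sym_rels d A \<subseteq> {\<one>\<^bsub>K\<^esub>}"
    unfolding sym_rels_eq
  proof (rule hom_generate_subset[OF _ gK g(1) srel_gens_carrier triv])
    fix t assume "t \<in> srel_gens"
    then obtain \<sigma> w where t: "\<sigma> permutes {..<d}" "w \<in> carrier (tfree d A)"
      "t = tcl d A (lmap (permute_list \<sigma>) w) \<otimes>\<^bsub>tensor_power d A\<^esub> inv\<^bsub>tensor_power d A\<^esub> tcl d A w"
      unfolding srel_gens_def by blast
    then have "g t = h w \<otimes>\<^bsub>K\<^esub> inv\<^bsub>K\<^esub> h w"
      using tcl_closed lmap_permute_closed g(2) hp by simp
    then show "g t \<in> {\<one>\<^bsub>K\<^esub>}" using h.hom_closed[OF t(2)] by simp
  qed (rule g.G.is_group)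
  then have "sym_rels d A \<subseteq> kernel (tensor_power d A) K g"
    using subgroup.subset[OF sym_rels_subgroup] by (auto simp: kernel_def)
  from g.FactGroup_universal_kernel[OF sym_rels_normal this]
  obtain k where "k \<in> hom (sym_power d A) K" "\<And>t. t \<in> carrier (tensor_power d A) \<Longrightarrow> k (sym_rels d A #>\<^bsub>tensor_power d A\<^esub> t) = g t"
    unfolding sym_power_def by blast
  then show ?thesis using that[of k] g(2) tcl_closed by (simp add: scl_def)
qed

end

lemma lmap_mor_hom: "f \<in> mor A B \<Longrightarrow> lmap (map f) \<in> hom (tfree d A) (tfree d B)"
  by (intro frag_extend_hom) (simp add: map_pure_tensors keys_frag_of)

lemma lmap_mor_rels:
  assumes "comm_group A" "comm_group B" "f \<in> mor A B"
  shows "lmap (map f) ` tensor_rels d A \<subseteq> tensor_rels d B"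
proof -
  interpret A: sym_pow d A by (rule sym_pow.intro) fact
  interpret B: sym_pow d B by (rule sym_pow.intro) fact
  show ?thesis
  proof (subst (1) tensor_rels_eq, rule hom_generate_subset[OF _ _ lmap_mor_hom[OF assms(3)] A.trel_gens_carrier B.tensor_rels_subgroup])
    fix w assume "w \<in> trel_gens d A"
    then obtain xs i x y where w: "w = frag_of (xs[i := x \<otimes>\<^bsub>A\<^esub> y]) - frag_of (xs[i := x]) - frag_of (xs[i := y])"
      and *: "xs \<in> pure_tensors d A" "i < d" "x \<in> carrier A" "y \<in> carrier A" unfolding trel_gens_def by blast
    from trel_gensI[OF map_pure_tensors[OF assms(3) *(1)] *(2) mor_closed[OF assms(3) *(3)] mor_closed[OF assms(3) *(4)]]
    have "lmap (map f) w \<in> trel_gens d B"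
      unfolding w by (simp add: frag_extend_diff map_update mor_mult[OF assms(3) *(3,4)])
    then show "lmap (map f) w \<in> tensor_rels d B" unfolding tensor_rels_eq by (rule generate.incl)
  qed simp_all
qed

lemma tensor_power_map_tcl:
  assumes "comm_group A" "comm_group B" "f \<in> mor A B" "w \<in> carrier (tfree d A)"
  shows "tensor_power_map d A B f (tcl d A w) = tcl d B (lmap (map f) w)"
proof -
  interpret A: sym_pow d A by (rule sym_pow.intro) fact
  interpret B: sym_pow d B by (rule sym_pow.intro) fact
  show ?thesis unfolding tensor_power_map_def tcl_def
    by (rule quot_map_coset[OF _ _ A.tensor_rels_normal B.tensor_rels_normal lmap_mor_hom lmap_mor_rels])
      (use assms in auto)
qed

lemma tensor_power_map_mor:
  assumes "comm_group A" "comm_group B" "f \<in> mor A B"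
  shows "tensor_power_map d A B f \<in> mor (tensor_power d A) (tensor_power d B)"
proof -
  interpret A: sym_pow d A by (rule sym_pow.intro) fact
  interpret B: sym_pow d B by (rule sym_pow.intro) fact
  show ?thesis unfolding tensor_power_map_def tensor_power_def
    by (rule quot_map_mor[OF _ _ A.tensor_rels_normal B.tensor_rels_normal lmap_mor_hom lmap_mor_rels])
      (use assms in auto)
qed

lemma lmap_map_permute:
  assumes "\<sigma> permutes {..<d}" "w \<in> carrier (tfree d A)"
  shows "lmap (map f) (lmap (permute_list \<sigma>) w) = lmap (permute_list \<sigma>) (lmap (map f) w)"
  unfolding frag_extend_frag_extend
  using assms by (intro frag_extend_eq) (auto simp: pure_tensors_def permute_list_map)

lemma tensor_power_map_sym_rels:
  assumes "comm_group A" "comm_group B" "f \<in> mor A B"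
  shows "tensor_power_map d A B f ` sym_rels d A \<subseteq> sym_rels d B"
proof -
  interpret A: sym_pow d A by (rule sym_pow.intro) fact
  interpret B: sym_pow d B by (rule sym_pow.intro) fact
  have g: "group (tensor_power d A)" "group (tensor_power d B)"
    using A.tensor_power_comm B.tensor_power_comm by (auto intro: comm_group_group)
  note m = tensor_power_map_mor[OF assms, of d]
  show ?thesis unfolding A.sym_rels_eq
  proof (rule hom_generate_subset[OF g mor_hom[OF m] A.srel_gens_carrier B.sym_rels_subgroup])
    fix t assume "t \<in> A.srel_gens"
    then obtain \<sigma> w where t: "\<sigma> permutes {..<d}" "w \<in> carrier (tfree d A)"
      "t = tcl d A (lmap (permute_list \<sigma>) w) \<otimes>\<^bsub>tensor_power d A\<^esub> inv\<^bsub>tensor_power d A\<^esub> tcl d A w"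
      unfolding A.srel_gens_def by blast
    have cl: "tcl d A w \<in> carrier (tensor_power d A)" "tcl d A (lmap (permute_list \<sigma>) w) \<in> carrier (tensor_power d A)"
      using t A.tcl_closed A.lmap_permute_closed by auto
    have w': "lmap (map f) w \<in> carrier (tfree d B)" using lmap_mor_hom[OF assms(3)] t(2) hom_in_carrier by fast
    have "tensor_power_map d A B f t = tcl d B (lmap (permute_list \<sigma>) (lmap (map f) w)) \<otimes>\<^bsub>tensor_power d B\<^esub> inv\<^bsub>tensor_power d B\<^esub> tcl d B (lmap (map f) w)"
      unfolding t(3) using cl t g
      by (simp add: mor_mult[OF m] mor_inv[OF g m] group.inv_closed tensor_power_map_tcl[OF assms] A.lmap_permute_closed lmap_map_permute del: carrier_free_Abelian_group_iff)
    then have "tensor_power_map d A B f t \<in> B.srel_gens"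
      unfolding B.srel_gens_def by (simp only:) (rule CollectI, rule exI, rule exI, rule conjI[OF refl conjI[OF t(1) w']])
    then show "tensor_power_map d A B f t \<in> sym_rels d B" unfolding B.sym_rels_eq by (rule generate.incl)
  qed
qed

lemma sym_power_map_mor:
  assumes "comm_group A" "comm_group B" "f \<in> mor A B"
  shows "sym_power_map d A B f \<in> mor (sym_power d A) (sym_power d B)"
proof -
  interpret A: sym_pow d A by (rule sym_pow.intro) fact
  interpret B: sym_pow d B by (rule sym_pow.intro) fact
  show ?thesis unfolding sym_power_map_def sym_power_def
    using A.tensor_power_comm B.tensor_power_comm
    by (intro quot_map_mor[OF _ _ A.sym_rels_normal B.sym_rels_normal mor_hom[OF tensor_power_map_mor[OF assms]] tensor_power_map_sym_rels[OF assms]])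
      (auto intro: comm_group_group)
qed

lemma sym_power_map_scl:
  assumes "comm_group A" "comm_group B" "f \<in> mor A B" "w \<in> carrier (tfree d A)"
  shows "sym_power_map d A B f (scl d A w) = scl d B (lmap (map f) w)"
proof -
  interpret A: sym_pow d A by (rule sym_pow.intro) fact
  interpret B: sym_pow d B by (rule sym_pow.intro) fact
  have "sym_power_map d A B f (scl d A w) = sym_rels d B #>\<^bsub>tensor_power d B\<^esub> tensor_power_map d A B f (tcl d A w)"
    unfolding sym_power_map_def scl_def
    using A.tensor_power_comm B.tensor_power_comm A.tcl_closed[OF assms(4)]
    by (intro quot_map_coset[OF _ _ A.sym_rels_normal B.sym_rels_normal mor_hom[OF tensor_power_map_mor[OF assms(1-3)]] tensor_power_map_sym_rels[OF assms(1-3)]])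
      (auto intro: comm_group_group)
  then show ?thesis by (simp only: tensor_power_map_tcl[OF assms] scl_def)
qed

section \<open>Abelianization and its symmetric powers as functors\<close>

lemma is_functorD:
  assumes "is_functor F"
  shows "G \<in> gr \<Longrightarrow> comm_group (obj F G)"
    and "G \<in> gr \<Longrightarrow> group (obj F G)"
    and "G \<in> gr \<Longrightarrow> H \<in> gr \<Longrightarrow> f \<in> mor G H \<Longrightarrow> arr F G H f \<in> mor (obj F G) (obj F H)"
    and "G \<in> gr \<Longrightarrow> x \<in> carrier (obj F G) \<Longrightarrow> arr F G G (\<lambda>x\<in>carrier G. x) x = x"
    and "G \<in> gr \<Longrightarrow> H \<in> gr \<Longrightarrow> K \<in> gr \<Longrightarrow> f \<in> mor G H \<Longrightarrow> g \<in> mor H K \<Longrightarrow> x \<in> carrier (obj F G) \<Longrightarrow>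
      arr F G K (compose (carrier G) g f) x = arr F H K g (arr F G H f x)"
  using assms unfolding is_functor_def by (auto simp: comm_group_group compose_eq)

lemma gr_group: "G \<in> gr \<Longrightarrow> group G"
  by (simp add: gr_def)

lemma is_functorI:
  assumes "\<And>G. G \<in> gr \<Longrightarrow> comm_group (obj F G)"
    and m: "\<And>G H f. G \<in> gr \<Longrightarrow> H \<in> gr \<Longrightarrow> f \<in> mor G H \<Longrightarrow> arr F G H f \<in> mor (obj F G) (obj F H)"
    and i: "\<And>G x. G \<in> gr \<Longrightarrow> x \<in> carrier (obj F G) \<Longrightarrow> arr F G G (\<lambda>x\<in>carrier G. x) x = x"
    and c: "\<And>G H K f g x. G \<in> gr \<Longrightarrow> H \<in> gr \<Longrightarrow> K \<in> gr \<Longrightarrow> f \<in> mor G H \<Longrightarrow> g \<in> mor H K \<Longrightarrow> x \<in> carrier (obj F G) \<Longrightarrow>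
      arr F G K (compose (carrier G) g f) x = arr F H K g (arr F G H f x)"
  shows "is_functor F"
  unfolding is_functor_def
proof (intro conjI ballI)
  fix G :: "'a monoid" assume G: "G \<in> gr"
  show "arr F G G (\<lambda>x\<in>carrier G. x) = (\<lambda>x\<in>carrier (obj F G). x)"
  proof (rule mor_eqI)
    show "arr F G G (\<lambda>x\<in>carrier G. x) \<in> mor (obj F G) (obj F G)"
      using G by (intro m mor_id) (auto simp: gr_group group.is_monoid)
    show "(\<lambda>x\<in>carrier (obj F G). x) \<in> mor (obj F G) (obj F G)"
      using assms(1)[OF G] by (intro mor_id) (simp add: comm_group_group group.is_monoid)
  qed (use i G in auto)
  fix H K :: "'a monoid" and f g assume *: "H \<in> gr" "K \<in> gr" "f \<in> mor G H" "g \<in> mor H K"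
  show "arr F G K (compose (carrier G) g f) = compose (carrier (obj F G)) (arr F H K g) (arr F G H f)"
  proof (rule mor_eqI)
    show "arr F G K (compose (carrier G) g f) \<in> mor (obj F G) (obj F K)"
      using G * by (intro m mor_compose) (auto simp: gr_group group.is_monoid)
    show "compose (carrier (obj F G)) (arr F H K g) (arr F G H f) \<in> mor (obj F G) (obj F K)"
      using assms(1)[OF G] m * G by (intro mor_compose[of _ _ "obj F H"]) (auto simp: comm_group_group group.is_monoid)
  qed (use c G * in \<open>auto simp: compose_eq\<close>)
qed (use assms in auto)

lemma sym_power_after_functor:
  assumes "is_functor F"
  shows "is_functor (sym_power_after d F)"
proof (rule is_functorI)
  note F = is_functorD[OF assms]
  have [simp]: "obj (sym_power_after d F) = (\<lambda>G. sym_power d (obj F G))"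
    "arr (sym_power_after d F) = (\<lambda>G H f. sym_power_map d (obj F G) (obj F H) (arr F G H f))"
    by (simp_all add: sym_power_after_def)
  fix G :: "'a monoid" assume G: "G \<in> gr"
  interpret G: sym_pow d "obj F G" using F(1)[OF G] by (rule sym_pow.intro)
  show "comm_group (obj (sym_power_after d F) G)" using G.sym_power_comm by simp
  have idm: "(\<lambda>x\<in>carrier G. x) \<in> mor G G" using G by (simp add: mor_id gr_group group.is_monoid)
  {
    fix x assume "x \<in> carrier (obj (sym_power_after d F) G)"
    then obtain w where w: "w \<in> carrier (tfree d (obj F G))" "x = scl d (obj F G) w" by (auto simp: G.carrier_sym_power)
    have "lmap (map (arr F G G (\<lambda>x\<in>carrier G. x))) w = w"
      using w F(4)[OF G] by (intro frag_extend_id[of "pure_tensors d (obj F G)"]) (auto simp: pure_tensors_def intro!: arg_cong[where f = frag_of] map_idI)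
    then show "arr (sym_power_after d F) G G (\<lambda>x\<in>carrier G. x) x = x"
      using sym_power_map_scl[OF F(1)[OF G] F(1)[OF G] F(3)[OF G G idm] w(1)] w by simp
  }
  fix H :: "'a monoid" and f assume H: "H \<in> gr" "f \<in> mor G H"
  show "arr (sym_power_after d F) G H f \<in> mor (obj (sym_power_after d F) G) (obj (sym_power_after d F) H)"
    using sym_power_map_mor[OF F(1)[OF G] F(1)[OF H(1)] F(3)[OF G H]] by simp
  fix K :: "'a monoid" and g x assume K: "K \<in> gr" "g \<in> mor H K" and "x \<in> carrier (obj (sym_power_after d F) G)"
  then obtain w where w: "w \<in> carrier (tfree d (obj F G))" "x = scl d (obj F G) w" by (auto simp: G.carrier_sym_power)
  have cm: "compose (carrier G) g f \<in> mor G K" using G H K by (intro mor_compose) (auto simp: gr_group group.is_monoid)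
  have w': "lmap (map (arr F G H f)) w \<in> carrier (tfree d (obj F H))"
    using lmap_mor_hom[OF F(3)[OF G H]] w(1) hom_in_carrier by fast
  have "lmap (map (arr F G K (compose (carrier G) g f))) w = lmap (map (arr F H K g)) (lmap (map (arr F G H f)) w)"
    unfolding frag_extend_frag_extend
  proof (rule frag_extend_eq)
    fix xs assume "xs \<in> Poly_Mapping.keys w"
    then have xs: "y \<in> carrier (obj F G)" if "y \<in> set xs" for y using w that by (auto simp: pure_tensors_def)
    show "frag_of (map (arr F G K (compose (carrier G) g f)) xs) = lmap (map (arr F H K g)) (frag_of (map (arr F G H f) xs))"
      using F(5)[OF G H(1) K(1) H(2) K(2) xs] by (simp add: frag_of_eq)
  qed
  then show "arr (sym_power_after d F) G K (compose (carrier G) g f) x = arr (sym_power_after d F) H K g (arr (sym_power_after d F) G H f x)"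
    using sym_power_map_scl[OF F(1)[OF G] F(1)[OF K(1)] F(3)[OF G K(1) cm] w(1)]
      sym_power_map_scl[OF F(1)[OF G] F(1)[OF H(1)] F(3)[OF G H] w(1)]
      sym_power_map_scl[OF F(1)[OF H(1)] F(1)[OF K(1)] F(3)[OF H(1) K] w'] w(2) by simp
qed

lemma derived_normal: "group G \<Longrightarrow> derived G (carrier G) \<lhd> G"
  by (intro group.derived_is_normal)
    (simp_all add: group.normal_inv_iff group.subgroup_self group.is_monoid monoid.m_closed group.inv_closed)

lemma hom_derived:
  assumes "group G" "group H" "f \<in> hom G H"
  shows "f ` derived G (carrier G) \<subseteq> derived H (carrier H)"
proof -
  interpret group_hom G H f using assms by (simp add: group_hom_def group_hom_axioms_def)
  have "f ` derived G (carrier G) = derived H (f ` carrier G)" by (rule derived_img[symmetric]) simp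
  also have "\<dots> \<subseteq> derived H (carrier H)" by (intro H.mono_derived) auto
  finally show ?thesis .
qed

definition acl :: "'g monoid \<Rightarrow> 'g \<Rightarrow> 'g set" where
  "acl G x = derived G (carrier G) #>\<^bsub>G\<^esub> x"

lemma obj_abelianization [simp]: "obj abelianization G = G Mod derived G (carrier G)"
  by (simp add: abelianization_def)

lemma carrier_abelianization: "carrier (obj abelianization G) = acl G ` carrier G"
  by (simp add: carrier_Mod acl_def)

lemma acl_hom: "group G \<Longrightarrow> acl G \<in> hom G (obj abelianization G)"
  using coset_hom[OF derived_normal] by (simp add: acl_def[abs_def])

lemma abelianization_arr_acl:
  assumes "group G" "group H" "f \<in> mor G H" "x \<in> carrier G"
  shows "arr abelianization G H f (acl G x) = acl H (f x)"
  unfolding abelianization_def acl_def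
  using assms mor_hom[OF assms(3)]
  by simp (intro quot_map_coset hom_derived derived_normal)

lemma abelianization_functor: "is_functor abelianization"
proof (rule is_functorI)
  fix G :: "'a monoid" assume G: "G \<in> gr"
  note g = gr_group[OF G]
  show "comm_group (obj abelianization G)" using group.derived_quot_is_comm_group[OF g] by simp
  have idm: "(\<lambda>x\<in>carrier G. x) \<in> mor G G" using g by (simp add: mor_id group.is_monoid)
  show "arr abelianization G G (\<lambda>x\<in>carrier G. x) x = x" if "x \<in> carrier (obj abelianization G)" for x
    using that abelianization_arr_acl[OF g g idm] unfolding carrier_abelianization by auto
  fix H :: "'a monoid" and f assume H: "H \<in> gr" "f \<in> mor G H"
  note h = gr_group[OF H(1)]
  show "arr abelianization G H f \<in> mor (obj abelianization G) (obj abelianization H)"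
    using quot_map_mor[OF g h derived_normal[OF g] derived_normal[OF h] mor_hom[OF H(2)] hom_derived[OF g h mor_hom[OF H(2)]]]
    by (simp add: abelianization_def)
  fix K :: "'a monoid" and k x assume K: "K \<in> gr" "k \<in> mor H K" and x: "x \<in> carrier (obj abelianization G)"
  note kk = gr_group[OF K(1)]
  have cm: "compose (carrier G) k f \<in> mor G K" using g H K by (intro mor_compose) (auto simp: group.is_monoid)
  show "arr abelianization G K (compose (carrier G) k f) x = arr abelianization H K k (arr abelianization G H f x)"
    using x abelianization_arr_acl[OF g kk cm] abelianization_arr_acl[OF g h H(2)] abelianization_arr_acl[OF h kk K(2)] mor_closed[OF H(2)]
    unfolding carrier_abelianization by (auto simp: compose_eq)
qed

section \<open>Natural transformations\<close>

lemma nat_transD: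
  assumes "\<eta> \<in> nat_trans F F'"
  shows "G \<in> gr \<Longrightarrow> \<eta> G \<in> mor (obj F G) (obj F' G)"
    and "G \<in> gr \<Longrightarrow> H \<in> gr \<Longrightarrow> f \<in> mor G H \<Longrightarrow> x \<in> carrier (obj F G) \<Longrightarrow>
      arr F' G H f (\<eta> G x) = \<eta> H (arr F G H f x)"
    and "\<eta> \<in> extensional gr"
    and "G \<in> gr \<Longrightarrow> x \<in> carrier (obj F G) \<Longrightarrow> \<eta> G x \<in> carrier (obj F' G)"
    and "G \<in> gr \<Longrightarrow> x \<in> carrier (obj F G) \<Longrightarrow> y \<in> carrier (obj F G) \<Longrightarrow>
      \<eta> G (x \<otimes>\<^bsub>obj F G\<^esub> y) = \<eta> G x \<otimes>\<^bsub>obj F' G\<^esub> \<eta> G y"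
proof -
  have m: "\<eta> G \<in> mor (obj F G) (obj F' G)" if "G \<in> gr" for G
    using assms that by (auto simp: nat_trans_def)
  show "G \<in> gr \<Longrightarrow> \<eta> G \<in> mor (obj F G) (obj F' G)" by (rule m)
  show "\<eta> \<in> extensional gr" using assms by (auto simp: nat_trans_def PiE_def)
  show "G \<in> gr \<Longrightarrow> x \<in> carrier (obj F G) \<Longrightarrow> \<eta> G x \<in> carrier (obj F' G)"
    by (rule mor_closed[OF m])
  show "G \<in> gr \<Longrightarrow> x \<in> carrier (obj F G) \<Longrightarrow> y \<in> carrier (obj F G) \<Longrightarrow>
      \<eta> G (x \<otimes>\<^bsub>obj F G\<^esub> y) = \<eta> G x \<otimes>\<^bsub>obj F' G\<^esub> \<eta> G y"
    by (rule mor_mult[OF m])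
  assume *: "G \<in> gr" "H \<in> gr" "f \<in> mor G H" "x \<in> carrier (obj F G)"
  then have "compose (carrier (obj F G)) (arr F' G H f) (\<eta> G) = compose (carrier (obj F G)) (\<eta> H) (arr F G H f)"
    using assms by (auto simp: nat_trans_def)
  from fun_cong[OF this, of x] show "arr F' G H f (\<eta> G x) = \<eta> H (arr F G H f x)"
    using * by (simp add: compose_eq)
qed

lemma nat_transI:
  assumes "\<eta> \<in> extensional gr" "\<And>G. G \<in> gr \<Longrightarrow> \<eta> G \<in> mor (obj F G) (obj F' G)"
    and n: "\<And>G H f x. G \<in> gr \<Longrightarrow> H \<in> gr \<Longrightarrow> f \<in> mor G H \<Longrightarrow> x \<in> carrier (obj F G) \<Longrightarrow>
      arr F' G H f (\<eta> G x) = \<eta> H (arr F G H f x)"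
  shows "\<eta> \<in> nat_trans F F'"
  unfolding nat_trans_def
proof (intro CollectI conjI ballI)
  show "\<eta> \<in> (\<Pi>\<^sub>E G\<in>gr. mor (obj F G) (obj F' G))" using assms by (auto simp: PiE_def)
  fix G H :: "'a monoid" and f assume "G \<in> gr" "H \<in> gr" "f \<in> mor G H"
  then show "compose (carrier (obj F G)) (arr F' G H f) (\<eta> G) = compose (carrier (obj F G)) (\<eta> H) (arr F G H f)"
    using n by (auto simp: compose_def fun_eq_iff)
qed

lemma nat_trans_eqI:
  assumes "\<eta> \<in> nat_trans F F'" "\<theta> \<in> nat_trans F F'"
    and "\<And>G x. G \<in> gr \<Longrightarrow> x \<in> carrier (obj F G) \<Longrightarrow> \<eta> G x = \<theta> G x"
  shows "\<eta> = \<theta>"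
proof (rule extensionalityI[OF nat_transD(3)[OF assms(1)] nat_transD(3)[OF assms(2)]])
  fix G :: "'a monoid" assume G: "G \<in> gr"
  show "\<eta> G = \<theta> G"
    by (rule mor_eqI[OF nat_transD(1)[OF assms(1) G] nat_transD(1)[OF assms(2) G] assms(3)[OF G]])
qed

lemma nat_trans_one:
  assumes "is_functor F" "is_functor F'" "\<eta> \<in> nat_trans F F'" "G \<in> gr"
  shows "\<eta> G \<one>\<^bsub>obj F G\<^esub> = \<one>\<^bsub>obj F' G\<^esub>"
  using mor_one[OF is_functorD(2)[OF assms(1,4)] is_functorD(2)[OF assms(2,4)] nat_transD(1)[OF assms(3,4)]] .

lemma nat_trans_inv:
  assumes "is_functor F" "is_functor F'" "\<eta> \<in> nat_trans F F'" "G \<in> gr" "x \<in> carrier (obj F G)"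
  shows "\<eta> G (inv\<^bsub>obj F G\<^esub> x) = inv\<^bsub>obj F' G\<^esub> \<eta> G x"
  using mor_inv[OF is_functorD(2)[OF assms(1,4)] is_functorD(2)[OF assms(2,4)] nat_transD(1)[OF assms(3,4)] assms(5)] .

lemma arr_closed: "is_functor F \<Longrightarrow> G \<in> gr \<Longrightarrow> H \<in> gr \<Longrightarrow> f \<in> mor G H \<Longrightarrow> x \<in> carrier (obj F G) \<Longrightarrow>
    arr F G H f x \<in> carrier (obj F H)"
  by (rule mor_closed[OF is_functorD(3)])

lemma nt_comp_eq: "G \<in> gr \<Longrightarrow> x \<in> carrier (obj F G) \<Longrightarrow> nt_comp F \<theta> \<eta> G x = \<theta> G (\<eta> G x)"
  by (simp add: nt_comp_def compose_eq)

lemma nt_comp_closed: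
  assumes F: "is_functor F" and \<eta>: "\<eta> \<in> nat_trans F F'" and \<theta>: "\<theta> \<in> nat_trans F' F''"
  shows "nt_comp F \<theta> \<eta> \<in> nat_trans F F''"
proof (rule nat_transI)
  show "nt_comp F \<theta> \<eta> \<in> extensional gr" by (simp add: nt_comp_def)
  fix G :: "'a monoid" assume G: "G \<in> gr"
  show "nt_comp F \<theta> \<eta> G \<in> mor (obj F G) (obj F'' G)"
    using mor_compose[OF group.is_monoid[OF is_functorD(2)[OF F G]] nat_transD(1)[OF \<eta> G] nat_transD(1)[OF \<theta> G]] G
    by (simp add: nt_comp_def)
  fix H :: "'a monoid" and f x assume *: "H \<in> gr" "f \<in> mor G H" "x \<in> carrier (obj F G)"
  have "arr F G H f x \<in> carrier (obj F H)" by (rule arr_closed[OF F G *])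
  then show "arr F'' G H f (nt_comp F \<theta> \<eta> G x) = nt_comp F \<theta> \<eta> H (arr F G H f x)"
    using G * nat_transD(2)[OF \<eta> G *] nat_transD(2)[OF \<theta> G *(1,2) nat_transD(4)[OF \<eta> G *(3)]]
    by (simp add: nt_comp_eq)
qed

definition nt_id :: "('g, 'u) gr_functor \<Rightarrow> 'g monoid \<Rightarrow> 'u \<Rightarrow> 'u" where
  "nt_id F = (\<lambda>G\<in>gr. \<lambda>x\<in>carrier (obj F G). x)"

lemma nt_id_closed:
  assumes "is_functor F" shows "nt_id F \<in> nat_trans F F"
  by (rule nat_transI)
    (auto simp: nt_id_def arr_closed[OF assms] intro!: mor_id group.is_monoid is_functorD(2)[OF assms])

lemma nt_mult_eq: "G \<in> gr \<Longrightarrow> x \<in> carrier (obj F G) \<Longrightarrow>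
    (\<eta> \<otimes>\<^bsub>hom_group F F'\<^esub> \<theta>) G x = \<eta> G x \<otimes>\<^bsub>obj F' G\<^esub> \<theta> G x"
  by (simp add: hom_group_def)

lemma nt_one_eq: "G \<in> gr \<Longrightarrow> x \<in> carrier (obj F G) \<Longrightarrow> \<one>\<^bsub>hom_group F F'\<^esub> G x = \<one>\<^bsub>obj F' G\<^esub>"
  by (simp add: hom_group_def)

lemma carrier_hom_group [simp]: "carrier (hom_group F F') = nat_trans F F'"
  by (simp add: hom_group_def)

text \<open>Transformations have to be undefined outside the category and outside the carriers; this takes care
  of the restriction.\<close>

lemma nt_pointwise_closed:
  assumes F: "is_functor F" and F': "is_functor F'"
    and c: "\<And>G x. G \<in> gr \<Longrightarrow> x \<in> carrier (obj F G) \<Longrightarrow> h G x \<in> carrier (obj F' G)"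
    and m: "\<And>G x y. G \<in> gr \<Longrightarrow> x \<in> carrier (obj F G) \<Longrightarrow> y \<in> carrier (obj F G) \<Longrightarrow>
      h G (x \<otimes>\<^bsub>obj F G\<^esub> y) = h G x \<otimes>\<^bsub>obj F' G\<^esub> h G y"
    and n: "\<And>G H f x. G \<in> gr \<Longrightarrow> H \<in> gr \<Longrightarrow> f \<in> mor G H \<Longrightarrow> x \<in> carrier (obj F G) \<Longrightarrow>
      arr F' G H f (h G x) = h H (arr F G H f x)"
  shows "(\<lambda>G\<in>gr. \<lambda>x\<in>carrier (obj F G). h G x) \<in> nat_trans F F'"
proof (rule nat_transI)
  fix G :: "'a monoid" assume G: "G \<in> gr"
  have "(\<lambda>x\<in>carrier (obj F G). h G x) \<in> mor (obj F G) (obj F' G)"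
    using c[OF G] m[OF G] by (intro restrict_mor group.is_monoid is_functorD(2)[OF F G] homI)
  then show "(\<lambda>G\<in>gr. \<lambda>x\<in>carrier (obj F G). h G x) G \<in> mor (obj F G) (obj F' G)" using G by simp
  fix H :: "'a monoid" and f x assume *: "H \<in> gr" "f \<in> mor G H" "x \<in> carrier (obj F G)"
  have "arr F G H f x \<in> carrier (obj F H)" by (rule arr_closed[OF F G *])
  then show "arr F' G H f ((\<lambda>G\<in>gr. \<lambda>x\<in>carrier (obj F G). h G x) G x)
      = (\<lambda>G\<in>gr. \<lambda>x\<in>carrier (obj F G). h G x) H (arr F G H f x)"
    using n[OF G *] G * by simp
qed simp

lemma nt_inv_closed:
  assumes F: "is_functor F" and F': "is_functor F'" and \<eta>: "\<eta> \<in> nat_trans F F'"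
  shows "(\<lambda>G\<in>gr. \<lambda>x\<in>carrier (obj F G). inv\<^bsub>obj F' G\<^esub> \<eta> G x) \<in> nat_trans F F'"
proof (rule nt_pointwise_closed[OF F F'])
  fix G :: "'a monoid" assume G: "G \<in> gr"
  interpret B: comm_group "obj F' G" by (rule is_functorD(1)[OF F' G])
  note e = nat_transD[OF \<eta>]
  show "inv\<^bsub>obj F' G\<^esub> \<eta> G x \<in> carrier (obj F' G)" if "x \<in> carrier (obj F G)" for x
    using that e(4)[OF G] by simp
  show "inv\<^bsub>obj F' G\<^esub> \<eta> G (x \<otimes>\<^bsub>obj F G\<^esub> y) = inv\<^bsub>obj F' G\<^esub> \<eta> G x \<otimes>\<^bsub>obj F' G\<^esub> inv\<^bsub>obj F' G\<^esub> \<eta> G y"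
    if "x \<in> carrier (obj F G)" "y \<in> carrier (obj F G)" for x y
    using that e(4,5)[OF G] by (simp add: B.inv_mult)
  fix H :: "'a monoid" and f x assume *: "H \<in> gr" "f \<in> mor G H" "x \<in> carrier (obj F G)"
  show "arr F' G H f (inv\<^bsub>obj F' G\<^esub> \<eta> G x) = inv\<^bsub>obj F' H\<^esub> \<eta> H (arr F G H f x)"
    using mor_inv[OF is_functorD(2)[OF F' G] is_functorD(2)[OF F' *(1)] is_functorD(3)[OF F' G *(1,2)] e(4)[OF G *(3)]] e(2)[OF G *]
    by simp
qed

lemma hom_group_comm:
  assumes F: "is_functor F" and F': "is_functor F'"
  shows "comm_group (hom_group F F')"
proof (rule comm_groupI)
  note B = is_functorD(1)[OF F']
  have mg: "monoid (obj F' G)" "comm_monoid (obj F' G)" if "G \<in> gr" for G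
    using B[OF that] by (auto simp: comm_group_def comm_monoid_def)
  show mc: "\<eta> \<otimes>\<^bsub>hom_group F F'\<^esub> \<theta> \<in> carrier (hom_group F F')"
    if "\<eta> \<in> carrier (hom_group F F')" "\<theta> \<in> carrier (hom_group F F')" for \<eta> \<theta>
  proof -
    note e = nat_transD[OF that(1)[unfolded carrier_hom_group]] and t = nat_transD[OF that(2)[unfolded carrier_hom_group]]
    have "(\<lambda>G\<in>gr. \<lambda>x\<in>carrier (obj F G). \<eta> G x \<otimes>\<^bsub>obj F' G\<^esub> \<theta> G x) \<in> nat_trans F F'"
    proof (rule nt_pointwise_closed[OF F F'])
      fix G :: "'a monoid" assume G: "G \<in> gr"
      interpret B: comm_group "obj F' G" by (rule B[OF G])
      show "\<eta> G x \<otimes>\<^bsub>obj F' G\<^esub> \<theta> G x \<in> carrier (obj F' G)" if "x \<in> carrier (obj F G)" for x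
        using e(4)[OF G that] t(4)[OF G that] by simp
      show "\<eta> G (x \<otimes>\<^bsub>obj F G\<^esub> y) \<otimes>\<^bsub>obj F' G\<^esub> \<theta> G (x \<otimes>\<^bsub>obj F G\<^esub> y) =
          (\<eta> G x \<otimes>\<^bsub>obj F' G\<^esub> \<theta> G x) \<otimes>\<^bsub>obj F' G\<^esub> (\<eta> G y \<otimes>\<^bsub>obj F' G\<^esub> \<theta> G y)"
        if "x \<in> carrier (obj F G)" "y \<in> carrier (obj F G)" for x y
        using e(4,5)[OF G] t(4,5)[OF G] that by (simp add: B.m_ac)
      fix H :: "'a monoid" and f x assume *: "H \<in> gr" "f \<in> mor G H" "x \<in> carrier (obj F G)"
      show "arr F' G H f (\<eta> G x \<otimes>\<^bsub>obj F' G\<^esub> \<theta> G x) = \<eta> H (arr F G H f x) \<otimes>\<^bsub>obj F' H\<^esub> \<theta> H (arr F G H f x)"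
        using mor_mult[OF is_functorD(3)[OF F' G *(1,2)] e(4)[OF G *(3)] t(4)[OF G *(3)]] e(2)[OF G *] t(2)[OF G *] by simp
    qed
    then show ?thesis by (simp add: hom_group_def)
  qed
  show oc: "\<one>\<^bsub>hom_group F F'\<^esub> \<in> carrier (hom_group F F')"
  proof -
    have "(\<lambda>G\<in>gr. \<lambda>x\<in>carrier (obj F G). \<one>\<^bsub>obj F' G\<^esub>) \<in> nat_trans F F'"
      using mg(1) mor_one[OF is_functorD(2)[OF F'] is_functorD(2)[OF F'] is_functorD(3)[OF F']]
      by (intro nt_pointwise_closed[OF F F']) (auto simp: monoid.l_one)
    then show ?thesis by (simp add: hom_group_def)
  qed
  fix \<eta> assume \<eta>: "\<eta> \<in> carrier (hom_group F F')"
  note e = nat_transD(4)[OF \<eta>[unfolded carrier_hom_group]]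
  show "\<one>\<^bsub>hom_group F F'\<^esub> \<otimes>\<^bsub>hom_group F F'\<^esub> \<eta> = \<eta>"
    using mc[OF oc \<eta>] \<eta> e mg(1) by (intro nat_trans_eqI[of _ F F']) (auto simp: nt_mult_eq nt_one_eq monoid.l_one)
  define i where "i = (\<lambda>G\<in>gr. \<lambda>x\<in>carrier (obj F G). inv\<^bsub>obj F' G\<^esub> \<eta> G x)"
  have i: "i \<in> carrier (hom_group F F')" unfolding i_def using nt_inv_closed[OF F F'] \<eta> by simp
  have "i \<otimes>\<^bsub>hom_group F F'\<^esub> \<eta> = \<one>\<^bsub>hom_group F F'\<^esub>"
    using mc[OF i \<eta>] oc e is_functorD(2)[OF F']
    by (intro nat_trans_eqI[of _ F F']) (auto simp: nt_mult_eq nt_one_eq i_def group.l_inv)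
  then show "\<exists>y\<in>carrier (hom_group F F'). y \<otimes>\<^bsub>hom_group F F'\<^esub> \<eta> = \<one>\<^bsub>hom_group F F'\<^esub>" using i by blast
  fix \<theta> assume \<theta>: "\<theta> \<in> carrier (hom_group F F')"
  note t = nat_transD(4)[OF \<theta>[unfolded carrier_hom_group]]
  show "\<eta> \<otimes>\<^bsub>hom_group F F'\<^esub> \<theta> = \<theta> \<otimes>\<^bsub>hom_group F F'\<^esub> \<eta>"
    using mc[OF \<eta> \<theta>] mc[OF \<theta> \<eta>] e t mg(2)
    by (intro nat_trans_eqI[of _ F F']) (auto simp: nt_mult_eq comm_monoid.m_comm)
  fix \<zeta> assume \<zeta>: "\<zeta> \<in> carrier (hom_group F F')"
  note z = nat_transD(4)[OF \<zeta>[unfolded carrier_hom_group]]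
  show "\<eta> \<otimes>\<^bsub>hom_group F F'\<^esub> \<theta> \<otimes>\<^bsub>hom_group F F'\<^esub> \<zeta> = \<eta> \<otimes>\<^bsub>hom_group F F'\<^esub> (\<theta> \<otimes>\<^bsub>hom_group F F'\<^esub> \<zeta>)"
    using mc[OF mc[OF \<eta> \<theta>] \<zeta>] mc[OF \<eta> mc[OF \<theta> \<zeta>]] e t z mg(1)
    by (intro nat_trans_eqI[of _ F F']) (auto simp: nt_mult_eq monoid.m_assoc)
qed

lemma nt_inv_eq:
  assumes F: "is_functor F" "is_functor F'" and \<eta>: "\<eta> \<in> nat_trans F F'" and G: "G \<in> gr" and x: "x \<in> carrier (obj F G)"
  shows "(inv\<^bsub>hom_group F F'\<^esub> \<eta>) G x = inv\<^bsub>obj F' G\<^esub> \<eta> G x"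
proof -
  interpret H: comm_group "hom_group F F'" by (rule hom_group_comm[OF F])
  interpret B: comm_group "obj F' G" by (rule is_functorD(1)[OF F(2) G])
  have i: "inv\<^bsub>hom_group F F'\<^esub> \<eta> \<in> nat_trans F F'" using H.inv_closed[of \<eta>] \<eta> by simp
  have "(inv\<^bsub>hom_group F F'\<^esub> \<eta> \<otimes>\<^bsub>hom_group F F'\<^esub> \<eta>) G x = \<one>\<^bsub>obj F' G\<^esub>"
    using H.l_inv[of \<eta>] \<eta> G x by (simp add: nt_one_eq)
  then have "(inv\<^bsub>hom_group F F'\<^esub> \<eta>) G x \<otimes>\<^bsub>obj F' G\<^esub> \<eta> G x = \<one>\<^bsub>obj F' G\<^esub>"
    using G x by (simp add: nt_mult_eq)
  then show ?thesis using B.inv_equality[symmetric] nat_transD(4)[OF i G x] nat_transD(4)[OF \<eta> G x] by simp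
qed

section \<open>Kernels and copies of functors\<close>

text \<open>Lifting against an exact pair means lifting against the epimorphism onto a kernel, so kernels have to
  be functors themselves.\<close>

definition ker_functor :: "('g, 'u) gr_functor \<Rightarrow> ('g, 'v) gr_functor \<Rightarrow> ('g monoid \<Rightarrow> 'u \<Rightarrow> 'v) \<Rightarrow> ('g, 'u) gr_functor" where
  "ker_functor F F' \<theta> =
     \<lparr>obj = (\<lambda>G. (obj F G)\<lparr>carrier := kernel (obj F G) (obj F' G) (\<theta> G)\<rparr>),
      arr = (\<lambda>G H f. \<lambda>x\<in>kernel (obj F G) (obj F' G) (\<theta> G). arr F G H f x)\<rparr>"

lemma ker_functor_is_functor:
  assumes F: "is_functor F" and F': "is_functor F'" and \<theta>: "\<theta> \<in> nat_trans F F'"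
  shows "is_functor (ker_functor F F' \<theta>)"
proof (rule is_functorI)
  note t = nat_transD[OF \<theta>]
  define K where "K G = kernel (obj F G) (obj F' G) (\<theta> G)" for G
  have K: "x \<in> K G \<longleftrightarrow> x \<in> carrier (obj F G) \<and> \<theta> G x = \<one>\<^bsub>obj F' G\<^esub>" for x G
    by (auto simp: K_def kernel_def)
  have o: "obj (ker_functor F F' \<theta>) G = (obj F G)\<lparr>carrier := K G\<rparr>" for G
    by (simp add: ker_functor_def K_def)
  have a: "arr (ker_functor F F' \<theta>) G H f = (\<lambda>x\<in>K G. arr F G H f x)" for G H f
    by (simp add: ker_functor_def K_def)
  have ac: "arr F G H f x \<in> K H" if "G \<in> gr" "H \<in> gr" "f \<in> mor G H" "x \<in> K G" for G H f x
    using that t(2)[OF that(1-3), symmetric] arr_closed[OF F that(1-3)]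
      mor_one[OF is_functorD(2)[OF F' that(1)] is_functorD(2)[OF F' that(2)] is_functorD(3)[OF F' that(1-3)]]
    by (auto simp: K)
  fix G :: "'a monoid" assume G: "G \<in> gr"
  interpret A: comm_group "obj F G" by (rule is_functorD(1)[OF F G])
  interpret B: comm_group "obj F' G" by (rule is_functorD(1)[OF F' G])
  interpret h: group_hom "obj F G" "obj F' G" "\<theta> G" using mor_hom[OF t(1)[OF G]] by unfold_locales
  have s: "subgroup (K G) (obj F G)" unfolding K_def by (rule h.subgroup_kernel)
  show "comm_group (obj (ker_functor F F' \<theta>) G)" unfolding o
    using A.subgroup_imp_group[OF s] subgroup.mem_carrier[OF s] A.m_comm by (intro group.group_comm_groupI) auto
  show "arr (ker_functor F F' \<theta>) G G (\<lambda>x\<in>carrier G. x) x = x" if "x \<in> carrier (obj (ker_functor F F' \<theta>) G)" for x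
    using that is_functorD(4)[OF F G] by (simp add: o a K)
  fix H :: "'a monoid" and f assume H: "H \<in> gr" "f \<in> mor G H"
  show "arr (ker_functor F F' \<theta>) G H f \<in> mor (obj (ker_functor F F' \<theta>) G) (obj (ker_functor F F' \<theta>) H)"
  proof (rule morI)
    show "arr (ker_functor F F' \<theta>) G H f \<in> hom (obj (ker_functor F F' \<theta>) G) (obj (ker_functor F F' \<theta>) H)"
      using ac[OF G H] mor_mult[OF is_functorD(3)[OF F G H]] subgroup.m_closed[OF s]
      by (intro homI) (auto simp: o a K)
  qed (simp add: o a)
  fix L :: "'a monoid" and g x assume L: "L \<in> gr" "g \<in> mor H L" and x: "x \<in> carrier (obj (ker_functor F F' \<theta>) G)"
  show "arr (ker_functor F F' \<theta>) G L (compose (carrier G) g f) x =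
     arr (ker_functor F F' \<theta>) H L g (arr (ker_functor F F' \<theta>) G H f x)"
    using x ac[OF G H] is_functorD(5)[OF F G H(1) L(1) H(2) L(2)] by (simp add: o a K)
qed

text \<open>Transport of structure along injections into another type. It brings functors with values in
  arbitrary types into the type that projectivity refers to.\<close>

definition copy :: "('g monoid \<Rightarrow> 'a \<Rightarrow> 'u) \<Rightarrow> ('g, 'a) gr_functor \<Rightarrow> ('g, 'u) gr_functor" where
  "copy s F = (let dec = (\<lambda>G. inv_into (carrier (obj F G)) (s G)) in
     \<lparr>obj = (\<lambda>G. \<lparr>carrier = s G ` carrier (obj F G),
        monoid.mult = (\<lambda>x y. s G (dec G x \<otimes>\<^bsub>obj F G\<^esub> dec G y)), one = s G \<one>\<^bsub>obj F G\<^esub>\<rparr>),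
      arr = (\<lambda>G H f. \<lambda>x\<in>s G ` carrier (obj F G). s H (arr F G H f (dec G x)))\<rparr>)"

definition cp_up :: "('g monoid \<Rightarrow> 'a \<Rightarrow> 'u) \<Rightarrow> ('g, 'a) gr_functor \<Rightarrow> 'g monoid \<Rightarrow> 'a \<Rightarrow> 'u" where
  "cp_up s F = (\<lambda>G\<in>gr. \<lambda>x\<in>carrier (obj F G). s G x)"

definition cp_down :: "('g monoid \<Rightarrow> 'a \<Rightarrow> 'u) \<Rightarrow> ('g, 'a) gr_functor \<Rightarrow> 'g monoid \<Rightarrow> 'u \<Rightarrow> 'a" where
  "cp_down s F = (\<lambda>G\<in>gr. \<lambda>x\<in>s G ` carrier (obj F G). inv_into (carrier (obj F G)) (s G) x)"

locale functor_copy =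
  fixes s :: "'g monoid \<Rightarrow> 'a \<Rightarrow> 'u" and F :: "('g, 'a) gr_functor"
  assumes F: "is_functor F" and inj: "\<And>G. G \<in> gr \<Longrightarrow> inj_on (s G) (carrier (obj F G))"
begin

lemma carrier_copy: "carrier (obj (copy s F) G) = s G ` carrier (obj F G)"
  by (simp add: copy_def)

lemma dec [simp]: "G \<in> gr \<Longrightarrow> x \<in> carrier (obj F G) \<Longrightarrow> inv_into (carrier (obj F G)) (s G) (s G x) = x"
  using inj by (simp add: inv_into_f_f)

lemma mult_copy: "G \<in> gr \<Longrightarrow> x \<in> carrier (obj F G) \<Longrightarrow> y \<in> carrier (obj F G) \<Longrightarrow>
    s G x \<otimes>\<^bsub>obj (copy s F) G\<^esub> s G y = s G (x \<otimes>\<^bsub>obj F G\<^esub> y)"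
  by (simp add: copy_def)

lemma one_copy: "\<one>\<^bsub>obj (copy s F) G\<^esub> = s G \<one>\<^bsub>obj F G\<^esub>"
  by (simp add: copy_def)

lemma arr_copy: "G \<in> gr \<Longrightarrow> x \<in> carrier (obj F G) \<Longrightarrow> arr (copy s F) G H f (s G x) = s H (arr F G H f x)"
  by (simp add: copy_def)

lemma copy_functor: "is_functor (copy s F)"
proof (rule is_functorI)
  fix G :: "'g monoid" assume G: "G \<in> gr"
  interpret A: comm_group "obj F G" by (rule is_functorD(1)[OF F G])
  show "comm_group (obj (copy s F) G)"
  proof (rule comm_groupI)
    fix x assume "x \<in> carrier (obj (copy s F) G)"
    then obtain a where a: "a \<in> carrier (obj F G)" "x = s G a" by (auto simp: carrier_copy)
    show "\<exists>y\<in>carrier (obj (copy s F) G). y \<otimes>\<^bsub>obj (copy s F) G\<^esub> x = \<one>\<^bsub>obj (copy s F) G\<^esub>"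
      using a G by (intro bexI[of _ "s G (inv\<^bsub>obj F G\<^esub> a)"]) (auto simp: carrier_copy mult_copy one_copy)
  qed (use G in \<open>auto simp: carrier_copy mult_copy one_copy A.m_ac\<close>)
  show "arr (copy s F) G G (\<lambda>x\<in>carrier G. x) x = x" if "x \<in> carrier (obj (copy s F) G)" for x
    using that is_functorD(4)[OF F G] G by (auto simp: carrier_copy arr_copy)
  fix H :: "'g monoid" and f assume H: "H \<in> gr" "f \<in> mor G H"
  show "arr (copy s F) G H f \<in> mor (obj (copy s F) G) (obj (copy s F) H)"
  proof (rule morI)
    show "arr (copy s F) G H f \<in> hom (obj (copy s F) G) (obj (copy s F) H)"
      using arr_closed[OF F G H] mor_mult[OF is_functorD(3)[OF F G H]] G H
      by (intro homI) (auto simp: carrier_copy mult_copy arr_copy)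
  qed (simp add: copy_def)
  fix L :: "'g monoid" and g x assume L: "L \<in> gr" "g \<in> mor H L" and x: "x \<in> carrier (obj (copy s F) G)"
  show "arr (copy s F) G L (compose (carrier G) g f) x = arr (copy s F) H L g (arr (copy s F) G H f x)"
    using x arr_closed[OF F G H] is_functorD(5)[OF F G H(1) L(1) H(2) L(2)] G H L
    by (auto simp: carrier_copy arr_copy)
qed

lemma cp_up_closed: "cp_up s F \<in> nat_trans F (copy s F)"
  unfolding cp_up_def
  by (intro nt_pointwise_closed F copy_functor) (auto simp: carrier_copy mult_copy arr_copy)

lemma cp_down_closed: "cp_down s F \<in> nat_trans (copy s F) F"
proof -
  have "(\<lambda>G\<in>gr. \<lambda>x\<in>carrier (obj (copy s F) G). inv_into (carrier (obj F G)) (s G) x) \<in> nat_trans (copy s F) F"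
    using is_functorD(2)[OF F]
    by (intro nt_pointwise_closed F copy_functor)
      (auto simp: carrier_copy mult_copy arr_copy arr_closed[OF F] group.is_monoid monoid.m_closed)
  then show ?thesis by (simp add: cp_down_def carrier_copy)
qed

lemma cp_down_up: "G \<in> gr \<Longrightarrow> x \<in> carrier (obj F G) \<Longrightarrow> cp_down s F G (cp_up s F G x) = x"
  by (simp add: cp_down_def cp_up_def)

lemma cp_up_down: "G \<in> gr \<Longrightarrow> x \<in> carrier (obj (copy s F) G) \<Longrightarrow> cp_up s F G (cp_down s F G x) = x"
  by (auto simp: cp_down_def cp_up_def carrier_copy)

end

section \<open>Comparison of projective resolutions\<close>

lemma exact_atD:
  assumes "exact_at F F' F'' \<eta> \<theta>"
  shows "\<eta> \<in> nat_trans F F'" "\<theta> \<in> nat_trans F' F''"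
    and "G \<in> gr \<Longrightarrow> x \<in> carrier (obj F G) \<Longrightarrow> \<theta> G (\<eta> G x) = \<one>\<^bsub>obj F'' G\<^esub>"
    and "G \<in> gr \<Longrightarrow> y \<in> carrier (obj F' G) \<Longrightarrow> \<theta> G y = \<one>\<^bsub>obj F'' G\<^esub> \<Longrightarrow> \<exists>x\<in>carrier (obj F G). y = \<eta> G x"
proof -
  show "\<eta> \<in> nat_trans F F'" "\<theta> \<in> nat_trans F' F''" using assms by (auto simp: exact_at_def)
  have e: "\<eta> G ` carrier (obj F G) = kernel (obj F' G) (obj F'' G) (\<theta> G)" if "G \<in> gr"
    using assms that by (auto simp: exact_at_def)
  show "\<theta> G (\<eta> G x) = \<one>\<^bsub>obj F'' G\<^esub>" if "G \<in> gr" "x \<in> carrier (obj F G)"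
    using e[OF that(1)] imageI[OF that(2), of "\<eta> G"] by (simp add: kernel_def)
  show "\<exists>x\<in>carrier (obj F G). y = \<eta> G x" if "G \<in> gr" "y \<in> carrier (obj F' G)" "\<theta> G y = \<one>\<^bsub>obj F'' G\<^esub>"
  proof -
    have "y \<in> \<eta> G ` carrier (obj F G)" unfolding e[OF that(1)] using that by (simp add: kernel_def)
    then show ?thesis by blast
  qed
qed

lemma projective_functor: "projective P \<Longrightarrow> is_functor P"
  by (simp add: projective_def)

lemma projective_lift:
  fixes P E Q :: "('g, 'u) gr_functor"
  assumes "projective P" "is_functor E" "is_functor Q" "is_epi E Q e" "f \<in> nat_trans P Q"
  obtains g where "g \<in> nat_trans P E" "\<And>G x. G \<in> gr \<Longrightarrow> x \<in> carrier (obj P G) \<Longrightarrow> e G (g G x) = f G x"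
proof -
  obtain g where g: "g \<in> nat_trans P E" "nt_comp P e g = f"
    using assms unfolding projective_def by blast
  show ?thesis
  proof (rule that[OF g(1)])
    fix G :: "'g monoid" and x assume "G \<in> gr" "x \<in> carrier (obj P G)"
    then show "e G (g G x) = f G x" using nt_comp_eq[of G x P e g] g(2) by simp
  qed
qed

text \<open>Projectivity speaks about functors with values in \<open>'u\<close>, but \<open>A\<close> may have values elsewhere. A
  choice of preimages embeds the values of \<open>A\<close> into those of \<open>E\<close>, and lifting is possible
  against the copy of \<open>A\<close> along this embedding.\<close>

lemma projective_lift_epi:
  fixes P E :: "('g, 'u) gr_functor" and A :: "('g, 'a) gr_functor"
  assumes P: "projective P" and E: "is_functor E" and A: "is_functor A" and e: "is_epi E A e" and f: "f \<in> nat_trans P A"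
  obtains g where "g \<in> nat_trans P E" "\<And>G x. G \<in> gr \<Longrightarrow> x \<in> carrier (obj P G) \<Longrightarrow> e G (g G x) = f G x"
proof -
  define s where "s G = inv_into (carrier (obj E G)) (e G)" for G
  have en: "e \<in> nat_trans E A" and im: "\<And>G. G \<in> gr \<Longrightarrow> e G ` carrier (obj E G) = carrier (obj A G)"
    using e by (auto simp: is_epi_def)
  interpret functor_copy s A
  proof
    fix G :: "'g monoid" assume "G \<in> gr"
    then show "inj_on (s G) (carrier (obj A G))" unfolding s_def using im by (intro inj_on_inv_into) auto
  qed (rule A)
  define e' where "e' = nt_comp E (cp_up s A) e"
  define f' where "f' = nt_comp P (cp_up s A) f"
  have e': "e' \<in> nat_trans E (copy s A)" unfolding e'_def by (rule nt_comp_closed[OF E en cp_up_closed])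
  have f': "f' \<in> nat_trans P (copy s A)" unfolding f'_def by (rule nt_comp_closed[OF projective_functor[OF P] f cp_up_closed])
  have "is_epi E (copy s A) e'"
    unfolding is_epi_def
  proof (intro conjI e' ballI)
    fix G :: "'g monoid" assume G: "G \<in> gr"
    have "e' G ` carrier (obj E G) = s G ` (e G ` carrier (obj E G))"
      using G nat_transD(4)[OF en G] by (auto simp: e'_def nt_comp_eq cp_up_def image_image)
    then show "e' G ` carrier (obj E G) = carrier (obj (copy s A) G)" using im[OF G] by (simp add: carrier_copy)
  qed
  from projective_lift[OF P E copy_functor this f']
  obtain g where g: "g \<in> nat_trans P E" "\<And>G x. G \<in> gr \<Longrightarrow> x \<in> carrier (obj P G) \<Longrightarrow> e' G (g G x) = f' G x" by blast
  show ?thesis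
  proof (rule that[OF g(1)])
    fix G :: "'g monoid" and x assume G: "G \<in> gr" and x: "x \<in> carrier (obj P G)"
    have gx: "g G x \<in> carrier (obj E G)" by (rule nat_transD(4)[OF g(1) G x])
    have "cp_down s A G (e' G (g G x)) = cp_down s A G (f' G x)" using g(2)[OF G x] by simp
    then show "e G (g G x) = f G x"
      using G x gx cp_down_up[OF G nat_transD(4)[OF en G gx]] cp_down_up[OF G nat_transD(4)[OF f G x]]
      by (simp add: e'_def f'_def nt_comp_eq)
  qed
qed

text \<open>The first map of an exact pair is an epimorphism onto the kernel of the second one.\<close>

lemma projective_lift_exact:
  fixes P E E' :: "('g, 'u) gr_functor" and E'' :: "('g, 'v) gr_functor"
  assumes P: "projective P" and E: "is_functor E'" "is_functor E" "is_functor E''"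
    and ex: "exact_at E' E E'' \<eta> \<theta>" and f: "f \<in> nat_trans P E"
    and z: "\<And>G x. G \<in> gr \<Longrightarrow> x \<in> carrier (obj P G) \<Longrightarrow> \<theta> G (f G x) = \<one>\<^bsub>obj E'' G\<^esub>"
  obtains g where "g \<in> nat_trans P E'" "\<And>G x. G \<in> gr \<Longrightarrow> x \<in> carrier (obj P G) \<Longrightarrow> \<eta> G (g G x) = f G x"
proof -
  note x = exact_atD[OF ex]
  let ?K = "ker_functor E E'' \<theta>"
  have K: "is_functor ?K" by (rule ker_functor_is_functor[OF E(2,3) x(2)])
  have o: "obj ?K G = (obj E G)\<lparr>carrier := kernel (obj E G) (obj E'' G) (\<theta> G)\<rparr>" for G
    by (simp add: ker_functor_def)
  have into: "h \<in> nat_trans F ?K" if h: "h \<in> nat_trans F E"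
    and hz: "\<And>G x. G \<in> gr \<Longrightarrow> x \<in> carrier (obj F G) \<Longrightarrow> \<theta> G (h G x) = \<one>\<^bsub>obj E'' G\<^esub>" for F h
  proof (rule nat_transI[OF nat_transD(3)[OF h]])
    fix G :: "'g monoid" assume G: "G \<in> gr"
    show "h G \<in> mor (obj F G) (obj ?K G)"
      using nat_transD(4,5)[OF h G] hz[OF G] mor_ext[OF nat_transD(1)[OF h G]]
      by (auto simp: o kernel_def intro!: morI homI)
    fix H :: "'g monoid" and k y assume *: "H \<in> gr" "k \<in> mor G H" "y \<in> carrier (obj F G)"
    then show "arr ?K G H k (h G y) = h H (arr F G H k y)"
      using nat_transD(2)[OF h G *] nat_transD(4)[OF h G *(3)] hz[OF G *(3)] by (simp add: ker_functor_def kernel_def)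
  qed
  have "is_epi E' ?K \<eta>"
    unfolding is_epi_def using into[OF x(1) x(3)] ex by (auto simp: exact_at_def o)
  from projective_lift[OF P E(1) K this into[OF f z]] show ?thesis using that by blast
qed

locale proj_resolution =
  fixes A :: "('g, 'a) gr_functor" and P :: "nat \<Rightarrow> ('g, 'u) gr_functor"
    and \<delta> :: "nat \<Rightarrow> 'g monoid \<Rightarrow> 'u \<Rightarrow> 'u" and \<epsilon> :: "'g monoid \<Rightarrow> 'u \<Rightarrow> 'a"
  assumes A: "is_functor A" and res: "projective_resolution A P \<delta> \<epsilon>"
begin

lemma proj: "projective (P n)" and epi: "is_epi (P 0) A \<epsilon>"
  and ex0: "exact_at (P 1) (P 0) A (\<delta> 0) \<epsilon>"
  and exS: "exact_at (P (Suc (Suc n))) (P (Suc n)) (P n) (\<delta> (Suc n)) (\<delta> n)"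
  using res by (auto simp: projective_resolution_def)

lemma is_func: "is_functor (P n)" by (rule projective_functor[OF proj])

lemma eps: "\<epsilon> \<in> nat_trans (P 0) A" using epi by (simp add: is_epi_def)

lemma del: "\<delta> n \<in> nat_trans (P (Suc n)) (P n)"
  using exact_atD(2)[OF exS] .

lemma del_closed: "G \<in> gr \<Longrightarrow> x \<in> carrier (obj (P (Suc n)) G) \<Longrightarrow> \<delta> n G x \<in> carrier (obj (P n) G)"
  by (rule nat_transD(4)[OF del])

lemma eps_del: "G \<in> gr \<Longrightarrow> x \<in> carrier (obj (P (Suc 0)) G) \<Longrightarrow> \<epsilon> G (\<delta> 0 G x) = \<one>\<^bsub>obj A G\<^esub>"
  using exact_atD(3)[OF ex0] by simp

lemma del_del: "G \<in> gr \<Longrightarrow> x \<in> carrier (obj (P (Suc (Suc n))) G) \<Longrightarrow> \<delta> n G (\<delta> (Suc n) G x) = \<one>\<^bsub>obj (P n) G\<^esub>"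
  by (rule exact_atD(3)[OF exS])

end

locale two_resolutions = P: proj_resolution A P \<delta> \<epsilon> + Q: proj_resolution A Q \<delta>' \<epsilon>'
  for A :: "('g, 'a) gr_functor" and P Q :: "nat \<Rightarrow> ('g, 'u) gr_functor" and \<delta> \<delta>' \<epsilon> \<epsilon>'
begin

definition chain_map :: "(nat \<Rightarrow> 'g monoid \<Rightarrow> 'u \<Rightarrow> 'u) \<Rightarrow> bool" where
  "chain_map \<phi> \<longleftrightarrow> (\<forall>n. \<phi> n \<in> nat_trans (P n) (Q n)) \<and>
     (\<forall>n. \<forall>G\<in>gr. \<forall>x\<in>carrier (obj (P (Suc n)) G). \<delta>' n G (\<phi> (Suc n) G x) = \<phi> n G (\<delta> n G x))"

text \<open>The comparison theorem: lift one degree at a time.\<close>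

lemma chain_map_exists:
  "\<exists>\<phi>. chain_map \<phi> \<and> (\<forall>G\<in>gr. \<forall>x\<in>carrier (obj (P 0) G). \<epsilon>' G (\<phi> 0 G x) = \<epsilon> G x)"
proof -
  define C where "C n \<phi> \<longleftrightarrow> \<phi> \<in> nat_trans (P n) (Q n) \<and>
     (case n of 0 \<Rightarrow> (\<forall>G\<in>gr. \<forall>x\<in>carrier (obj (P 0) G). \<epsilon>' G (\<phi> G x) = \<epsilon> G x)
      | Suc m \<Rightarrow> (\<forall>G\<in>gr. \<forall>x\<in>carrier (obj (P (Suc n)) G). \<delta>' m G (\<phi> G (\<delta> n G x)) = \<one>\<^bsub>obj (Q m) G\<^esub>))" for n \<phi>
  define R where "R n \<phi> \<psi> \<longleftrightarrow> (\<forall>G\<in>gr. \<forall>x\<in>carrier (obj (P (Suc n)) G). \<delta>' n G (\<psi> G x) = \<phi> G (\<delta> n G x))" for n \<phi> \<psi>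
  have 0: "\<exists>\<phi>. C 0 \<phi>"
  proof -
    obtain \<phi> where "\<phi> \<in> nat_trans (P 0) (Q 0)"
      "\<And>G x. G \<in> gr \<Longrightarrow> x \<in> carrier (obj (P 0) G) \<Longrightarrow> \<epsilon>' G (\<phi> G x) = \<epsilon> G x"
      using projective_lift_epi[OF P.proj Q.is_func P.A Q.epi P.eps] by blast
    then show ?thesis by (auto simp: C_def)
  qed
  have S: "\<exists>\<psi>. C (Suc n) \<psi> \<and> R n \<phi> \<psi>" if C: "C n \<phi>" for n \<phi>
  proof -
    have \<phi>: "\<phi> \<in> nat_trans (P n) (Q n)" using C by (simp add: C_def)
    define f where "f = nt_comp (P (Suc n)) \<phi> (\<delta> n)"
    have f: "f \<in> nat_trans (P (Suc n)) (Q n)" unfolding f_def by (rule nt_comp_closed[OF P.is_func P.del \<phi>])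
    have fx: "f G x = \<phi> G (\<delta> n G x)" if "G \<in> gr" "x \<in> carrier (obj (P (Suc n)) G)" for G x
      using that by (simp add: f_def nt_comp_eq)
    obtain \<psi> where \<psi>: "\<psi> \<in> nat_trans (P (Suc n)) (Q (Suc n))"
      "\<And>G x. G \<in> gr \<Longrightarrow> x \<in> carrier (obj (P (Suc n)) G) \<Longrightarrow> \<delta>' n G (\<psi> G x) = f G x"
    proof (cases n)
      case 0
      have z: "\<epsilon>' G (f G x) = \<one>\<^bsub>obj A G\<^esub>" if G: "G \<in> gr" "x \<in> carrier (obj (P (Suc 0)) G)" for G x
        using C P.del_closed[OF G] P.eps_del[OF G] G 0 by (simp add: fx C_def)
      obtain \<psi> where "\<psi> \<in> nat_trans (P (Suc 0)) (Q 1)"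
        "\<And>G x. G \<in> gr \<Longrightarrow> x \<in> carrier (obj (P (Suc 0)) G) \<Longrightarrow> \<delta>' 0 G (\<psi> G x) = f G x"
        using projective_lift_exact[OF P.proj Q.is_func Q.is_func P.A Q.ex0 f[unfolded 0] z] by blast
      then show ?thesis using that[of \<psi>] 0 by simp
    next
      case (Suc m)
      have z: "\<delta>' m G (f G x) = \<one>\<^bsub>obj (Q m) G\<^esub>" if G: "G \<in> gr" "x \<in> carrier (obj (P (Suc (Suc m))) G)" for G x
        using C G Suc by (simp add: fx C_def)
      obtain \<psi> where "\<psi> \<in> nat_trans (P (Suc (Suc m))) (Q (Suc (Suc m)))"
        "\<And>G x. G \<in> gr \<Longrightarrow> x \<in> carrier (obj (P (Suc (Suc m))) G) \<Longrightarrow> \<delta>' (Suc m) G (\<psi> G x) = f G x"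
        using projective_lift_exact[OF P.proj Q.is_func Q.is_func Q.is_func Q.exS f[unfolded Suc] z] by blast
      then show ?thesis using that[of \<psi>] Suc by simp
    qed
    have "\<delta>' n G (\<psi> G (\<delta> (Suc n) G x)) = \<one>\<^bsub>obj (Q n) G\<^esub>" if G: "G \<in> gr" "x \<in> carrier (obj (P (Suc (Suc n))) G)" for G x
      using \<psi>(2)[OF G(1) P.del_closed[OF G]] fx[OF G(1) P.del_closed[OF G]] P.del_del[OF G]
        nat_trans_one[OF P.is_func Q.is_func \<phi> G(1)] by simp
    then have "C (Suc n) \<psi>" using \<psi>(1) by (simp add: C_def)
    moreover have "R n \<phi> \<psi>" using \<psi>(2) fx by (simp add: R_def)
    ultimately show ?thesis by blast
  qed
  obtain \<phi> where \<phi>: "\<And>n. C n (\<phi> n)" "\<And>n. R n (\<phi> n) (\<phi> (Suc n))"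
    using dependent_nat_choice[of C R, OF 0 S] by blast
  have "chain_map \<phi>" unfolding chain_map_def
  proof (intro conjI allI)
    show "\<phi> n \<in> nat_trans (P n) (Q n)" for n using \<phi>(1)[of n] by (simp add: C_def)
  qed (use \<phi>(2) in \<open>simp add: R_def\<close>)
  moreover have "\<forall>G\<in>gr. \<forall>x\<in>carrier (obj (P 0) G). \<epsilon>' G (\<phi> 0 G x) = \<epsilon> G x"
    using \<phi>(1)[of 0] by (simp add: C_def)
  ultimately show ?thesis by blast
qed

text \<open>A chain map over the zero map is null-homotopic. The step takes \<open>s n\<close> with the weaker
  property that \<open>\<delta>' n\<close> and \<open>s n\<close> compose to \<open>f n\<close> on the image of \<open>\<delta> n\<close>, which is all
  that is needed to lift the difference of \<open>f (Suc n)\<close> and \<open>s n\<close> after \<open>\<delta> n\<close>.\<close>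

lemma null_homotopy_exists:
  assumes f: "chain_map f" and f0: "\<And>G x. G \<in> gr \<Longrightarrow> x \<in> carrier (obj (P 0) G) \<Longrightarrow> \<epsilon>' G (f 0 G x) = \<one>\<^bsub>obj A G\<^esub>"
  shows "\<exists>s. (\<forall>n. s n \<in> nat_trans (P n) (Q (Suc n))) \<and>
     (\<forall>n. \<forall>G\<in>gr. \<forall>x\<in>carrier (obj (P (Suc n)) G).
       f (Suc n) G x = \<delta>' (Suc n) G (s (Suc n) G x) \<otimes>\<^bsub>obj (Q (Suc n)) G\<^esub> s n G (\<delta> n G x))"
proof -
  have fn: "f n \<in> nat_trans (P n) (Q n)" for n using f by (simp add: chain_map_def)
  have fd: "\<delta>' n G (f (Suc n) G x) = f n G (\<delta> n G x)" if "G \<in> gr" "x \<in> carrier (obj (P (Suc n)) G)" for n G x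
    using f that by (simp add: chain_map_def)
  define C where "C n s \<longleftrightarrow> s \<in> nat_trans (P n) (Q (Suc n)) \<and>
     (\<forall>G\<in>gr. \<forall>x\<in>carrier (obj (P (Suc n)) G). \<delta>' n G (s G (\<delta> n G x)) = f n G (\<delta> n G x))" for n s
  define R where "R n s t \<longleftrightarrow> (\<forall>G\<in>gr. \<forall>x\<in>carrier (obj (P (Suc n)) G).
       f (Suc n) G x = \<delta>' (Suc n) G (t G x) \<otimes>\<^bsub>obj (Q (Suc n)) G\<^esub> s G (\<delta> n G x))" for n s t
  have 0: "\<exists>s. C 0 s"
  proof -
    obtain s where "s \<in> nat_trans (P 0) (Q 1)" "\<And>G x. G \<in> gr \<Longrightarrow> x \<in> carrier (obj (P 0) G) \<Longrightarrow> \<delta>' 0 G (s G x) = f 0 G x"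
      using projective_lift_exact[OF P.proj Q.is_func Q.is_func P.A Q.ex0 fn f0] by blast
    then show ?thesis using P.del_closed by (auto simp: C_def)
  qed
  have S: "\<exists>t. C (Suc n) t \<and> R n s t" if C: "C n s" for n s
  proof -
    have s: "s \<in> nat_trans (P n) (Q (Suc n))" using C by (simp add: C_def)
    let ?H = "hom_group (P (Suc n)) (Q (Suc n))"
    interpret H: comm_group ?H by (rule hom_group_comm[OF P.is_func Q.is_func])
    define u where "u = nt_comp (P (Suc n)) s (\<delta> n)"
    have u: "u \<in> nat_trans (P (Suc n)) (Q (Suc n))" unfolding u_def by (rule nt_comp_closed[OF P.is_func P.del s])
    define h where "h = f (Suc n) \<otimes>\<^bsub>?H\<^esub> inv\<^bsub>?H\<^esub> u"
    have h: "h \<in> nat_trans (P (Suc n)) (Q (Suc n))"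
      using H.m_closed[OF _ H.inv_closed, of "f (Suc n)" u] fn u by (simp add: h_def)
    have hx: "h G x = f (Suc n) G x \<otimes>\<^bsub>obj (Q (Suc n)) G\<^esub> inv\<^bsub>obj (Q (Suc n)) G\<^esub> s G (\<delta> n G x)"
      if G: "G \<in> gr" "x \<in> carrier (obj (P (Suc n)) G)" for G x
      using G nt_inv_eq[OF P.is_func Q.is_func u G] by (simp add: h_def nt_mult_eq u_def nt_comp_eq)
    have sc: "s G (\<delta> n G x) \<in> carrier (obj (Q (Suc n)) G)" if G: "G \<in> gr" "x \<in> carrier (obj (P (Suc n)) G)" for G x
      by (rule nat_transD(4)[OF s G(1) P.del_closed[OF G]])
    have hz: "\<delta>' n G (h G x) = \<one>\<^bsub>obj (Q n) G\<^esub>" if G: "G \<in> gr" "x \<in> carrier (obj (P (Suc n)) G)" for G x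
    proof -
      interpret q: group "obj (Q n) G" by (rule is_functorD(2)[OF Q.is_func G(1)])
      interpret q': group "obj (Q (Suc n)) G" by (rule is_functorD(2)[OF Q.is_func G(1)])
      have "\<delta>' n G (h G x) = \<delta>' n G (f (Suc n) G x) \<otimes>\<^bsub>obj (Q n) G\<^esub> inv\<^bsub>obj (Q n) G\<^esub> \<delta>' n G (s G (\<delta> n G x))"
        unfolding hx[OF G] using nat_transD(4)[OF fn G] sc[OF G]
        by (simp add: nat_transD(5)[OF Q.del G(1)] nat_trans_inv[OF Q.is_func Q.is_func Q.del G(1)])
      also have "\<dots> = \<one>\<^bsub>obj (Q n) G\<^esub>"
        using C fd[OF G] G nat_transD(4)[OF fn G(1) P.del_closed[OF G]] by (simp add: C_def)
      finally show ?thesis .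
    qed
    obtain t where t: "t \<in> nat_trans (P (Suc n)) (Q (Suc (Suc n)))"
      "\<And>G x. G \<in> gr \<Longrightarrow> x \<in> carrier (obj (P (Suc n)) G) \<Longrightarrow> \<delta>' (Suc n) G (t G x) = h G x"
      using projective_lift_exact[OF P.proj Q.is_func Q.is_func Q.is_func Q.exS h hz] by blast
    have "R n s t" unfolding R_def
    proof (intro ballI)
      fix G :: "'g monoid" and x assume G: "G \<in> gr" "x \<in> carrier (obj (P (Suc n)) G)"
      interpret q': group "obj (Q (Suc n)) G" by (rule is_functorD(2)[OF Q.is_func G(1)])
      show "f (Suc n) G x = \<delta>' (Suc n) G (t G x) \<otimes>\<^bsub>obj (Q (Suc n)) G\<^esub> s G (\<delta> n G x)"
        using t(2)[OF G] hx[OF G] sc[OF G] nat_transD(4)[OF fn G] by (simp add: q'.m_assoc)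
    qed
    moreover have "C (Suc n) t" unfolding C_def
    proof (intro conjI ballI)
      fix G :: "'g monoid" and x assume G: "G \<in> gr" "x \<in> carrier (obj (P (Suc (Suc n))) G)"
      interpret q': group "obj (Q (Suc n)) G" by (rule is_functorD(2)[OF Q.is_func G(1)])
      note dx = P.del_closed[OF G]
      show "\<delta>' (Suc n) G (t G (\<delta> (Suc n) G x)) = f (Suc n) G (\<delta> (Suc n) G x)"
        using t(2)[OF G(1) dx] hx[OF G(1) dx] P.del_del[OF G] nat_trans_one[OF P.is_func Q.is_func s G(1)] nat_transD(4)[OF fn G(1) dx]
        by simp
    qed (rule t(1))
    ultimately show ?thesis by blast
  qed
  obtain s where "\<And>n. C n (s n)" "\<And>n. R n (s n) (s (Suc n))"
    using dependent_nat_choice[of C R, OF 0 S] by blast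
  then show ?thesis by (intro exI[of _ s]) (simp add: C_def R_def)
qed

end

context proj_resolution
begin

text \<open>The difference of the chain map and the identity lies over the zero map.\<close>

lemma homotopic_to_identity:
  assumes f: "two_resolutions.chain_map P P \<delta> \<delta> f"
    and f0: "\<And>G x. G \<in> gr \<Longrightarrow> x \<in> carrier (obj (P 0) G) \<Longrightarrow> \<epsilon> G (f 0 G x) = \<epsilon> G x"
  shows "\<exists>s. (\<forall>n. s n \<in> nat_trans (P n) (P (Suc n))) \<and>
     (\<forall>n. \<forall>G\<in>gr. \<forall>x\<in>carrier (obj (P (Suc n)) G).
       f (Suc n) G x = x \<otimes>\<^bsub>obj (P (Suc n)) G\<^esub> (\<delta> (Suc n) G (s (Suc n) G x) \<otimes>\<^bsub>obj (P (Suc n)) G\<^esub> s n G (\<delta> n G x)))"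
proof -
  interpret two_resolutions A P P \<delta> \<delta> \<epsilon> \<epsilon> by unfold_locales
  have fn: "f n \<in> nat_trans (P n) (P n)" for n using f by (simp add: chain_map_def)
  have fd: "\<delta> n G (f (Suc n) G x) = f n G (\<delta> n G x)" if "G \<in> gr" "x \<in> carrier (obj (P (Suc n)) G)" for n G x
    using f that by (simp add: chain_map_def)
  define h where "h n = f n \<otimes>\<^bsub>hom_group (P n) (P n)\<^esub> inv\<^bsub>hom_group (P n) (P n)\<^esub> nt_id (P n)" for n
  have hn: "h n \<in> nat_trans (P n) (P n)" for n
  proof -
    interpret H: comm_group "hom_group (P n) (P n)" by (rule hom_group_comm[OF is_func is_func])
    show ?thesis using H.m_closed[OF _ H.inv_closed, of "f n" "nt_id (P n)"] fn nt_id_closed[OF is_func] by (simp add: h_def)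
  qed
  have hx: "h n G x = f n G x \<otimes>\<^bsub>obj (P n) G\<^esub> inv\<^bsub>obj (P n) G\<^esub> x"
    if G: "G \<in> gr" "x \<in> carrier (obj (P n) G)" for n G x
    using G nt_inv_eq[OF is_func is_func nt_id_closed[OF is_func] G] by (simp add: h_def nt_mult_eq nt_id_def)
  have "chain_map h"
    unfolding chain_map_def
  proof (intro conjI allI ballI hn)
    fix n and G :: "'g monoid" and x assume G: "G \<in> gr" "x \<in> carrier (obj (P (Suc n)) G)"
    interpret q: group "obj (P n) G" by (rule is_functorD(2)[OF is_func G(1)])
    interpret q': group "obj (P (Suc n)) G" by (rule is_functorD(2)[OF is_func G(1)])
    show "\<delta> n G (h (Suc n) G x) = h n G (\<delta> n G x)"
      using hx[OF G] hx[OF G(1) del_closed[OF G]] fd[OF G] nat_transD(4)[OF fn G] G(2)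
      by (simp add: nat_transD(5)[OF del G(1)] nat_trans_inv[OF is_func is_func del G(1)])
  qed
  moreover have "\<epsilon> G (h 0 G x) = \<one>\<^bsub>obj A G\<^esub>" if G: "G \<in> gr" "x \<in> carrier (obj (P 0) G)" for G x
  proof -
    interpret q: group "obj A G" by (rule is_functorD(2)[OF A G(1)])
    interpret q': group "obj (P 0) G" by (rule is_functorD(2)[OF is_func G(1)])
    show ?thesis
      using hx[OF G] f0[OF G] nat_transD(4)[OF fn G] G(2) nat_transD(4)[OF eps G]
      by (simp add: nat_transD(5)[OF eps G(1)] nat_trans_inv[OF is_func A eps G(1)])
  qed
  ultimately obtain s where s: "\<And>n. s n \<in> nat_trans (P n) (P (Suc n))"
     "\<And>n G x. G \<in> gr \<Longrightarrow> x \<in> carrier (obj (P (Suc n)) G) \<Longrightarrow>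
       h (Suc n) G x = \<delta> (Suc n) G (s (Suc n) G x) \<otimes>\<^bsub>obj (P (Suc n)) G\<^esub> s n G (\<delta> n G x)"
    using null_homotopy_exists[of h] by blast
  have "f (Suc n) G x = x \<otimes>\<^bsub>obj (P (Suc n)) G\<^esub> (\<delta> (Suc n) G (s (Suc n) G x) \<otimes>\<^bsub>obj (P (Suc n)) G\<^esub> s n G (\<delta> n G x))"
    if G: "G \<in> gr" "x \<in> carrier (obj (P (Suc n)) G)" for n G x
  proof -
    interpret q': comm_group "obj (P (Suc n)) G" by (rule is_functorD(1)[OF is_func G(1)])
    have "f (Suc n) G x = x \<otimes>\<^bsub>obj (P (Suc n)) G\<^esub> h (Suc n) G x"
      unfolding hx[OF G] using G(2) nat_transD(4)[OF fn G] by (simp add: q'.m_lcomm[of x])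
    then show ?thesis using s(2)[OF G] by simp
  qed
  then show ?thesis using s(1) by blast
qed

text \<open>Cocycles and coboundaries in pointwise form, without the restrictions that equality of
  transformations involves.\<close>

definition cocycle :: "('g, 'v) gr_functor \<Rightarrow> nat \<Rightarrow> ('g monoid \<Rightarrow> 'u \<Rightarrow> 'v) \<Rightarrow> bool" where
  "cocycle B n c \<longleftrightarrow> c \<in> nat_trans (P n) B \<and>
     (\<forall>G\<in>gr. \<forall>x\<in>carrier (obj (P (Suc n)) G). c G (\<delta> n G x) = \<one>\<^bsub>obj B G\<^esub>)"

definition coboundary :: "('g, 'v) gr_functor \<Rightarrow> nat \<Rightarrow> ('g monoid \<Rightarrow> 'u \<Rightarrow> 'v) \<Rightarrow> bool" where
  "coboundary B m c \<longleftrightarrow> (\<exists>b\<in>nat_trans (P m) B. \<forall>G\<in>gr. \<forall>x\<in>carrier (obj (P (Suc m)) G). c G x = b G (\<delta> m G x))"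

lemma cocycles_eq:
  assumes B: "is_functor B"
  shows "cocycles P \<delta> B n = {c. cocycle B n c}"
proof -
  have "coboundary_map P \<delta> n c = \<one>\<^bsub>hom_group (P (Suc n)) B\<^esub> \<longleftrightarrow>
      (\<forall>G\<in>gr. \<forall>x\<in>carrier (obj (P (Suc n)) G). c G (\<delta> n G x) = \<one>\<^bsub>obj B G\<^esub>)" (is "?L \<longleftrightarrow> ?R")
    if c: "c \<in> nat_trans (P n) B" for c
  proof
    assume L: ?L
    show ?R
    proof (intro ballI)
      fix G :: "'g monoid" and x assume G: "G \<in> gr" "x \<in> carrier (obj (P (Suc n)) G)"
      have "coboundary_map P \<delta> n c G x = \<one>\<^bsub>hom_group (P (Suc n)) B\<^esub> G x" using L by simp
      then show "c G (\<delta> n G x) = \<one>\<^bsub>obj B G\<^esub>" using G by (simp add: coboundary_map_def nt_comp_eq nt_one_eq)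
    qed
  next
    assume R: ?R
    interpret H: comm_group "hom_group (P (Suc n)) B" by (rule hom_group_comm[OF is_func B])
    show ?L
    proof (rule nat_trans_eqI)
      show "coboundary_map P \<delta> n c \<in> nat_trans (P (Suc n)) B"
        unfolding coboundary_map_def by (rule nt_comp_closed[OF is_func del c])
      show "\<one>\<^bsub>hom_group (P (Suc n)) B\<^esub> \<in> nat_trans (P (Suc n)) B" using H.one_closed by simp
    qed (use R in \<open>simp add: coboundary_map_def nt_comp_eq nt_one_eq\<close>)
  qed
  then show ?thesis by (auto simp: cocycles_def kernel_def cocycle_def)
qed

lemma coboundaries_eq:
  assumes B: "is_functor B"
  shows "coboundaries P \<delta> B (Suc m) = {c. cocycle B (Suc m) c \<and> coboundary B m c}"
proof (intro subset_antisym subsetI)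
  fix c assume "c \<in> coboundaries P \<delta> B (Suc m)"
  then obtain b where b: "b \<in> nat_trans (P m) B" "c = coboundary_map P \<delta> m b" by (auto simp: coboundaries_def)
  have c: "c \<in> nat_trans (P (Suc m)) B"
    unfolding b(2) coboundary_map_def by (rule nt_comp_closed[OF is_func del b(1)])
  have cx: "c G x = b G (\<delta> m G x)" if "G \<in> gr" "x \<in> carrier (obj (P (Suc m)) G)" for G x
    using that by (simp add: b(2) coboundary_map_def nt_comp_eq)
  have "c G (\<delta> (Suc m) G x) = \<one>\<^bsub>obj B G\<^esub>" if G: "G \<in> gr" "x \<in> carrier (obj (P (Suc (Suc m))) G)" for G x
    using cx[OF G(1) del_closed[OF G]] del_del[OF G] nat_trans_one[OF is_func B b(1) G(1)] by simp
  then show "c \<in> {c. cocycle B (Suc m) c \<and> coboundary B m c}"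
    using c cx b(1) by (auto simp: cocycle_def coboundary_def)
next
  fix c assume "c \<in> {c. cocycle B (Suc m) c \<and> coboundary B m c}"
  then obtain b where b: "c \<in> nat_trans (P (Suc m)) B" "b \<in> nat_trans (P m) B"
    "\<And>G x. G \<in> gr \<Longrightarrow> x \<in> carrier (obj (P (Suc m)) G) \<Longrightarrow> c G x = b G (\<delta> m G x)"
    by (auto simp: cocycle_def coboundary_def)
  have "c = coboundary_map P \<delta> m b"
    unfolding coboundary_map_def
    by (rule nat_trans_eqI[OF b(1) nt_comp_closed[OF is_func del b(2)]]) (simp add: b(3) nt_comp_eq)
  then show "c \<in> coboundaries P \<delta> B (Suc m)" using b(2) by (auto simp: coboundaries_def)
qed

end

context two_resolutions
begin

lemma pullback_cocycle:
  assumes f: "chain_map f" and B: "is_functor B" and c: "Q.cocycle B n c"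
  shows "P.cocycle B n (nt_comp (P n) c (f n))"
proof -
  have fn: "f n \<in> nat_trans (P n) (Q n)" for n using f by (simp add: chain_map_def)
  have cn: "c \<in> nat_trans (Q n) B" using c by (simp add: Q.cocycle_def)
  have "nt_comp (P n) c (f n) G (\<delta> n G x) = \<one>\<^bsub>obj B G\<^esub>" if G: "G \<in> gr" "x \<in> carrier (obj (P (Suc n)) G)" for G x
  proof -
    have "nt_comp (P n) c (f n) G (\<delta> n G x) = c G (\<delta>' n G (f (Suc n) G x))"
      using f G P.del_closed[OF G] by (simp add: nt_comp_eq chain_map_def)
    then show ?thesis using c G nat_transD(4)[OF fn G] by (simp add: Q.cocycle_def)
  qed
  then show ?thesis using nt_comp_closed[OF P.is_func fn cn] by (simp add: P.cocycle_def)
qed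

lemma pullback_coboundary:
  assumes f: "chain_map f" and B: "is_functor B" and c: "Q.coboundary B m c"
  shows "P.coboundary B m (nt_comp (P (Suc m)) c (f (Suc m)))"
proof -
  have fn: "f n \<in> nat_trans (P n) (Q n)" for n using f by (simp add: chain_map_def)
  obtain b where b: "b \<in> nat_trans (Q m) B"
    "\<And>G x. G \<in> gr \<Longrightarrow> x \<in> carrier (obj (Q (Suc m)) G) \<Longrightarrow> c G x = b G (\<delta>' m G x)"
    using c by (auto simp: Q.coboundary_def)
  have "nt_comp (P (Suc m)) c (f (Suc m)) G x = nt_comp (P m) b (f m) G (\<delta> m G x)"
    if G: "G \<in> gr" "x \<in> carrier (obj (P (Suc m)) G)" for G x
    using f G P.del_closed[OF G] b(2)[OF G(1) nat_transD(4)[OF fn G]] by (simp add: nt_comp_eq chain_map_def)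
  then show ?thesis unfolding P.coboundary_def
    by (intro bexI[of _ "nt_comp (P m) b (f m)"] nt_comp_closed[OF P.is_func fn b(1)]) simp
qed

end

context proj_resolution
begin

text \<open>On a cocycle the part of the homotopy that contains the outer differential vanishes.\<close>

lemma pullback_homotopic:
  assumes f: "two_resolutions.chain_map P P \<delta> \<delta> f"
    and f0: "\<And>G x. G \<in> gr \<Longrightarrow> x \<in> carrier (obj (P 0) G) \<Longrightarrow> \<epsilon> G (f 0 G x) = \<epsilon> G x"
    and B: "is_functor B" and c: "cocycle B (Suc m) c"
  shows "\<exists>b\<in>nat_trans (P m) B. \<forall>G\<in>gr. \<forall>x\<in>carrier (obj (P (Suc m)) G).
     c G (f (Suc m) G x) = c G x \<otimes>\<^bsub>obj B G\<^esub> b G (\<delta> m G x)"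
proof -
  obtain s where s: "\<And>n. s n \<in> nat_trans (P n) (P (Suc n))"
     "\<And>n G x. G \<in> gr \<Longrightarrow> x \<in> carrier (obj (P (Suc n)) G) \<Longrightarrow>
       f (Suc n) G x = x \<otimes>\<^bsub>obj (P (Suc n)) G\<^esub> (\<delta> (Suc n) G (s (Suc n) G x) \<otimes>\<^bsub>obj (P (Suc n)) G\<^esub> s n G (\<delta> n G x))"
    using homotopic_to_identity[OF f f0] by blast
  have cn: "c \<in> nat_trans (P (Suc m)) B" using c by (simp add: cocycle_def)
  show ?thesis
  proof (intro bexI[of _ "nt_comp (P m) c (s m)"] ballI)
    show "nt_comp (P m) c (s m) \<in> nat_trans (P m) B" by (rule nt_comp_closed[OF is_func s(1) cn])
    fix G :: "'g monoid" and x assume G: "G \<in> gr" "x \<in> carrier (obj (P (Suc m)) G)"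
    interpret q: comm_group "obj (P (Suc m)) G" by (rule is_functorD(1)[OF is_func G(1)])
    interpret b: comm_group "obj B G" by (rule is_functorD(1)[OF B G(1)])
    have c1: "\<delta> (Suc m) G (s (Suc m) G x) \<in> carrier (obj (P (Suc m)) G)"
      by (rule del_closed[OF G(1) nat_transD(4)[OF s(1) G]])
    have c2: "s m G (\<delta> m G x) \<in> carrier (obj (P (Suc m)) G)"
      by (rule nat_transD(4)[OF s(1) G(1) del_closed[OF G]])
    have "c G (\<delta> (Suc m) G (s (Suc m) G x)) = \<one>\<^bsub>obj B G\<^esub>"
      using c G(1) nat_transD(4)[OF s(1) G] by (simp add: cocycle_def)
    then show "c G (f (Suc m) G x) = c G x \<otimes>\<^bsub>obj B G\<^esub> nt_comp (P m) c (s m) G (\<delta> m G x)"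
      unfolding s(2)[OF G] using G(2) c1 c2 nat_transD(4)[OF cn G(1) c2] del_closed[OF G] G(1)
      by (simp add: nat_transD(5)[OF cn G(1)] nt_comp_eq)
  qed
qed

end

text \<open>If \<open>\<Lambda>\<close> classifies the cocycles on \<open>Q\<close> modulo coboundaries by the elements of \<open>K\<close>, pulling
  back along a chain map \<open>Q \<rightarrow> P\<close> over \<open>A\<close> turns it into an invariant of the cocycles on
  \<open>P\<close>. It is complete because the composites of the comparison maps \<open>P \<rightarrow> Q\<close> and \<open>Q \<rightarrow> P\<close>
  are homotopic to the identity. The group \<open>Ext\<close> is computed from an unknown resolution, so this
  is how an explicit one becomes usable.\<close>

theorem cohomology_iso:
  fixes A :: "('g, 'a) gr_functor" and B :: "('g, 'v) gr_functor"
    and P Q :: "nat \<Rightarrow> ('g, 'u) gr_functor"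
  assumes A: "is_functor A" and B: "is_functor B"
    and P: "projective_resolution A P \<delta> \<epsilon>" and Q: "projective_resolution A Q \<delta>' \<epsilon>'"
    and K: "group K"
    and hom: "\<And>c c'. proj_resolution.cocycle Q \<delta>' B (Suc m) c \<Longrightarrow> proj_resolution.cocycle Q \<delta>' B (Suc m) c' \<Longrightarrow>
      \<Lambda> (c \<otimes>\<^bsub>hom_group (Q (Suc m)) B\<^esub> c') = \<Lambda> c \<otimes>\<^bsub>K\<^esub> \<Lambda> c'"
    and onto: "\<Lambda> ` {c. proj_resolution.cocycle Q \<delta>' B (Suc m) c} = carrier K"
    and ker: "\<And>c. proj_resolution.cocycle Q \<delta>' B (Suc m) c \<Longrightarrow>
      \<Lambda> c = \<one>\<^bsub>K\<^esub> \<longleftrightarrow> proj_resolution.coboundary Q \<delta>' B m c"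
  shows "cohomology P \<delta> B (Suc m) \<cong> K"
proof -
  interpret PQ: two_resolutions A P Q \<delta> \<delta>' \<epsilon> \<epsilon>' using A P Q by unfold_locales
  interpret QP: two_resolutions A Q P \<delta>' \<delta> \<epsilon>' \<epsilon> by unfold_locales
  interpret PP: two_resolutions A P P \<delta> \<delta> \<epsilon> \<epsilon> by unfold_locales
  interpret QQ: two_resolutions A Q Q \<delta>' \<delta>' \<epsilon>' \<epsilon>' by unfold_locales
  interpret K: group K by (rule K)
  let ?n = "Suc m"
  obtain \<phi> where \<phi>: "PQ.chain_map \<phi>" "\<And>G x. G \<in> gr \<Longrightarrow> x \<in> carrier (obj (P 0) G) \<Longrightarrow> \<epsilon>' G (\<phi> 0 G x) = \<epsilon> G x"
    using PQ.chain_map_exists by blast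
  obtain \<psi> where \<psi>: "QP.chain_map \<psi>" "\<And>G x. G \<in> gr \<Longrightarrow> x \<in> carrier (obj (Q 0) G) \<Longrightarrow> \<epsilon> G (\<psi> 0 G x) = \<epsilon>' G x"
    using QP.chain_map_exists by blast
  have \<phi>n: "\<phi> n \<in> nat_trans (P n) (Q n)" for n using \<phi>(1) by (simp add: PQ.chain_map_def)
  have \<psi>n: "\<psi> n \<in> nat_trans (Q n) (P n)" for n using \<psi>(1) by (simp add: QP.chain_map_def)
  have \<phi>c: "\<phi> n G x \<in> carrier (obj (Q n) G)" if "G \<in> gr" "x \<in> carrier (obj (P n) G)" for n G x
    by (rule nat_transD(4)[OF \<phi>n that])
  have \<psi>c: "\<psi> n G x \<in> carrier (obj (P n) G)" if "G \<in> gr" "x \<in> carrier (obj (Q n) G)" for n G x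
    by (rule nat_transD(4)[OF \<psi>n that])
  define f where "f n = nt_comp (P n) (\<psi> n) (\<phi> n)" for n
  define g where "g n = nt_comp (Q n) (\<phi> n) (\<psi> n)" for n
  have f: "PP.chain_map f" "\<And>G x. G \<in> gr \<Longrightarrow> x \<in> carrier (obj (P 0) G) \<Longrightarrow> \<epsilon> G (f 0 G x) = \<epsilon> G x"
    using \<phi> \<psi> \<phi>c PQ.P.del_closed
    by (auto simp: PP.chain_map_def PQ.chain_map_def QP.chain_map_def f_def nt_comp_eq intro!: nt_comp_closed[OF PQ.P.is_func \<phi>n \<psi>n])
  have g: "QQ.chain_map g" "\<And>G x. G \<in> gr \<Longrightarrow> x \<in> carrier (obj (Q 0) G) \<Longrightarrow> \<epsilon>' G (g 0 G x) = \<epsilon>' G x"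
    using \<phi> \<psi> \<psi>c PQ.Q.del_closed
    by (auto simp: QQ.chain_map_def PQ.chain_map_def QP.chain_map_def g_def nt_comp_eq intro!: nt_comp_closed[OF PQ.Q.is_func \<psi>n \<phi>n])
  let ?HP = "hom_group (P ?n) B" and ?HQ = "hom_group (Q ?n) B"
  interpret HP: comm_group ?HP by (rule hom_group_comm[OF PQ.P.is_func B])
  interpret HQ: comm_group ?HQ by (rule hom_group_comm[OF PQ.Q.is_func B])
  define Z where "Z = {c. PQ.P.cocycle B ?n c}"
  define h where "h c = \<Lambda> (nt_comp (Q ?n) c (\<psi> ?n))" for c
  have Zn: "c \<in> nat_trans (P ?n) B" if "c \<in> Z" for c using that by (simp add: Z_def PQ.P.cocycle_def)
  have bck: "PQ.Q.cocycle B ?n (nt_comp (Q ?n) c (\<psi> ?n))" if "c \<in> Z" for c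
    using QP.pullback_cocycle[OF \<psi>(1) B] that by (simp add: Z_def)
  have Lc: "\<Lambda> c \<in> carrier K" if "PQ.Q.cocycle B ?n c" for c using onto that by blast
  have sub: "subgroup Z ?HP"
  proof (rule subgroup.intro)
    show "Z \<subseteq> carrier ?HP" using Zn by auto
    show "c \<otimes>\<^bsub>?HP\<^esub> c' \<in> Z" if "c \<in> Z" "c' \<in> Z" for c c'
    proof -
      have "c \<otimes>\<^bsub>?HP\<^esub> c' \<in> nat_trans (P ?n) B" using HP.m_closed[of c c'] Zn that by simp
      then show ?thesis using that PQ.P.del_closed is_functorD(2)[OF B]
        by (auto simp: Z_def PQ.P.cocycle_def nt_mult_eq group.is_monoid monoid.l_one monoid.one_closed)
    qed
    show "\<one>\<^bsub>?HP\<^esub> \<in> Z"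
      using HP.one_closed PQ.P.del_closed by (simp add: Z_def PQ.P.cocycle_def nt_one_eq)
    show "inv\<^bsub>?HP\<^esub> c \<in> Z" if "c \<in> Z" for c
    proof -
      have "inv\<^bsub>?HP\<^esub> c \<in> nat_trans (P ?n) B" using HP.inv_closed[of c] Zn that by simp
      then show ?thesis using that PQ.P.del_closed is_functorD(2)[OF B] nt_inv_eq[OF PQ.P.is_func B Zn[OF that]]
        by (auto simp: Z_def PQ.P.cocycle_def group.is_monoid monoid.inv_one)
    qed
  qed
  let ?Z = "?HP\<lparr>carrier := Z\<rparr>"
  have "h \<in> hom ?Z K"
  proof (rule homI)
    show "h c \<in> carrier K" if "c \<in> carrier ?Z" for c using Lc[OF bck[of c]] that by (simp add: h_def)
    fix c c' assume "c \<in> carrier ?Z" "c' \<in> carrier ?Z"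
    then have cc: "c \<in> Z" "c' \<in> Z" by auto
    have "nt_comp (Q ?n) (c \<otimes>\<^bsub>?HP\<^esub> c') (\<psi> ?n) = nt_comp (Q ?n) c (\<psi> ?n) \<otimes>\<^bsub>?HQ\<^esub> nt_comp (Q ?n) c' (\<psi> ?n)"
    proof (rule nat_trans_eqI)
      show "nt_comp (Q ?n) (c \<otimes>\<^bsub>?HP\<^esub> c') (\<psi> ?n) \<in> nat_trans (Q ?n) B"
        using HP.m_closed[of c c'] Zn cc by (intro nt_comp_closed[OF PQ.Q.is_func \<psi>n]) simp
      show "nt_comp (Q ?n) c (\<psi> ?n) \<otimes>\<^bsub>?HQ\<^esub> nt_comp (Q ?n) c' (\<psi> ?n) \<in> nat_trans (Q ?n) B"
        using HQ.m_closed[of "nt_comp (Q ?n) c (\<psi> ?n)" "nt_comp (Q ?n) c' (\<psi> ?n)"]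
          nt_comp_closed[OF PQ.Q.is_func \<psi>n Zn] cc by simp
    qed (simp add: nt_comp_eq nt_mult_eq \<psi>c)
    then show "h (c \<otimes>\<^bsub>?Z\<^esub> c') = h c \<otimes>\<^bsub>K\<^esub> h c'"
      using hom[OF bck[OF cc(1)] bck[OF cc(2)]] by (simp add: h_def)
  qed
  then interpret h: group_hom ?Z K h
    using HP.subgroup_imp_group[OF sub] K by (simp add: group_hom_def group_hom_axioms_def)
  have "kernel ?Z K h = coboundaries P \<delta> B ?n"
    unfolding PQ.P.coboundaries_eq[OF B]
  proof (intro subset_antisym subsetI)
    fix c assume "c \<in> {c. PQ.P.cocycle B ?n c \<and> PQ.P.coboundary B m c}"
    then have c: "c \<in> Z" "PQ.P.coboundary B m c" by (auto simp: Z_def)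
    have "PQ.Q.coboundary B m (nt_comp (Q ?n) c (\<psi> ?n))" by (rule QP.pullback_coboundary[OF \<psi>(1) B c(2)])
    then show "c \<in> kernel ?Z K h" using ker[OF bck[OF c(1)]] c(1) by (simp add: kernel_def h_def)
  next
    fix c assume "c \<in> kernel ?Z K h"
    then have c: "c \<in> Z" "PQ.Q.coboundary B m (nt_comp (Q ?n) c (\<psi> ?n))"
      using ker[OF bck] by (auto simp: kernel_def h_def)
    obtain b where b: "b \<in> nat_trans (P m) B"
      "\<And>G x. G \<in> gr \<Longrightarrow> x \<in> carrier (obj (P ?n) G) \<Longrightarrow> nt_comp (P ?n) (nt_comp (Q ?n) c (\<psi> ?n)) (\<phi> ?n) G x = b G (\<delta> m G x)"
      using PQ.pullback_coboundary[OF \<phi>(1) B c(2)] unfolding PQ.P.coboundary_def by blast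
    obtain b' where b': "b' \<in> nat_trans (P m) B"
      "\<And>G x. G \<in> gr \<Longrightarrow> x \<in> carrier (obj (P ?n) G) \<Longrightarrow> c G (f ?n G x) = c G x \<otimes>\<^bsub>obj B G\<^esub> b' G (\<delta> m G x)"
      using PQ.P.pullback_homotopic[OF f B] c(1) unfolding Z_def by blast
    let ?H = "hom_group (P m) B"
    interpret H: comm_group ?H by (rule hom_group_comm[OF PQ.P.is_func B])
    have bb: "b \<otimes>\<^bsub>?H\<^esub> inv\<^bsub>?H\<^esub> b' \<in> nat_trans (P m) B" using H.m_closed[OF _ H.inv_closed, of b b'] b b' by simp
    have "c G x = (b \<otimes>\<^bsub>?H\<^esub> inv\<^bsub>?H\<^esub> b') G (\<delta> m G x)" if G: "G \<in> gr" "x \<in> carrier (obj (P ?n) G)" for G x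
    proof -
      interpret BG: comm_group "obj B G" by (rule is_functorD(1)[OF B G(1)])
      note dx = PQ.P.del_closed[OF G]
      have "c G (f ?n G x) = b G (\<delta> m G x)"
        using b(2)[OF G] G \<phi>c[OF G] by (simp add: nt_comp_eq f_def)
      then have "b G (\<delta> m G x) = c G x \<otimes>\<^bsub>obj B G\<^esub> b' G (\<delta> m G x)" using b'(2)[OF G] by simp
      then have "c G x = b G (\<delta> m G x) \<otimes>\<^bsub>obj B G\<^esub> inv\<^bsub>obj B G\<^esub> b' G (\<delta> m G x)"
        using nat_transD(4)[OF Zn[OF c(1)] G] nat_transD(4)[OF b'(1) G(1) dx] by (simp add: BG.m_assoc)
      then show ?thesis using G(1) dx nt_inv_eq[OF PQ.P.is_func B b'(1) G(1) dx] by (simp add: nt_mult_eq)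
    qed
    then have "PQ.P.coboundary B m c" unfolding PQ.P.coboundary_def using bb by blast
    then show "c \<in> {c. PQ.P.cocycle B ?n c \<and> PQ.P.coboundary B m c}" using c(1) by (simp add: Z_def)
  qed
  moreover have "h ` carrier ?Z = carrier K"
  proof (intro subset_antisym subsetI)
    fix k assume "k \<in> carrier K"
    then obtain c where c: "PQ.Q.cocycle B ?n c" "k = \<Lambda> c" using onto by auto
    have cn: "c \<in> nat_trans (Q ?n) B" using c(1) by (simp add: PQ.Q.cocycle_def)
    define c' where "c' = nt_comp (P ?n) c (\<phi> ?n)"
    have c': "c' \<in> Z" using PQ.pullback_cocycle[OF \<phi>(1) B c(1)] by (simp add: Z_def c'_def)
    obtain b' where b': "b' \<in> nat_trans (Q m) B"
      "\<And>G x. G \<in> gr \<Longrightarrow> x \<in> carrier (obj (Q ?n) G) \<Longrightarrow> c G (g ?n G x) = c G x \<otimes>\<^bsub>obj B G\<^esub> b' G (\<delta>' m G x)"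
      using PQ.Q.pullback_homotopic[OF g B c(1)] by blast
    define e where "e = nt_comp (Q ?n) b' (\<delta>' m)"
    have en: "e \<in> nat_trans (Q ?n) B" unfolding e_def by (rule nt_comp_closed[OF PQ.Q.is_func PQ.Q.del b'(1)])
    have eb: "PQ.Q.coboundary B m e" unfolding PQ.Q.coboundary_def using b'(1) by (auto simp: e_def nt_comp_eq)
    have ec: "PQ.Q.cocycle B ?n e"
      using en PQ.Q.del_closed PQ.Q.del_del nat_trans_one[OF PQ.Q.is_func B b'(1)] by (simp add: PQ.Q.cocycle_def e_def nt_comp_eq)
    have "nt_comp (Q ?n) c' (\<psi> ?n) = c \<otimes>\<^bsub>?HQ\<^esub> e"
    proof (rule nat_trans_eqI)
      show "nt_comp (Q ?n) c' (\<psi> ?n) \<in> nat_trans (Q ?n) B" by (rule nt_comp_closed[OF PQ.Q.is_func \<psi>n Zn[OF c']])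
      show "c \<otimes>\<^bsub>?HQ\<^esub> e \<in> nat_trans (Q ?n) B" using HQ.m_closed[of c e] cn en by simp
      show "nt_comp (Q ?n) c' (\<psi> ?n) G x = (c \<otimes>\<^bsub>?HQ\<^esub> e) G x" if G: "G \<in> gr" "x \<in> carrier (obj (Q ?n) G)" for G x
        using b'(2)[OF G] G \<psi>c[OF G] by (simp add: c'_def nt_comp_eq nt_mult_eq e_def g_def)
    qed
    then have "h c' = \<Lambda> c \<otimes>\<^bsub>K\<^esub> \<Lambda> e" using hom[OF c(1) ec] by (simp add: h_def)
    also have "\<dots> = k" using ker[OF ec] eb Lc[OF c(1)] c(2) by simp
    finally show "k \<in> h ` carrier ?Z" using c' by auto
  qed (use h.hom_closed in auto)
  ultimately have "?Z Mod coboundaries P \<delta> B ?n \<cong> K" using h.FactGroup_iso by metis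
  then show ?thesis unfolding cohomology_def PQ.P.cocycles_eq[OF B] Z_def .
qed

theorem Ext_iso:
  fixes A :: "('g, 'a) gr_functor" and B :: "('g, 'v) gr_functor"
    and Q :: "nat \<Rightarrow> ('g, 'u) gr_functor"
  assumes A: "is_functor A" and B: "is_functor B" and Q: "projective_resolution A Q \<delta>' \<epsilon>'"
    and K: "group K"
    and hom: "\<And>c c'. proj_resolution.cocycle Q \<delta>' B (Suc m) c \<Longrightarrow> proj_resolution.cocycle Q \<delta>' B (Suc m) c' \<Longrightarrow>
      \<Lambda> (c \<otimes>\<^bsub>hom_group (Q (Suc m)) B\<^esub> c') = \<Lambda> c \<otimes>\<^bsub>K\<^esub> \<Lambda> c'"
    and onto: "\<Lambda> ` {c. proj_resolution.cocycle Q \<delta>' B (Suc m) c} = carrier K"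
    and ker: "\<And>c. proj_resolution.cocycle Q \<delta>' B (Suc m) c \<Longrightarrow>
      \<Lambda> c = \<one>\<^bsub>K\<^esub> \<longleftrightarrow> proj_resolution.coboundary Q \<delta>' B m c"
  shows "Ext TYPE('u) (Suc m) A B \<cong> K"
proof -
  define R where "R = (SOME (P :: nat \<Rightarrow> ('g, 'u) gr_functor, \<delta>). \<exists>\<epsilon>. projective_resolution A P \<delta> \<epsilon>)"
  have "\<exists>R. case R of (P :: nat \<Rightarrow> ('g, 'u) gr_functor, \<delta>) \<Rightarrow> \<exists>\<epsilon>. projective_resolution A P \<delta> \<epsilon>"
    using Q by (intro exI[of _ "(Q, \<delta>')"]) auto
  then have "case R of (P, \<delta>) \<Rightarrow> \<exists>\<epsilon>. projective_resolution A P \<delta> \<epsilon>" unfolding R_def by (rule someI_ex)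
  then obtain P \<delta> \<epsilon> where R: "R = (P, \<delta>)" and P: "projective_resolution A P \<delta> \<epsilon>" by (cases R) auto
  have "Ext TYPE('u) (Suc m) A B = cohomology P \<delta> B (Suc m)"
    unfolding Ext_def R_def[symmetric] R by simp
  then show ?thesis using cohomology_iso[where \<Lambda> = \<Lambda>, OF A B P Q K hom onto ker] by simp
qed

section \<open>Words and free groups\<close>

lemma word_val_Nil [simp]: "word_val G [] = \<one>\<^bsub>G\<^esub>"
  by (simp add: word_val_def)

lemma word_val_Cons [simp]: "word_val G ((b, x) # w) = (if b then x else inv\<^bsub>G\<^esub> x) \<otimes>\<^bsub>G\<^esub> word_val G w"
  by (simp add: word_val_def)

lemma word_val_closed: "group G \<Longrightarrow> snd ` set w \<subseteq> carrier G \<Longrightarrow> word_val G w \<in> carrier G"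
  by (induction w) (auto simp: group.is_monoid monoid.m_closed monoid.one_closed group.inv_closed)

lemma word_val_append:
  assumes "group G" "snd ` set u \<subseteq> carrier G" "snd ` set v \<subseteq> carrier G"
  shows "word_val G (u @ v) = word_val G u \<otimes>\<^bsub>G\<^esub> word_val G v"
proof -
  interpret group G by fact
  show ?thesis using assms(2)
    by (induction u) (auto simp: word_val_closed[OF assms(1)] assms(3) m_assoc)
qed

lemma word_val_cancel:
  assumes "group G" "snd ` set (u @ (b, x) # (\<not> b, x) # v) \<subseteq> carrier G"
  shows "word_val G (u @ (b, x) # (\<not> b, x) # v) = word_val G (u @ v)"
proof -
  interpret group G by fact
  have c: "snd ` set u \<subseteq> carrier G" "snd ` set v \<subseteq> carrier G" "x \<in> carrier G"
    "snd ` set ((b, x) # (\<not> b, x) # v) \<subseteq> carrier G" using assms(2) by auto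
  have "word_val G ((b, x) # (\<not> b, x) # v) = word_val G v"
    using c word_val_closed[OF assms(1) c(2)] by (cases b) (auto simp flip: m_assoc)
  then show ?thesis unfolding word_val_append[OF assms(1) c(1,4)] word_val_append[OF assms(1) c(1,2)] by simp
qed

lemma mor_word_val:
  assumes "group G" "group H" "f \<in> mor G H" "snd ` set w \<subseteq> carrier G"
  shows "f (word_val G w) = word_val H (map (\<lambda>(b, x). (b, f x)) w)"
  using assms(4)
proof (induction w)
  case Nil
  then show ?case using mor_one[OF assms(1-3)] by simp
next
  case (Cons a w)
  obtain b x where a: "a = (b, x)" by (cases a)
  interpret G: group G by fact
  have "x \<in> carrier G" "word_val G w \<in> carrier G" using Cons.prems a word_val_closed[OF assms(1), of w] by auto
  then show ?case using Cons a mor_inv[OF assms(1-3)] by (simp add: mor_mult[OF assms(3)])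
qed

lemma not_reduced_split: "\<not> reduced_word w \<Longrightarrow> \<exists>u b x v. w = u @ (b, x) # (\<not> b, x) # v"
proof (induction w)
  case Nil
  then show ?case by (simp add: reduced_word_def)
next
  case (Cons a w)
  show ?case
  proof (cases "reduced_word w")
    case True
    then obtain c w' where w: "w = c # w'" using Cons.prems by (cases w) (auto simp: reduced_word_def)
    obtain b x where a: "a = (b, x)" by (cases a)
    obtain b' y where c: "c = (b', y)" by (cases c)
    have "x = y \<and> b \<noteq> b'" using True Cons.prems unfolding w a c reduced_word_def by auto
    then have "a # w = [] @ (b, x) # (\<not> b, x) # w'" using a c w by simp
    then show ?thesis by blast
  next
    case False
    then obtain u b x v where "w = u @ (b, x) # (\<not> b, x) # v" using Cons.IH by blast
    then have "a # w = (a # u) @ (b, x) # (\<not> b, x) # v" by simp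
    then show ?thesis by blast
  qed
qed

lemma reduce_word:
  assumes inv: "\<And>u b x v. snd ` set (u @ (b, x) # (\<not> b, x) # v) \<subseteq> S \<Longrightarrow>
      \<Phi> (u @ (b, x) # (\<not> b, x) # v) = \<Phi> (u @ v)"
    and w: "snd ` set w \<subseteq> S"
  shows "\<exists>r. reduced_word r \<and> snd ` set r \<subseteq> S \<and> \<Phi> r = \<Phi> w"
  using w
proof (induction "length w" arbitrary: w rule: less_induct)
  case less
  show ?case
  proof (cases "reduced_word w")
    case True
    then show ?thesis using less.prems by blast
  next
    case False
    then obtain u b x v where w: "w = u @ (b, x) # (\<not> b, x) # v" using not_reduced_split by blast
    have "\<exists>r. reduced_word r \<and> snd ` set r \<subseteq> S \<and> \<Phi> r = \<Phi> (u @ v)"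
      using less.prems w by (intro less.hyps) auto
    then show ?thesis using inv[of u b x v] less.prems w by simp
  qed
qed

text \<open>Two words with the same value in a free group have the same reduced form, since they are equal to
  it after cancellations and reduced words are determined by their value. So a function of words that
  does not see cancellations descends to the group; this is how homomorphisms out of a free group
  and the Fox derivative are defined.\<close>

lemma free_invariant:
  assumes G: "group G" and fb: "free_basis G S"
    and inv: "\<And>u b x v. snd ` set (u @ (b, x) # (\<not> b, x) # v) \<subseteq> S \<Longrightarrow>
      \<Phi> (u @ (b, x) # (\<not> b, x) # v) = \<Phi> (u @ v)"
    and w: "snd ` set w \<subseteq> S" "snd ` set w' \<subseteq> S" "word_val G w = word_val G w'"
  shows "\<Phi> w = \<Phi> w'"
proof -
  have S: "S \<subseteq> carrier G" and inj: "inj_on (word_val G) {w. reduced_word w \<and> snd ` set w \<subseteq> S}"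
    using fb by (auto simp: free_basis_def bij_betw_def)
  \<comment> \<open>Carrying the value along shows that the reduced words below have the same value.\<close>
  define \<Psi> where "\<Psi> w = (word_val G w, \<Phi> w)" for w
  have inv': "\<Psi> (u @ (b, x) # (\<not> b, x) # v) = \<Psi> (u @ v)" if "snd ` set (u @ (b, x) # (\<not> b, x) # v) \<subseteq> S" for u b x v
    unfolding \<Psi>_def using word_val_cancel[OF G order_trans[OF that S]] inv[OF that] by simp
  obtain r where r: "reduced_word r" "snd ` set r \<subseteq> S" "\<Psi> r = \<Psi> w"
  proof -
    have "\<exists>r. reduced_word r \<and> snd ` set r \<subseteq> S \<and> \<Psi> r = \<Psi> w" by (rule reduce_word[OF _ w(1)]) (rule inv')
    then show ?thesis using that by blast
  qed
  obtain r' where r': "reduced_word r'" "snd ` set r' \<subseteq> S" "\<Psi> r' = \<Psi> w'"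
  proof -
    have "\<exists>r. reduced_word r \<and> snd ` set r \<subseteq> S \<and> \<Psi> r = \<Psi> w'" by (rule reduce_word[OF _ w(2)]) (rule inv')
    then show ?thesis using that by blast
  qed
  have "r = r'" using r r' w(3) inj by (intro inj_onD[OF inj]) (auto simp: \<Psi>_def)
  then show ?thesis using r(3) r'(3) by (simp add: \<Psi>_def)
qed

text \<open>Some word for \<open>g\<close>, not necessarily reduced: the invariance under cancellation makes the choice
  irrelevant.\<close>

definition word_for :: "'g monoid \<Rightarrow> 'g set \<Rightarrow> 'g \<Rightarrow> (bool \<times> 'g) list" where
  "word_for G S g = (SOME w. snd ` set w \<subseteq> S \<and> word_val G w = g)"

lemma word_for:
  assumes "free_basis G S" "g \<in> carrier G"
  shows "snd ` set (word_for G S g) \<subseteq> S" "word_val G (word_for G S g) = g"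
proof -
  have "\<exists>w. snd ` set w \<subseteq> S \<and> word_val G w = g"
  proof -
    have "word_val G ` {w. reduced_word w \<and> snd ` set w \<subseteq> S} = carrier G"
      using assms(1) by (simp add: free_basis_def bij_betw_def)
    then have "g \<in> word_val G ` {w. reduced_word w \<and> snd ` set w \<subseteq> S}" using assms(2) by simp
    then show ?thesis by auto
  qed
  then have "snd ` set (word_for G S g) \<subseteq> S \<and> word_val G (word_for G S g) = g" unfolding word_for_def by (rule someI_ex)
  then show "snd ` set (word_for G S g) \<subseteq> S" "word_val G (word_for G S g) = g" by auto
qed

lemma free_basis_carrier: "free_basis G S \<Longrightarrow> S \<subseteq> carrier G"
  by (simp add: free_basis_def)

lemma free_hom_exists:
  assumes G: "group G" and fb: "free_basis G S" and H: "group H" and \<phi>: "\<phi> ` S \<subseteq> carrier H"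
  shows "\<exists>f\<in>mor G H. \<forall>x\<in>S. f x = \<phi> x"
proof -
  interpret G: group G by fact
  interpret H: group H by fact
  note S = free_basis_carrier[OF fb] and word_for = word_for[OF fb]
  define m where "m = map (\<lambda>(b :: bool, x). (b, \<phi> x))"
  define \<Phi> where "\<Phi> w = word_val H (m w)" for w
  have mc: "snd ` set (m w) \<subseteq> carrier H" if "snd ` set w \<subseteq> S" for w using that \<phi> by (fastforce simp: m_def)
  have inv: "\<Phi> (u @ (b, x) # (\<not> b, x) # v) = \<Phi> (u @ v)" if "snd ` set (u @ (b, x) # (\<not> b, x) # v) \<subseteq> S" for u b x v
    using word_val_cancel[OF H, of "m u" b "\<phi> x" "m v"] mc[OF that] unfolding \<Phi>_def by (simp add: m_def)
  have fi: "\<Phi> w = \<Phi> w'" if "snd ` set w \<subseteq> S" "snd ` set w' \<subseteq> S" "word_val G w = word_val G w'" for w w'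
    by (rule free_invariant[OF G fb _ that]) (rule inv)
  define f where "f = (\<lambda>g\<in>carrier G. \<Phi> (word_for G S g))"
  have fw: "f (word_val G w) = \<Phi> w" if w: "snd ` set w \<subseteq> S" for w
    using word_val_closed[OF G order_trans[OF w S]] fi[OF word_for(1)[of "word_val G w"] w word_for(2)] by (simp add: f_def)
  have "f \<in> mor G H"
  proof (intro morI homI)
    show "f g \<in> carrier H" if "g \<in> carrier G" for g
      using word_val_closed[OF H mc[OF word_for(1)[OF that]]] that by (simp add: f_def \<Phi>_def)
    fix g h assume gh: "g \<in> carrier G" "h \<in> carrier G"
    let ?u = "word_for G S g" and ?v = "word_for G S h"
    have uv: "snd ` set (?u @ ?v) \<subseteq> S" using word_for(1)[OF gh(1)] word_for(1)[OF gh(2)] by auto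
    have "g \<otimes>\<^bsub>G\<^esub> h = word_val G (?u @ ?v)"
      using word_val_append[OF G order_trans[OF word_for(1)[OF gh(1)] S] order_trans[OF word_for(1)[OF gh(2)] S]] word_for(2) gh by simp
    then have "f (g \<otimes>\<^bsub>G\<^esub> h) = \<Phi> (?u @ ?v)" using fw[OF uv] by simp
    also have "\<dots> = \<Phi> ?u \<otimes>\<^bsub>H\<^esub> \<Phi> ?v"
      using word_val_append[OF H mc[OF word_for(1)[OF gh(1)]] mc[OF word_for(1)[OF gh(2)]]] by (simp add: \<Phi>_def m_def)
    finally show "f (g \<otimes>\<^bsub>G\<^esub> h) = f g \<otimes>\<^bsub>H\<^esub> f h" using gh by (simp add: f_def)
  qed (simp add: f_def)
  moreover have "f x = \<phi> x" if "x \<in> S" for x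
    using fw[of "[(True, x)]"] that S \<phi> by (auto simp: \<Phi>_def m_def subset_iff image_subset_iff)
  ultimately show ?thesis by blast
qed

lemma free_hom_unique:
  assumes G: "group G" and fb: "free_basis G S" and H: "group H" and f: "f \<in> mor G H" "g \<in> mor G H"
    and eq: "\<And>x. x \<in> S \<Longrightarrow> f x = g x"
  shows "f = g"
proof (rule mor_eqI[OF f])
  fix x assume x: "x \<in> carrier G"
  note w = word_for[OF fb x]
  have "map (\<lambda>(b, x). (b, f x)) (word_for G S x) = map (\<lambda>(b, x). (b, g x)) (word_for G S x)" using w(1) eq by auto
  then have 0: "word_val H (map (\<lambda>(b, x). (b, f x)) (word_for G S x)) = word_val H (map (\<lambda>(b, x). (b, g x)) (word_for G S x))"
    by (rule arg_cong)
  note c = order_trans[OF w(1) free_basis_carrier[OF fb]]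
  show "f x = g x"
    using mor_word_val[OF G H f(1) c] mor_word_val[OF G H f(2) c] unfolding w(2) 0 by (rule trans[OF _ sym])
qed

lemma gr_countable: "G \<in> gr \<Longrightarrow> countable (carrier G)"
proof -
  assume "G \<in> gr"
  then obtain S where S: "finite S" "free_basis G S" by (auto simp: gr_def)
  have "carrier G \<subseteq> word_val G ` lists (UNIV \<times> S)"
  proof
    fix g assume g: "g \<in> carrier G"
    have "word_for G S g \<in> lists (UNIV \<times> S)" using word_for(1)[OF S(2) g] by fastforce
    then show "g \<in> word_val G ` lists (UNIV \<times> S)" using word_for(2)[OF S(2) g] by (metis imageI)
  qed
  moreover have "countable (lists (UNIV \<times> S :: (bool \<times> 'a) set))"
    using S(1) by (intro countable_lists countable_finite) simp
  ultimately show ?thesis by (meson countable_image countable_subset)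
qed

subsection \<open>Free groups of every finite rank\<close>

text \<open>The reduced form of \<open>a # w\<close> for reduced \<open>w\<close>. Iterating it multiplies reduced words, which gives
  the free groups.\<close>

definition letter_cons :: "bool \<times> 'x \<Rightarrow> (bool \<times> 'x) list \<Rightarrow> (bool \<times> 'x) list" where
  "letter_cons a w = (case w of [] \<Rightarrow> [a] | c # w' \<Rightarrow> if snd a = snd c \<and> fst a \<noteq> fst c then w' else a # w)"

definition letter_inv :: "bool \<times> 'x \<Rightarrow> bool \<times> 'x" where "letter_inv a = (\<not> fst a, snd a)"

lemma reduced_word_Cons: "reduced_word (a # w) \<longleftrightarrow> (w = [] \<or> \<not> (snd a = snd (hd w) \<and> fst a \<noteq> fst (hd w))) \<and> reduced_word w"
  by (cases w) (auto simp: reduced_word_def split: prod.splits)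

lemma reduced_word_Nil [simp]: "reduced_word []"
  by (simp add: reduced_word_def)

lemma letter_cons_reduced: "reduced_word w \<Longrightarrow> reduced_word (letter_cons a w)"
  by (cases w) (auto simp: letter_cons_def reduced_word_Cons)

lemma letter_cons_Cons: "reduced_word (a # w) \<Longrightarrow> letter_cons a w = a # w"
  by (cases w) (auto simp: letter_cons_def reduced_word_Cons)

lemma letter_cons_set: "set (letter_cons a w) \<subseteq> insert a (set w)"
  by (cases w) (auto simp: letter_cons_def)

lemma letter_cons_letter_cons_letter_inv: "reduced_word w \<Longrightarrow> letter_cons a (letter_cons (letter_inv a) w) = w"
proof (cases w)
  case (Cons c w')
  assume r: "reduced_word w"
  show ?thesis
  proof (cases "c = a")
    case True
    have "letter_cons (letter_inv a) (a # w') = w'" by (simp add: letter_cons_def letter_inv_def)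
    then show ?thesis using r Cons letter_cons_Cons[of a w'] True by simp
  next
    case False
    then have "letter_cons (letter_inv a) w = letter_inv a # w" using Cons by (cases a; cases c) (auto simp: letter_cons_def letter_inv_def)
    then show ?thesis by (simp add: letter_cons_def letter_inv_def)
  qed
qed (simp add: letter_cons_def letter_inv_def)

definition word_mult :: "(bool \<times> 'x) list \<Rightarrow> (bool \<times> 'x) list \<Rightarrow> (bool \<times> 'x) list" where
  "word_mult u v = foldr letter_cons u v"

lemma word_mult_simps [simp]: "word_mult [] v = v" "word_mult (a # u) v = letter_cons a (word_mult u v)"
  by (simp_all add: word_mult_def)

lemma word_mult_reduced: "reduced_word v \<Longrightarrow> reduced_word (word_mult u v)"
  by (induction u) (auto simp: letter_cons_reduced)

lemma word_mult_set: "set (word_mult u v) \<subseteq> set u \<union> set v"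
  by (induction u) (use letter_cons_set in fastforce)+

text \<open>The step from which associativity follows. If \<open>a\<close> cancels against the first letter of \<open>u\<close>, the claim
  is that prepending a letter after its inverse has no effect.\<close>

lemma word_mult_letter_cons: "reduced_word u \<Longrightarrow> reduced_word v \<Longrightarrow> word_mult (letter_cons a u) v = letter_cons a (word_mult u v)"
proof (cases u)
  case (Cons c u')
  assume r: "reduced_word u" "reduced_word v"
  show ?thesis
  proof (cases "snd a = snd c \<and> fst a \<noteq> fst c")
    case True
    then have "c = letter_inv a" by (cases a; cases c) (auto simp: letter_inv_def)
    then show ?thesis using True Cons letter_cons_letter_cons_letter_inv[OF word_mult_reduced[OF r(2)]] by (simp add: letter_cons_def)
  qed (auto simp: Cons letter_cons_def)
qed (simp add: letter_cons_def)

lemma word_mult_assoc: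
  assumes "reduced_word v" "reduced_word w"
  shows "word_mult (word_mult u v) w = word_mult u (word_mult v w)"
  by (induction u) (auto simp: word_mult_letter_cons word_mult_reduced assms)

lemma word_mult_letter_inv: "reduced_word u \<Longrightarrow> \<exists>v. reduced_word v \<and> snd ` set v \<subseteq> snd ` set u \<and> word_mult v u = []"
proof (induction u)
  case Nil
  then show ?case by (intro exI[of _ "[]"]) auto
next
  case (Cons a u)
  then obtain v where v: "reduced_word v" "snd ` set v \<subseteq> snd ` set u" "word_mult v u = []"
    by (auto simp: reduced_word_Cons)
  have u: "reduced_word u" "reduced_word [letter_inv a]" using Cons.prems by (auto simp: reduced_word_Cons)
  let ?v = "word_mult v [letter_inv a]"
  have "word_mult ?v (a # u) = word_mult v (letter_cons (letter_inv a) (a # u))"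
    using word_mult_assoc[OF u(2) Cons.prems, of v] by simp
  also have "letter_cons (letter_inv a) (a # u) = u" by (simp add: letter_cons_def letter_inv_def)
  finally have "word_mult ?v (a # u) = []" using v by simp
  moreover have "snd ` set ?v \<subseteq> snd ` set (a # u)"
    using word_mult_set[of v "[letter_inv a]"] v(2) by (force simp: letter_inv_def)
  ultimately show ?case using word_mult_reduced[OF u(2), of v] by blast
qed

text \<open>The reduced words in \<open>n\<close> letters form a group under concatenation and reduction; as there are
  countably many of them they embed into any infinite type.\<close>

lemma free_group_exists:
  "\<exists>(G :: 'g::infinite monoid) bs. group G \<and> length bs = n \<and> distinct bs \<and> free_basis G (set bs)"
proof -
  have "infinite (UNIV :: 'g set)" by (rule infinite_UNIV)
  then obtain e0 :: "nat \<Rightarrow> 'g" where e0: "inj e0" using infinite_countable_subset by blast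
  define e where "e = e0 \<circ> (to_nat :: (bool \<times> nat) list \<Rightarrow> nat)"
  have e: "e x = e y \<longleftrightarrow> x = y" for x y using e0 by (auto simp: e_def inj_eq)
  have ie [simp]: "inv_into UNIV e (e x) = x" for x by (rule inv_into_f_f) (auto simp: inj_def e)
  define W where "W = {w. reduced_word w \<and> snd ` set w \<subseteq> {..<n}}"
  define G where "G = \<lparr>carrier = e ` W, monoid.mult = (\<lambda>x y. e (word_mult (inv_into UNIV e x) (inv_into UNIV e y))), one = e []\<rparr>"
  have mG [simp]: "e u \<otimes>\<^bsub>G\<^esub> e v = e (word_mult u v)" for u v by (simp add: G_def)
  have oG [simp]: "\<one>\<^bsub>G\<^esub> = e []" by (simp add: G_def)
  have cG: "carrier G = e ` W" by (simp add: G_def)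
  have Wm: "word_mult u v \<in> W" if "u \<in> W" "v \<in> W" for u v
    using that word_mult_reduced[of v u] word_mult_set[of u v] by (fastforce simp: W_def)
  have W0: "[] \<in> W" by (simp add: W_def)
  have Wr: "reduced_word u" if "u \<in> W" for u using that by (simp add: W_def)
  have G: "group G"
  proof (rule groupI)
    fix x assume "x \<in> carrier G"
    then obtain u where u: "u \<in> W" "x = e u" by (auto simp: cG)
    then obtain v where v: "reduced_word v" "snd ` set v \<subseteq> snd ` set u" "word_mult v u = []" using word_mult_letter_inv[of u] by (auto simp: W_def)
    have "v \<in> W" using v u by (auto simp: W_def)
    then show "\<exists>y\<in>carrier G. y \<otimes>\<^bsub>G\<^esub> x = \<one>\<^bsub>G\<^esub>" using v(3) u(2) by (intro bexI[of _ "e v"]) (auto simp: cG)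
  qed (auto simp: cG Wm W0 word_mult_assoc Wr)
  interpret group G by (rule G)
  define b where "b i = e [(True, i)]" for i
  have Wl: "[(c, i)] \<in> W" if "i < n" for c i using that by (simp add: W_def reduced_word_def)
  have bc: "b i \<in> carrier G" if "i < n" for i using Wl[OF that] by (simp add: b_def cG)
  have bi: "inv\<^bsub>G\<^esub> b i = e [(False, i)]" if "i < n" for i
    using Wl[OF that] by (intro inv_equality) (auto simp: b_def cG letter_cons_def)
  have val: "word_val G (map (\<lambda>(c, i). (c, b i)) w) = e w" if "w \<in> W" for w
    using that
  proof (induction w)
    case (Cons a w)
    obtain c i where a: "a = (c, i)" by (cases a)
    have "w \<in> W" "i < n" using Cons.prems a by (auto simp: W_def reduced_word_Cons)
    moreover have "letter_cons a w = a # w" using Cons.prems by (intro letter_cons_Cons) (simp add: W_def)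
    ultimately show ?case using Cons.IH a bi by (auto simp: b_def)
  qed simp
  have binj: "b i = b j \<longleftrightarrow> i = j" for i j by (simp add: b_def e)
  let ?S = "set (map b [0..<n])"
  have S: "?S = b ` {..<n}" by auto
  have "bij_betw (word_val G) {w. reduced_word w \<and> snd ` set w \<subseteq> ?S} (carrier G)"
  proof -
    let ?m = "map (\<lambda>(c :: bool, i). (c, b i))"
    have "{w. reduced_word w \<and> snd ` set w \<subseteq> ?S} = ?m ` W"
    proof (intro subset_antisym subsetI)
      fix w assume "w \<in> {w. reduced_word w \<and> snd ` set w \<subseteq> ?S}"
      then have w: "reduced_word w" "snd ` set w \<subseteq> b ` {..<n}" unfolding S by auto
      let ?v = "map (\<lambda>(c, x). (c, inv_into UNIV b x)) w"
      have ib: "inv_into UNIV b (b i) = i" for i by (rule inv_into_f_f) (auto simp: inj_def binj)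
      have wv: "w = ?m ?v"
        using w(2) by (induction w) (auto simp: ib)
      moreover have "?v \<in> W"
      proof -
        have "reduced_word (?m v) \<longleftrightarrow> reduced_word v" for v
          by (induction v) (auto simp: reduced_word_Cons hd_map binj split: prod.splits)
        then have "reduced_word ?v" using w(1) wv by metis
        moreover have "snd ` set ?v \<subseteq> {..<n}" using w(2) by (force simp: ib)
        ultimately show ?thesis by (simp add: W_def)
      qed
      ultimately show "w \<in> ?m ` W" by blast
    next
      fix w assume "w \<in> ?m ` W"
      then obtain v where v: "v \<in> W" "w = ?m v" by blast
      have "reduced_word (?m v) \<longleftrightarrow> reduced_word v" for v
        by (induction v) (auto simp: reduced_word_Cons hd_map binj split: prod.splits)
      then show "w \<in> {w. reduced_word w \<and> snd ` set w \<subseteq> ?S}" using v by (fastforce simp: W_def)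
    qed
    moreover have "bij_betw (word_val G) (?m ` W) (carrier G)"
      unfolding bij_betw_def
    proof
      show "inj_on (word_val G) (?m ` W)" by (rule inj_onI) (auto simp: val e)
      show "word_val G ` (?m ` W) = carrier G" by (auto simp: val cG image_image)
    qed
    ultimately show ?thesis by simp
  qed
  then have "free_basis G ?S" using bc by (auto simp: free_basis_def)
  then show ?thesis using G binj by (intro exI[of _ G] exI[of _ "map b [0..<n]"]) (auto simp: distinct_map inj_on_def)
qed

definition free_rank :: "nat \<Rightarrow> 'g::infinite monoid \<times> 'g list" where
  "free_rank n = (SOME (G, bs). group G \<and> length bs = n \<and> distinct bs \<and> free_basis G (set bs))"

definition FG :: "nat \<Rightarrow> 'g::infinite monoid" where "FG n = fst (free_rank n)"

definition gens :: "nat \<Rightarrow> 'g::infinite list" where "gens n = snd (free_rank n)"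

lemma free_rank:
  "group (FG n :: 'g::infinite monoid)" "length (gens n :: 'g list) = n" "distinct (gens n :: 'g list)"
  "free_basis (FG n) (set (gens n :: 'g list))"
proof -
  have "\<exists>p. case p of (G :: 'g monoid, bs) \<Rightarrow> group G \<and> length bs = n \<and> distinct bs \<and> free_basis G (set bs)"
    using free_group_exists[where 'g = 'g, of n] by auto
  then have "case (free_rank n :: 'g monoid \<times> 'g list) of (G, bs) \<Rightarrow> group G \<and> length bs = n \<and> distinct bs \<and> free_basis G (set bs)"
    unfolding free_rank_def by (rule someI_ex)
  then show "group (FG n :: 'g::infinite monoid)" "length (gens n :: 'g list) = n" "distinct (gens n :: 'g list)"
    "free_basis (FG n) (set (gens n :: 'g list))" by (auto simp: FG_def gens_def split: prod.splits)
qed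

lemma FG_gr: "FG n \<in> gr"
  using free_rank[where n = n] unfolding gr_def by blast

lemma gens_carrier: "set (gens n) \<subseteq> carrier (FG n)"
  by (rule free_basis_carrier[OF free_rank(4)])

lemma FG_hom_exists:
  fixes H :: "'h monoid"
  assumes H: "group H" and xs: "length xs = n" "set xs \<subseteq> carrier H"
  shows "\<exists>f\<in>mor (FG n :: 'g::infinite monoid) H. map f (gens n) = xs"
proof -
  define \<phi> where "\<phi> x = xs ! (THE i. i < n \<and> gens n ! i = x)" for x :: 'g
  have \<phi>: "\<phi> (gens n ! i) = xs ! i" if "i < n" for i
  proof -
    have "(THE j. j < n \<and> gens n ! j = (gens n ! i :: 'g)) = i"
      using that free_rank(2,3)[where n = n and 'g = 'g] by (auto simp: nth_eq_iff_index_eq)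
    then show ?thesis by (simp add: \<phi>_def)
  qed
  have "\<phi> ` set (gens n) \<subseteq> carrier H"
  proof
    fix y assume "y \<in> \<phi> ` set (gens n)"
    then obtain i where "i < n" "y = xs ! i"
      using \<phi> free_rank(2)[where n = n and 'g = 'g] by (auto simp: in_set_conv_nth)
    then show "y \<in> carrier H" using xs nth_mem[of i xs] by auto
  qed
  from free_hom_exists[OF free_rank(1,4) H this]
  obtain f where "f \<in> mor (FG n) H" "\<forall>x\<in>set (gens n). f x = \<phi> x" by blast
  then show ?thesis
    using \<phi> xs(1) free_rank(2)[where n = n and 'g = 'g]
    by (intro bexI[of _ f]) (auto simp: list_eq_iff_nth_eq)
qed

lemma FG_hom_unique:
  assumes "group H" "f \<in> mor (FG n) H" "g \<in> mor (FG n) H" "map f (gens n) = map g (gens n)"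
  shows "f = g"
  using assms(4) by (intro free_hom_unique[OF free_rank(1,4) assms(1-3)]) auto

section \<open>The bar complex\<close>

definition fcat :: "('a list \<Rightarrow>\<^sub>0 int) \<Rightarrow> ('a list \<Rightarrow>\<^sub>0 int) \<Rightarrow> ('a list \<Rightarrow>\<^sub>0 int)" where
  "fcat a b = frag_extend (\<lambda>u. lmap (\<lambda>v. u @ v) b) a"

lemma fcat_left [simp]: "fcat 0 b = 0" "fcat (a + a') b = fcat a b + fcat a' b"
  "fcat (a - a') b = fcat a b - fcat a' b" "fcat (- a) b = - fcat a b"
  by (simp_all add: fcat_def frag_extend_add frag_extend_diff frag_extend_minus)

lemma fcat_of [simp]: "fcat (frag_of u) (frag_of v) = frag_of (u @ v)"
  by (simp add: fcat_def)

lemma frag_UNIV_induct [case_names zero one diff]: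
  assumes "P 0" "\<And>x. P (frag_of x)" "\<And>a b. P a \<Longrightarrow> P b \<Longrightarrow> P (a - b)"
  shows "P (w :: 'a \<Rightarrow>\<^sub>0 int)"
proof -
  have "Poly_Mapping.keys w \<subseteq> UNIV" by simp
  then show ?thesis by (induction w rule: frag_induction) (auto intro: assms)
qed

lemma fcat_right [simp]: "fcat a 0 = 0" "fcat a (b + b') = fcat a b + fcat a b'"
  "fcat a (b - b') = fcat a b - fcat a b'" "fcat a (- b) = - fcat a b"
  by (induction a rule: frag_UNIV_induct)
    (simp_all add: fcat_def frag_extend_add frag_extend_diff frag_extend_minus)

lemma fcat_assoc: "fcat (fcat a b) c = fcat a (fcat b c)"
proof (induction a rule: frag_UNIV_induct)
  case (one u)
  show ?case
  proof (induction b rule: frag_UNIV_induct)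
    case (one v)
    show ?case by (induction c rule: frag_UNIV_induct) simp_all
  qed simp_all
qed simp_all

abbreviation fpre :: "'a \<Rightarrow> ('a list \<Rightarrow>\<^sub>0 int) \<Rightarrow> ('a list \<Rightarrow>\<^sub>0 int)" where
  "fpre g \<equiv> fcat (frag_of [g])"

text \<open>The differential of the bar complex with trivial coefficients, which maps a tuple to the alternating
  sum of the tuples with the first entry removed, two neighbours multiplied, or the last entry
  removed. The recursion compares a tuple with its tail: multiplying neighbours further right is
  the differential of the tail with the first entry put back, and the correction \<open>g # xs\<close>
  cancels the term of that differential which removes its own first entry (or, for a pair, is the
  term without the last entry). On a tuple of
  length one the differential is zero, so that the complex starts in degree one and the
  empty tuple never occurs.\<close>

fun bdl :: "'g monoid \<Rightarrow> 'g list \<Rightarrow> ('g list \<Rightarrow>\<^sub>0 int)" where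
  "bdl G [] = 0"
| "bdl G [g] = 0"
| "bdl G (g # h # xs) = frag_of (h # xs) - frag_of ((g \<otimes>\<^bsub>G\<^esub> h) # xs) + frag_of (g # xs) - fpre g (bdl G (h # xs))"

definition bd :: "'g monoid \<Rightarrow> ('g list \<Rightarrow>\<^sub>0 int) \<Rightarrow> ('g list \<Rightarrow>\<^sub>0 int)" where
  "bd G = frag_extend (bdl G)"

lemma bd_simps [simp]: "bd G 0 = 0" "bd G (a + b) = bd G a + bd G b" "bd G (a - b) = bd G a - bd G b"
  "bd G (- a) = - bd G a" "bd G (frag_of xs) = bdl G xs"
  by (simp_all add: bd_def frag_extend_add frag_extend_diff frag_extend_minus)

definition bar_set :: "nat \<Rightarrow> 'g monoid \<Rightarrow> 'g list set" where
  "bar_set n G = {xs. length xs = n \<and> set xs \<subseteq> carrier G}"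

lemma fpre_keys: "g \<in> carrier G \<Longrightarrow> Poly_Mapping.keys y \<subseteq> bar_set n G \<Longrightarrow> Poly_Mapping.keys (fpre g y) \<subseteq> bar_set (Suc n) G"
  by (simp add: fcat_def, rule frag_extend_closed[of "bar_set n G"]) (auto simp: bar_set_def keys_frag_of)

lemma bdl_keys:
  assumes "group G"
  shows "xs \<in> bar_set (Suc n) G \<Longrightarrow> Poly_Mapping.keys (bdl G xs) \<subseteq> bar_set n G"
proof (induction xs arbitrary: n)
  case Nil
  then show ?case by simp
next
  case (Cons g ys)
  interpret group G by fact
  show ?case
  proof (cases ys)
    case Nil
    then show ?thesis by simp
  next
    case ys: (Cons h xs)
    then obtain m where m: "n = Suc m" "length xs = m" using Cons.prems by (auto simp: bar_set_def)
    have gh: "g \<in> carrier G" "h \<in> carrier G" "set xs \<subseteq> carrier G" using Cons.prems ys by (auto simp: bar_set_def)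
    have "Poly_Mapping.keys (bdl G (h # xs)) \<subseteq> bar_set m G"
      using Cons.IH[of m] Cons.prems ys m by (auto simp: bar_set_def)
    then have "Poly_Mapping.keys (fpre g (bdl G (h # xs))) \<subseteq> bar_set n G" unfolding m(1) by (rule fpre_keys[OF gh(1)])
    moreover have "h # xs \<in> bar_set n G" "(g \<otimes>\<^bsub>G\<^esub> h) # xs \<in> bar_set n G" "g # xs \<in> bar_set n G"
      using gh m by (auto simp: bar_set_def)
    ultimately show ?thesis unfolding ys bdl.simps
      by (intro keys_diff_subset keys_add_subset) (auto simp: keys_frag_of)
  qed
qed

lemma bd_keys:
  "group G \<Longrightarrow> Poly_Mapping.keys w \<subseteq> bar_set (Suc n) G \<Longrightarrow> Poly_Mapping.keys (bd G w) \<subseteq> bar_set n G"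
  unfolding bd_def by (rule frag_extend_closed[OF bdl_keys])

lemma bd_pre_pre:
  "bd G (fpre g (fpre h z)) = fpre h z - fpre (g \<otimes>\<^bsub>G\<^esub> h) z + fpre g z - fpre g (bd G (fpre h z))"
  by (induction z rule: frag_UNIV_induct) (simp_all add: algebra_simps)

lemma bd_bdl:
  assumes G: "group G"
  shows "set xs \<subseteq> carrier G \<Longrightarrow> bd G (bdl G xs) = 0"
proof (induction "length xs" arbitrary: xs rule: less_induct)
  case less
  interpret group G by (rule G)
  show ?case
  proof (cases xs)
    case Nil
    then show ?thesis by simp
  next
    case g: (Cons g xs1)
    show ?thesis
    proof (cases xs1)
      case Nil
      then show ?thesis using g by simp
    next
      case h: (Cons h xs2)
      show ?thesis
      proof (cases xs2)
        case Nil
        then show ?thesis using g h by simp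
      next
        case k: (Cons k ys)
        have c: "g \<in> carrier G" "h \<in> carrier G" "k \<in> carrier G" using less.prems g h k by auto
        define B where "B = bdl G (k # ys)"
        have "bd G (bdl G (h # k # ys)) = 0" using less.hyps[of "h # k # ys"] less.prems g h k by simp
        then have hB: "bd G (fpre h B) = B - bdl G ((h \<otimes>\<^bsub>G\<^esub> k) # ys) + bdl G (h # ys)"
          by (simp add: B_def)
        show ?thesis
          unfolding g h k using bd_pre_pre[of G g h B] hB c
          by (simp add: B_def[symmetric] m_assoc)
      qed
    qed
  qed
qed

lemma bd_bd:
  assumes "group G" "Poly_Mapping.keys w \<subseteq> bar_set n G"
  shows "bd G (bd G w) = 0"
  using assms(2)
proof (induction w rule: frag_induction)
  case (one x)
  then show ?case using bd_bdl[OF assms(1), of x] by (simp add: bar_set_def)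
qed simp_all

lemma bdl_map:
  assumes f: "f \<in> mor G H"
  shows "set xs \<subseteq> carrier G \<Longrightarrow> lmap (map f) (bdl G xs) = bdl H (map f xs)"
proof (induction xs)
  case (Cons g ys)
  have pre: "lmap (map f) (fpre g y) = fpre (f g) (lmap (map f) y)" for g y
    by (induction y rule: frag_UNIV_induct) (simp_all add: frag_extend_diff)
  show ?case
    using Cons mor_mult[OF f] by (cases ys) (simp_all add: frag_extend_diff frag_extend_add pre)
qed simp

lemma bd_map:
  assumes f: "f \<in> mor G H" and w: "Poly_Mapping.keys w \<subseteq> bar_set n G"
  shows "lmap (map f) (bd G w) = bd H (lmap (map f) w)"
  using w
proof (induction w rule: frag_induction)
  case (one xs)
  then show ?case using bdl_map[OF f, of xs] by (simp add: bar_set_def)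
qed (simp_all add: frag_extend_diff)

section \<open>The bar complex of a free group\<close>

definition rmul :: "'g monoid \<Rightarrow> 'g \<Rightarrow> ('g list \<Rightarrow>\<^sub>0 int) \<Rightarrow> ('g list \<Rightarrow>\<^sub>0 int)" where
  "rmul G h = lmap (\<lambda>l. [l ! 0, l ! 1 \<otimes>\<^bsub>G\<^esub> h])"

lemma rmul_simps [simp]: "rmul G h 0 = 0" "rmul G h (a + b) = rmul G h a + rmul G h b"
  "rmul G h (- a) = - rmul G h a" "rmul G h (a - b) = rmul G h a - rmul G h b" "rmul G h (frag_of [s, r]) = frag_of [s, r \<otimes>\<^bsub>G\<^esub> h]"
  by (simp_all add: rmul_def frag_extend_add frag_extend_minus frag_extend_diff)

text \<open>The Fox derivative of a word, with values in the pairs of a generator and a group element. The pair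
  \<open>[x, r]\<close> stands for the bar chain by which \<open>x\<close> is split off from \<open>x * r\<close>.\<close>

fun fox_word :: "'g monoid \<Rightarrow> (bool \<times> 'g) list \<Rightarrow> ('g list \<Rightarrow>\<^sub>0 int)" where
  "fox_word G [] = 0"
| "fox_word G ((b, x) # w) = (if b then frag_of [x, word_val G w]
     else - frag_of [x, inv\<^bsub>G\<^esub> x \<otimes>\<^bsub>G\<^esub> word_val G w]) + fox_word G w"

lemma fox_word_append:
  assumes "group G" "snd ` set u \<subseteq> carrier G" "snd ` set v \<subseteq> carrier G"
  shows "fox_word G (u @ v) = rmul G (word_val G v) (fox_word G u) + fox_word G v"
  using assms(2)
proof (induction u)
  case (Cons a u)
  interpret group G by fact
  obtain b x where a: "a = (b, x)" by (cases a)
  have c: "x \<in> carrier G" "snd ` set u \<subseteq> carrier G" using Cons.prems a by auto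
  show ?case
    using Cons.IH[OF c(2)] c(1) word_val_closed[OF assms(1) c(2)] word_val_closed[OF assms(1,3)] word_val_append[OF assms(1) c(2) assms(3)]
    by (simp add: a m_assoc)
qed simp

text \<open>A letter and its inverse contribute opposite pairs, so the Fox derivative depends only on the element
  of the free group.\<close>

lemma fox_word_cancel:
  assumes "group G" "snd ` set (u @ (b, x) # (\<not> b, x) # v) \<subseteq> carrier G"
  shows "fox_word G (u @ (b, x) # (\<not> b, x) # v) = fox_word G (u @ v)"
proof -
  interpret group G by fact
  have c: "snd ` set u \<subseteq> carrier G" "snd ` set v \<subseteq> carrier G" "x \<in> carrier G"
    "snd ` set ((b, x) # (\<not> b, x) # v) \<subseteq> carrier G" using assms(2) by auto
  have e: "fox_word G ((b, x) # (\<not> b, x) # v) = fox_word G v"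
    using c word_val_closed[OF assms(1) c(2)] by (cases b) (auto simp flip: m_assoc)
  have "word_val G ((b, x) # (\<not> b, x) # v) = word_val G v"
    using word_val_cancel[of G "[]" b x v] assms(1) c by simp
  then show ?thesis unfolding fox_word_append[OF assms(1) c(1,4)] fox_word_append[OF assms(1) c(1,2)] e by simp
qed

definition fox :: "'g monoid \<Rightarrow> 'g set \<Rightarrow> 'g \<Rightarrow> ('g list \<Rightarrow>\<^sub>0 int)" where
  "fox G S g = fox_word G (word_for G S g)"

lemma fox_word_keys:
  assumes "group G" shows "snd ` set w \<subseteq> carrier G \<Longrightarrow> Poly_Mapping.keys (fox_word G w) \<subseteq> bar_set 2 G"
proof (induction w)
  case (Cons a w)
  interpret group G by fact
  obtain b x where a: "a = (b, x)" by (cases a)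
  have c: "x \<in> carrier G" "snd ` set w \<subseteq> carrier G" using Cons.prems a by auto
  have "Poly_Mapping.keys (if b then frag_of [x, word_val G w] else - frag_of [x, inv\<^bsub>G\<^esub> x \<otimes>\<^bsub>G\<^esub> word_val G w]) \<subseteq> bar_set 2 G"
    using c word_val_closed[OF assms c(2)] by (auto simp: keys_frag_of bar_set_def)
  then show ?case unfolding a fox_word.simps using Cons.IH[OF c(2)] by (rule keys_add_subset)
qed simp

locale free_grp =
  fixes G :: "'g monoid" and S :: "'g set"
  assumes G: "group G" and fb: "free_basis G S"
begin

sublocale group G by (rule G)

lemma fox_word: "snd ` set w \<subseteq> S \<Longrightarrow> g = word_val G w \<Longrightarrow> fox G S g = fox_word G w"
proof -
  assume w: "snd ` set w \<subseteq> S" "g = word_val G w"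
  note S = free_basis_carrier[OF fb]
  have g: "g \<in> carrier G" using w word_val_closed[OF G order_trans[OF w(1) S]] by simp
  show ?thesis unfolding fox_def
  proof (rule free_invariant[OF G fb _ word_for(1)[OF fb g] w(1)])
    show "fox_word G (u @ (b, x) # (\<not> b, x) # v) = fox_word G (u @ v)" if "snd ` set (u @ (b, x) # (\<not> b, x) # v) \<subseteq> S" for u b x v
      by (rule fox_word_cancel[OF G order_trans[OF that S]])
    show "word_val G (word_for G S g) = word_val G w" using word_for(2)[OF fb g] w(2) by simp
  qed
qed

lemma fox_mult:
  assumes g: "g \<in> carrier G" "h \<in> carrier G"
  shows "fox G S (g \<otimes>\<^bsub>G\<^esub> h) = rmul G h (fox G S g) + fox G S h"
proof -
  note S = free_basis_carrier[OF fb] and w1 = word_for[OF fb g(1)] and w2 = word_for[OF fb g(2)]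
  note c1 = order_trans[OF w1(1) S] and c2 = order_trans[OF w2(1) S]
  have "fox G S (g \<otimes>\<^bsub>G\<^esub> h) = fox_word G (word_for G S g @ word_for G S h)"
    using w1 w2 word_val_append[OF G c1 c2] by (intro fox_word) auto
  then show ?thesis using fox_word_append[OF G c1 c2] w2(2) by (simp add: fox_def)
qed

text \<open>Splitting the letters of the word off one by one telescopes to the difference between the trivial
  element and the value of the word in first position.\<close>

lemma bd_fox_cat:
  assumes w: "snd ` set w \<subseteq> carrier G" and h: "h \<in> carrier G"
  shows "bd G (fcat (fox_word G w) (frag_of (h # xs))) =
     frag_of (\<one>\<^bsub>G\<^esub> # h # xs) - frag_of (word_val G w # h # xs)
     + fcat (rmul G h (fox_word G w)) (frag_of xs) - fcat (fox_word G w) (frag_of xs) + fcat (fox_word G w) (bdl G (h # xs))"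
  using w
proof (induction w)
  case Nil
  then show ?case by simp
next
  case (Cons a w)
  obtain b x where a: "a = (b, x)" by (cases a)
  have c: "x \<in> carrier G" "snd ` set w \<subseteq> carrier G" using Cons.prems a by auto
  note vw = word_val_closed[OF G c(2)]
  have two: "fcat (frag_of [s, r]) y = fpre s (fpre r y)" for s r y
    using fcat_assoc[of "frag_of [s]" "frag_of [r]" y] by simp
  have t: "bd G (frag_of (s # r # h # xs)) = frag_of (r # h # xs) - frag_of ((s \<otimes>\<^bsub>G\<^esub> r) # h # xs)
      + frag_of (s # (r \<otimes>\<^bsub>G\<^esub> h) # xs) - frag_of (s # r # xs) + fcat (frag_of [s, r]) (bdl G (h # xs))" for s r
    by (simp add: two)
  show ?case
  proof (cases b)
    case True
    then show ?thesis using Cons.IH[OF c(2)] t[of x "word_val G w"] by (simp add: a)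
  next
    case False
    have "x \<otimes>\<^bsub>G\<^esub> (inv\<^bsub>G\<^esub> x \<otimes>\<^bsub>G\<^esub> word_val G w) = word_val G w" using c vw by (simp flip: m_assoc)
    then show ?thesis using Cons.IH[OF c(2)] t[of x "inv\<^bsub>G\<^esub> x \<otimes>\<^bsub>G\<^esub> word_val G w"] False by (simp add: a)
  qed
qed

text \<open>A contracting homotopy of the bar complex of a free group in degrees at least two: the first entry is
  decomposed into generators. It reflects that a free group has cohomological dimension one.\<close>

definition contraction :: "('g list \<Rightarrow>\<^sub>0 int) \<Rightarrow> ('g list \<Rightarrow>\<^sub>0 int)" where
  "contraction = frag_extend (\<lambda>l. case l of [] \<Rightarrow> 0
     | g # ys \<Rightarrow> frag_of (\<one>\<^bsub>G\<^esub> # \<one>\<^bsub>G\<^esub> # ys) - fcat (fox G S g) (frag_of ys))"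

lemma contraction_simps [simp]: "contraction 0 = 0" "contraction (a + b) = contraction a + contraction b" "contraction (a - b) = contraction a - contraction b"
  "contraction (frag_of (g # ys)) = frag_of (\<one>\<^bsub>G\<^esub> # \<one>\<^bsub>G\<^esub> # ys) - fcat (fox G S g) (frag_of ys)"
  by (simp_all add: contraction_def frag_extend_add frag_extend_diff)

lemma contraction_pre: "contraction (fpre g y) = fcat (frag_of [\<one>\<^bsub>G\<^esub>, \<one>\<^bsub>G\<^esub>]) y - fcat (fox G S g) y"
  by (induction y rule: frag_UNIV_induct) simp_all

lemma contraction_keys:
  assumes "Poly_Mapping.keys w \<subseteq> bar_set (Suc n) G"
  shows "Poly_Mapping.keys (contraction w) \<subseteq> bar_set (Suc (Suc n)) G"
  unfolding contraction_def
proof (rule frag_extend_closed[OF _ assms])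
  fix l assume "l \<in> bar_set (Suc n) G"
  then obtain g ys where l: "l = g # ys" "g \<in> carrier G" "ys \<in> bar_set n G" by (cases l) (auto simp: bar_set_def)
  have "snd ` set (word_for G S g) \<subseteq> carrier G" using word_for(1)[OF fb l(2)] free_basis_carrier[OF fb] by blast
  from fox_word_keys[OF G this] have "Poly_Mapping.keys (fox G S g) \<subseteq> bar_set 2 G" by (simp add: fox_def)
  then have "Poly_Mapping.keys (fcat (fox G S g) (frag_of ys)) \<subseteq> bar_set (Suc (Suc n)) G"
    unfolding fcat_def using l(3)
    by (elim frag_extend_closed[of "bar_set 2 G", rotated]) (auto simp: keys_frag_of bar_set_def)
  moreover have "\<one>\<^bsub>G\<^esub> # \<one>\<^bsub>G\<^esub> # ys \<in> bar_set (Suc (Suc n)) G" using l by (auto simp: bar_set_def)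
  ultimately show "Poly_Mapping.keys (case l of [] \<Rightarrow> 0
     | g # ys \<Rightarrow> frag_of (\<one>\<^bsub>G\<^esub> # \<one>\<^bsub>G\<^esub> # ys) - fcat (fox G S g) (frag_of ys)) \<subseteq> bar_set (Suc (Suc n)) G"
    unfolding l(1) by (simp add: keys_diff_subset keys_frag_of)
qed

text \<open>The boundary of the Fox derivative produces the tuple itself and terms that the derivation rule
  \<open>fox_mult\<close> matches with the contraction of the boundary; the summand with two trivial entries
  accounts for the tuples starting with the trivial element.\<close>

lemma homotopy_list:
  assumes "g \<in> carrier G" "h \<in> carrier G"
  shows "bd G (contraction (frag_of (g # h # xs))) + contraction (bd G (frag_of (g # h # xs))) = frag_of (g # h # xs)"
proof -
  have "snd ` set (word_for G S g) \<subseteq> carrier G" using word_for(1)[OF fb assms(1)] free_basis_carrier[OF fb] by blast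
  from bd_fox_cat[OF this assms(2), of xs]
  have f: "bd G (fcat (fox G S g) (frag_of (h # xs))) =
     frag_of (\<one>\<^bsub>G\<^esub> # h # xs) - frag_of (g # h # xs)
     + fcat (rmul G h (fox G S g)) (frag_of xs) - fcat (fox G S g) (frag_of xs) + fcat (fox G S g) (bdl G (h # xs))"
    using word_for(2)[OF fb assms(1)] by (simp add: fox_def)
  have two: "fcat (frag_of [\<one>\<^bsub>G\<^esub>, \<one>\<^bsub>G\<^esub>]) y = fpre \<one>\<^bsub>G\<^esub> (fpre \<one>\<^bsub>G\<^esub> y)" for y
    using fcat_assoc[of "frag_of [\<one>\<^bsub>G\<^esub>]" "frag_of [\<one>\<^bsub>G\<^esub>]" y] by simp
  show ?thesis
    using f fox_mult[OF assms] assms by (simp add: contraction_pre two)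
qed

lemma bar_exact:
  assumes w: "Poly_Mapping.keys w \<subseteq> bar_set (Suc (Suc n)) G" and z: "bd G w = 0"
  shows "\<exists>v. Poly_Mapping.keys v \<subseteq> bar_set (Suc (Suc (Suc n))) G \<and> bd G v = w"
proof -
  have "bd G (contraction w) + contraction (bd G w) = w"
    using w
  proof (induction w rule: frag_induction)
    case (one l)
    then obtain g h xs where "l = g # h # xs" "g \<in> carrier G" "h \<in> carrier G"
      by (cases l; cases "tl l") (auto simp: bar_set_def)
    then show ?case using homotopy_list by blast
  next
    case (diff a b)
    then show ?case by (simp add: algebra_simps)
  qed simp
  then show ?thesis using z contraction_keys[OF w] by auto
qed

end

text \<open>Modulo boundaries \<open>[g * k]\<close> is \<open>[g]\<close> plus \<open>[k]\<close>, so every chain is congruent to a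
  single \<open>[g]\<close>, and the \<open>g\<close> with \<open>[g]\<close> a boundary form a normal subgroup with commutative
  quotient. This is \<open>H\<^sub>1(G) = G / [G, G]\<close>, for every group \<open>G\<close>.\<close>

lemma bar_exact_1:
  assumes G: "group G" and h: "h \<in> hom (free_Abelian_group (bar_set 1 G)) (obj abelianization G)"
    and hg: "\<And>g. g \<in> carrier G \<Longrightarrow> h (frag_of [g]) = acl G g"
    and w: "Poly_Mapping.keys w \<subseteq> bar_set 1 G"
  shows "h w = \<one>\<^bsub>obj abelianization G\<^esub> \<longleftrightarrow> (\<exists>v. Poly_Mapping.keys v \<subseteq> bar_set 2 G \<and> bd G v = w)"
proof
  interpret group G by (rule G)
  let ?A = "obj abelianization G" and ?F = "free_Abelian_group (bar_set 1 G)"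
  interpret A: comm_group ?A using derived_quot_is_comm_group by simp
  interpret h: group_hom ?F ?A h using h A.is_group by (simp add: group_hom_def group_hom_axioms_def del: obj_abelianization)
  note am = hom_mult[OF acl_hom[OF G]]
  have ac: "acl G g \<in> carrier ?A" if "g \<in> carrier G" for g using that by (simp add: carrier_abelianization del: obj_abelianization)
  have hd: "h (a - b) = h a \<otimes>\<^bsub>?A\<^esub> inv\<^bsub>?A\<^esub> h b" if "Poly_Mapping.keys a \<subseteq> bar_set 1 G" "Poly_Mapping.keys b \<subseteq> bar_set 1 G" for a b
    using h.hom_mult[of a "- b"] h.hom_inv[of b] that by simp
  have b1: "[g] \<in> bar_set 1 G" if "g \<in> carrier G" for g using that by (simp add: bar_set_def)
  \<comment> \<open>The boundaries, and below the elements whose class bounds.\<close>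
  define I where "I w \<longleftrightarrow> (\<exists>v. Poly_Mapping.keys v \<subseteq> bar_set 2 G \<and> bd G v = w)" for w
  have Id: "I (a - b)" if "I a" "I b" for a b
    using that unfolding I_def by (metis bd_simps(3) keys_diff_subset)
  have I0: "I 0" unfolding I_def by (intro exI[of _ 0]) simp
  have Im: "I (- a)" if "I a" for a using Id[OF I0 that] by simp
  have Ia: "I (a + b)" if "I a" "I b" for a b using Id[OF that(1) Im[OF that(2)]] by simp
  have Ig: "I (frag_of [k] - frag_of [g \<otimes>\<^bsub>G\<^esub> k] + frag_of [g])" if "g \<in> carrier G" "k \<in> carrier G" for g k
    unfolding I_def using that by (intro exI[of _ "frag_of [g, k]"]) (simp add: keys_frag_of bar_set_def)
  have I1: "I (frag_of [\<one>\<^bsub>G\<^esub>])" using Ig[of "\<one>\<^bsub>G\<^esub>" "\<one>\<^bsub>G\<^esub>"] by simp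
  define K where "K = {g \<in> carrier G. I (frag_of [g])}"
  have Km: "I (frag_of [g \<otimes>\<^bsub>G\<^esub> k] - frag_of [g] - frag_of [k])" if "g \<in> carrier G" "k \<in> carrier G" for g k
    using Im[OF Ig[OF that]] by (simp add: algebra_simps)
  have Ki: "I (frag_of [inv\<^bsub>G\<^esub> g] + frag_of [g])" if "g \<in> carrier G" for g
    using Ia[OF Ig[of g "inv\<^bsub>G\<^esub> g"] I1] that by simp
  {
    assume "\<exists>v. Poly_Mapping.keys v \<subseteq> bar_set 2 G \<and> bd G v = w"
    then obtain v where v: "Poly_Mapping.keys v \<subseteq> bar_set 2 G" "w = bd G v" by auto
    have "Poly_Mapping.keys (bd G v) \<subseteq> bar_set 1 G \<and> h (bd G v) = \<one>\<^bsub>?A\<^esub>"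
      using v(1)
    proof (induction v rule: frag_induction)
      case zero
      then show ?case using h.hom_one by simp
    next
      case (one l)
      then obtain g k where l: "l = [g, k]" "g \<in> carrier G" "k \<in> carrier G"
        by (cases l; cases "tl l") (auto simp: bar_set_def)
      have k1: "Poly_Mapping.keys (frag_of [k] - frag_of [g \<otimes>\<^bsub>G\<^esub> k]) \<subseteq> bar_set 1 G"
        using l b1 by (intro keys_diff_subset) (auto simp: keys_frag_of)
      have k2: "Poly_Mapping.keys (bd G (frag_of l)) \<subseteq> bar_set 1 G"
        using keys_add_subset[OF k1, of "frag_of [g]"] l b1 by (simp add: keys_frag_of)
      have "h (bd G (frag_of l)) = (acl G k \<otimes>\<^bsub>?A\<^esub> inv\<^bsub>?A\<^esub> acl G (g \<otimes>\<^bsub>G\<^esub> k)) \<otimes>\<^bsub>?A\<^esub> acl G g"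
        using h.hom_mult[of "frag_of [k] - frag_of [g \<otimes>\<^bsub>G\<^esub> k]" "frag_of [g]"] k1 hd[of "frag_of [k]" "frag_of [g \<otimes>\<^bsub>G\<^esub> k]"] l b1 hg
        by (simp add: keys_frag_of del: obj_abelianization)
      also have "\<dots> = \<one>\<^bsub>?A\<^esub>"
      proof -
        note cl = ac[OF l(2)] ac[OF l(3)]
        have "(acl G k \<otimes>\<^bsub>?A\<^esub> inv\<^bsub>?A\<^esub> x) \<otimes>\<^bsub>?A\<^esub> acl G g = (acl G g \<otimes>\<^bsub>?A\<^esub> acl G k) \<otimes>\<^bsub>?A\<^esub> inv\<^bsub>?A\<^esub> x"
          if "x \<in> carrier ?A" for x using cl that by (simp add: A.m_ac del: obj_abelianization)
        from this[of "acl G g \<otimes>\<^bsub>?A\<^esub> acl G k"] show ?thesis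
          using cl am[OF l(2,3)] by (simp del: obj_abelianization)
      qed
      finally show ?case using k2 by simp
    next
      case (diff a b)
      then show ?case using hd[of "bd G a" "bd G b"] by (simp add: keys_diff_subset del: obj_abelianization)
    qed
    then show "h w = \<one>\<^bsub>?A\<^esub>" using v by simp
  }
  assume hw: "h w = \<one>\<^bsub>?A\<^esub>"
  have "\<exists>g\<in>carrier G. I (w - frag_of [g]) \<and> acl G g = h w"
    using w
  proof (induction w rule: free_Abelian_group_induct[consumes 1, case_names zero diff one])
    case zero
    show ?case
      using Im[OF I1] hom_one[OF acl_hom[OF G] G A.is_group] h.hom_one by (intro bexI[of _ "\<one>\<^bsub>G\<^esub>"]) (auto simp del: obj_abelianization)
  next
    case (one l)
    then obtain g where "l = [g]" "g \<in> carrier G" by (cases l) (auto simp: bar_set_def)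
    then show ?case using I0 hg by (intro bexI[of _ g]) auto
  next
    case (diff x y)
    then obtain g k where g: "g \<in> carrier G" "I (x - frag_of [g])" "acl G g = h x"
      and k: "k \<in> carrier G" "I (y - frag_of [k])" "acl G k = h y" by blast
    have "I ((x - frag_of [g]) - (y - frag_of [k]) - (frag_of [g \<otimes>\<^bsub>G\<^esub> inv\<^bsub>G\<^esub> k] - frag_of [g] - frag_of [inv\<^bsub>G\<^esub> k])
       - (frag_of [inv\<^bsub>G\<^esub> k] + frag_of [k]))"
      by (rule Id[OF Id[OF Id[OF g(2) k(2)] Km[OF g(1) inv_closed[OF k(1)]]] Ki[OF k(1)]])
    moreover have "acl G (g \<otimes>\<^bsub>G\<^esub> inv\<^bsub>G\<^esub> k) = h (x - y)"
      using hd[OF diff.hyps(1,2)] g k am[of g "inv\<^bsub>G\<^esub> k"] group_hom.hom_inv[of G ?A "acl G" k]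
        acl_hom[OF G] A.is_group G by (simp add: group_hom_def group_hom_axioms_def del: obj_abelianization)
    ultimately show ?case using g(1) k(1) by (intro bexI[of _ "g \<otimes>\<^bsub>G\<^esub> inv\<^bsub>G\<^esub> k"]) (auto simp: algebra_simps)
  qed
  then obtain g where g: "g \<in> carrier G" "I (w - frag_of [g])" "acl G g = \<one>\<^bsub>?A\<^esub>" using hw by auto
  have gd: "g \<in> derived G (carrier G)"
    using g coset_eq_one[OF derived_normal[OF G] g(1)] by (simp add: acl_def)
  have "derived G (carrier G) \<subseteq> K"
    unfolding derived_def
  proof (rule generate_subgroup_incl)
    show "derived_set G (carrier G) \<subseteq> K"
    proof
      fix c assume "c \<in> derived_set G (carrier G)"
      then obtain a b where c: "a \<in> carrier G" "b \<in> carrier G" "c = a \<otimes>\<^bsub>G\<^esub> b \<otimes>\<^bsub>G\<^esub> inv\<^bsub>G\<^esub> a \<otimes>\<^bsub>G\<^esub> inv\<^bsub>G\<^esub> b" by blast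
      have "I ((frag_of [c] - frag_of [a \<otimes>\<^bsub>G\<^esub> b \<otimes>\<^bsub>G\<^esub> inv\<^bsub>G\<^esub> a] - frag_of [inv\<^bsub>G\<^esub> b])
         + (frag_of [a \<otimes>\<^bsub>G\<^esub> b \<otimes>\<^bsub>G\<^esub> inv\<^bsub>G\<^esub> a] - frag_of [a \<otimes>\<^bsub>G\<^esub> b] - frag_of [inv\<^bsub>G\<^esub> a])
         + (frag_of [a \<otimes>\<^bsub>G\<^esub> b] - frag_of [a] - frag_of [b])
         + (frag_of [inv\<^bsub>G\<^esub> a] + frag_of [a]) + (frag_of [inv\<^bsub>G\<^esub> b] + frag_of [b]))"
        unfolding c(3) using c(1,2) by (intro Ia[OF Ia[OF Ia[OF Ia[OF Km Km] Km] Ki] Ki]) auto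
      then have "I (frag_of [c])" by simp
      then show "c \<in> K" using c by (simp add: K_def)
    qed
    show "subgroup K G"
    proof (rule subgroupI)
      show "K \<noteq> {}" using I1 by (auto simp: K_def)
      show "inv\<^bsub>G\<^esub> a \<in> K" if "a \<in> K" for a
        using that Id[OF Ki[of a], of "frag_of [a]"] by (auto simp: K_def)
      show "a \<otimes>\<^bsub>G\<^esub> b \<in> K" if "a \<in> K" "b \<in> K" for a b
        using that Ia[OF Ia[OF Km[of a b], of "frag_of [a]"], of "frag_of [b]"] by (auto simp: K_def)
    qed (auto simp: K_def)
  qed
  then have "I (frag_of [g])" using gd by (auto simp: K_def)
  from Ia[OF g(2) this] have "I w" by simp
  then show "\<exists>v. Poly_Mapping.keys v \<subseteq> bar_set 2 G \<and> bd G v = w" by (simp add: I_def)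
qed

section \<open>The bar resolution of the abelianization functor\<close>

definition bar :: "nat \<Rightarrow> ('g, 'g list \<Rightarrow>\<^sub>0 int) gr_functor" where
  "bar n = \<lparr>obj = (\<lambda>G. free_Abelian_group (bar_set n G)),
     arr = (\<lambda>G H f. \<lambda>w\<in>carrier (free_Abelian_group (bar_set n G)). lmap (map f) w)\<rparr>"

lemma obj_bar [simp]: "obj (bar n) G = free_Abelian_group (bar_set n G)"
  by (simp add: bar_def)

lemma arr_bar: "Poly_Mapping.keys w \<subseteq> bar_set n G \<Longrightarrow> arr (bar n) G H f w = lmap (map f) w"
  by (simp add: bar_def)

lemma map_bar_set: "f \<in> mor G H \<Longrightarrow> xs \<in> bar_set n G \<Longrightarrow> map f xs \<in> bar_set n H"
  using mor_closed[of f G H] by (auto simp: bar_set_def)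

lemma lmap_bar_hom: "f \<in> mor G H \<Longrightarrow> lmap (map f) \<in> hom (free_Abelian_group (bar_set n G)) (free_Abelian_group (bar_set n H))"
  by (intro frag_extend_hom) (simp add: keys_frag_of map_bar_set)

lemma lmap_bar_keys: "f \<in> mor G H \<Longrightarrow> Poly_Mapping.keys w \<subseteq> bar_set n G \<Longrightarrow> Poly_Mapping.keys (lmap (map f) w) \<subseteq> bar_set n H"
  by (rule frag_extend_closed[of "bar_set n G"]) (simp_all add: keys_frag_of map_bar_set)

lemma bar_functor: "is_functor (bar n)"
proof (rule is_functorI)
  fix G :: "'a monoid" assume G: "G \<in> gr"
  show "comm_group (obj (bar n) G)" by (simp add: abelian_free_Abelian_group)
  show "arr (bar n) G G (\<lambda>x\<in>carrier G. x) w = w" if "w \<in> carrier (obj (bar n) G)" for w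
    using that by (auto simp: arr_bar bar_set_def intro!: frag_extend_id[of "bar_set n G"] arg_cong[where f = frag_of] map_idI)
  fix H :: "'a monoid" and f assume H: "H \<in> gr" "f \<in> mor G H"
  show "arr (bar n) G H f \<in> mor (obj (bar n) G) (obj (bar n) H)"
    using restrict_mor[OF group.is_monoid[OF group_free_Abelian_group] lmap_bar_hom[OF H(2)]] by (simp add: bar_def)
  fix K :: "'a monoid" and g w assume K: "K \<in> gr" "g \<in> mor H K" and w: "w \<in> carrier (obj (bar n) G)"
  have "lmap (map (compose (carrier G) g f)) w = lmap (map g) (lmap (map f) w)"
    unfolding frag_extend_frag_extend
  proof (rule frag_extend_eq)
    fix xs assume "xs \<in> Poly_Mapping.keys w"
    then have "x \<in> carrier G" if "x \<in> set xs" for x using w that by (auto simp: bar_set_def)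
    then show "frag_of (map (compose (carrier G) g f) xs) = lmap (map g) (frag_of (map f xs))"
      by (simp add: frag_of_eq compose_eq)
  qed
  then show "arr (bar n) G K (compose (carrier G) g f) w = arr (bar n) H K g (arr (bar n) G H f w)"
    using w lmap_bar_keys[OF H(2)] by (simp add: arr_bar)
qed

lemma gens_bar: "(gens n :: 'g::infinite list) \<in> bar_set n (FG n)"
  unfolding bar_set_def using gens_carrier[where 'a = 'g, of n] free_rank(2)[where 'g = 'g, of n] by (intro CollectI conjI)

lemma bar_set_hom:
  fixes G :: "'g::infinite monoid"
  assumes "G \<in> gr" "xs \<in> bar_set n G"
  shows "\<exists>\<phi>\<in>mor (FG n :: 'g monoid) G. map \<phi> (gens n) = xs"
  using assms(2) by (intro FG_hom_exists[OF gr_group[OF assms(1)]]) (auto simp: bar_set_def)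

text \<open>Tuples of length \<open>n\<close> in \<open>G\<close> are the homomorphisms from the free group of rank \<open>n\<close> to \<open>G\<close>,
  so \<open>bar n\<close> is the linearization of a representable functor. By the Yoneda lemma its
  transformations to \<open>B\<close> are the elements of the value of \<open>B\<close> at that free group, the image of
  the tuple of generators.\<close>

lemma yoneda_exists:
  fixes B :: "('g::infinite, 'v) gr_functor"
  assumes B: "is_functor B" and y: "y \<in> carrier (obj B (FG n))"
  shows "\<exists>\<eta>\<in>nat_trans (bar n) B. \<eta> (FG n) (frag_of (gens n)) = y"
proof -
  define \<phi> where "\<phi> G xs = (SOME f. f \<in> mor (FG n :: 'g monoid) G \<and> map f (gens n) = xs)" for G :: "'g monoid" and xs
  have \<phi>: "\<phi> G xs \<in> mor (FG n) G" "map (\<phi> G xs) (gens n) = xs" if Gx: "G \<in> gr" "xs \<in> bar_set n G" for G xs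
  proof -
    have "\<exists>f. f \<in> mor (FG n :: 'g monoid) G \<and> map f (gens n) = xs"
      using bar_set_hom[OF Gx] unfolding Bex_def .
    then have "\<phi> G xs \<in> mor (FG n) G \<and> map (\<phi> G xs) (gens n) = xs" unfolding \<phi>_def by (rule someI_ex)
    then show "\<phi> G xs \<in> mor (FG n) G" "map (\<phi> G xs) (gens n) = xs" by auto
  qed
  define v where "v G xs = arr B (FG n) G (\<phi> G xs) y" for G xs
  have vc: "v G xs \<in> carrier (obj B G)" if "G \<in> gr" "xs \<in> bar_set n G" for G xs
    unfolding v_def by (rule arr_closed[OF B FG_gr that(1) \<phi>(1)[OF that] y])
  define e where "e G = (SOME h. h \<in> hom (free_Abelian_group (bar_set n G)) (obj B G) \<and> (\<forall>xs\<in>bar_set n G. h (frag_of xs) = v G xs))" for G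
  have e: "e G \<in> hom (free_Abelian_group (bar_set n G)) (obj B G)" "\<And>xs. xs \<in> bar_set n G \<Longrightarrow> e G (frag_of xs) = v G xs"
    if G: "G \<in> gr" for G
  proof -
    have "v G ` bar_set n G \<subseteq> carrier (obj B G)" by (rule image_subsetI) (rule vc[OF G])
    from comm_group.free_Abelian_group_universal[OF is_functorD(1)[OF B G] this]
    obtain h where "h \<in> hom (free_Abelian_group (bar_set n G)) (obj B G)" "\<And>xs. xs \<in> bar_set n G \<Longrightarrow> h (frag_of xs) = v G xs" by blast
    then have "\<exists>h. h \<in> hom (free_Abelian_group (bar_set n G)) (obj B G) \<and> (\<forall>xs\<in>bar_set n G. h (frag_of xs) = v G xs)"
      by (intro exI conjI ballI)
    then have "e G \<in> hom (free_Abelian_group (bar_set n G)) (obj B G) \<and> (\<forall>xs\<in>bar_set n G. e G (frag_of xs) = v G xs)"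
      unfolding e_def by (rule someI_ex)
    then show "e G \<in> hom (free_Abelian_group (bar_set n G)) (obj B G)" "\<And>xs. xs \<in> bar_set n G \<Longrightarrow> e G (frag_of xs) = v G xs" by auto
  qed
  have nat: "arr B G H f (e G w) = e H (lmap (map f) w)"
    if G: "G \<in> gr" "H \<in> gr" "f \<in> mor G H" and w: "w \<in> carrier (free_Abelian_group (bar_set n G))" for G H f w
  proof -
    have "(arr B G H f \<circ> e G) w = (e H \<circ> lmap (map f)) w"
    proof (rule hom_free_eqI[OF is_functorD(2)[OF B G(2)] _ _ _ w])
      show "arr B G H f \<circ> e G \<in> hom (free_Abelian_group (bar_set n G)) (obj B H)"
        using e(1)[OF G(1)] mor_hom[OF is_functorD(3)[OF B G]] by (rule Group.hom_compose)
      show "e H \<circ> lmap (map f) \<in> hom (free_Abelian_group (bar_set n G)) (obj B H)"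
        using lmap_bar_hom[OF G(3)] e(1)[OF G(2)] by (rule Group.hom_compose)
      fix xs assume xs: "xs \<in> bar_set n G"
      have m: "map f xs \<in> bar_set n H" by (rule map_bar_set[OF G(3) xs])
      have "compose (carrier (FG n)) f (\<phi> G xs) = \<phi> H (map f xs)"
      proof (rule FG_hom_unique[OF gr_group[OF G(2)]])
        show "compose (carrier (FG n)) f (\<phi> G xs) \<in> mor (FG n) H"
          by (rule mor_compose[OF group.is_monoid[OF free_rank(1)] \<phi>(1)[OF G(1) xs] G(3)])
        show "\<phi> H (map f xs) \<in> mor (FG n) H" by (rule \<phi>(1)[OF G(2) m])
        have "map (compose (carrier (FG n)) f (\<phi> G xs)) (gens n) = map f (map (\<phi> G xs) (gens n))"
          using gens_carrier[where 'a = 'g, of n] by (auto simp: compose_def)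
        then show "map (compose (carrier (FG n)) f (\<phi> G xs)) (gens n) = map (\<phi> H (map f xs)) (gens n)"
          using \<phi>(2)[OF G(1) xs] \<phi>(2)[OF G(2) m] by simp
      qed
      then have "arr B G H f (v G xs) = v H (map f xs)"
        unfolding v_def using is_functorD(5)[OF B FG_gr G(1,2) \<phi>(1)[OF G(1) xs] G(3) y] by simp
      then show "(arr B G H f \<circ> e G) (frag_of xs) = (e H \<circ> lmap (map f)) (frag_of xs)"
        using e(2)[OF G(1) xs] e(2)[OF G(2) m] by simp
    qed
    then show ?thesis by simp
  qed
  let ?\<eta> = "\<lambda>G\<in>gr. \<lambda>w\<in>carrier (obj (bar n) G). e G w"
  have "?\<eta> \<in> nat_trans (bar n) B"
  proof (rule nt_pointwise_closed[OF bar_functor B])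
    fix G :: "'g monoid" assume G: "G \<in> gr"
    show "e G w \<in> carrier (obj B G)" if "w \<in> carrier (obj (bar n) G)" for w
      using hom_in_carrier[OF e(1)[OF G]] that by simp
    show "e G (w \<otimes>\<^bsub>obj (bar n) G\<^esub> w') = e G w \<otimes>\<^bsub>obj B G\<^esub> e G w'" if "w \<in> carrier (obj (bar n) G)" "w' \<in> carrier (obj (bar n) G)" for w w'
      using hom_mult[OF e(1)[OF G]] that by simp
    fix H :: "'g monoid" and f w assume H: "H \<in> gr" "f \<in> mor G H" and w: "w \<in> carrier (obj (bar n) G)"
    show "arr B G H f (e G w) = e H (arr (bar n) G H f w)" using nat[OF G H] w by (simp add: arr_bar)
  qed
  moreover have "?\<eta> (FG n) (frag_of (gens n)) = y"
  proof -
    have id: "(\<lambda>x\<in>carrier (FG n). x) \<in> mor (FG n) (FG n :: 'g monoid)" by (rule mor_id[OF group.is_monoid[OF free_rank(1)]])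
    have "map (\<lambda>x\<in>carrier (FG n). x) (gens n) = (gens n :: 'g list)" using gens_carrier[where 'a = 'g, of n] by (auto intro!: map_idI)
    then have "\<phi> (FG n) (gens n) = (\<lambda>x\<in>carrier (FG n). x)"
      using \<phi>[OF FG_gr gens_bar] by (intro FG_hom_unique[OF free_rank(1) _ id]) simp_all
    then show ?thesis
      using e(2)[OF FG_gr gens_bar] is_functorD(4)[OF B FG_gr y] FG_gr[where 'a = 'g, of n] gens_bar[where 'g = 'g, of n] by (simp add: v_def keys_frag_of)
  qed
  ultimately show ?thesis by blast
qed

lemma yoneda_value:
  fixes B :: "('g::infinite, 'v) gr_functor"
  assumes \<eta>: "\<eta> \<in> nat_trans (bar n) B" and \<phi>: "G \<in> gr" "\<phi> \<in> mor (FG n) G" "map \<phi> (gens n) = xs"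
  shows "\<eta> G (frag_of xs) = arr B (FG n) G \<phi> (\<eta> (FG n) (frag_of (gens n)))"
  using nat_transD(2)[OF \<eta> FG_gr \<phi>(1,2), of "frag_of (gens n)"] gens_bar[where 'g = 'g, of n] \<phi>(3)
  by (simp add: keys_frag_of arr_bar)

lemma bar_nat_eqI:
  fixes B :: "('g::infinite, 'v) gr_functor"
  assumes B: "is_functor B" and \<eta>: "\<eta> \<in> nat_trans (bar n) B" "\<theta> \<in> nat_trans (bar n) B"
    and eq: "\<And>G xs. G \<in> gr \<Longrightarrow> xs \<in> bar_set n G \<Longrightarrow> \<eta> G (frag_of xs) = \<theta> G (frag_of xs)"
  shows "\<eta> = \<theta>"
proof (rule nat_trans_eqI[OF \<eta>])
  fix G :: "'g monoid" and w assume G: "G \<in> gr" and w: "w \<in> carrier (obj (bar n) G)"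
  show "\<eta> G w = \<theta> G w"
    by (rule hom_free_eqI[OF is_functorD(2)[OF B G]
          mor_hom[OF nat_transD(1)[OF \<eta>(1) G], unfolded obj_bar] mor_hom[OF nat_transD(1)[OF \<eta>(2) G], unfolded obj_bar]
          eq[OF G] w[unfolded obj_bar]])
qed

lemma yoneda_unique:
  fixes B :: "('g::infinite, 'v) gr_functor"
  assumes B: "is_functor B" and \<eta>: "\<eta> \<in> nat_trans (bar n) B" "\<theta> \<in> nat_trans (bar n) B"
    and eq: "\<eta> (FG n) (frag_of (gens n)) = \<theta> (FG n) (frag_of (gens n))"
  shows "\<eta> = \<theta>"
proof (rule bar_nat_eqI[OF B \<eta>])
  fix G :: "'g monoid" and xs assume G: "G \<in> gr" and xs: "xs \<in> bar_set n G"
  obtain \<phi> where \<phi>: "\<phi> \<in> mor (FG n :: 'g monoid) G" "map \<phi> (gens n) = xs"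
    using bar_set_hom[OF G xs] by (rule bexE)
  show "\<eta> G (frag_of xs) = \<theta> G (frag_of xs)"
    unfolding yoneda_value[OF \<eta>(1) G \<phi>] yoneda_value[OF \<eta>(2) G \<phi>] eq ..
qed

text \<open>Lift the image of the universal element along the epimorphism at the free group of rank \<open>n\<close>.\<close>

lemma bar_lift:
  fixes E :: "('g::infinite, 'v) gr_functor" and Q :: "('g, 'w) gr_functor"
  assumes E: "is_functor E" and Q: "is_functor Q" and e: "is_epi E Q e" and f: "f \<in> nat_trans (bar n) Q"
  shows "\<exists>g\<in>nat_trans (bar n) E. nt_comp (bar n) e g = f"
proof -
  have en: "e \<in> nat_trans E Q" using e unfolding is_epi_def by (rule conjunct1)
  have im: "e (FG n) ` carrier (obj E (FG n)) = carrier (obj Q (FG n))"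
    by (rule bspec[OF conjunct2[OF e[unfolded is_epi_def]] FG_gr])
  have u: "frag_of (gens n) \<in> carrier (obj (bar n) (FG n :: 'g monoid))" using gens_bar[where 'g = 'g, of n] by (simp add: keys_frag_of)
  have "f (FG n) (frag_of (gens n)) \<in> carrier (obj Q (FG n))" by (rule nat_transD(4)[OF f FG_gr u])
  then have "f (FG n) (frag_of (gens n)) \<in> e (FG n) ` carrier (obj E (FG n))" unfolding im .
  then obtain y where y: "f (FG n) (frag_of (gens n)) = e (FG n) y" "y \<in> carrier (obj E (FG n))"
    by (rule imageE)
  obtain g where g: "g \<in> nat_trans (bar n) E" "g (FG n) (frag_of (gens n)) = y" using yoneda_exists[OF E y(2)] by (rule bexE)
  have "nt_comp (bar n) e g = f"
  proof (rule yoneda_unique[OF Q nt_comp_closed[OF bar_functor g(1) en] f])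
    show "nt_comp (bar n) e g (FG n) (frag_of (gens n)) = f (FG n) (frag_of (gens n))"
      unfolding nt_comp_eq[OF FG_gr u] g(2) y(1) ..
  qed
  then show ?thesis using g(1) by blast
qed

lemma copy_bar_projective:
  fixes s :: "'g::infinite monoid \<Rightarrow> ('g list \<Rightarrow>\<^sub>0 int) \<Rightarrow> 'u"
  assumes "\<And>G. G \<in> gr \<Longrightarrow> inj_on (s G) (carrier (obj (bar n) G))"
  shows "projective (copy s (bar n))"
proof -
  interpret functor_copy s "bar n" using assms by (intro functor_copy.intro bar_functor)
  show ?thesis
    unfolding projective_def
  proof (intro conjI copy_functor allI impI, elim conjE)
    fix E Q :: "('g, 'u) gr_functor" and e f
    assume E: "is_functor E" and Q: "is_functor Q" and e: "is_epi E Q e" and f: "f \<in> nat_trans (copy s (bar n)) Q"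
    obtain g where g: "g \<in> nat_trans (bar n) E" "nt_comp (bar n) e g = nt_comp (bar n) f (cp_up s (bar n))"
      using bar_lift[OF E Q e nt_comp_closed[OF bar_functor cp_up_closed f]] by blast
    let ?g = "nt_comp (copy s (bar n)) g (cp_down s (bar n))"
    have gn: "?g \<in> nat_trans (copy s (bar n)) E" by (rule nt_comp_closed[OF copy_functor cp_down_closed g(1)])
    have en: "e \<in> nat_trans E Q" using e unfolding is_epi_def by (rule conjunct1)
    have "nt_comp (copy s (bar n)) e ?g = f"
    proof (rule nat_trans_eqI[OF nt_comp_closed[OF copy_functor gn en] f])
      fix G :: "'g monoid" and x assume G: "G \<in> gr" and x: "x \<in> carrier (obj (copy s (bar n)) G)"
      have d: "cp_down s (bar n) G x \<in> carrier (obj (bar n) G)" by (rule nat_transD(4)[OF cp_down_closed G x])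
      have "e G (g G (cp_down s (bar n) G x)) = nt_comp (bar n) e g G (cp_down s (bar n) G x)"
        using G d by (simp add: nt_comp_eq del: obj_bar)
      also have "\<dots> = f G x" unfolding g(2) using G d x by (simp add: nt_comp_eq cp_up_down del: obj_bar)
      finally show "nt_comp (copy s (bar n)) e ?g G x = f G x" using G x by (simp add: nt_comp_eq)
    qed
    then show "\<exists>g\<in>nat_trans (copy s (bar n)) E. nt_comp (copy s (bar n)) e g = f" using gn by blast
  qed
qed

lemma countable_frag:
  assumes "countable S"
  shows "countable {w :: 'a \<Rightarrow>\<^sub>0 int. Poly_Mapping.keys w \<subseteq> S}"
proof -
  define f where "f l = (\<Sum>(k, x)\<leftarrow>l. frag_cmul k (frag_of x))" for l :: "(int \<times> 'a) list"
  have "{w. Poly_Mapping.keys w \<subseteq> S} \<subseteq> f ` lists (UNIV \<times> S)"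
  proof
    fix w :: "'a \<Rightarrow>\<^sub>0 int" assume "w \<in> {w. Poly_Mapping.keys w \<subseteq> S}"
    then have "Poly_Mapping.keys w \<subseteq> S" by simp
    then show "w \<in> f ` lists (UNIV \<times> S)"
    proof (induction w rule: frag_induction)
      case zero
      show ?case by (rule image_eqI[of _ _ "[]"]) (auto simp: f_def)
    next
      case (one x)
      then show ?case by (intro image_eqI[of _ _ "[(1, x)]"]) (auto simp: f_def)
    next
      case (diff a b)
      from diff(1) obtain l where l: "a = f l" "l \<in> lists (UNIV \<times> S)" by (rule imageE)
      from diff(2) obtain m where m: "b = f m" "m \<in> lists (UNIV \<times> S)" by (rule imageE)
      let ?m = "map (\<lambda>(k, x). (- k, x)) m"
      have "f ?m = - f m"
      proof (induction m)
        case (Cons p m)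
        then show ?case by (cases p) (simp add: f_def)
      qed (simp add: f_def)
      moreover have "f (l @ ?m) = f l + f ?m" by (simp add: f_def)
      ultimately have "a - b = f (l @ ?m)" using l m by simp
      moreover have "l @ ?m \<in> lists (UNIV \<times> S)" using l(2) m(2) by (auto simp: in_lists_conv_set)
      ultimately show ?case by (rule image_eqI)
    qed
  qed
  moreover have "countable (lists (UNIV \<times> S :: (int \<times> 'a) set))" using assms by (intro countable_lists) auto
  ultimately show ?thesis by (meson countable_image countable_subset)
qed

text \<open>A finitely generated free group is countable, and so are its bar chains.\<close>

lemma bar_embedding:
  assumes "G \<in> gr"
  shows "\<exists>s :: ('g list \<Rightarrow>\<^sub>0 int) \<Rightarrow> 'u::infinite. inj_on s (carrier (obj (bar n) (G :: 'g monoid)))"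
proof -
  have "countable (lists (carrier G))" using gr_countable[OF assms] by (rule countable_lists)
  then have "countable (bar_set n G)" by (rule countable_subset[rotated]) (auto simp: bar_set_def)
  from countable_frag[OF this] obtain c :: "_ \<Rightarrow> nat" where c: "inj_on c {w :: 'g list \<Rightarrow>\<^sub>0 int. Poly_Mapping.keys w \<subseteq> bar_set n G}"
    by (auto simp: countable_def)
  have "infinite (UNIV :: 'u set)" by (rule infinite_UNIV)
  then obtain e :: "nat \<Rightarrow> 'u" where e: "inj e" using infinite_countable_subset by blast
  have "carrier (obj (bar n) G) = {w. Poly_Mapping.keys w \<subseteq> bar_set n G}" by auto
  then have "inj_on (e \<circ> c) (carrier (obj (bar n) G))" using c e by (auto intro!: comp_inj_on intro: inj_on_subset)
  then show ?thesis by blast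
qed

definition emb :: "nat \<Rightarrow> 'g monoid \<Rightarrow> ('g list \<Rightarrow>\<^sub>0 int) \<Rightarrow> 'u::infinite" where
  "emb n G = (SOME s. inj_on s (carrier (obj (bar n) G)))"

lemma emb: "G \<in> gr \<Longrightarrow> inj_on (emb n G :: _ \<Rightarrow> 'u::infinite) (carrier (obj (bar n) (G :: 'g::infinite monoid)))"
  unfolding emb_def by (rule someI_ex[OF bar_embedding])

text \<open>The \<open>n\<close>-th term of the resolution is the functor of bar chains of degree \<open>n + 1\<close>, copied into the
  type [\<open>'u\<close>]; \<open>up\<close> and \<open>down\<close> translate between the two.\<close>

definition BR :: "nat \<Rightarrow> ('g::infinite, 'u::infinite) gr_functor" where
  "BR n = copy (emb (Suc n)) (bar (Suc n))"

definition up :: "nat \<Rightarrow> 'g::infinite monoid \<Rightarrow> ('g list \<Rightarrow>\<^sub>0 int) \<Rightarrow> 'u::infinite" where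
  "up n = cp_up (emb (Suc n)) (bar (Suc n))"

definition down :: "nat \<Rightarrow> 'g::infinite monoid \<Rightarrow> 'u::infinite \<Rightarrow> ('g list \<Rightarrow>\<^sub>0 int)" where
  "down n = cp_down (emb (Suc n)) (bar (Suc n))"

lemma BR_copy: "functor_copy (emb n :: 'g::infinite monoid \<Rightarrow> _ \<Rightarrow> 'u::infinite) (bar n)"
  using emb by (intro functor_copy.intro bar_functor)

lemma BR_functor: "is_functor (BR n :: ('g::infinite, 'u::infinite) gr_functor)"
  unfolding BR_def by (rule functor_copy.copy_functor[OF BR_copy])

lemma BR_projective: "projective (BR n :: ('g::infinite, 'u::infinite) gr_functor)"
  unfolding BR_def by (rule copy_bar_projective[OF emb])

lemma up: "(up n :: 'g::infinite monoid \<Rightarrow> _ \<Rightarrow> 'u::infinite) \<in> nat_trans (bar (Suc n)) (BR n)"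
  unfolding BR_def up_def by (rule functor_copy.cp_up_closed[OF BR_copy])

lemma BR_nat_closed: "G \<in> gr \<Longrightarrow> w \<in> carrier (obj (bar (Suc n)) (G :: 'g::infinite monoid)) \<Longrightarrow>
    (up n G w :: 'u::infinite) \<in> carrier (obj (BR n) G)"
  by (rule nat_transD(4)[OF up])

lemma down: "(down n :: 'g::infinite monoid \<Rightarrow> 'u::infinite \<Rightarrow> _) \<in> nat_trans (BR n) (bar (Suc n))"
  unfolding BR_def down_def by (rule functor_copy.cp_down_closed[OF BR_copy])

lemma down_up: "G \<in> gr \<Longrightarrow> x \<in> carrier (obj (bar (Suc n)) G) \<Longrightarrow>
    down n G (up n G x :: 'u::infinite) = (x :: 'g::infinite list \<Rightarrow>\<^sub>0 int)"
  unfolding up_def down_def by (rule functor_copy.cp_down_up[OF BR_copy])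

lemma up_down: "G \<in> gr \<Longrightarrow> x \<in> carrier (obj (BR n) G) \<Longrightarrow> up n G (down n G x) = x"
  unfolding up_def down_def BR_def by (rule functor_copy.cp_up_down[OF BR_copy])

definition bd_nat :: "nat \<Rightarrow> 'g monoid \<Rightarrow> ('g list \<Rightarrow>\<^sub>0 int) \<Rightarrow> ('g list \<Rightarrow>\<^sub>0 int)" where
  "bd_nat n = (\<lambda>G\<in>gr. \<lambda>w\<in>carrier (obj (bar (Suc n)) G). bd G w)"

lemma bd_nat: "bd_nat n \<in> nat_trans (bar (Suc n)) (bar n)"
  unfolding bd_nat_def
  by (rule nt_pointwise_closed[OF bar_functor bar_functor])
    (auto simp: arr_bar lmap_bar_keys bd_keys[OF gr_group] bd_map[symmetric] dest: subsetD[OF bd_keys[OF gr_group]])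

lemma bd_nat_eq: "G \<in> gr \<Longrightarrow> Poly_Mapping.keys w \<subseteq> bar_set (Suc n) G \<Longrightarrow> bd_nat n G w = bd G w"
  by (simp add: bd_nat_def)

definition br_del :: "nat \<Rightarrow> 'g::infinite monoid \<Rightarrow> 'u::infinite \<Rightarrow> 'u" where
  "br_del n = nt_comp (BR (Suc n)) (nt_comp (bar (Suc (Suc n))) (up n) (bd_nat (Suc n))) (down (Suc n))"

lemma br_del: "br_del n \<in> nat_trans (BR (Suc n)) (BR n)"
  unfolding br_del_def by (rule nt_comp_closed[OF BR_functor down nt_comp_closed[OF bar_functor bd_nat up]])

lemma br_del_up:
  assumes "(G :: 'g::infinite monoid) \<in> gr" "x \<in> carrier (obj (bar (Suc (Suc n))) G)"
  shows "br_del n G (up (Suc n) G x :: 'u::infinite) = up n G (bd G x)"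
  using assms BR_nat_closed[where 'u = 'u, OF assms] by (simp add: br_del_def nt_comp_eq down_up bd_nat_eq)

lemma BR_cases:
  assumes "G \<in> gr" "x \<in> carrier (obj (BR n) G)"
  obtains w where "w \<in> carrier (obj (bar (Suc n)) G)" "x = up n G w"
  using up_down[OF assms] nat_transD(4)[OF down assms] by metis

lemma up_inj: "G \<in> gr \<Longrightarrow> x \<in> carrier (obj (bar (Suc n)) G) \<Longrightarrow> y \<in> carrier (obj (bar (Suc n)) G) \<Longrightarrow>
    (up n G x :: 'u::infinite) = up n G y \<longleftrightarrow> x = (y :: 'g::infinite list \<Rightarrow>\<^sub>0 int)"
  by (metis down_up)

lemma eps_exists:
  "\<exists>\<epsilon>\<in>nat_trans (bar 1) (abelianization :: ('g::infinite, 'g set) gr_functor).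
     \<forall>G\<in>gr. \<forall>g\<in>carrier G. \<epsilon> G (frag_of [g]) = acl G g"
proof -
  obtain z where z: "gens 1 = [z :: 'g]" using free_rank(2)[where 'g = 'g, of 1] by (cases "gens 1 :: 'g list") auto
  have zc: "z \<in> carrier (FG 1)" using gens_carrier[where 'a = 'g, of 1] z by auto
  have "acl (FG 1) z \<in> carrier (obj abelianization (FG 1))" using zc by (simp add: carrier_abelianization del: obj_abelianization)
  from yoneda_exists[OF abelianization_functor this]
  obtain \<epsilon> where \<epsilon>: "\<epsilon> \<in> nat_trans (bar 1) abelianization" "\<epsilon> (FG 1) (frag_of (gens 1)) = acl (FG 1) z" by (rule bexE)
  have "\<epsilon> G (frag_of [g]) = acl G g" if G: "G \<in> gr" "g \<in> carrier G" for G g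
  proof -
    have "[g] \<in> bar_set 1 G" using G(2) by (simp add: bar_set_def)
    from bar_set_hom[OF G(1) this] obtain \<phi> where \<phi>: "\<phi> \<in> mor (FG 1 :: 'g monoid) G" "map \<phi> (gens 1) = [g]"
      by (rule bexE)
    show ?thesis
      using yoneda_value[OF \<epsilon>(1) G(1) \<phi>] \<epsilon>(2) \<phi>(2) z abelianization_arr_acl[OF free_rank(1) gr_group[OF G(1)] \<phi>(1) zc] by simp
  qed
  then show ?thesis using \<epsilon>(1) by blast
qed

text \<open>The homology of a free group is its abelianization in degree one and zero above. Hence the bar
  complex in positive degrees, shifted by one, is a resolution of abelianization, and its terms are
  linearizations of representable functors.\<close>

theorem bar_resolution:
  "\<exists>\<epsilon>. projective_resolution (abelianization :: ('g::infinite, 'g set) gr_functor) (BR :: nat \<Rightarrow> ('g, 'u::infinite) gr_functor) br_del \<epsilon>"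
proof -
  let ?Ab = "abelianization :: ('g, 'g set) gr_functor" and ?B = "BR :: nat \<Rightarrow> ('g, 'u) gr_functor"
  obtain \<epsilon> where \<epsilon>: "\<epsilon> \<in> nat_trans (bar 1) ?Ab" "\<And>G g. G \<in> gr \<Longrightarrow> g \<in> carrier G \<Longrightarrow> \<epsilon> G (frag_of [g]) = acl G g"
    using eps_exists by blast
  define e where "e = nt_comp (?B 0) \<epsilon> (down 0)"
  have \<epsilon>1: "\<epsilon> \<in> nat_trans (bar (Suc 0)) ?Ab" using \<epsilon>(1) by simp
  have e: "e \<in> nat_trans (?B 0) ?Ab" unfolding e_def by (rule nt_comp_closed[OF BR_functor down \<epsilon>1])
  have eu: "e G (up 0 G w) = \<epsilon> G w" if "G \<in> gr" "w \<in> carrier (obj (bar (Suc 0)) G)" for G w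
    using that BR_nat_closed[where 'u = 'u, OF that] by (simp add: e_def nt_comp_eq down_up)
  have epi: "is_epi (?B 0) ?Ab e"
    unfolding is_epi_def
  proof (intro conjI e ballI subset_antisym subsetI)
    fix G :: "'g monoid" and y assume G: "G \<in> gr" and y: "y \<in> carrier (obj ?Ab G)"
    then obtain g where g: "g \<in> carrier G" "y = acl G g" by (auto simp: carrier_abelianization simp del: obj_abelianization)
    have w: "frag_of [g] \<in> carrier (obj (bar (Suc 0)) G)" using g by (simp add: keys_frag_of bar_set_def)
    show "y \<in> e G ` carrier (obj (?B 0) G)"
      using eu[OF G w] \<epsilon>(2)[OF G g(1)] g(2) BR_nat_closed[where 'u = 'u, OF G w] by (metis image_eqI)
  qed (use nat_transD(4)[OF e] in blast)
  have ex: "exact_at (?B (Suc (Suc n))) (?B (Suc n)) F (br_del (Suc n)) \<theta>"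
    if \<theta>: "\<theta> \<in> nat_trans (?B (Suc n)) F"
      and z: "\<And>G w. G \<in> gr \<Longrightarrow> w \<in> carrier (obj (bar (Suc (Suc n))) G) \<Longrightarrow> \<theta> G (up (Suc n) G w) = \<one>\<^bsub>obj F G\<^esub> \<longleftrightarrow> bd G w = 0" for n and F :: "('g, 'w) gr_functor" and \<theta>
    unfolding exact_at_def
  proof (intro conjI br_del \<theta> ballI subset_antisym subsetI)
    fix G :: "'g monoid" and y assume G: "G \<in> gr" and "y \<in> br_del (Suc n) G ` carrier (obj (?B (Suc (Suc n))) G)"
    then obtain x where x: "x \<in> carrier (obj (?B (Suc (Suc n))) G)" "y = br_del (Suc n) G x" by auto
    obtain w where w: "w \<in> carrier (obj (bar (Suc (Suc (Suc n)))) G)" "x = up (Suc (Suc n)) G w" using BR_cases[OF G x(1)] .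
    have y: "y = up (Suc n) G (bd G w)" using br_del_up[OF G w(1)] w(2) x(2) by simp
    have "bd G w \<in> carrier (obj (bar (Suc (Suc n))) G)" using bd_keys[OF gr_group[OF G]] w(1) by simp
    then show "y \<in> kernel (obj (?B (Suc n)) G) (obj F G) (\<theta> G)"
      using z[OF G] bd_bd[OF gr_group[OF G]] w(1) BR_nat_closed[where 'u = 'u, OF G] unfolding y kernel_def by auto
  next
    fix G :: "'g monoid" and y assume G: "G \<in> gr" and y: "y \<in> kernel (obj (?B (Suc n)) G) (obj F G) (\<theta> G)"
    then have yc: "y \<in> carrier (obj (?B (Suc n)) G)" by (simp add: kernel_def)
    obtain w where w: "w \<in> carrier (obj (bar (Suc (Suc n))) G)" "y = up (Suc n) G w" using BR_cases[OF G yc] .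
    have b0: "bd G w = 0" using y z[OF G w(1)] w(2) by (simp add: kernel_def)
    obtain S where "free_basis G S" using G by (auto simp: gr_def)
    then interpret fg: free_grp G S using gr_group[OF G] by (intro free_grp.intro)
    obtain v where v: "Poly_Mapping.keys v \<subseteq> bar_set (Suc (Suc (Suc n))) G" "bd G v = w"
      using fg.bar_exact[OF _ b0, of n] w(1) by auto
    have "br_del (Suc n) G (up (Suc (Suc n)) G v) = y" using br_del_up[OF G, of v] v w(2) by simp
    moreover have "up (Suc (Suc n)) G v \<in> carrier (obj (?B (Suc (Suc n))) G)" using BR_nat_closed[where 'u = 'u, OF G] v(1) by simp
    ultimately show "y \<in> br_del (Suc n) G ` carrier (obj (?B (Suc (Suc n))) G)" by blast
  qed
  have exS: "exact_at (?B (Suc (Suc n))) (?B (Suc n)) (?B n) (br_del (Suc n)) (br_del n)" for n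
  proof (rule ex[OF br_del])
    fix G :: "'g monoid" and w assume G: "G \<in> gr" and w: "w \<in> carrier (obj (bar (Suc (Suc n))) G)"
    have b: "bd G w \<in> carrier (obj (bar (Suc n)) G)" using bd_keys[OF gr_group[OF G]] w by simp
    have 0: "0 \<in> carrier (obj (bar (Suc n)) G)" by simp
    have "up n G 0 = \<one>\<^bsub>obj (?B n) G\<^esub>" using nat_trans_one[OF bar_functor BR_functor up[where 'u = 'u, of n] G] by simp
    then show "br_del n G (up (Suc n) G w) = \<one>\<^bsub>obj (?B n) G\<^esub> \<longleftrightarrow> bd G w = 0"
      using br_del_up[OF G w] up_inj[OF G b 0] by metis
  qed
  have ex0: "exact_at (?B 1) (?B 0) ?Ab (br_del 0) e"
    unfolding exact_at_def
  proof (intro conjI ballI)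
    show "br_del 0 \<in> nat_trans (?B 1) (?B 0)" using br_del[of 0] by simp
    show "e \<in> nat_trans (?B 0) ?Ab" by (rule e)
    fix G :: "'g monoid" assume G: "G \<in> gr"
    have h: "\<epsilon> G \<in> hom (free_Abelian_group (bar_set 1 G)) (obj ?Ab G)" using mor_hom[OF nat_transD(1)[OF \<epsilon>(1) G]] by simp
    note b1 = bar_exact_1[OF gr_group[OF G] h \<epsilon>(2)[OF G]]
    show "br_del 0 G ` carrier (obj (?B 1) G) = kernel (obj (?B 0) G) (obj ?Ab G) (e G)"
    proof (intro subset_antisym subsetI)
      fix y assume "y \<in> br_del 0 G ` carrier (obj (?B 1) G)"
      then obtain x where x: "x \<in> carrier (obj (?B (Suc 0)) G)" "y = br_del 0 G x" by auto
      obtain w where w: "w \<in> carrier (obj (bar (Suc (Suc 0))) G)" "x = up (Suc 0) G w" using BR_cases[OF G x(1)] .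
      have y: "y = up 0 G (bd G w)" using br_del_up[OF G w(1)] w(2) x(2) by simp
      have b: "bd G w \<in> carrier (obj (bar (Suc 0)) G)" using bd_keys[OF gr_group[OF G]] w(1) by simp
      have "\<epsilon> G (bd G w) = \<one>\<^bsub>obj ?Ab G\<^esub>" using b1[of "bd G w"] b w(1) by (auto simp: numeral_2_eq_2 simp del: obj_abelianization)
      then show "y \<in> kernel (obj (?B 0) G) (obj ?Ab G) (e G)"
        unfolding y kernel_def using eu[OF G b] BR_nat_closed[where 'u = 'u, OF G b] by simp
    next
      fix y assume y: "y \<in> kernel (obj (?B 0) G) (obj ?Ab G) (e G)"
      then have yc: "y \<in> carrier (obj (?B 0) G)" by (simp add: kernel_def)
      obtain w where w: "w \<in> carrier (obj (bar (Suc 0)) G)" "y = up 0 G w" using BR_cases[OF G yc] .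
      have "\<epsilon> G w = \<one>\<^bsub>obj ?Ab G\<^esub>" using y eu[OF G w(1)] w(2) by (simp add: kernel_def)
      then obtain v where v: "Poly_Mapping.keys v \<subseteq> bar_set (Suc (Suc 0)) G" "bd G v = w"
        using b1[of w] w(1) by (auto simp: numeral_2_eq_2 simp del: obj_abelianization)
      have "br_del 0 G (up (Suc 0) G v) = y" using br_del_up[OF G, of v 0] v w(2) by simp
      moreover have "up (Suc 0) G v \<in> carrier (obj (?B 1) G)" using BR_nat_closed[where 'u = 'u, OF G, of v "Suc 0"] v(1) by simp
      ultimately show "y \<in> br_del 0 G ` carrier (obj (?B 1) G)" by blast
    qed
  qed
  have "projective_resolution ?Ab ?B br_del e"
    unfolding projective_resolution_def by (intro conjI allI BR_projective epi ex0 exS)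
  then show ?thesis by (rule exI[of _ e])
qed

section \<open>Homogeneous integer polynomials\<close>

text \<open>The linear extension of \<open>f\<close> to formal combinations. A form is represented by a combination of
  exponent lists, and \<open>f\<close> is the evaluation of monomials.\<close>

definition lin_eval :: "('a \<Rightarrow> int) \<Rightarrow> ('a \<Rightarrow>\<^sub>0 int) \<Rightarrow> int" where
  "lin_eval f w = (\<Sum>a\<in>Poly_Mapping.keys w. poly_mapping.lookup w a * f a)"

lemma lin_eval_superset:
  assumes "finite S" "Poly_Mapping.keys w \<subseteq> S"
  shows "lin_eval f w = (\<Sum>a\<in>S. poly_mapping.lookup w a * f a)"
  unfolding lin_eval_def using assms by (intro sum.mono_neutral_left) (auto simp: in_keys_iff)

lemma lin_eval_simps [simp]:
  "lin_eval f 0 = 0" "lin_eval f (frag_of a) = f a" "lin_eval f (v + w) = lin_eval f v + lin_eval f w"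
  "lin_eval f (v - w) = lin_eval f v - lin_eval f w" "lin_eval f (- w) = - lin_eval f w" "lin_eval f (frag_cmul k w) = k * lin_eval f w"
proof -
  let ?S = "Poly_Mapping.keys v \<union> Poly_Mapping.keys w"
  have S: "finite ?S" by simp
  show "lin_eval f 0 = 0" "lin_eval f (frag_of a) = f a" by (simp_all add: lin_eval_def)
  have v: "lin_eval f v = (\<Sum>a\<in>?S. poly_mapping.lookup v a * f a)" by (rule lin_eval_superset) auto
  have w: "lin_eval f w = (\<Sum>a\<in>?S. poly_mapping.lookup w a * f a)" by (rule lin_eval_superset) auto
  have "lin_eval f (v + w) = (\<Sum>a\<in>?S. poly_mapping.lookup (v + w) a * f a)"
    by (rule lin_eval_superset[OF S Poly_Mapping.keys_add])
  then show "lin_eval f (v + w) = lin_eval f v + lin_eval f w" unfolding v w by (simp add: lookup_add algebra_simps sum.distrib)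
  have "lin_eval f (v - w) = (\<Sum>a\<in>?S. poly_mapping.lookup (v - w) a * f a)"
    by (rule lin_eval_superset[OF S keys_diff])
  then show "lin_eval f (v - w) = lin_eval f v - lin_eval f w" unfolding v w by (simp add: lookup_minus algebra_simps sum_subtractf)
  show "lin_eval f (- w) = - lin_eval f w" by (simp add: lin_eval_def sum_negf)
  have "lin_eval f (frag_cmul k w) = (\<Sum>a\<in>Poly_Mapping.keys w. poly_mapping.lookup (frag_cmul k w) a * f a)"
    by (rule lin_eval_superset) (auto simp: in_keys_iff)
  then show "lin_eval f (frag_cmul k w) = k * lin_eval f w" by (simp add: lin_eval_def sum_distrib_left algebra_simps)
qed

lemma lin_eval_sum: "lin_eval f (\<Sum>i\<in>I. g i) = (\<Sum>i\<in>I. lin_eval f (g i))"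
  by (induction I rule: infinite_finite_induct) auto

definition exps :: "nat \<Rightarrow> nat \<Rightarrow> nat list set" where
  "exps n d = {\<alpha>. length \<alpha> = n \<and> sum_list \<alpha> = d}"

lemma finite_exps: "finite (exps n d)"
proof (rule finite_subset)
  show "exps n d \<subseteq> {\<alpha>. set \<alpha> \<subseteq> {..d} \<and> length \<alpha> = n}"
    using member_le_sum_list by (auto simp: exps_def)
qed (rule finite_lists_length_eq, simp)

fun mon :: "nat list \<Rightarrow> int list \<Rightarrow> int" where
  "mon (a # \<alpha>) (x # xs) = x ^ a * mon \<alpha> xs"
| "mon _ _ = 1"

abbreviation peval :: "(nat list \<Rightarrow>\<^sub>0 int) \<Rightarrow> int list \<Rightarrow> int" where
  "peval w xs \<equiv> lin_eval (\<lambda>\<alpha>. mon \<alpha> xs) w"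

fun digits :: "nat \<Rightarrow> nat list \<Rightarrow> nat" where
  "digits b [] = 0"
| "digits b (a # \<alpha>) = a + b * digits b \<alpha>"

fun powers :: "nat \<Rightarrow> nat \<Rightarrow> int \<Rightarrow> int list" where
  "powers b 0 x = []"
| "powers b (Suc n) x = x # powers b n (x ^ b)"

lemma length_powers [simp]: "length (powers b n x) = n"
  by (induction n arbitrary: x) auto

lemma mon_powers: "mon \<alpha> (powers b (length \<alpha>) x) = x ^ digits b \<alpha>"
  by (induction \<alpha> arbitrary: x) (simp_all add: power_add power_mult)

lemma digits_inj: "length \<alpha> = length \<beta> \<Longrightarrow> (\<And>a. a \<in> set \<alpha> \<union> set \<beta> \<Longrightarrow> a < b) \<Longrightarrow> digits b \<alpha> = digits b \<beta> \<Longrightarrow> \<alpha> = \<beta>"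
proof (induction \<alpha> \<beta> rule: list_induct2)
  case (Cons x xs y ys)
  have *: "x < b" "y < b" using Cons.prems(1) by auto
  have e: "x + b * digits b xs = y + b * digits b ys" using Cons.prems(2) by simp
  have "x = y" using arg_cong[OF e, of "\<lambda>t. t mod b"] * by simp
  moreover have "digits b xs = digits b ys" using arg_cong[OF e, of "\<lambda>t. t div b"] * by simp
  ultimately show ?case using Cons by auto
qed simp

text \<open>Substituting \<open>x\<close>, \<open>x ^ b\<close>, \<open>x ^ (b ^ 2)\<close> and so on for the variables, with \<open>b > d\<close>, sends the
  monomials of degree \<open>d\<close> to distinct powers of \<open>x\<close>, namely \<open>x\<close> to the number with the exponents
  as digits. The claim reduces to polynomials in one variable.\<close>

lemma peval_eq_0:
  assumes w: "Poly_Mapping.keys w \<subseteq> exps n d" and z: "\<And>xs. length xs = n \<Longrightarrow> peval w xs = 0"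
  shows "w = 0"
proof (rule poly_mapping_eqI)
  fix \<beta>
  let ?c = "digits (Suc d)"
  define p where "p = (\<Sum>\<alpha>\<in>Poly_Mapping.keys w. monom (poly_mapping.lookup w \<alpha>) (?c \<alpha>))"
  have "poly p x = 0" for x
  proof -
    have "poly p x = peval w (powers (Suc d) n x)"
      unfolding p_def lin_eval_def poly_sum
    proof (rule sum.cong[OF refl])
      fix \<alpha> assume "\<alpha> \<in> Poly_Mapping.keys w"
      then have "length \<alpha> = n" using w by (auto simp: exps_def)
      then show "poly (monom (poly_mapping.lookup w \<alpha>) (?c \<alpha>)) x = poly_mapping.lookup w \<alpha> * mon \<alpha> (powers (Suc d) n x)"
        using mon_powers[of \<alpha> "Suc d" x] by (simp add: poly_monom)
    qed
    then show ?thesis using z by simp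
  qed
  then have p0: "p = 0" using poly_all_0_iff_0 by blast
  show "poly_mapping.lookup w \<beta> = poly_mapping.lookup 0 \<beta>"
  proof (cases "\<beta> \<in> Poly_Mapping.keys w")
    case True
    have b: "a < Suc d" if "\<alpha> \<in> Poly_Mapping.keys w" "a \<in> set \<alpha>" for \<alpha> a
      using w that member_le_sum_list[of a \<alpha>] by (auto simp: exps_def)
    have "coeff p (?c \<beta>) = (\<Sum>\<alpha>\<in>Poly_Mapping.keys w. if \<alpha> = \<beta> then poly_mapping.lookup w \<alpha> else 0)"
      unfolding p_def coeff_sum
    proof (rule sum.cong[OF refl])
      fix \<alpha> assume \<alpha>: "\<alpha> \<in> Poly_Mapping.keys w"
      have "?c \<alpha> = ?c \<beta> \<longleftrightarrow> \<alpha> = \<beta>"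
        using digits_inj[of \<alpha> \<beta> "Suc d"] b[OF \<alpha>] b[OF True] w \<alpha> True by (auto simp: exps_def)
      then show "coeff (monom (poly_mapping.lookup w \<alpha>) (?c \<alpha>)) (?c \<beta>) = (if \<alpha> = \<beta> then poly_mapping.lookup w \<alpha> else 0)"
        by simp
    qed
    then show ?thesis using p0 True by simp
  qed (simp add: in_keys_iff)
qed

text \<open>The expansion of the monomial with exponents \<open>u @ [k] @ v\<close> after the variable with exponent \<open>k\<close>
  has been replaced by the sum of two variables.\<close>

definition split_var :: "nat list \<Rightarrow> nat \<Rightarrow> nat list \<Rightarrow> (nat list \<Rightarrow>\<^sub>0 int)" where
  "split_var u k v = (\<Sum>i\<le>k. frag_cmul (int (k choose i)) (frag_of (u @ [i, k - i] @ v)))"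

lemma mon_append: "length u = length xs \<Longrightarrow> mon (u @ v) (xs @ ys) = mon u xs * mon v ys"
  by (induction u xs rule: list_induct2) auto

lemma peval_split_var:
  assumes "length u = length xs"
  shows "peval (split_var u k v) (xs @ [x, y] @ ys) = mon (u @ [k] @ v) (xs @ [x + y] @ ys)"
  unfolding split_var_def lin_eval_sum by (simp add: mon_append[OF assms] binomial_ring sum_distrib_left sum_distrib_right algebra_simps)

lemma keys_sum_subset: "(\<And>i. i \<in> I \<Longrightarrow> Poly_Mapping.keys (g i) \<subseteq> S) \<Longrightarrow> Poly_Mapping.keys (\<Sum>i\<in>I. g i :: 'a \<Rightarrow>\<^sub>0 int) \<subseteq> S"
proof (induction I rule: infinite_finite_induct)
  case (insert i I)
  then show ?case using keys_add_subset[of "g i" S "\<Sum>i\<in>I. g i"] by simp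
qed simp_all

lemma split_var_keys: "length u + length v + 2 = n \<Longrightarrow> sum_list u + k + sum_list v = d \<Longrightarrow> Poly_Mapping.keys (split_var u k v) \<subseteq> exps n d"
  unfolding split_var_def by (rule keys_sum_subset) (auto simp: exps_def keys_cmul dest!: subsetD[OF keys_cmul])

lemma lookup_frag_of: "poly_mapping.lookup (frag_of a) b = (if a = b then 1 else 0)"
  by (simp add: lookup_single)

lemma lookup_sum: "poly_mapping.lookup (\<Sum>i\<in>I. g i :: 'a \<Rightarrow>\<^sub>0 int) b = (\<Sum>i\<in>I. poly_mapping.lookup (g i) b)"
  by (induction I rule: infinite_finite_induct) (simp_all add: lookup_add)

lemma lookup_split_var:
  "poly_mapping.lookup (split_var u k v) (u' @ [a, b] @ v')
    = int (a + b choose a) * poly_mapping.lookup (frag_of (u @ [k] @ v)) (u' @ [a + b] @ v')" if "length u = length u'"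
proof -
  have "poly_mapping.lookup (split_var u k v) (u' @ [a, b] @ v') =
     (\<Sum>i\<le>k. if i = a then (if u = u' \<and> v = v' \<and> k = a + b then int (k choose a) else 0) else 0)"
    unfolding split_var_def lookup_sum using that by (intro sum.cong) (auto simp: lookup_frag_of)
  also have "\<dots> = (if u = u' \<and> v = v' \<and> k = a + b then int (k choose a) else 0)"
    by (simp add: sum.delta)
  finally show ?thesis using that by (auto simp: lookup_frag_of)
qed

definition arr2 :: "(nat list \<Rightarrow>\<^sub>0 int) \<Rightarrow> nat \<Rightarrow> nat \<Rightarrow> int" where
  "arr2 w a b = poly_mapping.lookup w [a, b]"

definition arr3 :: "(nat list \<Rightarrow>\<^sub>0 int) \<Rightarrow> nat \<Rightarrow> nat \<Rightarrow> nat \<Rightarrow> int" where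
  "arr3 w a b c = poly_mapping.lookup w [a, b, c]"

text \<open>The coboundary of a form. Coefficientwise it is \<open>cob2\<close>, on values it is the coboundary of the
  additive group of integers; these two descriptions link arithmetic and functors.\<close>

definition poly_cob2 :: "(nat list \<Rightarrow>\<^sub>0 int) \<Rightarrow> (nat list \<Rightarrow>\<^sub>0 int)" where
  "poly_cob2 = frag_extend (\<lambda>\<alpha>. frag_of (0 # \<alpha>) - split_var [] (\<alpha>!0) [\<alpha>!1] + split_var [\<alpha>!0] (\<alpha>!1) [] - frag_of (\<alpha> @ [0]))"

definition poly_cob3 :: "(nat list \<Rightarrow>\<^sub>0 int) \<Rightarrow> (nat list \<Rightarrow>\<^sub>0 int)" where
  "poly_cob3 = frag_extend (\<lambda>\<alpha>. frag_of (0 # \<alpha>) - split_var [] (\<alpha>!0) [\<alpha>!1, \<alpha>!2] + split_var [\<alpha>!0] (\<alpha>!1) [\<alpha>!2]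
     - split_var [\<alpha>!0, \<alpha>!1] (\<alpha>!2) [] + frag_of (\<alpha> @ [0]))"

lemma exps2_cases: "\<alpha> \<in> exps 2 d \<Longrightarrow> (\<And>k l. \<alpha> = [k, l] \<Longrightarrow> k + l = d \<Longrightarrow> thesis) \<Longrightarrow> thesis"
  by (cases \<alpha>; cases "tl \<alpha>"; auto simp: exps_def)

lemma exps3_cases: "\<alpha> \<in> exps 3 d \<Longrightarrow> (\<And>j k l. \<alpha> = [j, k, l] \<Longrightarrow> j + k + l = d \<Longrightarrow> thesis) \<Longrightarrow> thesis"
  by (cases \<alpha>; cases "tl \<alpha>"; cases "tl (tl \<alpha>)"; auto simp: exps_def numeral_3_eq_3)

lemma poly_cob2_keys: "Poly_Mapping.keys w \<subseteq> exps 2 d \<Longrightarrow> Poly_Mapping.keys (poly_cob2 w) \<subseteq> exps 3 d"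
  unfolding poly_cob2_def
proof (rule frag_extend_closed)
  fix \<alpha> assume "\<alpha> \<in> exps 2 d"
  then obtain k l where a: "\<alpha> = [k, l]" "k + l = d" by (rule exps2_cases)
  show "Poly_Mapping.keys (frag_of (0 # \<alpha>) - split_var [] (\<alpha>!0) [\<alpha>!1] + split_var [\<alpha>!0] (\<alpha>!1) [] - frag_of (\<alpha> @ [0])) \<subseteq> exps 3 d"
    by (intro keys_diff_subset keys_add_subset split_var_keys) (use a in \<open>auto simp: exps_def keys_frag_of\<close>)
qed

lemma poly_cob3_keys: "Poly_Mapping.keys w \<subseteq> exps 3 d \<Longrightarrow> Poly_Mapping.keys (poly_cob3 w) \<subseteq> exps 4 d"
  unfolding poly_cob3_def
proof (rule frag_extend_closed)
  fix \<alpha> assume "\<alpha> \<in> exps 3 d"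
  then obtain j k l where a: "\<alpha> = [j, k, l]" "j + k + l = d" by (rule exps3_cases)
  show "Poly_Mapping.keys (frag_of (0 # \<alpha>) - split_var [] (\<alpha>!0) [\<alpha>!1, \<alpha>!2] + split_var [\<alpha>!0] (\<alpha>!1) [\<alpha>!2]
     - split_var [\<alpha>!0, \<alpha>!1] (\<alpha>!2) [] + frag_of (\<alpha> @ [0])) \<subseteq> exps 4 d"
    by (intro keys_diff_subset keys_add_subset split_var_keys) (use a in \<open>auto simp: exps_def keys_frag_of\<close>)
qed

lemma peval_poly_cob2:
  assumes "Poly_Mapping.keys w \<subseteq> exps 2 d"
  shows "peval (poly_cob2 w) [x, y, z] = peval w [y, z] - peval w [x + y, z] + peval w [x, y + z] - peval w [x, y]"
  using assms
proof (induction w rule: frag_induction)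
  case (one \<alpha>)
  then obtain k l where a: "\<alpha> = [k, l]" "k + l = d" by (rule exps2_cases)
  show ?case
    using peval_split_var[of "[]" "[]" x y "[z]" k "[l]"] peval_split_var[of "[k]" "[x]" y z "[]" l "[]"] by (simp add: poly_cob2_def a(1))
qed (simp_all add: poly_cob2_def frag_extend_diff)

lemma peval_poly_cob3:
  assumes "Poly_Mapping.keys w \<subseteq> exps 3 d"
  shows "peval (poly_cob3 w) [t, x, y, z] = peval w [x, y, z] - peval w [t + x, y, z] + peval w [t, x + y, z]
     - peval w [t, x, y + z] + peval w [t, x, y]"
  using assms
proof (induction w rule: frag_induction)
  case (one \<alpha>)
  then obtain j k l where a: "\<alpha> = [j, k, l]" "j + k + l = d" by (rule exps3_cases)
  show ?case
    using peval_split_var[of "[]" "[]" t x "[y, z]" j "[k, l]"] peval_split_var[of "[j]" "[t]" x y "[z]" k "[l]"]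
      peval_split_var[of "[j, k]" "[t, x]" y z "[]" l "[]"] by (simp add: poly_cob3_def a(1))
qed (simp_all add: poly_cob3_def frag_extend_diff)

lemma poly_cob_diff [simp]: "poly_cob2 (v - w) = poly_cob2 v - poly_cob2 w" "poly_cob3 (v - w) = poly_cob3 v - poly_cob3 w"
  by (simp_all add: poly_cob2_def poly_cob3_def frag_extend_diff)

lemma arr_diff: "arr2 (v - w) = (\<lambda>a b. arr2 v a b - arr2 w a b)" "arr3 (v - w) = (\<lambda>a b c. arr3 v a b c - arr3 w a b c)"
  by (simp_all add: arr2_def arr3_def lookup_minus fun_eq_iff)

lemma arr3_poly_cob2:
  assumes "Poly_Mapping.keys w \<subseteq> exps 2 d"
  shows "arr3 (poly_cob2 w) a b c = cob2 (arr2 w) a b c"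
  using assms
proof (induction w rule: frag_induction)
  case (one \<alpha>)
  then obtain k l where \<alpha>: "\<alpha> = [k, l]" "k + l = d" by (rule exps2_cases)
  show ?case
    using lookup_split_var[of "[]" "[]" k "[l]" a b "[c]"] lookup_split_var[of "[k]" "[a]" l "[]" b c "[]"]
    by (simp add: poly_cob2_def \<alpha>(1) arr3_def arr2_def cob2_def lookup_add lookup_minus lookup_frag_of)
next
  case (diff v w)
  then show ?case by (simp add: arr_diff cob2_diff)
qed (simp add: poly_cob2_def arr3_def arr2_def cob2_def)

lemma lookup_poly_cob3:
  assumes "Poly_Mapping.keys w \<subseteq> exps 3 d"
  shows "poly_mapping.lookup (poly_cob3 w) [a, b, c, e] = cob3 (arr3 w) a b c e"
  using assms
proof (induction w rule: frag_induction)
  case (one \<alpha>)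
  then obtain j k l where \<alpha>: "\<alpha> = [j, k, l]" "j + k + l = d" by (rule exps3_cases)
  show ?case
    using lookup_split_var[of "[]" "[]" j "[k, l]" a b "[c, e]"] lookup_split_var[of "[j]" "[a]" k "[l]" b c "[e]"]
      lookup_split_var[of "[j, k]" "[a, b]" l "[]" c e "[]"]
    by (simp add: poly_cob3_def \<alpha>(1) arr3_def cob3_def lookup_add lookup_minus lookup_frag_of)
next
  case (diff v w)
  then show ?case by (simp add: arr_diff cob3_diff lookup_minus)
qed (simp add: poly_cob3_def arr3_def cob3_def)

definition of_fun :: "nat \<Rightarrow> nat \<Rightarrow> (nat list \<Rightarrow> int) \<Rightarrow> (nat list \<Rightarrow>\<^sub>0 int)" where
  "of_fun n d f = (\<Sum>\<alpha>\<in>exps n d. frag_cmul (f \<alpha>) (frag_of \<alpha>))"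

lemma lookup_of_fun: "poly_mapping.lookup (of_fun n d f) \<alpha> = (if \<alpha> \<in> exps n d then f \<alpha> else 0)"
  using finite_exps[of n d] by (simp add: of_fun_def lookup_sum lookup_frag_of if_distrib cong: if_cong)

lemma of_fun_keys: "Poly_Mapping.keys (of_fun n d f) \<subseteq> exps n d"
  by (auto simp: in_keys_iff lookup_of_fun split: if_splits)

lemma wt3_arr3: "Poly_Mapping.keys w \<subseteq> exps 3 d \<Longrightarrow> wt3 d (arr3 w)"
  by (auto simp: wt3_def arr3_def exps_def in_keys_iff subset_iff)

lemma frag_of_arr3:
  assumes "wt3 d f"
  shows "\<exists>w. Poly_Mapping.keys w \<subseteq> exps 3 d \<and> arr3 w = f"
proof (intro exI conjI ext)
  let ?w = "of_fun 3 d (\<lambda>\<alpha>. f (\<alpha>!0) (\<alpha>!1) (\<alpha>!2))"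
  show "Poly_Mapping.keys ?w \<subseteq> exps 3 d" by (rule of_fun_keys)
  show "arr3 ?w a b c = f a b c" for a b c using assms by (simp add: arr3_def lookup_of_fun exps_def wt3_def add.assoc)
qed

lemma frag_of_arr2:
  assumes "wt2 d g"
  shows "\<exists>w. Poly_Mapping.keys w \<subseteq> exps 2 d \<and> arr2 w = g"
proof (intro exI conjI ext)
  let ?w = "of_fun 2 d (\<lambda>\<alpha>. g (\<alpha>!0) (\<alpha>!1))"
  show "Poly_Mapping.keys ?w \<subseteq> exps 2 d" by (rule of_fun_keys)
  show "arr2 ?w a b = g a b" for a b using assms by (simp add: arr2_def lookup_of_fun exps_def wt2_def)
qed

lemma arr3_inj:
  assumes "Poly_Mapping.keys v \<subseteq> exps 3 d" "Poly_Mapping.keys w \<subseteq> exps 3 d" "\<And>a b c. arr3 v a b c = arr3 w a b c"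
  shows "v = w"
proof (rule poly_mapping_eqI)
  fix \<alpha>
  show "poly_mapping.lookup v \<alpha> = poly_mapping.lookup w \<alpha>"
  proof (cases "\<alpha> \<in> exps 3 d")
    case True
    then obtain j k l where "\<alpha> = [j, k, l]" by (rule exps3_cases)
    then show ?thesis using assms(3)[of j k l] by (simp add: arr3_def)
  next
    case False
    then have "\<alpha> \<notin> Poly_Mapping.keys v" "\<alpha> \<notin> Poly_Mapping.keys w" using assms(1,2) by auto
    then show ?thesis by (simp add: in_keys_iff)
  qed
qed

section \<open>Symmetric powers of abelianized free groups\<close>

text \<open>The list of variables with multiplicities, in order, of the monomial with the given exponents.\<close>

definition var_list :: "nat list \<Rightarrow> nat list" where
  "var_list \<alpha> = concat (map (\<lambda>i. replicate (\<alpha> ! i) i) [0..<length \<alpha>])"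

lemma mset_var_list: "count (mset (var_list \<alpha>)) j = (if j < length \<alpha> then \<alpha> ! j else 0)"
proof -
  have *: "count (mset (concat xss)) j = (\<Sum>xs\<leftarrow>xss. count (mset xs) j)" for xss :: "nat list list"
    by (induction xss) auto
  have "count (mset (var_list \<alpha>)) j = (\<Sum>i\<leftarrow>[0..<length \<alpha>]. if i = j then \<alpha> ! j else 0)"
    unfolding var_list_def * map_map by (intro arg_cong[where f = sum_list] map_cong) auto
  also have "\<dots> = (\<Sum>i\<in>{0..<length \<alpha>}. if i = j then \<alpha> ! j else 0)"
    by (simp only: interv_sum_list_conv_sum_set_nat set_upt)
  also have "\<dots> = (if j < length \<alpha> then \<alpha> ! j else 0)"
    by (simp add: sum.delta)
  finally show ?thesis .
qed

lemma length_var_list: "length (var_list \<alpha>) = sum_list \<alpha>"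
proof -
  have "length (var_list \<alpha>) = (\<Sum>i\<leftarrow>[0..<length \<alpha>]. \<alpha> ! i)" by (simp add: var_list_def length_concat comp_def)
  also have "\<dots> = sum_list \<alpha>" by (simp add: map_nth)
  finally show ?thesis .
qed

lemma set_var_list: "set (var_list \<alpha>) \<subseteq> {..<length \<alpha>}"
  by (auto simp: var_list_def)

lemma mon_eq_prod: "length \<alpha> = length xs \<Longrightarrow> mon \<alpha> xs = (\<Prod>i<length \<alpha>. xs ! i ^ \<alpha> ! i)"
  by (induction \<alpha> xs rule: list_induct2) (simp_all add: prod.lessThan_Suc_shift del: prod.lessThan_Suc)

lemma prod_var_list:
  assumes "length \<alpha> = length xs"
  shows "prod_list (map (\<lambda>i. xs ! i) (var_list \<alpha>)) = mon \<alpha> xs"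
proof -
  have "prod_list (map f (concat xss)) = (\<Prod>ys\<leftarrow>xss. prod_list (map f ys))" for f :: "nat \<Rightarrow> int" and xss
    by (induction xss) auto
  then have "prod_list (map (\<lambda>i. xs ! i) (var_list \<alpha>)) = (\<Prod>i\<leftarrow>[0..<length \<alpha>]. xs ! i ^ \<alpha> ! i)"
    by (simp add: var_list_def comp_def map_replicate)
  also have "\<dots> = (\<Prod>i\<in>{0..<length \<alpha>}. xs ! i ^ \<alpha> ! i)"
    by (subst prod.distinct_set_conv_list[symmetric]) auto
  finally show ?thesis using mon_eq_prod[OF assms] by (simp add: atLeast0LessThan)
qed

abbreviation abl :: "nat \<Rightarrow> 'g::infinite set monoid" where
  "abl n \<equiv> obj abelianization (FG n)"

definition gen_power :: "int \<Rightarrow> 'g::infinite" where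
  "gen_power k = (gens 1 ! 0) [^]\<^bsub>FG 1\<^esub> k"

lemma gen1_carrier: "(gens 1 ! 0 :: 'g::infinite) \<in> carrier (FG 1)"
  using gens_carrier[where 'a = 'g, of 1] free_rank(2)[where 'g = 'g, of 1] by (cases "gens 1 :: 'g list") auto

lemma gen_power_hom: "(gen_power :: int \<Rightarrow> 'g::infinite) \<in> mor integer_group (FG 1)"
  using group.hom_integer_group_pow[OF free_rank(1) gen1_carrier] by (simp add: mor_def gen_power_def[abs_def] extensional_def)

lemma gen_power_carrier: "gen_power k \<in> carrier (FG 1)"
  by (rule mor_closed[OF gen_power_hom]) simp

lemma abl_comm: "comm_group (abl n :: 'g::infinite set monoid)"
  by (rule is_functorD(1)[OF abelianization_functor FG_gr])

lemma acl_closed: "group G \<Longrightarrow> x \<in> carrier G \<Longrightarrow> acl G x \<in> carrier (obj abelianization G)"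
  by (rule hom_in_carrier[OF acl_hom])

lemma degree_exists: "\<exists>e \<in> hom (abl 1 :: 'g::infinite set monoid) integer_group. \<forall>k. e (acl (FG 1) (gen_power k)) = k"
proof -
  let ?Z = "FG 1 :: 'g monoid"
  have gZ: "group ?Z" by (rule free_rank(1))
  obtain f where f: "f \<in> mor ?Z integer_group" "map f (gens 1) = [1]"
    using FG_hom_exists[where 'g = 'g, OF group_integer_group, of "[1]" 1] by (auto simp del: mult_integer_group)
  interpret f: group_hom ?Z integer_group f
    using mor_hom[OF f(1)] gZ by (simp add: group_hom_def group_hom_axioms_def)
  have "f (gens 1 ! 0) = 1" using f(2) by (cases "gens 1 :: 'g list") auto
  then have gen_power: "f (gen_power k) = k" for k
    unfolding gen_power_def using f.hom_int_pow[OF gen1_carrier, of k] by simp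
  have "f ` derived ?Z (carrier ?Z) \<subseteq> {0}"
    unfolding derived_def
  proof (rule hom_generate_subset[OF gZ group_integer_group mor_hom[OF f(1)]])
    show "subgroup {0} integer_group" using group.triv_subgroup[OF group_integer_group] by simp
    show "derived_set ?Z (carrier ?Z) \<subseteq> carrier ?Z" by (auto simp del: One_nat_def)
    show "f x \<in> {0}" if "x \<in> derived_set ?Z (carrier ?Z)" for x using that by (auto simp del: One_nat_def)
  qed
  then have "derived ?Z (carrier ?Z) \<subseteq> kernel ?Z integer_group f"
    using normal_imp_subgroup[OF derived_normal[OF gZ]] by (auto simp: kernel_def dest: subgroup.mem_carrier)
  from f.FactGroup_universal_kernel[OF derived_normal[OF gZ] this]
  obtain e where e: "e \<in> hom (?Z Mod derived ?Z (carrier ?Z)) integer_group"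
    "\<And>x. x \<in> carrier ?Z \<Longrightarrow> e (derived ?Z (carrier ?Z) #>\<^bsub>?Z\<^esub> x) = f x" by blast
  have "e (acl ?Z (gen_power k)) = k" for k unfolding acl_def using e(2)[OF gen_power_carrier] gen_power by simp
  then show ?thesis using e(1) unfolding obj_abelianization by blast
qed

lemma theta_exists:
  "\<exists>\<theta> \<in> hom (sym_power d (abl 1 :: 'g::infinite set monoid)) integer_group.
     \<forall>ks. length ks = d \<longrightarrow> \<theta> (scl d (abl 1) (frag_of (map (\<lambda>k. acl (FG 1) (gen_power k)) ks))) = prod_list ks"
proof -
  let ?A = "abl 1 :: 'g set monoid"
  obtain e where e: "e \<in> hom ?A integer_group" "\<And>k. e (acl (FG 1) (gen_power k)) = k" using degree_exists[where 'g = 'g] by blast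
  interpret sy: sym_pow d ?A by (rule sym_pow.intro[OF abl_comm])
  let ?h = "lin_eval (\<lambda>ts. prod_list (map e ts))"
  have h: "?h \<in> hom (tfree d ?A) integer_group" by (rule homI) simp_all
  have upd: "prod_list (map e (xs[i := x])) = prod_list (map e (take i xs)) * (e x * prod_list (map e (drop (Suc i) xs)))"
    if "i < length xs" for xs i x
    using that by (simp add: upd_conv_take_nth_drop)
  have rel: "?h w = \<one>\<^bsub>integer_group\<^esub>" if "w \<in> trel_gens d ?A" for w
  proof -
    from that obtain xs i x y where w: "w = frag_of (xs[i := x \<otimes>\<^bsub>?A\<^esub> y]) - frag_of (xs[i := x]) - frag_of (xs[i := y])"
      and *: "xs \<in> pure_tensors d ?A" "i < d" "x \<in> carrier ?A" "y \<in> carrier ?A" unfolding trel_gens_def by blast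
    have l: "i < length xs" using * by (simp add: pure_tensors_def)
    have "e (x \<otimes>\<^bsub>?A\<^esub> y) = e x + e y" using hom_mult[OF e(1) *(3,4)] by simp
    then show ?thesis unfolding w using upd[OF l] by (simp add: algebra_simps del: obj_abelianization)
  qed
  have perm: "?h (frag_of (permute_list \<sigma> xs)) = ?h (frag_of xs)" if "\<sigma> permutes {..<d}" "xs \<in> pure_tensors d ?A" for \<sigma> xs
  proof -
    have "mset (permute_list \<sigma> xs) = mset xs" using that by (intro mset_permute_list) (simp add: pure_tensors_def)
    then have "prod_mset (image_mset e (mset (permute_list \<sigma> xs))) = prod_mset (image_mset e (mset xs))" by simp
    then show ?thesis by (simp add: prod_mset_prod_list flip: mset_map)
  qed
  obtain \<theta> where \<theta>: "\<theta> \<in> hom (sym_power d ?A) integer_group" "\<And>w. w \<in> carrier (tfree d ?A) \<Longrightarrow> \<theta> (scl d ?A w) = ?h w"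
  proof (rule sy.sym_power_universal[OF abelian_integer_group h])
    show "?h w = \<one>\<^bsub>integer_group\<^esub>" if "w \<in> trel_gens d ?A" for w by (rule rel[OF that])
    show "?h (frag_of (permute_list \<sigma> xs)) = ?h (frag_of xs)" if "\<sigma> permutes {..<d}" "xs \<in> pure_tensors d ?A" for \<sigma> xs
      by (rule perm[OF that])
  qed (rule that)
  have "\<theta> (scl d ?A (frag_of (map (\<lambda>k. acl (FG 1) (gen_power k)) ks))) = prod_list ks" if "length ks = d" for ks
  proof -
    have "map (\<lambda>k. acl (FG 1) (gen_power k)) ks \<in> pure_tensors d ?A"
      using that acl_closed[OF free_rank(1) gen_power_carrier] by (auto simp: pure_tensors_def simp del: obj_abelianization)
    then have "frag_of (map (\<lambda>k. acl (FG 1) (gen_power k)) ks) \<in> carrier (tfree d ?A)" by (simp add: keys_frag_of del: obj_abelianization)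
    then show ?thesis using \<theta>(2) e(2) by (simp add: comp_def del: obj_abelianization carrier_free_Abelian_group_iff)
  qed
  then show ?thesis using \<theta>(1) by blast
qed

text \<open>The abelianization of the free group of rank one is infinite cyclic. Multiplying the degrees of
  the factors identifies its symmetric power with the integers; this is what turns the value of a
  transformation at a tuple of powers of the generator into a number.\<close>

definition theta :: "nat \<Rightarrow> ('g::infinite set list \<Rightarrow>\<^sub>0 int) set set \<Rightarrow> int" where
  "theta d = (SOME \<theta>. \<theta> \<in> hom (sym_power d (abl 1)) integer_group \<and>
     (\<forall>ks. length ks = d \<longrightarrow> \<theta> (scl d (abl 1) (frag_of (map (\<lambda>k. acl (FG 1) (gen_power k)) ks))) = prod_list ks))"

lemma theta:
  "theta d \<in> hom (sym_power d (abl 1 :: 'g::infinite set monoid)) integer_group"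
  "length ks = d \<Longrightarrow> theta d (scl d (abl 1 :: 'g set monoid) (frag_of (map (\<lambda>k. acl (FG 1) (gen_power k)) ks))) = prod_list ks"
proof -
  have "theta d \<in> hom (sym_power d (abl 1 :: 'g set monoid)) integer_group \<and>
     (\<forall>ks. length ks = d \<longrightarrow> theta d (scl d (abl 1 :: 'g set monoid) (frag_of (map (\<lambda>k. acl (FG 1) (gen_power k)) ks))) = prod_list ks)"
    unfolding theta_def by (rule someI_ex[OF theta_exists[where 'g = 'g, of d, unfolded Bex_def]])
  then show "theta d \<in> hom (sym_power d (abl 1 :: 'g::infinite set monoid)) integer_group"
    "length ks = d \<Longrightarrow> theta d (scl d (abl 1 :: 'g set monoid) (frag_of (map (\<lambda>k. acl (FG 1) (gen_power k)) ks))) = prod_list ks"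
    by auto
qed

definition gen_class :: "nat \<Rightarrow> nat \<Rightarrow> 'g::infinite set" where
  "gen_class n i = acl (FG n) (gens n ! i)"

text \<open>The element of the symmetric power that a form of degree \<open>d\<close> in \<open>n\<close> variables stands for: the
  variables become the classes of the free generators.\<close>

definition sym_of_poly :: "nat \<Rightarrow> nat \<Rightarrow> (nat list \<Rightarrow>\<^sub>0 int) \<Rightarrow> ('g::infinite set list \<Rightarrow>\<^sub>0 int) set set" where
  "sym_of_poly n d w = scl d (abl n) (lmap (\<lambda>\<alpha>. map (gen_class n) (var_list \<alpha>)) w)"

lemma gens_nth_carrier: "i < n \<Longrightarrow> (gens n ! i :: 'g::infinite) \<in> carrier (FG n)"
  by (rule subsetD[OF gens_carrier nth_mem]) (simp add: free_rank(2)[where 'g = 'g, of n])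

lemma gen_class_carrier: "i < n \<Longrightarrow> (gen_class n i :: 'g::infinite set) \<in> carrier (abl n)"
  unfolding gen_class_def by (rule acl_closed[OF free_rank(1) gens_nth_carrier])

lemma var_list_pure: "\<alpha> \<in> exps n d \<Longrightarrow> map (gen_class n :: nat \<Rightarrow> 'g::infinite set) (var_list \<alpha>) \<in> pure_tensors d (abl n)"
  using set_var_list[of \<alpha>] gen_class_carrier[where 'g = 'g and n = n] by (auto simp: pure_tensors_def exps_def length_var_list simp del: obj_abelianization)

lemma sym_of_poly_arg_keys:
  "Poly_Mapping.keys w \<subseteq> exps n d \<Longrightarrow> lmap (\<lambda>\<alpha>. map (gen_class n :: nat \<Rightarrow> 'g::infinite set) (var_list \<alpha>)) w \<in> carrier (tfree d (abl n))"
  unfolding carrier_free_Abelian_group_iff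
  by (rule frag_extend_closed[of "exps n d"]) (simp_all add: keys_frag_of var_list_pure del: obj_abelianization)

lemma sym_of_poly_closed: "Poly_Mapping.keys w \<subseteq> exps n d \<Longrightarrow> (sym_of_poly n d w :: ('g::infinite set list \<Rightarrow>\<^sub>0 int) set set) \<in> carrier (sym_power d (abl n))"
  unfolding sym_of_poly_def by (rule hom_in_carrier[OF sym_pow.scl_hom[OF sym_pow.intro[OF abl_comm]] sym_of_poly_arg_keys])

lemma generate_gens: "generate (FG n) (set (gens n)) = carrier (FG n :: 'g::infinite monoid)"
proof
  let ?G = "FG n :: 'g monoid" and ?S = "set (gens n :: 'g list)"
  interpret G: group ?G by (rule free_rank(1))
  have S: "?S \<subseteq> carrier ?G" by (rule gens_carrier)
  show "generate ?G ?S \<subseteq> carrier ?G" by (rule G.generate_incl[OF S])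
  have "word_val ?G w \<in> generate ?G ?S" if "snd ` set w \<subseteq> ?S" for w
    using that
  proof (induction w)
    case (Cons a w)
    obtain b x where a: "a = (b, x)" by (cases a)
    have "(if b then x else inv\<^bsub>?G\<^esub> x) \<in> generate ?G ?S" using Cons.prems a by (auto intro: generate.incl generate.inv)
    then show ?case using Cons unfolding a word_val_Cons by (intro generate.eng) auto
  qed (simp add: generate.one)
  then show "carrier ?G \<subseteq> generate ?G ?S" using word_for[OF free_rank(4)[where 'g = 'g, of n]] by (metis subsetI)
qed

text \<open>Suppose that the factors of a pure tensor after position \<open>k\<close> are classes of generators. The class is
  additive in the factor at \<open>k\<close>, so the elements that may stand there form a subgroup, and it
  suffices to treat generators. In the end all factors are classes of generators, and such a tensor
  agrees, up to a permutation, with the one attached to its exponents.\<close>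

lemma sym_of_poly_onto:
  fixes y :: "('g::infinite set list \<Rightarrow>\<^sub>0 int) set set"
  assumes y: "y \<in> carrier (sym_power d (abl n))"
  shows "\<exists>w. Poly_Mapping.keys w \<subseteq> exps n d \<and> y = sym_of_poly n d w"
proof -
  let ?A = "abl n :: 'g set monoid" and ?g = "gen_class n :: nat \<Rightarrow> 'g set" and ?G = "FG n :: 'g monoid"
  interpret sy: sym_pow d ?A by (rule sym_pow.intro[OF abl_comm])
  interpret P: comm_group "sym_power d ?A" by (rule sy.sym_power_comm)
  have gA: "group ?A" by (rule comm_group_group[OF abl_comm])
  define S :: "('g set list \<Rightarrow>\<^sub>0 int) set set set" where "S = sym_of_poly n d ` {w. Poly_Mapping.keys w \<subseteq> exps n d}"
  have sc: "w \<in> carrier (tfree d ?A) \<Longrightarrow> scl d ?A w \<in> carrier (sym_power d ?A)" for w by (rule hom_in_carrier[OF sy.scl_hom])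
  have "sym_of_poly n d \<in> hom (free_Abelian_group (exps n d)) (sym_power d ?A)"
  proof (rule homI)
    fix v w assume "v \<in> carrier (free_Abelian_group (exps n d))" "w \<in> carrier (free_Abelian_group (exps n d))"
    then have k: "Poly_Mapping.keys v \<subseteq> exps n d" "Poly_Mapping.keys w \<subseteq> exps n d" by simp_all
    show "sym_of_poly n d v \<in> carrier (sym_power d ?A)" by (rule sym_of_poly_closed[OF k(1)])
    show "(sym_of_poly n d (v \<otimes>\<^bsub>free_Abelian_group (exps n d)\<^esub> w) :: ('g set list \<Rightarrow>\<^sub>0 int) set set) = sym_of_poly n d v \<otimes>\<^bsub>sym_power d ?A\<^esub> sym_of_poly n d w"
      unfolding sym_of_poly_def using hom_mult[OF sy.scl_hom sym_of_poly_arg_keys[OF k(1)] sym_of_poly_arg_keys[OF k(2)]] by (simp add: frag_extend_add)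
  qed
  then interpret H: group_hom "free_Abelian_group (exps n d)" "sym_power d ?A" "sym_of_poly n d"
    by (intro group_hom.intro group_hom_axioms.intro group_free_Abelian_group P.is_group)
  have fc: "carrier (free_Abelian_group (exps n d)) = {w. Poly_Mapping.keys w \<subseteq> exps n d}" by auto
  have S: "subgroup S (sym_power d ?A)" using H.img_is_subgroup unfolding S_def fc .
  have base: "scl d ?A (frag_of (map ?g is)) \<in> S" if l: "length is = d" "set is \<subseteq> {..<n}" for "is"
  proof -
    let ?\<alpha> = "map (count (mset is)) [0..<n]"
    have "sum_list ?\<alpha> = (\<Sum>i\<in>{0..<n}. count (mset is) i)" by (simp only: interv_sum_list_conv_sum_set_nat set_upt)
    also have "\<dots> = (\<Sum>i\<in>set is. count (mset is) i)" using l(2) by (intro sum.mono_neutral_right) (auto simp: not_in_iff[symmetric])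
    also have "\<dots> = d" using size_multiset_overloaded_eq[of "mset is"] l(1) by simp
    finally have E: "?\<alpha> \<in> exps n d" by (simp add: exps_def)
    have "mset (var_list ?\<alpha>) = mset is"
    proof (rule multiset_eqI)
      fix j show "count (mset (var_list ?\<alpha>)) j = count (mset is) j"
        using l(2) by (auto simp: mset_var_list not_in_iff[symmetric])
    qed
    then have "mset (map ?g (var_list ?\<alpha>)) = mset (map ?g is)" by (simp add: mset_map)
    obtain \<sigma> where \<sigma>: "\<sigma> permutes {..<length (map ?g is)}" "permute_list \<sigma> (map ?g is) = map ?g (var_list ?\<alpha>)"
      by (rule mset_eq_permutation[OF \<open>mset (map ?g (var_list ?\<alpha>)) = mset (map ?g is)\<close>])
    have s: "\<sigma> permutes {..<d}" using \<sigma>(1) l(1) by simp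
    have "map ?g is \<in> pure_tensors d ?A"
      using l gen_class_carrier[where 'g = 'g and n = n] by (auto simp: pure_tensors_def simp del: obj_abelianization)
    then have c: "frag_of (map ?g is) \<in> carrier (tfree d ?A)" by (simp add: keys_frag_of del: obj_abelianization)
    have "scl d ?A (frag_of (map ?g is)) = sym_of_poly n d (frag_of ?\<alpha>)"
      using sy.scl_permute[OF s c] by (simp add: sym_of_poly_def \<sigma>(2) del: obj_abelianization)
    then show ?thesis unfolding S_def using E by (intro image_eqI[of _ _ "frag_of ?\<alpha>"]) (simp_all add: keys_frag_of)
  qed
  have step: "\<forall>ts\<in>pure_tensors d ?A. (\<forall>j. k \<le> j \<and> j < d \<longrightarrow> ts ! j \<in> ?g ` {..<n}) \<longrightarrow> scl d ?A (frag_of ts) \<in> S" if "k \<le> d" for k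
    using that
  proof (induction k)
    case 0
    show ?case
    proof (intro ballI impI)
      fix ts assume ts: "ts \<in> pure_tensors d ?A" and g: "\<forall>j. 0 \<le> j \<and> j < d \<longrightarrow> ts ! j \<in> ?g ` {..<n}"
      have l: "length ts = d" using ts by (simp add: pure_tensors_def)
      have "\<forall>j. \<exists>i. j < d \<longrightarrow> i < n \<and> ts ! j = gen_class n i" using g by auto
      then obtain f where f: "\<And>j. j < d \<Longrightarrow> f j < n \<and> ts ! j = gen_class n (f j)" by metis
      have "ts = map ?g (map f [0..<d])" using l f by (intro nth_equalityI) auto
      moreover have "scl d ?A (frag_of (map ?g (map f [0..<d]))) \<in> S" using f by (intro base) auto
      ultimately show "scl d ?A (frag_of ts) \<in> S" by simp
    qed
  next
    case (Suc k)
    show ?case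
    proof (intro ballI impI)
      fix ts assume ts: "ts \<in> pure_tensors d ?A" and g: "\<forall>j. Suc k \<le> j \<and> j < d \<longrightarrow> ts ! j \<in> ?g ` {..<n}"
      have l: "length ts = d" using ts by (simp add: pure_tensors_def)
      define F where "F x = scl d ?A (frag_of (ts[k := x]))" for x
      have tc: "frag_of (ts[k := x]) \<in> carrier (tfree d ?A)" if "x \<in> carrier ?A" for x
        using pure_tensors_update[OF ts that] by (simp add: keys_frag_of del: obj_abelianization)
      have "F \<in> hom ?A (sym_power d ?A)"
      proof (rule homI)
        fix x y assume x: "x \<in> carrier ?A" and y: "y \<in> carrier ?A"
        show "F x \<in> carrier (sym_power d ?A)" unfolding F_def by (rule sc[OF tc[OF x]])
        have xy: "x \<otimes>\<^bsub>?A\<^esub> y \<in> carrier ?A" by (rule monoid.m_closed[OF group.is_monoid[OF gA] x y])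
        let ?r = "frag_of (ts[k := x \<otimes>\<^bsub>?A\<^esub> y]) - frag_of (ts[k := x]) - frag_of (ts[k := y])"
        have r: "?r \<in> trel_gens d ?A" using Suc.prems by (intro trel_gensI[OF ts _ x y]) simp
        have rc: "?r \<in> carrier (tfree d ?A)" by (rule subsetD[OF sy.trel_gens_carrier r])
        have sum: "frag_of (ts[k := x]) + frag_of (ts[k := y]) \<in> carrier (tfree d ?A)"
          using tc[OF x] tc[OF y] unfolding carrier_free_Abelian_group_iff by (rule keys_add_subset)
        have "F (x \<otimes>\<^bsub>?A\<^esub> y) = scl d ?A (?r \<otimes>\<^bsub>tfree d ?A\<^esub> (frag_of (ts[k := x]) + frag_of (ts[k := y])))"
          by (simp add: F_def)
        also have "\<dots> = scl d ?A ?r \<otimes>\<^bsub>sym_power d ?A\<^esub> scl d ?A (frag_of (ts[k := x]) + frag_of (ts[k := y]))"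
          by (rule hom_mult[OF sy.scl_hom rc sum])
        also have "\<dots> = scl d ?A (frag_of (ts[k := x]) + frag_of (ts[k := y]))"
          unfolding sy.scl_rels[OF r] by (rule P.l_one[OF sc[OF sum]])
        also have "\<dots> = scl d ?A (frag_of (ts[k := x]) \<otimes>\<^bsub>tfree d ?A\<^esub> frag_of (ts[k := y]))" by simp
        also have "\<dots> = F x \<otimes>\<^bsub>sym_power d ?A\<^esub> F y"
          unfolding F_def by (rule hom_mult[OF sy.scl_hom tc[OF x] tc[OF y]])
        finally show "F (x \<otimes>\<^bsub>?A\<^esub> y) = F x \<otimes>\<^bsub>sym_power d ?A\<^esub> F y" .
      qed
      from Group.hom_compose[OF acl_hom[OF free_rank(1)] this]
      have Fh: "F \<circ> acl ?G \<in> hom ?G (sym_power d ?A)" .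
      have "(F \<circ> acl ?G) ` generate ?G (set (gens n)) \<subseteq> S"
      proof (rule hom_generate_subset[OF free_rank(1) P.is_group Fh gens_carrier S])
        fix x :: 'g assume "x \<in> set (gens n)"
        then obtain i where i: "i < n" "x = gens n ! i" using free_rank(2)[where 'g = 'g, of n] by (auto simp: in_set_conv_nth)
        have u: "ts[k := ?g i] \<in> pure_tensors d ?A" by (rule pure_tensors_update[OF ts gen_class_carrier[OF i(1)]])
        have "\<forall>j. k \<le> j \<and> j < d \<longrightarrow> ts[k := ?g i] ! j \<in> ?g ` {..<n}"
        proof (intro allI impI)
          fix j assume j: "k \<le> j \<and> j < d"
          show "ts[k := ?g i] ! j \<in> ?g ` {..<n}"
            using g j i(1) l by (cases "j = k") auto
        qed
        then have "F (gen_class n i) \<in> S" unfolding F_def using Suc.IH Suc.prems u by simp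
        then show "(F \<circ> acl ?G) x \<in> S" by (simp add: gen_class_def i(2))
      qed
      moreover obtain x where "x \<in> carrier ?G" "ts ! k = acl ?G x"
      proof -
        have "ts ! k \<in> carrier ?A" using ts Suc.prems l by (auto simp: pure_tensors_def simp del: obj_abelianization)
        then show ?thesis using that unfolding carrier_abelianization by (elim imageE)
      qed
      ultimately have "F (ts ! k) \<in> S" unfolding generate_gens by auto
      then show "scl d ?A (frag_of ts) \<in> S" by (simp add: F_def)
    qed
  qed
  have pure: "scl d ?A (frag_of ts) \<in> S" if "ts \<in> pure_tensors d ?A" for ts by (rule mp[OF bspec[OF step[OF order_refl] that]]) auto
  obtain v where v: "v \<in> carrier (tfree d ?A)" "y = scl d ?A v" using y unfolding sy.carrier_sym_power by (rule imageE)
  interpret K: group_hom "tfree d ?A" "sym_power d ?A" "scl d ?A"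
    by (intro group_hom.intro group_hom_axioms.intro group_free_Abelian_group P.is_group sy.scl_hom)
  have "Poly_Mapping.keys v \<subseteq> pure_tensors d ?A" using v(1) by simp
  then have "Poly_Mapping.keys v \<subseteq> pure_tensors d ?A \<and> scl d ?A v \<in> S"
  proof (induction v rule: frag_induction)
    case zero
    show ?case using K.hom_one subgroup.one_closed[OF S] by simp
  next
    case (one ts)
    then show ?case using pure by (simp add: keys_frag_of)
  next
    case (diff a b)
    have "a = (a - b) \<otimes>\<^bsub>tfree d ?A\<^esub> b" by simp
    have ab: "Poly_Mapping.keys (a - b) \<subseteq> pure_tensors d ?A" using diff by (intro keys_diff_subset) auto
    have e: "scl d ?A (a - b) = scl d ?A a \<otimes>\<^bsub>sym_power d ?A\<^esub> inv\<^bsub>sym_power d ?A\<^esub> scl d ?A b"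
    proof (rule P.inv_solve_right[THEN iffD2])
      show "scl d ?A a = scl d ?A (a - b) \<otimes>\<^bsub>sym_power d ?A\<^esub> scl d ?A b"
        using hom_mult[OF sy.scl_hom, of "a - b" b] diff ab by simp
    qed (use diff ab sc in auto)
    show ?case unfolding e using ab diff S by (blast intro: subgroup.m_closed subgroup.m_inv_closed)
  qed
  then show ?thesis unfolding v(2) S_def by blast
qed

section \<open>Cochains as polynomials\<close>

declare One_nat_def [simp del]

abbreviation SB :: "nat \<Rightarrow> ('g::infinite, ('g set list \<Rightarrow>\<^sub>0 int) set set) gr_functor" where
  "SB d \<equiv> sym_power_after d abelianization"

lemma SB_functor: "is_functor (SB d)"
  by (rule sym_power_after_functor[OF abelianization_functor])

lemma obj_SB: "obj (SB d) G = sym_power d (obj abelianization G)"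
  by (simp add: sym_power_after_def)

lemma theta_hom: "theta d \<in> hom (obj (SB d) (FG 1 :: 'g::infinite monoid)) integer_group"
  unfolding obj_SB by (rule theta(1))

text \<open>The value of a transformation at a tuple of powers of the generator of the free group of rank one,
  as a function of the exponents.\<close>

definition pol :: "nat \<Rightarrow> ('g::infinite monoid \<Rightarrow> ('g list \<Rightarrow>\<^sub>0 int) \<Rightarrow> ('g set list \<Rightarrow>\<^sub>0 int) set set) \<Rightarrow> int list \<Rightarrow> int" where
  "pol d \<eta> xs = theta d (\<eta> (FG 1) (frag_of (map gen_power xs)))"

lemma gen_power_bar_set: "length xs = n \<Longrightarrow> map gen_power xs \<in> bar_set n (FG 1 :: 'g::infinite monoid)"
  using gen_power_carrier[where 'a = 'g] by (simp add: bar_set_def image_subset_iff)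

text \<open>The tuple of powers with exponents \<open>xs\<close> is the image of the universal tuple under a
  homomorphism to the infinite cyclic group, and on symmetric powers this homomorphism evaluates
  forms at \<open>xs\<close>.\<close>

lemma pol_nat:
  fixes \<eta> :: "'g::infinite monoid \<Rightarrow> _"
  assumes \<eta>: "\<eta> \<in> nat_trans (bar n) (SB d)" and e: "\<eta> (FG n) (frag_of (gens n)) = sym_of_poly n d w"
    and w: "Poly_Mapping.keys w \<subseteq> exps n d" and xs: "length xs = n"
  shows "pol d \<eta> xs = peval w xs"
proof -
  let ?Z = "FG 1 :: 'g monoid" and ?A = "abl n :: 'g set monoid"
  interpret sy: sym_pow d ?A by (rule sym_pow.intro[OF abl_comm])
  obtain \<phi> where \<phi>: "\<phi> \<in> mor (FG n :: 'g monoid) ?Z" "map \<phi> (gens n) = map gen_power xs"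
    using bar_set_hom[OF FG_gr gen_power_bar_set[OF xs]] by (rule bexE)
  let ?f = "arr abelianization (FG n) ?Z \<phi>"
  have f: "?f \<in> mor ?A (abl 1)" by (rule is_functorD(3)[OF abelianization_functor FG_gr FG_gr \<phi>(1)])
  have a: "arr (SB d) (FG n) ?Z \<phi> = sym_power_map d ?A (abl 1) ?f"
    by (simp add: sym_power_after_def del: obj_abelianization)
  have g: "?f (gen_class n i) = acl ?Z (gen_power (xs ! i))" if "i < n" for i
  proof -
    have "\<phi> (gens n ! i) = gen_power (xs ! i)"
      using arg_cong[OF \<phi>(2), of "\<lambda>l. l ! i"] that xs free_rank(2)[where 'g = 'g, of n] by simp
    then show ?thesis
      unfolding gen_class_def using abelianization_arr_acl[OF free_rank(1) free_rank(1) \<phi>(1) gens_nth_carrier[OF that]] by simp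
  qed
  interpret K: group_hom "tfree d (abl 1 :: 'g set monoid)" "sym_power d (abl 1)" "scl d (abl 1)"
    by (intro group_hom.intro group_hom_axioms.intro group_free_Abelian_group sym_pow.scl_hom[OF sym_pow.intro[OF abl_comm]]
        comm_group_group[OF sym_pow.sym_power_comm[OF sym_pow.intro[OF abl_comm]]])
  define T :: "nat list \<Rightarrow> 'g set list" where "T \<alpha> = map (\<lambda>i. acl ?Z (gen_power (xs ! i))) (var_list \<alpha>)" for \<alpha>
  have T: "T \<alpha> \<in> pure_tensors d (abl 1)" if "\<alpha> \<in> exps n d" for \<alpha>
    using that acl_closed[OF free_rank(1)[where 'g = 'g, of 1] gen_power_carrier] by (auto simp: T_def pure_tensors_def exps_def length_var_list simp del: obj_abelianization)
  have Tc: "lmap T v \<in> carrier (tfree d (abl 1))" if "Poly_Mapping.keys v \<subseteq> exps n d" for v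
    unfolding carrier_free_Abelian_group_iff
    by (rule frag_extend_closed[OF _ that]) (simp add: keys_frag_of T del: obj_abelianization)
  have "lmap (map ?f) (lmap (\<lambda>\<alpha>. map (gen_class n) (var_list \<alpha>)) w) = lmap T w"
    unfolding frag_extend_frag_extend
  proof (rule frag_extend_eq)
    fix \<alpha> assume "\<alpha> \<in> Poly_Mapping.keys w"
    then have "set (var_list \<alpha>) \<subseteq> {..<n}" using w set_var_list[of \<alpha>] by (auto simp: exps_def)
    then have "map ?f (map (gen_class n) (var_list \<alpha>)) = T \<alpha>"
      unfolding T_def map_map comp_def by (intro map_cong[OF refl] g) auto
    then show "lmap (map ?f) (frag_of (map (gen_class n) (var_list \<alpha>))) = frag_of (T \<alpha>)" by simp
  qed
  then have m: "arr (SB d) (FG n) ?Z \<phi> (sym_of_poly n d w) = scl d (abl 1) (lmap T w)"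
    unfolding a sym_of_poly_def sym_power_map_scl[OF abl_comm abl_comm f sym_of_poly_arg_keys[OF w]] by simp
  have th: "Poly_Mapping.keys w \<subseteq> exps n d \<and> theta d (scl d (abl 1) (lmap T w)) = peval w xs"
    using w
  proof (induction w rule: frag_induction)
    case zero
    have "scl d (abl 1 :: 'g set monoid) 0 = \<one>\<^bsub>sym_power d (abl 1)\<^esub>" using K.hom_one by simp
    moreover have "theta d \<one>\<^bsub>sym_power d (abl 1 :: 'g set monoid)\<^esub> = 0"
      using hom_one[OF theta(1) K.H.is_group group_integer_group] by simp
    ultimately show ?case by simp
  next
    case (one \<alpha>)
    have l: "length \<alpha> = length xs" "length (map (\<lambda>i. xs ! i) (var_list \<alpha>)) = d" using one xs by (auto simp: exps_def length_var_list)
    have "T \<alpha> = map (\<lambda>k. acl ?Z (gen_power k)) (map (\<lambda>i. xs ! i) (var_list \<alpha>))" by (simp add: T_def)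
    then have "theta d (scl d (abl 1) (frag_of (T \<alpha>))) = prod_list (map (\<lambda>i. xs ! i) (var_list \<alpha>))"
      using theta(2)[where 'g = 'g, OF l(2)] by simp
    then show ?case using prod_var_list[OF l(1)] one by (simp add: keys_frag_of)
  next
    case (diff v w)
    note kw = conjunct1[OF diff(2)] and k = keys_diff_subset[OF conjunct1[OF diff(1)] conjunct1[OF diff(2)]]
    have "lmap T v = lmap T (v - w) \<otimes>\<^bsub>tfree d (abl 1)\<^esub> lmap T w" by (simp add: frag_extend_diff)
    then have "scl d (abl 1) (lmap T v) = scl d (abl 1) (lmap T (v - w)) \<otimes>\<^bsub>sym_power d (abl 1)\<^esub> scl d (abl 1) (lmap T w)"
      using hom_mult[OF K.homh Tc[OF k] Tc[OF kw]] by (simp only:)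
    then have "theta d (scl d (abl 1) (lmap T v)) = theta d (scl d (abl 1) (lmap T (v - w))) + theta d (scl d (abl 1) (lmap T w))"
      using hom_mult[OF theta(1) K.hom_closed[OF Tc[OF k]] K.hom_closed[OF Tc[OF kw]]] by simp
    then show ?case using diff k by simp
  qed
  show ?thesis
    unfolding pol_def yoneda_value[OF \<eta> FG_gr \<phi>] e m by (rule conjunct2[OF th])
qed

lemma pol_cases:
  fixes \<eta> :: "'g::infinite monoid \<Rightarrow> _"
  assumes \<eta>: "\<eta> \<in> nat_trans (bar n) (SB d)"
  obtains w where "Poly_Mapping.keys w \<subseteq> exps n d" "\<eta> (FG n) (frag_of (gens n)) = sym_of_poly n d w"
    "\<And>xs. length xs = n \<Longrightarrow> pol d \<eta> xs = peval w xs"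
proof -
  have "frag_of (gens n) \<in> carrier (obj (bar n) (FG n :: 'g monoid))" using gens_bar[where 'g = 'g, of n] by (simp add: keys_frag_of)
  from nat_transD(4)[OF \<eta> FG_gr this] have "\<eta> (FG n) (frag_of (gens n)) \<in> carrier (sym_power d (abl n))" unfolding obj_SB .
  from sym_of_poly_onto[OF this] obtain w where w: "Poly_Mapping.keys w \<subseteq> exps n d" "\<eta> (FG n) (frag_of (gens n)) = sym_of_poly n d w" by (elim exE conjE)
  show thesis by (rule that[OF w]) (rule pol_nat[OF \<eta> w(2,1)])
qed

lemma pol_exists:
  assumes w: "Poly_Mapping.keys w \<subseteq> exps n d"
  shows "\<exists>\<eta> \<in> nat_trans (bar n) (SB d :: ('g::infinite, _) gr_functor). \<forall>xs. length xs = n \<longrightarrow> pol d \<eta> xs = peval w xs"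
proof -
  have "(sym_of_poly n d w :: ('g set list \<Rightarrow>\<^sub>0 int) set set) \<in> carrier (obj (SB d) (FG n))" unfolding obj_SB by (rule sym_of_poly_closed[OF w])
  from yoneda_exists[OF SB_functor this]
  obtain \<eta> where \<eta>: "\<eta> \<in> nat_trans (bar n) (SB d :: ('g, _) gr_functor)" "\<eta> (FG n) (frag_of (gens n)) = sym_of_poly n d w" by (rule bexE)
  show ?thesis using \<eta>(1) by (rule bexI[rotated]) (intro allI impI pol_nat[OF \<eta> w])
qed

text \<open>The two transformations are given by forms with the same values, hence the same coefficients, and the
  Yoneda lemma applies.\<close>

lemma pol_inj:
  fixes \<eta> \<theta> :: "'g::infinite monoid \<Rightarrow> _"
  assumes \<eta>: "\<eta> \<in> nat_trans (bar n) (SB d)" "\<theta> \<in> nat_trans (bar n) (SB d)"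
    and eq: "\<And>xs. length xs = n \<Longrightarrow> pol d \<eta> xs = pol d \<theta> xs"
  shows "\<eta> = \<theta>"
proof -
  obtain v where v: "Poly_Mapping.keys v \<subseteq> exps n d" "\<eta> (FG n) (frag_of (gens n)) = sym_of_poly n d v"
    "\<And>xs. length xs = n \<Longrightarrow> pol d \<eta> xs = peval v xs"
    by (rule pol_cases[OF \<eta>(1)]) (rule that)
  obtain w where w: "Poly_Mapping.keys w \<subseteq> exps n d" "\<theta> (FG n) (frag_of (gens n)) = sym_of_poly n d w"
    "\<And>xs. length xs = n \<Longrightarrow> pol d \<theta> xs = peval w xs"
    by (rule pol_cases[OF \<eta>(2)]) (rule that)
  have "v - w = 0" using keys_diff_subset[OF v(1) w(1)] v(3) w(3) eq by (intro peval_eq_0[of "v - w" n d]) auto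
  then have "v = w" by simp
  then show ?thesis using v(2) w(2) by (intro yoneda_unique[OF SB_functor \<eta>]) simp
qed

definition cobd :: "nat \<Rightarrow> ('g monoid \<Rightarrow> ('g list \<Rightarrow>\<^sub>0 int) \<Rightarrow> 'v) \<Rightarrow> 'g monoid \<Rightarrow> ('g list \<Rightarrow>\<^sub>0 int) \<Rightarrow> 'v" where
  "cobd n \<eta> = nt_comp (bar (Suc n)) \<eta> (bd_nat n)"

lemma cobd_closed: "\<eta> \<in> nat_trans (bar n) B \<Longrightarrow> cobd n \<eta> \<in> nat_trans (bar (Suc n)) B"
  unfolding cobd_def by (rule nt_comp_closed[OF bar_functor bd_nat])

lemma cobd_eq: "G \<in> gr \<Longrightarrow> Poly_Mapping.keys w \<subseteq> bar_set (Suc n) G \<Longrightarrow> cobd n \<eta> G w = \<eta> G (bd G w)"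
  by (simp add: cobd_def nt_comp_eq bd_nat_eq)

text \<open>Exponents add when powers multiply, so the tuples of powers form an image of the bar complex of the
  integers.\<close>

lemma pol_cobd:
  fixes \<eta> :: "'g::infinite monoid \<Rightarrow> _"
  assumes \<eta>: "\<eta> \<in> nat_trans (bar n) (SB d)" and xs: "length xs = Suc n"
  shows "pol d (cobd n \<eta>) xs = lin_eval (pol d \<eta>) (bdl integer_group xs)"
proof -
  let ?Z = "FG 1 :: 'g monoid" and ?S = "bar_set n integer_group"
  have k: "Poly_Mapping.keys (frag_of (map gen_power xs)) \<subseteq> bar_set (Suc n) ?Z" using gen_power_bar_set[OF xs] by (simp add: keys_frag_of)
  have b: "bd ?Z (frag_of (map gen_power xs)) = lmap (map gen_power) (bdl integer_group xs)"
    using bdl_map[OF gen_power_hom[where 'g = 'g], of xs] by simp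
  have kb: "Poly_Mapping.keys (bdl integer_group xs) \<subseteq> ?S"
    using xs by (intro bdl_keys[OF group_integer_group]) (simp add: bar_set_def)
  have h: "theta d \<circ> \<eta> ?Z \<in> hom (free_Abelian_group (bar_set n ?Z)) integer_group"
    using mor_hom[OF nat_transD(1)[OF \<eta> FG_gr]] theta_hom unfolding obj_bar by (rule Group.hom_compose)
  have p: "lmap (map gen_power) \<in> hom (free_Abelian_group ?S) (free_Abelian_group (bar_set n ?Z))"
    by (rule lmap_bar_hom[OF gen_power_hom])
  have "((theta d \<circ> \<eta> ?Z) \<circ> lmap (map gen_power)) (bdl integer_group xs) = lin_eval (pol d \<eta>) (bdl integer_group xs)"
  proof (rule hom_free_eqI[OF group_integer_group Group.hom_compose[OF p h]])
    show "lin_eval (pol d \<eta>) \<in> hom (free_Abelian_group ?S) integer_group" by (rule homI) simp_all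
    show "(theta d \<circ> \<eta> ?Z \<circ> lmap (map gen_power)) (frag_of ys) = lin_eval (pol d \<eta>) (frag_of ys)" for ys by (simp add: pol_def)
    show "bdl integer_group xs \<in> carrier (free_Abelian_group ?S)" using kb by simp
  qed
  then show ?thesis unfolding pol_def[of d "cobd n \<eta>"] cobd_eq[OF FG_gr k] b by simp
qed

lemma length_eq_cases:
  "length xs = 3 \<Longrightarrow> \<exists>x y z. xs = [x, y, z]" "length ys = 4 \<Longrightarrow> \<exists>t x y z. ys = [t, x, y, z]"
proof -
  have e: "(3 :: nat) = Suc (Suc (Suc 0))" "(4 :: nat) = Suc (Suc (Suc (Suc 0)))" by (rule numeral_3_eq_3, presburger)
  show "length xs = 3 \<Longrightarrow> \<exists>x y z. xs = [x, y, z]" "length ys = 4 \<Longrightarrow> \<exists>t x y z. ys = [t, x, y, z]"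
    unfolding e length_Suc_conv length_0_conv by blast+
qed

lemma pol_cobd_2:
  fixes \<eta> :: "'g::infinite monoid \<Rightarrow> _"
  assumes \<eta>: "\<eta> \<in> nat_trans (bar 2) (SB d)" and w: "Poly_Mapping.keys w \<subseteq> exps 2 d"
    and p: "\<And>xs. length xs = 2 \<Longrightarrow> pol d \<eta> xs = peval w xs" and xs: "length xs = 3"
  shows "pol d (cobd 2 \<eta>) xs = peval (poly_cob2 w) xs"
proof -
  obtain x y z where e: "xs = [x, y, z]" using length_eq_cases(1)[OF xs] by blast
  have l: "length xs = Suc 2" using xs by simp
  show ?thesis unfolding pol_cobd[OF \<eta> l] unfolding e peval_poly_cob2[OF w] by (simp add: p fcat_def frag_extend_diff frag_extend_add)
qed

lemma pol_cobd_3: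
  fixes \<eta> :: "'g::infinite monoid \<Rightarrow> _"
  assumes \<eta>: "\<eta> \<in> nat_trans (bar 3) (SB d)" and w: "Poly_Mapping.keys w \<subseteq> exps 3 d"
    and p: "\<And>xs. length xs = 3 \<Longrightarrow> pol d \<eta> xs = peval w xs" and xs: "length xs = 4"
  shows "pol d (cobd 3 \<eta>) xs = peval (poly_cob3 w) xs"
proof -
  obtain t x y z where e: "xs = [t, x, y, z]" using length_eq_cases(2)[OF xs] by blast
  have l: "length xs = Suc 3" using xs by simp
  show ?thesis unfolding pol_cobd[OF \<eta> l] unfolding e peval_poly_cob3[OF w] by (simp add: p fcat_def frag_extend_diff frag_extend_add)
qed

definition trivial_cochain :: "nat \<Rightarrow> ('g, 'v) gr_functor \<Rightarrow> 'g monoid \<Rightarrow> ('g list \<Rightarrow>\<^sub>0 int) \<Rightarrow> 'v" where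
  "trivial_cochain n B = \<one>\<^bsub>hom_group (bar n) B\<^esub>"

lemma trivial_cochain_closed: "is_functor B \<Longrightarrow> trivial_cochain n B \<in> nat_trans (bar n) B"
  unfolding trivial_cochain_def using monoid.one_closed[OF group.is_monoid[OF comm_group_group[OF hom_group_comm[OF bar_functor]]]] by simp

lemma trivial_cochain_eq: "G \<in> gr \<Longrightarrow> w \<in> carrier (obj (bar n) G) \<Longrightarrow> trivial_cochain n B G w = \<one>\<^bsub>obj B G\<^esub>"
  unfolding trivial_cochain_def by (rule nt_one_eq)

lemma pol_trivial_cochain: "length xs = n \<Longrightarrow> pol d (trivial_cochain n (SB d :: ('g::infinite, _) gr_functor)) xs = 0"
proof -
  assume "length xs = n"
  from gen_power_bar_set[OF this] have "frag_of (map gen_power xs) \<in> carrier (obj (bar n) (FG 1 :: 'g monoid))" by (simp add: keys_frag_of)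
  note tr = trivial_cochain_eq[OF FG_gr this]
  show ?thesis
    unfolding pol_def tr
    by (rule trans[OF hom_one[OF theta_hom comm_group_group[OF is_functorD(1)[OF SB_functor FG_gr]] group_integer_group] one_integer_group])
qed

text \<open>The polynomial of the coboundary of \<open>\<eta>\<close> is \<open>poly_cob3 w\<close>, whose coefficients are \<open>cob3\<close> of
  those of \<open>w\<close>; and a cochain, like a form, is determined by its values at integers.\<close>

lemma cobd_trivial_iff:
  fixes \<eta> :: "'g::infinite monoid \<Rightarrow> _"
  assumes \<eta>: "\<eta> \<in> nat_trans (bar 3) (SB d)" and w: "Poly_Mapping.keys w \<subseteq> exps 3 d"
    and p: "\<And>xs. length xs = 3 \<Longrightarrow> pol d \<eta> xs = peval w xs"
  shows "cobd 3 \<eta> = trivial_cochain 4 (SB d) \<longleftrightarrow> (\<forall>a b c e. cob3 (arr3 w) a b c e = 0)"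
proof
  assume "cobd 3 \<eta> = trivial_cochain 4 (SB d)"
  then have "peval (poly_cob3 w) xs = 0" if "length xs = 4" for xs using pol_cobd_3[OF \<eta> w p that] pol_trivial_cochain[where 'g = 'g, OF that] by simp
  then have "poly_cob3 w = 0" by (rule peval_eq_0[OF poly_cob3_keys[OF w]])
  then show "\<forall>a b c e. cob3 (arr3 w) a b c e = 0" using lookup_poly_cob3[OF w] by simp
next
  assume z: "\<forall>a b c e. cob3 (arr3 w) a b c e = 0"
  have "poly_cob3 w = 0"
  proof (rule poly_mapping_eqI)
    fix \<alpha> show "poly_mapping.lookup (poly_cob3 w) \<alpha> = poly_mapping.lookup 0 \<alpha>"
    proof (cases "\<alpha> \<in> exps 4 d")
      case True
      then have "length \<alpha> = 4" by (simp add: exps_def)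
      then obtain a b c e where "\<alpha> = [a, b, c, e]" using length_eq_cases(2) by blast
      then show ?thesis using z lookup_poly_cob3[OF w] by simp
    next
      case False
      then show ?thesis using poly_cob3_keys[OF w] by (auto simp: in_keys_iff)
    qed
  qed
  then have z: "pol d (cobd 3 \<eta>) xs = pol d (trivial_cochain 4 (SB d :: ('g, _) gr_functor)) xs" if "length xs = 4" for xs
    using pol_cobd_3[OF \<eta> w p that] pol_trivial_cochain[where 'g = 'g, OF that] by simp
  have "cobd 3 \<eta> \<in> nat_trans (bar 4) (SB d)" using cobd_closed[OF \<eta>] by simp
  then show "cobd 3 \<eta> = trivial_cochain 4 (SB d)" by (rule pol_inj[OF _ trivial_cochain_closed[OF SB_functor] z])
qed

lemma is_cobd_iff:
  fixes \<eta> :: "'g::infinite monoid \<Rightarrow> _"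
  assumes \<eta>: "\<eta> \<in> nat_trans (bar 3) (SB d)" and w: "Poly_Mapping.keys w \<subseteq> exps 3 d"
    and p: "\<And>xs. length xs = 3 \<Longrightarrow> pol d \<eta> xs = peval w xs"
  shows "(\<exists>\<beta> \<in> nat_trans (bar 2) (SB d). \<eta> = cobd 2 \<beta>) \<longleftrightarrow> (\<exists>g. wt2 d g \<and> (\<forall>a b c. arr3 w a b c = cob2 g a b c))"
proof
  assume "\<exists>\<beta> \<in> nat_trans (bar 2) (SB d). \<eta> = cobd 2 \<beta>"
  then obtain \<beta> where \<beta>: "\<beta> \<in> nat_trans (bar 2) (SB d)" "\<eta> = cobd 2 \<beta>" by (rule bexE)
  obtain v where v: "Poly_Mapping.keys v \<subseteq> exps 2 d" "\<beta> (FG 2) (frag_of (gens 2)) = sym_of_poly 2 d v"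
    "\<And>xs. length xs = 2 \<Longrightarrow> pol d \<beta> xs = peval v xs"
    by (rule pol_cases[OF \<beta>(1)]) (rule that)
  have "peval (w - poly_cob2 v) xs = 0" if "length xs = 3" for xs
    using pol_cobd_2[OF \<beta>(1) v(1,3) that] p[OF that] \<beta>(2) by simp
  then have "w - poly_cob2 v = 0" by (rule peval_eq_0[OF keys_diff_subset[OF w poly_cob2_keys[OF v(1)]]])
  then have "\<forall>a b c. arr3 w a b c = cob2 (arr2 v) a b c" using arr3_poly_cob2[OF v(1)] by simp
  moreover have "wt2 d (arr2 v)" using v(1) by (auto simp: wt2_def arr2_def exps_def in_keys_iff subset_iff)
  ultimately show "\<exists>g. wt2 d g \<and> (\<forall>a b c. arr3 w a b c = cob2 g a b c)" by blast
next
  assume "\<exists>g. wt2 d g \<and> (\<forall>a b c. arr3 w a b c = cob2 g a b c)"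
  then obtain g where g: "wt2 d g" "\<And>a b c. arr3 w a b c = cob2 g a b c" by blast
  obtain v where v: "Poly_Mapping.keys v \<subseteq> exps 2 d" "arr2 v = g" using frag_of_arr2[OF g(1)] by blast
  have e: "w = poly_cob2 v" using arr3_poly_cob2[OF v(1)] g(2) v(2) by (intro arr3_inj[OF w poly_cob2_keys[OF v(1)]]) simp
  from pol_exists[OF v(1)] obtain \<beta> where \<beta>: "\<beta> \<in> nat_trans (bar 2) (SB d :: ('g, _) gr_functor)"
    "\<forall>xs. length xs = 2 \<longrightarrow> pol d \<beta> xs = peval v xs" by (rule bexE)
  have b3: "cobd 2 \<beta> \<in> nat_trans (bar 3) (SB d)" using cobd_closed[OF \<beta>(1)] by simp
  have "\<eta> = cobd 2 \<beta>"
  proof (rule pol_inj[OF \<eta> b3])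
    fix xs :: "int list" assume l: "length xs = 3"
    show "pol d \<eta> xs = pol d (cobd 2 \<beta>) xs" using pol_cobd_2[OF \<beta>(1) v(1) _ l] \<beta>(2) p[OF l] e by simp
  qed
  then show "\<exists>\<beta> \<in> nat_trans (bar 2) (SB d). \<eta> = cobd 2 \<beta>" using \<beta>(1) by (rule bexI)
qed

section \<open>The second Ext group\<close>

text \<open>A cochain on the copied resolution as a cochain on the bar complex, and conversely.\<close>

definition on_bar :: "nat \<Rightarrow> ('g::infinite monoid \<Rightarrow> 'u::infinite \<Rightarrow> 'v) \<Rightarrow> 'g monoid \<Rightarrow> ('g list \<Rightarrow>\<^sub>0 int) \<Rightarrow> 'v" where
  "on_bar n c = nt_comp (bar (Suc n)) c (up n)"

definition on_copy :: "nat \<Rightarrow> ('g::infinite monoid \<Rightarrow> ('g list \<Rightarrow>\<^sub>0 int) \<Rightarrow> 'v) \<Rightarrow> 'g monoid \<Rightarrow> 'u::infinite \<Rightarrow> 'v" where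
  "on_copy n \<eta> = nt_comp (BR n) \<eta> (down n)"

lemma on_bar_closed: "(c :: 'g::infinite monoid \<Rightarrow> 'u::infinite \<Rightarrow> 'v) \<in> nat_trans (BR n) B \<Longrightarrow> on_bar n c \<in> nat_trans (bar (Suc n)) B"
  unfolding on_bar_def by (rule nt_comp_closed[OF bar_functor up])

lemma on_copy_closed: "\<eta> \<in> nat_trans (bar (Suc n)) B \<Longrightarrow> (on_copy n \<eta> :: 'g::infinite monoid \<Rightarrow> 'u::infinite \<Rightarrow> 'v) \<in> nat_trans (BR n) B"
  unfolding on_copy_def by (rule nt_comp_closed[OF BR_functor down])

lemma on_bar_eq: "G \<in> gr \<Longrightarrow> w \<in> carrier (obj (bar (Suc n)) G) \<Longrightarrow> on_bar n c G w = c G (up n G w)"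
  unfolding on_bar_def by (rule nt_comp_eq)

lemma on_copy_eq: "G \<in> gr \<Longrightarrow> x \<in> carrier (obj (BR n) G) \<Longrightarrow> on_copy n \<eta> G x = \<eta> G (down n G x)"
  unfolding on_copy_def by (rule nt_comp_eq)

lemma on_bar_on_copy:
  assumes \<eta>: "\<eta> \<in> nat_trans (bar (Suc n)) B"
  shows "on_bar n (on_copy n \<eta> :: 'g::infinite monoid \<Rightarrow> 'u::infinite \<Rightarrow> 'v) = \<eta>"
proof (rule nat_trans_eqI[OF on_bar_closed[OF on_copy_closed[OF \<eta>]] \<eta>])
  fix G :: "'g monoid" and w assume Gw: "G \<in> gr" "w \<in> carrier (obj (bar (Suc n)) G)"
  show "on_bar n (on_copy n \<eta> :: 'g monoid \<Rightarrow> 'u \<Rightarrow> 'v) G w = \<eta> G w"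
    unfolding on_bar_eq[OF Gw] on_copy_eq[OF Gw(1) BR_nat_closed[where 'u = 'u, OF Gw]] down_up[OF Gw] ..
qed

lemma cocycle_iff:
  fixes c :: "'g::infinite monoid \<Rightarrow> 'u::infinite \<Rightarrow> 'v"
  assumes res: "proj_resolution A (BR :: nat \<Rightarrow> ('g, 'u) gr_functor) br_del \<epsilon>" and B: "is_functor B"
  shows "proj_resolution.cocycle BR br_del B n c \<longleftrightarrow>
    c \<in> nat_trans (BR n) B \<and> cobd (Suc n) (on_bar n c) = trivial_cochain (Suc (Suc n)) B"
proof (cases "c \<in> nat_trans (BR n) B")
  case c: True
  have key: "c G (br_del n G (up (Suc n) G w)) = cobd (Suc n) (on_bar n c) G w"
    if Gw: "G \<in> gr" "w \<in> carrier (obj (bar (Suc (Suc n))) G)" for G w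
  proof -
    have k: "Poly_Mapping.keys w \<subseteq> bar_set (Suc (Suc n)) G" using Gw(2) by simp
    have b: "bd G w \<in> carrier (obj (bar (Suc n)) G)" using bd_keys[OF gr_group[OF Gw(1)] k] by simp
    show ?thesis unfolding br_del_up[OF Gw] cobd_eq[OF Gw(1) k] on_bar_eq[OF Gw(1) b] ..
  qed
  have "(\<forall>G\<in>gr. \<forall>x\<in>carrier (obj (BR (Suc n)) G). c G (br_del n G x) = \<one>\<^bsub>obj B G\<^esub>)
    \<longleftrightarrow> cobd (Suc n) (on_bar n c) = trivial_cochain (Suc (Suc n)) B" (is "?L \<longleftrightarrow> ?R")
  proof
    assume L: ?L
    show ?R
    proof (rule nat_trans_eqI[OF cobd_closed[OF on_bar_closed[OF c]] trivial_cochain_closed[OF B]])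
      fix G :: "'g monoid" and w assume Gw: "G \<in> gr" "w \<in> carrier (obj (bar (Suc (Suc n))) G)"
      show "cobd (Suc n) (on_bar n c) G w = trivial_cochain (Suc (Suc n)) B G w"
        unfolding trivial_cochain_eq[OF Gw] key[OF Gw, symmetric]
        by (rule bspec[OF bspec[OF L Gw(1)] BR_nat_closed[where 'u = 'u, OF Gw]])
    qed
  next
    assume R: ?R
    show ?L
    proof (intro ballI)
      fix G :: "'g monoid" and x :: 'u assume G: "G \<in> gr" and x: "x \<in> carrier (obj (BR (Suc n)) G)"
      obtain w where w: "w \<in> carrier (obj (bar (Suc (Suc n))) G)" "x = up (Suc n) G w" by (rule BR_cases[OF G x])
      show "c G (br_del n G x) = \<one>\<^bsub>obj B G\<^esub>" unfolding w(2) key[OF G w(1)] R by (rule trivial_cochain_eq[OF G w(1)])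
    qed
  qed
  then show ?thesis using c unfolding proj_resolution.cocycle_def[OF res] by blast
qed (simp add: proj_resolution.cocycle_def[OF res])

lemma coboundary_iff:
  fixes c :: "'g::infinite monoid \<Rightarrow> 'u::infinite \<Rightarrow> 'v"
  assumes res: "proj_resolution A (BR :: nat \<Rightarrow> ('g, 'u) gr_functor) br_del \<epsilon>"
    and c: "c \<in> nat_trans (BR (Suc n)) B"
  shows "proj_resolution.coboundary BR br_del B n c \<longleftrightarrow> (\<exists>\<beta>\<in>nat_trans (bar (Suc n)) B. on_bar (Suc n) c = cobd (Suc n) \<beta>)"
proof
  have down_bd: "br_del n G (up (Suc n) G w) = (up n G (bd G w) :: 'u)" "bd G w \<in> carrier (obj (bar (Suc n)) G)"
    "Poly_Mapping.keys w \<subseteq> bar_set (Suc (Suc n)) G"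
    if Gw: "G \<in> gr" "w \<in> carrier (obj (bar (Suc (Suc n))) G)" for G :: "'g monoid" and w
  proof -
    show k: "Poly_Mapping.keys w \<subseteq> bar_set (Suc (Suc n)) G" using Gw(2) by simp
    show "bd G w \<in> carrier (obj (bar (Suc n)) G)" using bd_keys[OF gr_group[OF Gw(1)] k] by simp
  qed (rule br_del_up[OF that])
  {
    assume "proj_resolution.coboundary BR br_del B n c"
    then obtain b where b: "b \<in> nat_trans (BR n) B" "\<And>G x. G \<in> gr \<Longrightarrow> x \<in> carrier (obj (BR (Suc n)) G) \<Longrightarrow> c G x = b G (br_del n G x)"
      unfolding proj_resolution.coboundary_def[OF res] by blast
    have "on_bar (Suc n) c = cobd (Suc n) (on_bar n b)"
    proof (rule nat_trans_eqI[OF on_bar_closed[OF c] cobd_closed[OF on_bar_closed[OF b(1)]]])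
      fix G :: "'g monoid" and w assume Gw: "G \<in> gr" "w \<in> carrier (obj (bar (Suc (Suc n))) G)"
      note d = down_bd[OF Gw]
      show "on_bar (Suc n) c G w = cobd (Suc n) (on_bar n b) G w"
        unfolding on_bar_eq[OF Gw] b(2)[OF Gw(1) BR_nat_closed[where 'u = 'u, OF Gw]] d(1) cobd_eq[OF Gw(1) d(3)] on_bar_eq[OF Gw(1) d(2)] ..
    qed
    then show "\<exists>\<beta>\<in>nat_trans (bar (Suc n)) B. on_bar (Suc n) c = cobd (Suc n) \<beta>"
      by (rule bexI[OF _ on_bar_closed[OF b(1)]])
  }
  assume "\<exists>\<beta>\<in>nat_trans (bar (Suc n)) B. on_bar (Suc n) c = cobd (Suc n) \<beta>"
  then obtain \<beta> where \<beta>: "\<beta> \<in> nat_trans (bar (Suc n)) B" "on_bar (Suc n) c = cobd (Suc n) \<beta>" by (rule bexE)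
  show "proj_resolution.coboundary BR br_del B n c"
    unfolding proj_resolution.coboundary_def[OF res]
  proof (intro bexI[OF _ on_copy_closed[OF \<beta>(1)]] ballI)
    fix G :: "'g monoid" and x :: 'u assume G: "G \<in> gr" and x: "x \<in> carrier (obj (BR (Suc n)) G)"
    obtain w where w: "w \<in> carrier (obj (bar (Suc (Suc n))) G)" "x = up (Suc n) G w" by (rule BR_cases[OF G x])
    note d = down_bd[OF G w(1)]
    have "c G x = cobd (Suc n) \<beta> G w" unfolding \<beta>(2)[symmetric] on_bar_eq[OF G w(1)] w(2) ..
    also have "\<dots> = \<beta> G (bd G w)" by (rule cobd_eq[OF G d(3)])
    also have "\<dots> = on_copy n \<beta> G (br_del n G x)"
      unfolding w(2) d(1) on_copy_eq[OF G BR_nat_closed[where 'u = 'u, OF G d(2)]] down_up[OF G d(2)] ..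
    finally show "c G x = on_copy n \<beta> G (br_del n G x)" .
  qed
qed

text \<open>The form that represents a cochain of degree two. Its coefficients carry the invariants.\<close>

definition coeffs_of :: "nat \<Rightarrow> ('g::infinite monoid \<Rightarrow> 'u::infinite \<Rightarrow> ('g set list \<Rightarrow>\<^sub>0 int) set set) \<Rightarrow> (nat list \<Rightarrow>\<^sub>0 int)" where
  "coeffs_of d c = (SOME w. Poly_Mapping.keys w \<subseteq> exps 3 d \<and> (\<forall>xs. length xs = 3 \<longrightarrow> pol d (on_bar 2 c) xs = peval w xs))"

lemma Suc_2_3: "Suc 2 = 3" "Suc 3 = 4" "Suc 1 = 2" by simp_all

lemma coeffs_of:
  fixes c :: "'g::infinite monoid \<Rightarrow> 'u::infinite \<Rightarrow> _"
  assumes c: "c \<in> nat_trans (BR 2) (SB d)"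
  shows "Poly_Mapping.keys (coeffs_of d c) \<subseteq> exps 3 d" "\<And>xs. length xs = 3 \<Longrightarrow> pol d (on_bar 2 c) xs = peval (coeffs_of d c) xs"
proof -
  obtain w where w: "Poly_Mapping.keys w \<subseteq> exps 3 d" "on_bar 2 c (FG 3) (frag_of (gens 3)) = sym_of_poly 3 d w"
    "\<And>xs. length xs = 3 \<Longrightarrow> pol d (on_bar 2 c) xs = peval w xs"
    by (rule pol_cases[OF on_bar_closed[OF c, unfolded Suc_2_3]]) (rule that)
  have "\<exists>w. Poly_Mapping.keys w \<subseteq> exps 3 d \<and> (\<forall>xs. length xs = 3 \<longrightarrow> pol d (on_bar 2 c) xs = peval w xs)"
    using w(1,3) by (intro exI[of _ w] conjI allI impI)
  then have "Poly_Mapping.keys (coeffs_of d c) \<subseteq> exps 3 d \<and> (\<forall>xs. length xs = 3 \<longrightarrow> pol d (on_bar 2 c) xs = peval (coeffs_of d c) xs)"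
    unfolding coeffs_of_def by (rule someI_ex)
  then show "Poly_Mapping.keys (coeffs_of d c) \<subseteq> exps 3 d" "\<And>xs. length xs = 3 \<Longrightarrow> pol d (on_bar 2 c) xs = peval (coeffs_of d c) xs" by auto
qed

lemma coeffs_of_unique:
  fixes c :: "'g::infinite monoid \<Rightarrow> 'u::infinite \<Rightarrow> _"
  assumes c: "c \<in> nat_trans (BR 2) (SB d)" and w: "Poly_Mapping.keys w \<subseteq> exps 3 d"
    and p: "\<And>xs. length xs = 3 \<Longrightarrow> pol d (on_bar 2 c) xs = peval w xs"
  shows "coeffs_of d c = w"
proof -
  have "coeffs_of d c - w = 0"
    using coeffs_of(2)[OF c] p by (intro peval_eq_0[OF keys_diff_subset[OF coeffs_of(1)[OF c] w]]) simp
  then show ?thesis by simp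
qed

lemma coeffs_of_mult:
  fixes c c' :: "'g::infinite monoid \<Rightarrow> 'u::infinite \<Rightarrow> _"
  assumes c: "c \<in> nat_trans (BR 2) (SB d)" "c' \<in> nat_trans (BR 2) (SB d)"
  shows "coeffs_of d (c \<otimes>\<^bsub>hom_group (BR 2) (SB d)\<^esub> c') = coeffs_of d c + coeffs_of d c'"
proof (rule coeffs_of_unique)
  interpret H: comm_group "hom_group (BR 2 :: ('g, 'u) gr_functor) (SB d)" by (rule hom_group_comm[OF BR_functor SB_functor])
  show "c \<otimes>\<^bsub>hom_group (BR 2) (SB d)\<^esub> c' \<in> nat_trans (BR 2) (SB d)"
    using H.m_closed c by simp
  show "Poly_Mapping.keys (coeffs_of d c + coeffs_of d c') \<subseteq> exps 3 d" by (rule keys_add_subset[OF coeffs_of(1)[OF c(1)] coeffs_of(1)[OF c(2)]])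
  fix xs :: "int list" assume l: "length xs = 3"
  let ?Z = "FG 1 :: 'g monoid" and ?w = "frag_of (map gen_power xs) :: 'g list \<Rightarrow>\<^sub>0 int"
  have l': "length xs = Suc 2" using l by simp
  have k: "?w \<in> carrier (obj (bar (Suc 2)) ?Z)" using gen_power_bar_set[OF l'] by (simp only: obj_bar carrier_free_Abelian_group_iff keys_frag_of) simp
  have u: "(up 2 ?Z ?w :: 'u) \<in> carrier (obj (BR 2) ?Z)" by (rule BR_nat_closed[OF FG_gr k])
  show "pol d (on_bar 2 (c \<otimes>\<^bsub>hom_group (BR 2) (SB d)\<^esub> c')) xs = peval (coeffs_of d c + coeffs_of d c') xs"
    unfolding lin_eval_simps coeffs_of(2)[OF c(1) l, symmetric] coeffs_of(2)[OF c(2) l, symmetric]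
    unfolding pol_def on_bar_eq[OF FG_gr k] nt_mult_eq[OF FG_gr u]
    using hom_mult[OF theta_hom nat_transD(4)[OF c(1) FG_gr u] nat_transD(4)[OF c(2) FG_gr u]] by simp
qed

lemma local_inv_add: "local_inv p n m (arr3 (v + w)) = local_inv p n m (arr3 v) + local_inv p n m (arr3 w)"
  by (simp add: local_inv_def Let_def arr3_def lookup_add)

theorem theorem2:
  fixes d :: nat
  assumes "d > 0"
  shows "Ext TYPE('u :: infinite) 2
           (abelianization :: ('g :: infinite, 'g set) gr_functor)
           (sym_power_after d abelianization)
         \<cong> sum_group (J d) integer_mod_group"
proof -
  let ?P = "BR :: nat \<Rightarrow> ('g, 'u) gr_functor" and ?B = "SB d :: ('g, _) gr_functor"
  let ?K = "sum_group (J d) integer_mod_group"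
  obtain \<epsilon> where "projective_resolution (abelianization :: ('g, 'g set) gr_functor) ?P br_del \<epsilon>"
    using bar_resolution[where 'g = 'g and 'u = 'u] by (rule exE)
  note res = this proj_resolution.intro[OF abelianization_functor this]
  have prime: "Factorial_Ring.prime p" if "p \<in> J d" for p using that by (simp add: J_def)
  have pos: "int p > 0" if "p \<in> J d" for p using prime_gt_0_nat[OF prime[OF that]] by simp
  have "\<forall>p. \<exists>n m. p \<in> J d \<longrightarrow> d = p ^ n * (p ^ m + 1) \<and> m \<ge> 1" by (auto simp: J_def)
  then obtain nn mm where e: "\<And>p. p \<in> J d \<Longrightarrow> d = p ^ nn p * (p ^ mm p + 1) \<and> mm p \<ge> 1" by metis
  define iv where "iv p w = local_inv p (nn p) (mm p) (arr3 w)" for p w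
  \<comment> \<open>The isomorphism sends a cocycle to its local invariants modulo the primes in \<open>J d\<close>.\<close>
  define \<Lambda> where "\<Lambda> c = (\<lambda>p\<in>J d. iv p (coeffs_of d c) mod int p)" for c :: "'g monoid \<Rightarrow> 'u \<Rightarrow> ('g set list \<Rightarrow>\<^sub>0 int) set set"
  have Kc: "carrier ?K = (\<Pi>\<^sub>E p\<in>J d. {0..<int p})"
  proof -
    have "carrier ?K = {x \<in> \<Pi>\<^sub>E p\<in>J d. carrier (integer_mod_group p). finite {p \<in> J d. x p \<noteq> \<one>\<^bsub>integer_mod_group p\<^esub>}}"
      by (rule carrier_sum_group) simp
    also have "\<dots> = (\<Pi>\<^sub>E p\<in>J d. carrier (integer_mod_group p))" using finite_J[OF assms] by auto
    also have "\<dots> = (\<Pi>\<^sub>E p\<in>J d. {0..<int p})"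
      by (rule PiE_cong) (use pos in \<open>auto simp: carrier_integer_mod_group\<close>)
    finally show ?thesis .
  qed
  have coc: "proj_resolution.cocycle ?P br_del ?B (Suc 1) c \<longleftrightarrow>
      c \<in> nat_trans (?P 2) ?B \<and> (\<forall>a b c' e. cob3 (arr3 (coeffs_of d c)) a b c' e = 0)" for c
  proof (cases "c \<in> nat_trans (?P 2) ?B")
    case True
    from cobd_trivial_iff[OF on_bar_closed[OF True, unfolded Suc_2_3] coeffs_of[OF True]] True
    show ?thesis unfolding cocycle_iff[OF res(2) SB_functor] Suc_2_3 by blast
  next
    case False
    then show ?thesis unfolding cocycle_iff[OF res(2) SB_functor] Suc_2_3 by blast
  qed
  have cob: "proj_resolution.coboundary ?P br_del ?B 1 c \<longleftrightarrow> (\<exists>g. wt2 d g \<and> (\<forall>a b c'. arr3 (coeffs_of d c) a b c' = cob2 g a b c'))"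
    if c: "c \<in> nat_trans (?P 2) ?B" for c
    using coboundary_iff[OF res(2), of c 1 ?B] is_cobd_iff[OF on_bar_closed[OF c, unfolded Suc_2_3] coeffs_of[OF c]] c
    unfolding Suc_2_3 by blast
  have "Ext TYPE('u) (Suc 1) (abelianization :: ('g, 'g set) gr_functor) ?B \<cong> ?K"
  proof (rule Ext_iso[OF abelianization_functor SB_functor res(1)])
    show "group ?K" by (rule sum_group) simp
  next
    fix c c' assume c: "proj_resolution.cocycle ?P br_del ?B (Suc 1) c" "proj_resolution.cocycle ?P br_del ?B (Suc 1) c'"
    then have "coeffs_of d (c \<otimes>\<^bsub>hom_group (?P 2) ?B\<^esub> c') = coeffs_of d c + coeffs_of d c'"
      unfolding coc by (intro coeffs_of_mult) auto
    then show "\<Lambda> (c \<otimes>\<^bsub>hom_group (?P (Suc 1)) ?B\<^esub> c') = \<Lambda> c \<otimes>\<^bsub>?K\<^esub> \<Lambda> c'"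
      unfolding Suc_2_3 by (auto simp: \<Lambda>_def iv_def local_inv_add mod_add_eq fun_eq_iff restrict_def)
  next
    show "\<Lambda> ` {c. proj_resolution.cocycle ?P br_del ?B (Suc 1) c} = carrier ?K"
    proof (intro subset_antisym subsetI)
      fix r assume "r \<in> \<Lambda> ` {c. proj_resolution.cocycle ?P br_del ?B (Suc 1) c}"
      then show "r \<in> carrier ?K" unfolding Kc \<Lambda>_def using pos by auto
    next
      fix r assume r: "r \<in> carrier ?K"
      have "\<exists>f. wt3 d f \<and> (\<forall>a b c e. cob3 f a b c e = 0) \<and> (\<forall>p\<in>J d. int p dvd local_inv p (nn p) (mm p) f - r p)"
        by (rule cocycle_with_invariants[OF assms e])
      then obtain f where f: "wt3 d f" "\<forall>a b c e. cob3 f a b c e = 0"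
        "\<forall>p\<in>J d. int p dvd local_inv p (nn p) (mm p) f - r p" by (elim exE conjE)
      obtain w where w: "Poly_Mapping.keys w \<subseteq> exps 3 d" "arr3 w = f" using frag_of_arr3[OF f(1)] by (elim exE conjE)
      obtain \<eta> where \<eta>: "\<eta> \<in> nat_trans (bar 3) ?B" "\<forall>xs. length xs = 3 \<longrightarrow> pol d \<eta> xs = peval w xs"
        using pol_exists[where 'g = 'g, OF w(1)] by (rule bexE)
      define c :: "'g monoid \<Rightarrow> 'u \<Rightarrow> ('g set list \<Rightarrow>\<^sub>0 int) set set" where "c = on_copy 2 \<eta>"
      have c: "c \<in> nat_trans (?P 2) ?B" unfolding c_def by (rule on_copy_closed[where n = 2, unfolded Suc_2_3, OF \<eta>(1)])
      have h: "on_bar 2 c = \<eta>" unfolding c_def by (rule on_bar_on_copy[where n = 2, unfolded Suc_2_3, OF \<eta>(1)])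
      have cw: "coeffs_of d c = w" using \<eta>(2) h by (intro coeffs_of_unique[OF c w(1)]) simp
      have "proj_resolution.cocycle ?P br_del ?B (Suc 1) c" unfolding coc cw w(2) using c f(2) by blast
      moreover have "\<Lambda> c = r"
      proof
        fix p
        have rp: "r \<in> (\<Pi>\<^sub>E p\<in>J d. {0..<int p})" using r unfolding Kc .
        show "\<Lambda> c p = r p"
        proof (cases "p \<in> J d")
          case True
          then have "r p \<in> {0..<int p}" using rp by (rule PiE_mem[rotated])
          moreover have "local_inv p (nn p) (mm p) f mod int p = r p mod int p"
            using f(3) True by (simp add: mod_eq_dvd_iff)
          ultimately show ?thesis using True by (simp add: \<Lambda>_def iv_def cw w(2))
        qed (use PiE_arb[OF rp] in \<open>simp add: \<Lambda>_def\<close>)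
      qed
      ultimately show "r \<in> \<Lambda> ` {c. proj_resolution.cocycle ?P br_del ?B (Suc 1) c}" by blast
    qed
  next
    fix c assume "proj_resolution.cocycle ?P br_del ?B (Suc 1) c"
    then have c: "c \<in> nat_trans (?P 2) ?B" "\<And>a b c' e. cob3 (arr3 (coeffs_of d c)) a b c' e = 0" unfolding coc by auto
    have "\<Lambda> c = \<one>\<^bsub>?K\<^esub> \<longleftrightarrow> (\<forall>p\<in>J d. int p dvd iv p (coeffs_of d c))"
      by (auto simp: \<Lambda>_def fun_eq_iff restrict_def dvd_eq_mod_eq_0)
    also have "\<dots> \<longleftrightarrow> (\<exists>g. wt2 d g \<and> (\<forall>a b c'. arr3 (coeffs_of d c) a b c' = cob2 g a b c'))"
    proof
      assume iv: "\<forall>p\<in>J d. int p dvd iv p (coeffs_of d c)"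
      have "int p dvd local_inv p n m (arr3 (coeffs_of d c))"
        if p: "Factorial_Ring.prime p" "d = p ^ n * (p ^ m + 1)" "m \<ge> 1" for p n m
      proof -
        have pJ: "p \<in> J d" using p unfolding J_def by blast
        have "nn p = n \<and> mm p = m" using e[OF pJ] p by (intro J_exponents_unique[OF p(1)]) simp_all
        then show ?thesis using iv pJ unfolding iv_def by blast
      qed
      then show "\<exists>g. wt2 d g \<and> (\<forall>a b c'. arr3 (coeffs_of d c) a b c' = cob2 g a b c')"
        using cocycle_is_coboundary[OF assms wt3_arr3[OF coeffs_of(1)[OF c(1)]] c(2)] by metis
    next
      assume "\<exists>g. wt2 d g \<and> (\<forall>a b c'. arr3 (coeffs_of d c) a b c' = cob2 g a b c')"
      then obtain g where "\<And>a b c'. arr3 (coeffs_of d c) a b c' = cob2 g a b c'" by blast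
      then have "arr3 (coeffs_of d c) = cob2 g" by (simp add: fun_eq_iff)
      then show "\<forall>p\<in>J d. int p dvd iv p (coeffs_of d c)" unfolding iv_def using local_inv_cob2_dvd[OF prime] e by simp
    qed
    also have "\<dots> \<longleftrightarrow> proj_resolution.coboundary ?P br_del ?B 1 c" by (rule cob[OF c(1), symmetric])
    finally show "\<Lambda> c = \<one>\<^bsub>?K\<^esub> \<longleftrightarrow> proj_resolution.coboundary ?P br_del ?B 1 c" .
  qed
  then show ?thesis unfolding Suc_2_3 .
qed

end
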